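(* For each Lie conformal superalgebra of rank $(2+1)$ in the list $\mathcal{A}_1,\dots,\mathcal{A}_4,\mathcal{B}_1,\mathcal{B}_2,\mathcal{C}_1,\mathcal{C}_2,\mathcal{C}_3,\mathcal{D}_1,\dots,\mathcal{D}_4$ (given in the context), the finite nontrivial irreducible conformal modules are classified, up to isomorphism, as follows (the modules are defined in the context): - for $\mathcal{A}_1,\mathcal{A}_2,\mathcal{A}_3,\mathcal{A}_4$: $N_{\mathfrak f}$; - for $\mathcal{B}_1$: $M_{A,\Delta,\eta}$, $M_{B,\Delta,\eta}$; - for $\mathcal{B}_2$: $M_{B,\Delta,\eta}$, $M^+_{\Delta,\eta}$, $M^-_{\Delta,\eta}$; - for $\mathcal{C}_1,\mathcal{C}_3$: $N_{\mathfrak g}$, $M_{A,\Delta,\eta}$; - for $\mathcal{C}_2$: $N_{\mathfrak g}$, $M^+_{\Delta,\eta}$, $M^-_{\Delta,\eta}$; - for $\mathcal{D}_1,\mathcal{D}_4$: $M_{A,\Delta,\eta}$, $M_{\Delta,\eta,\omega}$; - for $\mathcal{HVS}$, i.e. $\mathcal{D}_2$ with $(a,b,Q_2)=(1,0,0)$: $M_{A,\Delta,\eta}$, $M_{\Delta,\zeta,c,\epsilon}$; - for $\bar{\mathcal{D}}_2$, i.e. $\mathcal{D}_2$ with $(a,b,Q_2)\ne(1,0,0)$, and for $\mathcal{D}_3$: $M_{A,\Delta,\eta}$.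
   Context: A Lie conformal superalgebra is a $\mathbb{Z}_2$-graded $\mathbb{C}[\partial]$-module $R=R_{\bar 0}\oplus R_{\bar 1}$ with a $\mathbb{C}$-linear parity-compatible map $R\otimes R\to\mathbb{C}[\lambda]\otimes R$, $a\otimes b\mapsto[a_\lambda b]$, such that $[\partial a_\lambda b]=-\lambda[a_\lambda b]$, $[a_\lambda\partial b]=(\partial+\lambda)[a_\lambda b]$, $[a_\lambda b]=-(-1)^{|a||b|}[b_{-\lambda-\partial}a]$ and $[a_\lambda[b_\mu c]]=[[a_\lambda b]_{\lambda+\mu}c]+(-1)^{|a||b|}[b_\mu[a_\lambda c]]$. A conformal $R$-module is a $\mathbb{Z}_2$-graded $\mathbb{C}[\partial]$-module $M$ with a $\mathbb{C}$-linear parity-compatible map $R\otimes M\to\mathbb{C}[\lambda]\otimes M$, $a\otimes v\mapsto a_\lambda v$, with $(\partial a)_\lambda v=-\lambda a_\lambda v$, $a_\lambda(\partial v)=(\partial+\lambda)a_\lambda v$, $[a_\lambda b]_{\lambda+\mu}v=a_\lambda(b_\mu v)-(-1)^{|a||b|}b_\mu(a_\lambda v)$. It is finite if finitely generated over $\mathbb{C}[\partial]$, nontrivial if the action of $R$ is not zero, irreducible if it has no nontrivial proper submodule. Write $\mathbb{C}^*=\mathbb{C}\setminus\{0\}$. Algebras. All are $\mathbb{C}[\partial]A\oplus\mathbb{C}[\partial]B\oplus\mathbb{C}[\partial]X$, free, $A,B$ even, $X$ odd; omitted brackets vanish or follow from skew-symmetry. Parameters in different algebras are independent. $\mathcal{A}_1$: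 $[A_\lambda A]=f_1(\partial,\lambda)B$, $[A_\lambda X]=\phi_1(\lambda)X$ ($f_1\neq0$ skew-symmetric, i.e. $f(x,y)=-f(x,-x-y)$; $\phi_1\in\mathbb{C}[\lambda]$). $\mathcal{A}_2$: $[A_\lambda A]=f_2(\partial,\lambda)B$, $[X_\lambda X]=\psi(\partial)B$ ($f_2\ne0$ skew-symmetric, $\psi\in\mathbb{C}[\partial]$). $\mathcal{A}_3$: $[A_\lambda B]=2\phi_3(\lambda)B$, $[A_\lambda X]=\phi_3(\lambda)X$, $[X_\lambda X]=2B$ ($0\ne\phi_3\in\mathbb{C}[\lambda]$). $\mathcal{A}_4$: $[A_\lambda B]=p(\lambda)B$, $[A_\lambda X]=\phi_4(\lambda)X$ ($0\ne p\in\mathbb{C}[\lambda]$, $\phi_4\in\mathbb{C}[\lambda]$). $\mathcal{B}_1$: $[A_\lambda A]=(\partial+2\lambda)A$, $[B_\lambda B]=(\partial+2\lambda)B$, $[A_\lambda X]=(\partial+\alpha\lambda+\beta)X$ ($\alpha,\beta\in\mathbb{C}$). $\mathcal{B}_2$: $[A_\lambda A]=(\partial+2\lambda)A$, $[B_\lambda B]=(\partial+2\lambda)B$, $[A_\lambda X]=(\partial+\frac32\lambda)X$, $[X_\lambda X]=2A$. $\mathcal{C}_1$: $[A_\lambda A]=(\partial+2\lambda)A$, $[A_\lambda X]=(\partial+\alpha\lambda+\beta)X$ ($\alpha,\beta\in\mathbb{C}$). $\mathcal{C}_2$: $[A_\lambda A]=(\partial+2\lambda)A$, $[A_\lambda X]=(\partial+\frac32\lambda)X$,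 $[X_\lambda X]=2A$. $\mathcal{C}_3$: $[A_\lambda A]=(\partial+2\lambda)A$, $[B_\lambda X]=\varphi(\lambda)X$ ($0\ne\varphi\in\mathbb{C}[\lambda]$). $\mathcal{D}_1$: $[A_\lambda A]=(\partial+2\lambda)A+Q_1(\partial,\lambda)B$, $[A_\lambda B]=(\partial+a\lambda+b)B$, $[A_\lambda X]=(\partial+\alpha\lambda+\beta)X$ ($a,b,\alpha,\beta\in\mathbb{C}$, $(a,b,Q_1)$ satisfies C1). $\mathcal{D}_2$: $[A_\lambda A]=(\partial+2\lambda)A+Q_2(\partial,\lambda)B$, $[A_\lambda B]=(\partial+a\lambda+b)B$, $[A_\lambda X]=(\partial+\frac{a+1}2\lambda+\frac b2)X$, $[X_\lambda X]=2B$ ($a,b\in\mathbb{C}$, $(a,b,Q_2)$ satisfies C1). $\mathcal{D}_3$: $[A_\lambda A]=(\partial+2\lambda)A+Q_3(\partial,\lambda)B$, $[A_\lambda B]=(\partial+b)B$, $[A_\lambda X]=(\partial+\lambda+\frac b2)X$, $[X_\lambda X]=(\partial+b)B$ ($b\in\mathbb{C}$, $(0,b,Q_3)$ satisfies C1). $\mathcal{D}_4$: $[A_\lambda A]=(\partial+2\lambda)A$, $[A_\lambda B]=(\partial+\lambda)B$, $[A_\lambda X]=(\partial+\alpha\lambda+\beta)X$, $[B_\lambda X]=\gamma X$ ($\alpha,\beta,\gamma\in\mathbb{C}$). Condition C1 on $(a,b,Q)$: if $b\ne0$, then $Q=0$. If $b=0$, then, for some $c,d\in\mathbb{C}$: $Q=c(\partial+2\lambda)$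 if $a=1$; $Q=(\partial+2\lambda)(c(\partial\lambda+\lambda^2)+d\partial)$ if $a=0$; $Q=(\partial+2\lambda)(c\partial^2+d(\partial\lambda+\lambda^2)\partial)$ if $a=-1$; $Q=c(\partial+2\lambda)(\partial\lambda+\lambda^2)^3$ if $a=-4$; $Q=c(\partial+2\lambda)(11(\partial\lambda+\lambda^2)^4+2(\partial\lambda+\lambda^2)^3\partial^2)$ if $a=-6$; and $Q=0$ for all other $a$. Modules (parameters in different modules are independent). For the rank one modules $\mathbb{C}[\partial]v$ (free) the generator $v$ may have either parity; $v_{\bar0}$ is even and $v_{\bar1}$ is odd. $N_{\mathfrak f}=\mathbb{C}[\partial]v$: $A_\lambda v=\mathfrak f(\lambda)v$, $B_\lambda v=X_\lambda v=0$, with $0\ne\mathfrak f\in\mathbb{C}[\lambda]$. $N_{\mathfrak g}=\mathbb{C}[\partial]v$: $B_\lambda v=\mathfrak g(\lambda)v$, $A_\lambda v=X_\lambda v=0$, with $0\ne\mathfrak g\in\mathbb{C}[\lambda]$. $M_{A,\Delta,\eta}=\mathbb{C}[\partial]v$: $A_\lambda v=(\partial+\Delta\lambda+\eta)v$, $B_\lambda v=X_\lambda v=0$, with $\Delta\in\mathbb{C}^*,\eta\in\mathbb{C}$. $M_{B,\Delta,\eta}=\mathbb{C}[\partial]v$: $B_\lambda v=(\partial+\Delta\lambda+\eta)v$, $A_\lambda v=X_\lambda v=0$, with $\Delta\in\mathbb{C}^*,\eta\in\mathbb{C}$. $M^+_{\Delta,\eta}=\mathbb{C}[\partial]v_{\bar0}\oplus\mathbb{C}[\partial]v_{\bar1}$,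 $\Delta\in\mathbb{C}^*$, $\eta\in\mathbb{C}$: $A_\lambda v_{\bar0}=(\partial+\Delta\lambda+\eta)v_{\bar0}$, $A_\lambda v_{\bar1}=(\partial+(\Delta+\frac12)\lambda+\eta)v_{\bar1}$, $B_\lambda v_{\bar0}=B_\lambda v_{\bar1}=0$, $X_\lambda v_{\bar0}=v_{\bar1}$, $X_\lambda v_{\bar1}=(\partial+2\Delta\lambda+\eta)v_{\bar0}$. $M^-_{\Delta,\eta}=\mathbb{C}[\partial]v_{\bar0}\oplus\mathbb{C}[\partial]v_{\bar1}$, $\frac12\ne\Delta\in\mathbb{C}$, $\eta\in\mathbb{C}$: $A_\lambda v_{\bar0}=(\partial+\Delta\lambda+\eta)v_{\bar0}$, $A_\lambda v_{\bar1}=(\partial+(\Delta-\frac12)\lambda+\eta)v_{\bar1}$, $B_\lambda v_{\bar0}=B_\lambda v_{\bar1}=0$, $X_\lambda v_{\bar0}=(\partial+(2\Delta-1)\lambda+\eta)v_{\bar1}$, $X_\lambda v_{\bar1}=v_{\bar0}$. $M_{\Delta,\eta,\omega}=\mathbb{C}[\partial]v$, $\Delta,\eta\in\mathbb{C}$, $\omega\in\mathbb{C}^*$: $A_\lambda v=(\partial+\Delta\lambda+\eta)v$, $B_\lambda v=\omega v$, $X_\lambda v=0$. $M_{\Delta,\zeta,c,\epsilon}=\mathbb{C}[\partial]v_{\bar0}\oplus\mathbb{C}[\partial]v_{\bar1}$, $\Delta,\zeta\in\mathbb{C}$, $c,\epsilon\in\mathbb{C}^*$: $A_\lambda v_{i}=(\partial+\Delta\lambda+\zeta)v_{i}$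 and $B_\lambda v_i=c\epsilon v_i$ for $i=\bar0,\bar1$, $X_\lambda v_{\bar0}=cv_{\bar1}$, $X_\lambda v_{\bar1}=\epsilon v_{\bar0}$.
   Formalization: For D_1 the modules M_{Δ,η,ω} are listed only when (a,b,Q_1)=(1,0,0); for all other parameters they violate the module axioms over D_1, and the classification there is M_{A,Δ,η} alone. *)

theory Defs
  imports "HOL-Analysis.Analysis" "HOL-Library.Z2"
begin

section \<open>Graded \<open>\<complex>[\<partial>]\<close>-modules\<close>

text \<open>
  A \<open>\<complex>[\<partial>]\<close>-module is a module over the ring \<^typ>\<open>complex poly\<close>, whose indeterminate
  \<open>[:0, 1:]\<close> is \<open>\<partial>\<close>. The grading group is \<^typ>\<open>bit\<close>, with \<open>0\<close> even and \<open>1\<close> odd.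
\<close>

record 'm graded =
  smul :: "complex poly \<Rightarrow> 'm \<Rightarrow> 'm"
  part :: "bit \<Rightarrow> 'm set"

definition graded_module :: "('m::ab_group_add, 'z) graded_scheme \<Rightarrow> bool" where
  "graded_module M \<longleftrightarrow>
     module (smul M) \<and>
     (\<forall>i. module.subspace (smul M) (part M i)) \<and>
     part M 0 \<inter> part M 1 = {0} \<and>
     (\<forall>v. \<exists>x \<in> part M 0. \<exists>y \<in> part M 1. v = x + y)"

definition sgn_rule :: "bit \<Rightarrow> bit \<Rightarrow> 'm::ab_group_add \<Rightarrow> 'm" where
  "sgn_rule i j v = (if i * j = 1 then - v else v)"

text \<open>
  An element of \<open>\<complex>[\<lambda>] \<otimes> M\<close> is a polynomial in \<open>\<lambda>\<close> with coefficients in \<open>M\<close>, of type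
  \<open>'m poly\<close>. The value of \<open>p = \<Sum>\<lambda>\<^sup>n p\<^sub>n\<close> at \<open>\<lambda> := q \<in> \<complex>[\<partial>]\<close> is \<open>\<Sum>q\<^sup>n p\<^sub>n \<in> M\<close>; this covers both
  \<open>\<lambda> := x\<close> with \<open>x \<in> \<complex>\<close> (\<open>q = [:x:]\<close>) and \<open>\<lambda> := - x - \<partial>\<close> (\<open>q = [:- x, - 1:]\<close>).
\<close>

definition lambda_subst ::
    "('m::ab_group_add, 'z) graded_scheme \<Rightarrow> 'm poly \<Rightarrow> complex poly \<Rightarrow> 'm" where
  "lambda_subst M p q = (\<Sum>n\<le>degree p. smul M (q ^ n) (coeff p n))"

definition lambda_eval ::
    "('m::ab_group_add, 'z) graded_scheme \<Rightarrow> 'm poly \<Rightarrow> complex \<Rightarrow> 'm" where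
  "lambda_eval M p x = lambda_subst M p [:x:]"

text \<open>
  The axioms common to the bracket and to the action: \<open>\<complex>\<close>-bilinearity, compatibility with
  parities, \<open>(\<partial>a)\<^sub>\<lambda> v = - \<lambda> a\<^sub>\<lambda> v\<close> and \<open>a\<^sub>\<lambda>(\<partial>v) = (\<partial> + \<lambda>) a\<^sub>\<lambda> v\<close>. Multiplication by
  \<open>\<lambda>\<close> is \<open>pCons 0\<close>.
\<close>

definition lambda_map ::
    "('r::ab_group_add, 'y) graded_scheme \<Rightarrow> ('m::ab_group_add, 'z) graded_scheme \<Rightarrow>
     ('r \<Rightarrow> 'm \<Rightarrow> 'm poly) \<Rightarrow> bool" where
  "lambda_map R M f \<longleftrightarrow>
     (\<forall>a a' v. f (a + a') v = f a v + f a' v) \<and>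
     (\<forall>a v v'. f a (v + v') = f a v + f a v') \<and>
     (\<forall>c a v. f (smul R [:c:] a) v = map_poly (smul M [:c:]) (f a v)) \<and>
     (\<forall>c a v. f a (smul M [:c:] v) = map_poly (smul M [:c:]) (f a v)) \<and>
     (\<forall>i j. \<forall>a \<in> part R i. \<forall>v \<in> part M j. \<forall>n. coeff (f a v) n \<in> part M (i + j)) \<and>
     (\<forall>a v. f (smul R [:0, 1:] a) v = - pCons 0 (f a v)) \<and>
     (\<forall>a v. f a (smul M [:0, 1:] v) = map_poly (smul M [:0, 1:]) (f a v) + pCons 0 (f a v))"


section \<open>Lie conformal superalgebras and conformal modules\<close>

text \<open>
  Identities in \<open>\<complex>[\<lambda>, \<mu>] \<otimes> M\<close> are stated by evaluating \<open>\<lambda>\<close> and \<open>\<mu>\<close> at arbitrary complex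
  numbers, which determines a polynomial since \<open>\<complex>\<close> is infinite.
\<close>

record (overloaded) 'r conf_algebra = "'r graded" +
  brk :: "'r \<Rightarrow> 'r \<Rightarrow> 'r poly"

definition lie_conformal_superalgebra :: "'r::ab_group_add conf_algebra \<Rightarrow> bool" where
  "lie_conformal_superalgebra R \<longleftrightarrow>
     graded_module R \<and> lambda_map R R (brk R) \<and>
     (\<forall>i j. \<forall>a \<in> part R i. \<forall>b \<in> part R j. \<forall>x.
        lambda_eval R (brk R a b) x = - sgn_rule i j (lambda_subst R (brk R b a) [:- x, - 1:])) \<and>
     (\<forall>i j. \<forall>a \<in> part R i. \<forall>b \<in> part R j. \<forall>c x y.
        lambda_eval R (brk R a (lambda_eval R (brk R b c) y)) x =
          lambda_eval R (brk R (lambda_eval R (brk R a b) x) c) (x + y) +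
          sgn_rule i j (lambda_eval R (brk R b (lambda_eval R (brk R a c) x)) y))"

record (overloaded) ('r, 'm) conf_module = "'m graded" +
  act :: "'r \<Rightarrow> 'm \<Rightarrow> 'm poly"

definition conformal_module ::
    "'r::ab_group_add conf_algebra \<Rightarrow> ('r, 'm::ab_group_add) conf_module \<Rightarrow> bool" where
  "conformal_module R M \<longleftrightarrow>
     lie_conformal_superalgebra R \<and> graded_module M \<and> lambda_map R M (act M) \<and>
     (\<forall>i j. \<forall>a \<in> part R i. \<forall>b \<in> part R j. \<forall>v x y.
        lambda_eval M (act M (lambda_eval R (brk R a b) x) v) (x + y) =
          lambda_eval M (act M a (lambda_eval M (act M b v) y)) x -
          sgn_rule i j (lambda_eval M (act M b (lambda_eval M (act M a v) x)) y))"

definition finite_cmod :: "('r, 'm::ab_group_add) conf_module \<Rightarrow> bool" where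
  "finite_cmod M \<longleftrightarrow> (\<exists>S. finite S \<and> module.span (smul M) S = UNIV)"

definition nontrivial_cmod :: "('r, 'm::ab_group_add) conf_module \<Rightarrow> bool" where
  "nontrivial_cmod M \<longleftrightarrow> (\<exists>a v. act M a v \<noteq> 0)"

text \<open>
  Submodules are \<open>\<int>\<^sub>2\<close>-graded: they contain the homogeneous components of their elements.
\<close>

definition conformal_submodule :: "('r, 'm::ab_group_add) conf_module \<Rightarrow> 'm set \<Rightarrow> bool" where
  "conformal_submodule M N \<longleftrightarrow>
     module.subspace (smul M) N \<and>
     (\<forall>x \<in> part M 0. \<forall>y \<in> part M 1. x + y \<in> N \<longrightarrow> x \<in> N \<and> y \<in> N) \<and>
     (\<forall>a. \<forall>v \<in> N. \<forall>n. coeff (act M a v) n \<in> N)"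

definition irreducible_cmod :: "('r, 'm::ab_group_add) conf_module \<Rightarrow> bool" where
  "irreducible_cmod M \<longleftrightarrow> (\<forall>N. conformal_submodule M N \<longrightarrow> N = {0} \<or> N = UNIV)"

definition fin_nontriv_irred ::
    "'r::ab_group_add conf_algebra \<Rightarrow> ('r, 'm::ab_group_add) conf_module \<Rightarrow> bool" where
  "fin_nontriv_irred R M \<longleftrightarrow>
     conformal_module R M \<and> finite_cmod M \<and> nontrivial_cmod M \<and> irreducible_cmod M"

text \<open>Isomorphisms are even, that is, they preserve parities.\<close>

definition cmod_iso ::
    "('r, 'm::ab_group_add) conf_module \<Rightarrow> ('r, 'n::ab_group_add) conf_module \<Rightarrow> bool"
    (infix \<open>\<cong>\<close> 50) where
  "M \<cong> N \<longleftrightarrow>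
     (\<exists>f. bij f \<and> module_hom (smul M) (smul N) f \<and>
          (\<forall>i. f ` part M i = part N i) \<and>
          (\<forall>a v. act N a (f v) = map_poly f (act M a v)))"


section \<open>Free algebras and modules given on generators\<close>

text \<open>
  \<open>\<complex>[\<partial>, \<lambda>]\<close> is \<^typ>\<open>complex poly poly\<close>, with outer indeterminate \<open>\<lambda>\<close> and coefficients in
  \<open>\<complex>[\<partial>]\<close>. For \<open>p\<close> in one indeterminate, \<open>inst p t\<close> is \<open>p(t) \<in> \<complex>[\<partial>, \<lambda>]\<close>.
\<close>

abbreviation pDel :: "complex poly poly" where "pDel \<equiv> [:[:0, 1:]:]"
abbreviation pLam :: "complex poly poly" where "pLam \<equiv> [:0, 1:]"
abbreviation cst :: "complex \<Rightarrow> complex poly poly" where "cst c \<equiv> [:[:c:]:]"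

definition inst :: "complex poly \<Rightarrow> complex poly poly \<Rightarrow> complex poly poly" where
  "inst p t = poly (map_poly cst p) t"

text \<open>\<open>f(\<partial>, \<lambda>)\<close> becomes \<open>f(\<partial>, - \<lambda> - \<partial>)\<close>.\<close>

definition flip :: "complex poly poly \<Rightarrow> complex poly poly" where
  "flip f = pcompose f (- pLam - pDel)"

definition skew_symmetric :: "complex poly poly \<Rightarrow> bool" where
  "skew_symmetric f \<longleftrightarrow> f = - flip f"

text \<open>
  \<open>\<complex>[\<partial>] ^ 'j\<close> is the free module with the basis \<open>axis j 1\<close>. A table \<open>t\<close> gives
  \<open>i\<^sub>\<lambda> j = \<Sum>\<^sub>k t(i, j)\<^sub>k(\<partial>, \<lambda>) k\<close> for the generators, and sesquilinearity forces
  \<open>(p(\<partial>) i)\<^sub>\<lambda> (q(\<partial>) j) = p(- \<lambda>) q(\<partial> + \<lambda>) (i\<^sub>\<lambda> j)\<close>. The outer sum converts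
  \<open>\<complex>[\<partial>, \<lambda>] ^ 'j\<close> to \<open>(\<complex>[\<partial>] ^ 'j)[\<lambda>]\<close>.
\<close>

definition sesq_extend ::
    "('i::finite \<times> 'j::finite \<Rightarrow> complex poly poly ^ 'j) \<Rightarrow>
     complex poly ^ 'i \<Rightarrow> complex poly ^ 'j \<Rightarrow> (complex poly ^ 'j) poly" where
  "sesq_extend t u w =
     (\<Sum>k\<in>UNIV. map_poly (axis k)
        (\<Sum>i\<in>UNIV. \<Sum>j\<in>UNIV. inst (u $ i) (- pLam) * inst (w $ j) (pDel + pLam) * (t (i, j) $ k)))"

definition free_graded :: "('j::finite \<Rightarrow> bit) \<Rightarrow> (complex poly ^ 'j) graded" where
  "free_graded par =
     \<lparr> smul = (*s), part = (\<lambda>i. {u. \<forall>j. par j \<noteq> i \<longrightarrow> u $ j = 0}) \<rparr>"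

datatype gen = genA | genB | genX

lemma UNIV_gen: "UNIV = {genA, genB, genX}"
  using gen.exhaust by auto

instance gen :: finite
  by standard (simp add: UNIV_gen)

lemma UNIV_bit: "UNIV = {0, 1 :: bit}"
  using bit_not_one_iff by auto

instance bit :: finite
  by standard (simp add: UNIV_bit)

fun gpar :: "gen \<Rightarrow> bit" where
  "gpar genA = 0" | "gpar genB = 0" | "gpar genX = 1"

text \<open>
  Tables of brackets are given on the pairs \<open>AA\<close>, \<open>AB\<close>, \<open>AX\<close>, \<open>BB\<close>, \<open>BX\<close>, \<open>XX\<close>; the remaining pairs
  have an even member, and there \<open>[j\<^sub>\<lambda> i] = - [i\<^bsub>- \<lambda> - \<partial>\<^esub> j]\<close>.
\<close>

fun skew_complete ::
    "(gen \<times> gen \<Rightarrow> complex poly poly ^ gen) \<Rightarrow> gen \<times> gen \<Rightarrow> complex poly poly ^ gen" where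
  "skew_complete t (genB, genA) = (\<chi> k. - flip (t (genA, genB) $ k))"
| "skew_complete t (genX, genA) = (\<chi> k. - flip (t (genA, genX) $ k))"
| "skew_complete t (genX, genB) = (\<chi> k. - flip (t (genB, genX) $ k))"
| "skew_complete t p = t p"

type_synonym rank3 = "complex poly ^ gen"

definition algebra_of :: "(gen \<times> gen \<Rightarrow> complex poly poly ^ gen) \<Rightarrow> rank3 conf_algebra" where
  "algebra_of t = graded.extend (free_graded gpar) \<lparr> brk = sesq_extend (skew_complete t) \<rparr>"

definition module_of ::
    "('j::finite \<Rightarrow> bit) \<Rightarrow> (gen \<times> 'j \<Rightarrow> complex poly poly ^ 'j) \<Rightarrow>
     (rank3, complex poly ^ 'j) conf_module" where
  "module_of par t = graded.extend (free_graded par) \<lparr> act = sesq_extend t \<rparr>"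


section \<open>The algebras\<close>

abbreviation no_action :: "'i \<times> 'j \<Rightarrow> complex poly poly ^ 'k" where
  "no_action \<equiv> (\<lambda>_. 0)"

abbreviation Vir :: "complex poly poly" where
  "Vir \<equiv> pDel + 2 * pLam"

definition alg_A1 :: "complex poly poly \<Rightarrow> complex poly \<Rightarrow> rank3 conf_algebra" where
  "alg_A1 f \<phi> = algebra_of (no_action(
     (genA, genA) := axis genB f,
     (genA, genX) := axis genX (inst \<phi> pLam)))"

definition alg_A2 :: "complex poly poly \<Rightarrow> complex poly \<Rightarrow> rank3 conf_algebra" where
  "alg_A2 f \<psi> = algebra_of (no_action(
     (genA, genA) := axis genB f,
     (genX, genX) := axis genB (inst \<psi> pDel)))"

definition alg_A3 :: "complex poly \<Rightarrow> rank3 conf_algebra" where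
  "alg_A3 \<phi> = algebra_of (no_action(
     (genA, genB) := axis genB (2 * inst \<phi> pLam),
     (genA, genX) := axis genX (inst \<phi> pLam),
     (genX, genX) := axis genB 2))"

definition alg_A4 :: "complex poly \<Rightarrow> complex poly \<Rightarrow> rank3 conf_algebra" where
  "alg_A4 p \<phi> = algebra_of (no_action(
     (genA, genB) := axis genB (inst p pLam),
     (genA, genX) := axis genX (inst \<phi> pLam)))"

definition alg_B1 :: "complex \<Rightarrow> complex \<Rightarrow> rank3 conf_algebra" where
  "alg_B1 \<alpha> \<beta> = algebra_of (no_action(
     (genA, genA) := axis genA Vir,
     (genB, genB) := axis genB Vir,
     (genA, genX) := axis genX (pDel + cst \<alpha> * pLam + cst \<beta>)))"

definition alg_B2 :: "rank3 conf_algebra" where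
  "alg_B2 = algebra_of (no_action(
     (genA, genA) := axis genA Vir,
     (genB, genB) := axis genB Vir,
     (genA, genX) := axis genX (pDel + cst (3/2) * pLam),
     (genX, genX) := axis genA 2))"

definition alg_C1 :: "complex \<Rightarrow> complex \<Rightarrow> rank3 conf_algebra" where
  "alg_C1 \<alpha> \<beta> = algebra_of (no_action(
     (genA, genA) := axis genA Vir,
     (genA, genX) := axis genX (pDel + cst \<alpha> * pLam + cst \<beta>)))"

definition alg_C2 :: "rank3 conf_algebra" where
  "alg_C2 = algebra_of (no_action(
     (genA, genA) := axis genA Vir,
     (genA, genX) := axis genX (pDel + cst (3/2) * pLam),
     (genX, genX) := axis genA 2))"

definition alg_C3 :: "complex poly \<Rightarrow> rank3 conf_algebra" where
  "alg_C3 \<phi> = algebra_of (no_action(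
     (genA, genA) := axis genA Vir,
     (genB, genX) := axis genX (inst \<phi> pLam)))"

definition alg_D1 ::
    "complex \<Rightarrow> complex \<Rightarrow> complex poly poly \<Rightarrow> complex \<Rightarrow> complex \<Rightarrow> rank3 conf_algebra" where
  "alg_D1 a b Q \<alpha> \<beta> = algebra_of (no_action(
     (genA, genA) := axis genA Vir + axis genB Q,
     (genA, genB) := axis genB (pDel + cst a * pLam + cst b),
     (genA, genX) := axis genX (pDel + cst \<alpha> * pLam + cst \<beta>)))"

definition alg_D2 :: "complex \<Rightarrow> complex \<Rightarrow> complex poly poly \<Rightarrow> rank3 conf_algebra" where
  "alg_D2 a b Q = algebra_of (no_action(
     (genA, genA) := axis genA Vir + axis genB Q,
     (genA, genB) := axis genB (pDel + cst a * pLam + cst b),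
     (genA, genX) := axis genX (pDel + cst ((a + 1) / 2) * pLam + cst (b / 2)),
     (genX, genX) := axis genB 2))"

definition alg_D3 :: "complex \<Rightarrow> complex poly poly \<Rightarrow> rank3 conf_algebra" where
  "alg_D3 b Q = algebra_of (no_action(
     (genA, genA) := axis genA Vir + axis genB Q,
     (genA, genB) := axis genB (pDel + cst b),
     (genA, genX) := axis genX (pDel + pLam + cst (b / 2)),
     (genX, genX) := axis genB (pDel + cst b)))"

definition alg_D4 :: "complex \<Rightarrow> complex \<Rightarrow> complex \<Rightarrow> rank3 conf_algebra" where
  "alg_D4 \<alpha> \<beta> \<gamma> = algebra_of (no_action(
     (genA, genA) := axis genA Vir,
     (genA, genB) := axis genB (pDel + pLam),
     (genA, genX) := axis genX (pDel + cst \<alpha> * pLam + cst \<beta>),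
     (genB, genX) := axis genX (cst \<gamma>)))"

definition cond_C1 :: "complex \<Rightarrow> complex \<Rightarrow> complex poly poly \<Rightarrow> bool" where
  "cond_C1 a b Q \<longleftrightarrow>
     (let t = pDel * pLam + pLam ^ 2 in
      if b \<noteq> 0 then Q = 0
      else if a = 1 then \<exists>c. Q = cst c * Vir
      else if a = 0 then \<exists>c d. Q = Vir * (cst c * t + cst d * pDel)
      else if a = - 1 then \<exists>c d. Q = Vir * (cst c * pDel ^ 2 + cst d * t * pDel)
      else if a = - 4 then \<exists>c. Q = cst c * Vir * t ^ 3
      else if a = - 6 then \<exists>c. Q = cst c * Vir * (11 * t ^ 4 + 2 * t ^ 3 * pDel ^ 2)
      else Q = 0)"


section \<open>The modules\<close>

text \<open>
  In rank one the generator is \<open>axis () 1\<close> and \<open>i\<close> is its parity. In rank two the basis is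
  indexed by parity: \<open>v\<^sub>i = axis i 1\<close>.
\<close>

type_synonym rank1_module = "(rank3, complex poly ^ unit) conf_module"
type_synonym rank2_module = "(rank3, complex poly ^ bit) conf_module"

definition mod_Nf :: "bit \<Rightarrow> complex poly \<Rightarrow> rank1_module" where
  "mod_Nf i f = module_of (\<lambda>_. i) (no_action((genA, ()) := axis () (inst f pLam)))"

definition mod_Ng :: "bit \<Rightarrow> complex poly \<Rightarrow> rank1_module" where
  "mod_Ng i g = module_of (\<lambda>_. i) (no_action((genB, ()) := axis () (inst g pLam)))"

definition mod_MA :: "bit \<Rightarrow> complex \<Rightarrow> complex \<Rightarrow> rank1_module" where
  "mod_MA i \<Delta> \<eta> = module_of (\<lambda>_. i) (no_action(
     (genA, ()) := axis () (pDel + cst \<Delta> * pLam + cst \<eta>)))"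

definition mod_MB :: "bit \<Rightarrow> complex \<Rightarrow> complex \<Rightarrow> rank1_module" where
  "mod_MB i \<Delta> \<eta> = module_of (\<lambda>_. i) (no_action(
     (genB, ()) := axis () (pDel + cst \<Delta> * pLam + cst \<eta>)))"

definition mod_Mplus :: "complex \<Rightarrow> complex \<Rightarrow> rank2_module" where
  "mod_Mplus \<Delta> \<eta> = module_of (\<lambda>i. i) (no_action(
     (genA, 0) := axis 0 (pDel + cst \<Delta> * pLam + cst \<eta>),
     (genA, 1) := axis 1 (pDel + cst (\<Delta> + 1/2) * pLam + cst \<eta>),
     (genX, 0) := axis 1 1,
     (genX, 1) := axis 0 (pDel + cst (2 * \<Delta>) * pLam + cst \<eta>)))"

definition mod_Mminus :: "complex \<Rightarrow> complex \<Rightarrow> rank2_module" where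
  "mod_Mminus \<Delta> \<eta> = module_of (\<lambda>i. i) (no_action(
     (genA, 0) := axis 0 (pDel + cst \<Delta> * pLam + cst \<eta>),
     (genA, 1) := axis 1 (pDel + cst (\<Delta> - 1/2) * pLam + cst \<eta>),
     (genX, 0) := axis 1 (pDel + cst (2 * \<Delta> - 1) * pLam + cst \<eta>),
     (genX, 1) := axis 0 1))"

definition mod_Momega :: "bit \<Rightarrow> complex \<Rightarrow> complex \<Rightarrow> complex \<Rightarrow> rank1_module" where
  "mod_Momega i \<Delta> \<eta> \<omega> = module_of (\<lambda>_. i) (no_action(
     (genA, ()) := axis () (pDel + cst \<Delta> * pLam + cst \<eta>),
     (genB, ()) := axis () (cst \<omega>)))"

definition mod_Mceps :: "complex \<Rightarrow> complex \<Rightarrow> complex \<Rightarrow> complex \<Rightarrow> rank2_module" where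
  "mod_Mceps \<Delta> \<zeta> c \<epsilon> = module_of (\<lambda>i. i) (no_action(
     (genA, 0) := axis 0 (pDel + cst \<Delta> * pLam + cst \<zeta>),
     (genA, 1) := axis 1 (pDel + cst \<Delta> * pLam + cst \<zeta>),
     (genB, 0) := axis 0 (cst (c * \<epsilon>)),
     (genB, 1) := axis 1 (cst (c * \<epsilon>)),
     (genX, 0) := axis 1 (cst c),
     (genX, 1) := axis 0 (cst \<epsilon>)))"

definition fam_Nf :: "rank1_module set" where
  "fam_Nf = {mod_Nf i f | i f. f \<noteq> 0}"

definition fam_Ng :: "rank1_module set" where
  "fam_Ng = {mod_Ng i g | i g. g \<noteq> 0}"

definition fam_MA :: "rank1_module set" where
  "fam_MA = {mod_MA i \<Delta> \<eta> | i \<Delta> \<eta>. \<Delta> \<noteq> 0}"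

definition fam_MB :: "rank1_module set" where
  "fam_MB = {mod_MB i \<Delta> \<eta> | i \<Delta> \<eta>. \<Delta> \<noteq> 0}"

definition fam_Mplus :: "rank2_module set" where
  "fam_Mplus = {mod_Mplus \<Delta> \<eta> | \<Delta> \<eta>. \<Delta> \<noteq> 0}"

definition fam_Mminus :: "rank2_module set" where
  "fam_Mminus = {mod_Mminus \<Delta> \<eta> | \<Delta> \<eta>. \<Delta> \<noteq> 1/2}"

definition fam_Momega :: "rank1_module set" where
  "fam_Momega = {mod_Momega i \<Delta> \<eta> \<omega> | i \<Delta> \<eta> \<omega>. \<omega> \<noteq> 0}"

definition fam_Mceps :: "rank2_module set" where
  "fam_Mceps = {mod_Mceps \<Delta> \<zeta> c \<epsilon> | \<Delta> \<zeta> c \<epsilon>. c \<noteq> 0 \<and> \<epsilon> \<noteq> 0}"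

end

theory Submission
  imports Defs "HOL-Computational_Algebra.Fundamental_Theorem_Algebra"
begin

text \<open>Since a submodule is the whole module or zero, an odd generator with vanishing bracket and the
  members of an ideal that have a common kernel vector act trivially, and the module is torsion-free.
  Write \<open>a\<^sub>n\<close> for the coefficient of \<open>\<lambda>\<^sup>n\<close> in the action of \<open>a\<close>. If the generators in a set \<open>S\<close> have no
  common kernel, then each bounded part \<open>{v. a\<^sub>n v = 0 for a \<in> S, n \<ge> N}\<close> is finite-dimensional over
  \<open>\<complex>\<close>, because \<open>v\<close> is determined by the finitely many coefficients of \<open>a\<^bsub>\<lambda> - \<partial>\<^esub> v\<close>, and these take values
  in a finite-dimensional space. The commutation relations of the coefficients and of \<open>A\<^sub>0 - \<partial>\<close> on
  bounded parts rule out most actions of \<open>B\<close>: a relation \<open>[S, T] = c \<noteq> 0\<close> is impossible in finite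
  dimension, and an injective operator cannot shift eigenvalues. What survives has a common
  eigenvector with extremal weight, which generates a submodule of rank one or two and hence the module.

  Conversely, the Jacobi identities of the sesquilinear extension of a table reduce to the generators,
  where they are identities of polynomial functions in \<open>\<partial>\<close>, \<open>\<lambda>\<close>, \<open>\<mu>\<close>; and the listed modules are
  irreducible because the leading coefficient in \<open>\<lambda>\<close> of the action on any nonzero vector of a
  submodule is a nonzero constant multiple of a generator.\<close>

section \<open>Linear algebra over \<open>\<complex>\<close>\<close>

text \<open>The module is infinite-dimensional over \<complex>, so eigenvectors cannot be taken on
  it directly. Bounded parts repair this, at the price that neither \<partial> nor A_0 acts on them;
  the a_n with n \<ge> 1 and A_0 - \<partial> do. The a_n are plain coefficients of \<lambda>^n,
  without a factor n!, hence the binomials in the commutators. In type D, B survives only as a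
  current: a = 1 and b = 0 make B_0 commute with all A_n. On a space where B_0 = \<tau> \<noteq> 0,
  a cocycle Q = c(\<partial> + 2\<lambda>) gives [A_0 - \<partial>, A_1] = -c\<tau>, so c = 0; this
  singles out the triple (1, 0, 0). If moreover [X X] = 2B, then X_0^2 = \<tau>, which doubles the
  rank. If [X X] = 2A, then X_0 is a square root of A_0. The excluded values \<Delta> = 0, and
  \<Delta> = 1/2 for M^-, are those at which (\<partial> + \<eta>) v lies in a proper submodule,
  where v is the extremal vector.\<close>

locale complex_space = vector_space scale
  for scale :: "complex \<Rightarrow> 'm::ab_group_add \<Rightarrow> 'm" (infixr \<open>\<cdot>\<close> 75)
begin

text \<open>Containment in a finite span instead of equality with one: the notion passes to subsets
  and applies to images and kernels alike.\<close>

definition fin_dim :: "'m set \<Rightarrow> bool" where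
  "fin_dim V \<longleftrightarrow> (\<exists>B. finite B \<and> V \<subseteq> span B)"

definition endo :: "('m \<Rightarrow> 'm) \<Rightarrow> bool" where
  "endo T \<longleftrightarrow> (\<forall>u v. T (u + v) = T u + T v) \<and> (\<forall>c v. T (c \<cdot> v) = c \<cdot> T v)"

lemma endo_add: "endo T \<Longrightarrow> T (u + v) = T u + T v"
  and endo_scale: "endo T \<Longrightarrow> T (c \<cdot> v) = c \<cdot> T v"
  by (auto simp: endo_def)

lemma endo_zero: "endo T \<Longrightarrow> T 0 = 0"
  using endo_scale[of T 0 0] by simp

lemma endo_uminus: "endo T \<Longrightarrow> T (- v) = - T v"
  using endo_scale[of T "- 1" v] by simp

lemma endo_diff: "endo T \<Longrightarrow> T (u - v) = T u - T v"
  using endo_add[of T u "- v"] by (simp add: endo_uminus)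

lemma endo_sum: "endo T \<Longrightarrow> T (sum f A) = (\<Sum>x\<in>A. T (f x))"
  by (induction A rule: infinite_finite_induct) (auto simp: endo_zero endo_add)

lemma fin_dim_subset: "fin_dim V \<Longrightarrow> W \<subseteq> V \<Longrightarrow> fin_dim W"
  unfolding fin_dim_def by blast

lemma fin_dim_spanning:
  assumes "fin_dim V"
  obtains B where "finite B" "B \<subseteq> V" "V \<subseteq> span B"
proof -
  obtain B where B: "B \<subseteq> V" "independent B" "V \<subseteq> span B"
    using maximal_independent_subset by blast
  obtain C where C: "finite C" "V \<subseteq> span C"
    using assms fin_dim_def by blast
  have "finite B"
    using independent_span_bound[OF C(1) B(2)] B(1) C(2) by blast
  with B that show thesis by blast
qed

text \<open>This is p(T) v, written as a sum of vectors; \<open>papp_mult\<close> is the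
  multiplicativity of p \<mapsto> p(T).\<close>

definition papp :: "('m \<Rightarrow> 'm) \<Rightarrow> complex poly \<Rightarrow> 'm \<Rightarrow> 'm" where
  "papp T p v = (\<Sum>i\<le>degree p. coeff p i \<cdot> (T ^^ i) v)"

lemma papp_altdef:
  assumes "degree p \<le> n"
  shows "papp T p v = (\<Sum>i\<le>n. coeff p i \<cdot> (T ^^ i) v)"
  unfolding papp_def using assms
  by (intro sum.mono_neutral_left) (auto simp: coeff_eq_0)

lemma papp_pCons:
  assumes "endo T"
  shows "papp T (pCons a p) v = a \<cdot> v + T (papp T p v)"
proof -
  have "papp T (pCons a p) v = (\<Sum>i\<le>Suc (degree p). coeff (pCons a p) i \<cdot> (T ^^ i) v)"
    by (rule papp_altdef) (simp add: degree_pCons_le)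
  also have "\<dots> = a \<cdot> v + (\<Sum>i\<le>degree p. T (coeff p i \<cdot> (T ^^ i) v))"
    by (subst sum.atMost_Suc_shift) (simp add: endo_scale[OF assms])
  finally show ?thesis
    by (simp add: papp_def endo_sum[OF assms])
qed

lemma papp_0 [simp]: "papp T 0 v = 0"
  by (simp add: papp_def)

lemma papp_add: "papp T (p + q) v = papp T p v + papp T q v"
  by (subst (1 2 3) papp_altdef[where n = "max (degree p) (degree q)"])
     (auto simp: degree_add_le scale_left_distrib sum.distrib)

lemma papp_smult: "papp T (Polynomial.smult c p) v = c \<cdot> papp T p v"
  by (subst (1 2) papp_altdef[where n = "degree p"])
     (auto simp: scale_sum_right)

lemma papp_mult:
  assumes "endo T"
  shows "papp T (p * q) v = papp T p (papp T q v)"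
  by (induction p) (auto simp: papp_add papp_smult papp_pCons[OF assms])

lemma papp_commute:
  assumes "endo T"
  shows "papp T p (papp T q v) = papp T q (papp T p v)"
  by (metis papp_mult[OF assms] mult.commute)

lemma endo_papp:
  assumes "endo T"
  shows "endo (papp T p)"
  unfolding endo_def
  by (induction p) (auto simp: papp_pCons[OF assms] endo_add[OF assms] endo_scale[OF assms]
        scale_right_distrib algebra_simps)

lemma papp_in:
  assumes "endo T" "subspace V" "T ` V \<subseteq> V" "v \<in> V"
  shows "papp T p v \<in> V"
  using assms by (induction p) (auto simp: papp_pCons subspace_0 intro!: subspace_add subspace_scale)

lemma papp_eigen:
  assumes "endo T" "T v = t \<cdot> v"
  shows "papp T p v = poly p t \<cdot> v"
  by (induction p)
     (auto simp: papp_pCons[OF assms(1)] endo_scale[OF assms(1)] assms(2) scale_left_distrib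
        mult.commute)

text \<open>A relation among v, T v, T^2 v, ... is the polynomial. Linear dependence of a set
  ignores repetitions, so two equal powers are treated separately by X^i - X^j; otherwise card B + 1
  distinct vectors in the span of B are dependent.\<close>

lemma annihilating_poly_vector:
  assumes T: "endo T" and V: "fin_dim V" "T ` V \<subseteq> V" "v \<in> V"
  shows "\<exists>p. p \<noteq> 0 \<and> papp T p v = 0"
proof -
  obtain B where B: "finite B" "V \<subseteq> span B"
    using V fin_dim_def by blast
  have mem: "(T ^^ i) v \<in> V" for i
    by (induction i) (use V in auto)
  show ?thesis
  proof (cases "inj_on (\<lambda>i. (T ^^ i) v) {..card B}")
    case False
    then obtain i j where ij: "i \<noteq> j" "(T ^^ i) v = (T ^^ j) v"
      by (auto simp: inj_on_def)
    have "papp T (monom 1 k) v = (T ^^ k) v" for k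
      by (simp add: papp_altdef[of "monom 1 k" k] degree_monom_le if_distrib[of "\<lambda>c. c \<cdot> _"]
          sum.delta cong: if_cong)
    then have "papp T (monom 1 i + Polynomial.smult (- 1) (monom 1 j)) v = 0"
      by (simp only: papp_add papp_smult ij) simp
    moreover have "coeff (monom 1 i + Polynomial.smult (- 1) (monom 1 j)) i = (1::complex)"
      using ij(1) by simp
    ultimately show ?thesis
      by (metis coeff_0 zero_neq_one)
  next
    case True
    let ?S = "(\<lambda>i. (T ^^ i) v) ` {..card B}"
    have "dependent ?S"
    proof (rule ccontr)
      assume "independent ?S"
      with B(1) have "card ?S \<le> card B"
        using independent_span_bound[of B ?S] B(2) mem by blast
      with True show False by (simp add: card_image)
    qed
    then obtain u w where u: "w \<in> ?S" "u w \<noteq> 0" "(\<Sum>x\<in>?S. u x \<cdot> x) = 0"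
      using dependent_finite[of ?S] by auto
    then obtain k where k: "k \<le> card B" "u ((T ^^ k) v) \<noteq> 0" by auto
    let ?p = "\<Sum>i\<le>card B. monom (u ((T ^^ i) v)) i"
    have c: "coeff ?p i = (if i \<le> card B then u ((T ^^ i) v) else 0)" for i
      by (auto simp: coeff_sum)
    have "papp T ?p v = (\<Sum>i\<le>card B. u ((T ^^ i) v) \<cdot> (T ^^ i) v)"
      by (subst papp_altdef[of _ "card B"])
         (auto simp: c intro!: degree_sum_le degree_monom_le intro: order.trans[OF degree_monom_le])
    also have "\<dots> = 0"
      using u(3) True by (simp add: sum.reindex)
    finally show ?thesis
      using k c[of k] by (intro exI[of _ ?p]) auto
  qed
qed

text \<open>The product of the polynomials for the vectors of a finite spanning set works on all of
  V: the factors commute, so the one belonging to a given vector can be applied first.\<close>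

lemma annihilating_poly:
  assumes T: "endo T" and V: "fin_dim V" "T ` V \<subseteq> V"
  shows "\<exists>p. p \<noteq> 0 \<and> (\<forall>v\<in>V. papp T p v = 0)"
proof -
  obtain B where B: "finite B" "B \<subseteq> V" "V \<subseteq> span B"
    using fin_dim_spanning[OF V(1)] .
  obtain q where q: "\<And>b. b \<in> B \<Longrightarrow> q b \<noteq> 0 \<and> papp T (q b) b = 0"
    using annihilating_poly_vector[OF T V] B(2) by (metis subsetD)
  let ?p = "prod q B"
  have "papp T ?p v = 0" if "v \<in> span B" for v
    using that
  proof (induction rule: span_induct_alt)
    case base
    then show ?case by (rule endo_zero[OF endo_papp[OF T]])
  next
    case (step c x y)
    have "papp T ?p x = papp T (prod q (B - {x})) (papp T (q x) x)"
      using step B(1) by (simp add: prod.remove papp_mult[OF T] papp_commute[OF T])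
    then have "papp T ?p x = 0"
      using q step endo_zero[OF endo_papp[OF T]] by simp
    with step show ?case
      by (simp add: endo_add[OF endo_papp[OF T]] endo_scale[OF endo_papp[OF T]])
  qed
  with B q show ?thesis
    by (intro exI[of _ ?p]) auto
qed

text \<open>Every eigenvalue is a root of one nonzero polynomial that annihilates V.\<close>

lemma finite_eigenvalues:
  assumes "endo T" "fin_dim V" "T ` V \<subseteq> V"
  shows "finite {t. \<exists>v\<in>V. v \<noteq> 0 \<and> T v = t \<cdot> v}"
proof -
  obtain p where p: "p \<noteq> 0" "\<forall>v\<in>V. papp T p v = 0"
    using annihilating_poly[OF assms] by blast
  have "{t. \<exists>v\<in>V. v \<noteq> 0 \<and> T v = t \<cdot> v} \<subseteq> {t. poly p t = 0}"
    using p(2) papp_eigen[OF assms(1)] by force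
  then show ?thesis
    using poly_roots_finite[OF p(1)] finite_subset by blast
qed

lemma minimal_annihilating_poly:
  assumes "\<exists>p. p \<noteq> 0 \<and> papp T p v = 0"
  obtains p where "p \<noteq> 0" "papp T p v = 0" "\<And>q. degree q < degree p \<Longrightarrow> papp T q v = 0 \<Longrightarrow> q = 0"
proof -
  obtain p where "p \<noteq> 0 \<and> papp T p v = 0"
    "\<And>q. q \<noteq> 0 \<and> papp T q v = 0 \<Longrightarrow> degree p \<le> degree q"
    using ex_has_least_nat[of "\<lambda>p. p \<noteq> 0 \<and> papp T p v = 0" _ degree] assms by metis
  then show thesis by (intro that[of p]) (auto simp: not_le[symmetric])
qed

text \<open>If p has least degree with p(T) v = 0 and p = (X - r) q, then q(T) v is nonzero by
  minimality and is an eigenvector for r.\<close>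

lemma eigenvector_exists:
  assumes T: "endo T" and V: "subspace V" "fin_dim V" "T ` V \<subseteq> V" and "V \<noteq> {0}"
  obtains v t where "v \<in> V" "v \<noteq> 0" "T v = t \<cdot> v"
proof -
  obtain v where v: "v \<in> V" "v \<noteq> 0"
    using assms subspace_0 by blast
  obtain p where p: "p \<noteq> 0" "papp T p v = 0"
      "\<And>q. degree q < degree p \<Longrightarrow> papp T q v = 0 \<Longrightarrow> q = 0"
    using minimal_annihilating_poly[OF annihilating_poly_vector[OF T V(2,3) v(1)]] by blast
  have "degree p \<noteq> 0"
  proof
    assume "degree p = 0"
    then obtain c where "p = [:c:]" by (rule degree_eq_zeroE)
    with p v show False by (simp add: papp_pCons[OF T] endo_zero[OF T])
  qed
  then obtain r where "poly p r = 0"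
    using fundamental_theorem_of_algebra[of p] by (auto simp: constant_degree)
  then obtain q where q: "p = [:- r, 1:] * q"
    by (auto simp: poly_eq_0_iff_dvd)
  with p(1) have "q \<noteq> 0" by auto
  with q have "degree q < degree p"
    by (simp add: degree_mult_eq del: mult_pCons_left)
  with p(3) \<open>q \<noteq> 0\<close> have "papp T q v \<noteq> 0" by blast
  moreover have "T (papp T q v) = r \<cdot> papp T q v"
    using p(2) unfolding q papp_mult[OF T] by (simp add: papp_pCons[OF T] endo_zero[OF T] endo_scale[OF T])
  ultimately show thesis
    using papp_in[OF T V(1,3) v(1)] that by blast
qed

section \<open>Eigenspaces and commutation relations in finite dimension\<close>

definition eigenspace :: "'m set \<Rightarrow> ('m \<Rightarrow> 'm) \<Rightarrow> complex \<Rightarrow> 'm set" where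
  "eigenspace V T t = {v \<in> V. T v = t \<cdot> v}"

lemma subspace_eigenspace:
  assumes "endo T" "subspace V"
  shows "subspace (eigenspace V T t)"
  using assms(2) unfolding subspace_def eigenspace_def
  by (auto simp: endo_zero[OF assms(1)] endo_add[OF assms(1)] endo_scale[OF assms(1)]
      scale_right_distrib mult.commute)

lemma eigenspace_subset: "eigenspace V T t \<subseteq> V"
  by (auto simp: eigenspace_def)

lemma eigenspace_invariant:
  assumes "endo S" "S ` V \<subseteq> V" "\<And>v. v \<in> V \<Longrightarrow> S (T v) = T (S v)"
  shows "S ` eigenspace V T t \<subseteq> eigenspace V T t"
  using assms(2) unfolding eigenspace_def
  by (auto simp: endo_scale[OF assms(1)] simp flip: assms(3))

text \<open>Each further operator is restricted to the common eigenspace found so far, which it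
  preserves because the operators commute. Finitely many operators suffice for the applications, as
  the remaining coefficients vanish on a bounded part.\<close>

lemma common_eigenspace:
  assumes "\<And>n. endo (T n)" "subspace V" "fin_dim V" "\<And>n. T n ` V \<subseteq> V" "V \<noteq> {0}"
    and "\<And>n m v. v \<in> V \<Longrightarrow> T n (T m v) = T m (T n v)"
  shows "\<exists>g. {v \<in> V. \<forall>n<(N::nat). T n v = g n \<cdot> v} \<noteq> {0}"
proof (induction N)
  case 0
  then show ?case using assms(5) by simp
next
  case (Suc N)
  then obtain g where g: "{v \<in> V. \<forall>n<N. T n v = g n \<cdot> v} \<noteq> {0}" by blast
  let ?W = "{v \<in> V. \<forall>n<N. T n v = g n \<cdot> v}"
  have W: "subspace ?W"
    using assms(2) unfolding subspace_def
    by (auto simp: endo_zero[OF assms(1)] endo_add[OF assms(1)] endo_scale[OF assms(1)]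
        scale_right_distrib mult.commute)
  have inv: "T N ` ?W \<subseteq> ?W"
    using assms(4) by (auto simp: endo_scale[OF assms(1)] assms(6)[of _ _ N])
  have fd: "fin_dim ?W"
    by (rule fin_dim_subset[OF assms(3)]) auto
  obtain v t where v: "v \<in> ?W" "v \<noteq> 0" "T N v = t \<cdot> v"
    using eigenvector_exists[OF assms(1) W fd inv g] .
  then have "v \<in> {v \<in> V. \<forall>n<Suc N. T n v = (g(N := t)) n \<cdot> v}"
    by (auto simp: less_Suc_eq)
  with v(2) show ?case
    by (intro exI[of _ "g(N := t)"]) (metis (no_types, lifting) singletonD)
qed

text \<open>The relation [T, S] = c makes T act on polynomials in S as c times the
  derivative.\<close>

lemma commutator_papp:
  assumes S: "endo S" and T: "endo T" and V: "subspace V" "S ` V \<subseteq> V"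
    and rel: "\<And>v. v \<in> V \<Longrightarrow> T (S v) = S (T v) + c \<cdot> v"
    and v: "v \<in> V" "T v = t \<cdot> v"
  shows "T (papp S p v) = t \<cdot> papp S p v + c \<cdot> papp S (pderiv p) v"
proof (induction p)
  case 0
  then show ?case by (simp add: endo_zero[OF T])
next
  case (pCons a p)
  have "papp S p v \<in> V" by (rule papp_in[OF S V v(1)])
  with pCons show ?case
    by (simp add: papp_pCons[OF S] endo_add[OF T] endo_scale[OF T] endo_add[OF S] endo_scale[OF S]
        v(2) rel pderiv_pCons papp_add scale_right_distrib algebra_simps)
qed

text \<open>Minimal polynomials take the place of traces: if p has least degree with p(S) v = 0 for
  an eigenvector v of T, applying T gives c p'(S) v = 0, and p' is a nonzero polynomial of smaller
  degree because the characteristic is zero.\<close>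

lemma no_heisenberg:
  assumes S: "endo S" and T: "endo T" and V: "subspace V" "fin_dim V" "V \<noteq> {0}"
    and inv: "S ` V \<subseteq> V" "T ` V \<subseteq> V"
    and rel: "\<And>v. v \<in> V \<Longrightarrow> T (S v) = S (T v) + c \<cdot> v"
  shows "c = 0"
proof (rule ccontr)
  assume "c \<noteq> 0"
  obtain v t where v: "v \<in> V" "v \<noteq> 0" "T v = t \<cdot> v"
    using eigenvector_exists[OF T V(1,2) inv(2) V(3)] .
  obtain p where p: "p \<noteq> 0" "papp S p v = 0"
      "\<And>q. degree q < degree p \<Longrightarrow> papp S q v = 0 \<Longrightarrow> q = 0"
    using minimal_annihilating_poly[OF annihilating_poly_vector[OF S V(2) inv(1) v(1)]] by blast
  have dp: "degree p \<noteq> 0"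
  proof
    assume "degree p = 0"
    then obtain c where "p = [:c:]" by (rule degree_eq_zeroE)
    with p v show False by (simp add: papp_pCons[OF S] endo_zero[OF S])
  qed
  have "c \<cdot> papp S (pderiv p) v = 0"
    using commutator_papp[OF S T V(1) inv(1) rel v(1,3), of p] p(2) by (simp add: endo_zero[OF T])
  with \<open>c \<noteq> 0\<close> have "papp S (pderiv p) v = 0" by simp
  moreover have "degree (pderiv p) < degree p"
    using dp by (simp add: degree_pderiv)
  ultimately have "pderiv p = 0"
    using p(3) by blast
  with dp show False by (simp add: pderiv_eq_0_iff)
qed

lemma shifted_eigenvector:
  assumes "endo S" "endo T" "S (T v) = T (S v) + c \<cdot> T v" "S v = t \<cdot> v"
  shows "S (T v) = (t + c) \<cdot> T v"
  using assms by (simp add: endo_scale scale_left_distrib)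

text \<open>Applied repeatedly to an eigenvector of S, T never gives zero and produces the
  eigenvalues t + k c; for c \<noteq> 0 these are infinitely many.\<close>

lemma no_injective_shift:
  assumes S: "endo S" and T: "endo T" and V: "subspace V" "fin_dim V" "V \<noteq> {0}"
    and inv: "S ` V \<subseteq> V" "T ` V \<subseteq> V"
    and rel: "\<And>v. v \<in> V \<Longrightarrow> S (T v) = T (S v) + c \<cdot> T v"
    and inj: "\<And>v. v \<in> V \<Longrightarrow> T v = 0 \<Longrightarrow> v = 0"
  shows "c = 0"
proof (rule ccontr)
  assume "c \<noteq> 0"
  obtain v t where v: "v \<in> V" "v \<noteq> 0" "S v = t \<cdot> v"
    using eigenvector_exists[OF S V(1,2) inv(1) V(3)] .
  have ev: "(T ^^ k) v \<in> V \<and> (T ^^ k) v \<noteq> 0 \<and> S ((T ^^ k) v) = (t + of_nat k * c) \<cdot> (T ^^ k) v" for k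
  proof (induction k)
    case 0
    then show ?case using v by simp
  next
    case (Suc k)
    then have "S (T ((T ^^ k) v)) = (t + of_nat k * c + c) \<cdot> T ((T ^^ k) v)"
      using rel shifted_eigenvector[OF S T, of "(T ^^ k) v" c] by blast
    moreover have "t + of_nat (Suc k) * c = t + of_nat k * c + c"
      by (simp add: algebra_simps)
    ultimately show ?case
      using Suc inv(2) inj by auto
  qed
  have "range (\<lambda>k. t + of_nat k * c) \<subseteq> {t. \<exists>v\<in>V. v \<noteq> 0 \<and> S v = t \<cdot> v}"
    using ev by blast
  moreover have "inj (\<lambda>k. t + of_nat k * c)"
    using \<open>c \<noteq> 0\<close> by (auto simp: inj_on_def)
  ultimately show False
    using finite_subset[OF _ finite_eigenvalues[OF S V(2) inv(1)]] range_inj_infinite by blast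
qed

text \<open>Eigenvalues are complex, so they are ordered by real part and t is one with the least.
  An operator that shifts it by c with negative real part would produce an eigenvalue further down.
  Membership of T v in V is required only for the vector v at hand, so T need not preserve
  V.\<close>

lemma extremal_eigenspace:
  assumes S: "endo S" and V: "subspace V" "fin_dim V" "V \<noteq> {0}" "S ` V \<subseteq> V"
  obtains t where "eigenspace V S t \<noteq> {0}"
    "\<And>T c v. v \<in> eigenspace V S t \<Longrightarrow> endo T \<Longrightarrow> T v \<in> V \<Longrightarrow> S (T v) = T (S v) + c \<cdot> T v \<Longrightarrow>
       Re c < 0 \<Longrightarrow> T v = 0"
proof -
  let ?E = "{t. \<exists>v\<in>V. v \<noteq> 0 \<and> S v = t \<cdot> v}"
  obtain v\<^sub>0 t\<^sub>0 where "v\<^sub>0 \<in> V" "v\<^sub>0 \<noteq> 0" "S v\<^sub>0 = t\<^sub>0 \<cdot> v\<^sub>0"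
    using eigenvector_exists[OF S V(1,2,4,3)] .
  then have "t\<^sub>0 \<in> ?E" by (intro CollectI bexI[of _ v\<^sub>0] conjI)
  then have "Re ` ?E \<noteq> {}" by (simp only: image_is_empty) (metis empty_iff)
  from ex_min_if_finite[OF finite_imageI[OF finite_eigenvalues[OF S V(2,4)]] this]
  obtain m where m: "m \<in> Re ` ?E" "\<not> (\<exists>x\<in>Re ` ?E. x < m)" ..
  from m(1) obtain t where "t \<in> ?E" "m = Re t" by (rule imageE)
  have min: "Re t \<le> Re s" if "s \<in> ?E" for s
  proof -
    have "Re s \<in> Re ` ?E" by (rule imageI) (rule that)
    with m(2) have "\<not> Re s < m" by (metis (no_types))
    with \<open>m = Re t\<close> show ?thesis by simp
  qed
  show thesis
  proof (rule that[of t])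
    show "eigenspace V S t \<noteq> {0}"
    proof -
      obtain v where "v \<in> V" "v \<noteq> 0" "S v = t \<cdot> v"
        using \<open>t \<in> ?E\<close> by (elim CollectE bexE conjE)
      then have "v \<in> eigenspace V S t" by (simp add: eigenspace_def)
      with \<open>v \<noteq> 0\<close> show ?thesis by (metis singletonD)
    qed
    fix T c v
    assume v: "v \<in> eigenspace V S t" and T: "endo T" "T v \<in> V" "S (T v) = T (S v) + c \<cdot> T v"
      and c: "Re c < 0"
    show "T v = 0"
    proof (rule ccontr)
      assume "T v \<noteq> 0"
      moreover have "S (T v) = (t + c) \<cdot> T v"
        using v shifted_eigenvector[OF S T(1,3)] by (simp add: eigenspace_def)
      ultimately have "t + c \<in> ?E"
        using T(2) by (intro CollectI bexI[of _ "T v"] conjI)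
      from min[OF this] c show False by simp
    qed
  qed
qed

text \<open>V lies in the span of a finite spanning set of the kernel together with preimages,
  chosen in V, of a finite spanning set of the image.\<close>

lemma fin_dim_by_map:
  assumes L: "endo L" and V: "subspace V"
    and "fin_dim (L ` V)" "fin_dim {v \<in> V. L v = 0}"
  shows "fin_dim V"
proof -
  obtain C where C: "finite C" "C \<subseteq> L ` V" "L ` V \<subseteq> span C"
    using fin_dim_spanning[OF assms(3)] .
  obtain K where K: "finite K" "{v \<in> V. L v = 0} \<subseteq> span K"
    using assms(4) fin_dim_def by blast
  have "\<forall>c\<in>C. \<exists>v. v \<in> V \<and> L v = c"
    using C(2) by blast
  then obtain g where g: "\<And>c. c \<in> C \<Longrightarrow> g c \<in> V \<and> L (g c) = c"
    by (auto dest!: bchoice)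
  have lift: "\<exists>u \<in> span (g ` C) \<inter> V. L u = w" if "w \<in> span C" for w
    using that
  proof (induction rule: span_induct_alt)
    case base
    then show ?case using span_zero subspace_0[OF V] endo_zero[OF L] by blast
  next
    case (step c x y)
    then obtain u where u: "u \<in> span (g ` C) \<inter> V" "L u = y" by blast
    have "c \<cdot> g x + u \<in> span (g ` C) \<inter> V"
      using u g step(1)
      by (simp add: span_add span_scale span_base subspace_add[OF V] subspace_scale[OF V])
    moreover have "L (c \<cdot> g x + u) = c \<cdot> x + y"
      using u g step by (simp add: endo_add[OF L] endo_scale[OF L])
    ultimately show ?case by blast
  qed
  have "V \<subseteq> span (K \<union> g ` C)"
  proof
    fix v assume v: "v \<in> V"
    with C(3) obtain u where u: "u \<in> span (g ` C)" "u \<in> V" "L u = L v"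
      using lift[of "L v"] by blast
    then have "v - u \<in> span K"
      using v K(2) subspace_diff[OF V] by (auto simp: endo_diff[OF L])
    then have "(v - u) + u \<in> span (K \<union> g ` C)"
      using u(1) by (intro span_add) (meson span_mono subsetD Un_upper1 Un_upper2)+
    then show "v \<in> span (K \<union> g ` C)" by simp
  qed
  with K(1) C(1) show ?thesis
    unfolding fin_dim_def by (intro exI[of _ "K \<union> g ` C"]) simp
qed

text \<open>Restricting to the kernel of one map removes that map from the set;
  \<open>fin_dim_by_map\<close> lifts the result back to V.\<close>

lemma fin_dim_by_maps:
  assumes "finite \<L>" "\<And>L. L \<in> \<L> \<Longrightarrow> endo L" "subspace V"
    and "\<And>L. L \<in> \<L> \<Longrightarrow> fin_dim (L ` V)" "fin_dim {v \<in> V. \<forall>L\<in>\<L>. L v = 0}"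
  shows "fin_dim V"
  using assms
proof (induction \<L> arbitrary: V)
  case empty
  then show ?case by simp
next
  case (insert L \<L>)
  let ?W = "{v \<in> V. L v = 0}"
  have L: "endo L" by (simp add: insert)
  have W: "subspace ?W"
    using insert.prems(2) unfolding subspace_def
    by (auto simp: endo_zero[OF L] endo_add[OF L] endo_scale[OF L])
  have "fin_dim ?W"
  proof (rule insert.IH)
    show "fin_dim {v \<in> ?W. \<forall>L\<in>\<L>. L v = 0}"
      using insert.prems(4) by (rule fin_dim_subset) auto
    show "fin_dim (M ` ?W)" if "M \<in> \<L>" for M
      using insert.prems(3)[of M] that by (rule_tac fin_dim_subset[of "M ` V"]) auto
  qed (use insert W in auto)
  then show ?case
    by (rule fin_dim_by_map[OF L insert.prems(2) insert.prems(3)[OF insertI1]])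
qed

text \<open>The coordinates with respect to a basis separate vectors, which reduces identities of
  polynomials with vector coefficients to scalar ones.\<close>

lemma separating_functional:
  assumes "v \<noteq> 0"
  obtains \<phi> where "\<phi> v \<noteq> 0" "\<And>u w. \<phi> (u + w) = \<phi> u + \<phi> w" "\<And>c u. \<phi> (c \<cdot> u) = c * \<phi> u"
proof -
  obtain B where "B \<subseteq> UNIV" and B: "independent B" "UNIV \<subseteq> span B"
    using maximal_independent_subset[of UNIV] .
  have "\<exists>b. representation B v b \<noteq> 0"
  proof (rule ccontr)
    assume "\<not> ?thesis"
    then have "v = 0"
      using sum_nonzero_representation_eq[OF B(1), of v] B(2) by auto
    with assms show False by blast
  qed
  then obtain b where "representation B v b \<noteq> 0" ..
  then show thesis
    using B(2) by (intro that[of "\<lambda>u. representation B u b"])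
      (auto simp: representation_add[OF B(1)] representation_scale[OF B(1)] subset_iff)
qed

lemma vector_poly_zero:
  assumes "\<And>x. (\<Sum>n\<le>N. x ^ n \<cdot> w n) = 0" "n \<le> N"
  shows "w n = 0"
proof (rule ccontr)
  assume "w n \<noteq> 0"
  then obtain \<phi> where \<phi>: "\<phi> (w n) \<noteq> 0" "\<And>u w. \<phi> (u + w) = \<phi> u + \<phi> w" "\<And>c u. \<phi> (c \<cdot> u) = c * \<phi> u"
    using separating_functional by blast
  have z: "\<phi> 0 = 0" using \<phi>(3)[of 0 0] by simp
  have s: "\<phi> (sum f A) = (\<Sum>x\<in>A. \<phi> (f x))" for f :: "nat \<Rightarrow> 'm" and A
    by (induction A rule: infinite_finite_induct) (auto simp: \<phi>(2) z)
  let ?p = "\<Sum>n\<le>N. monom (\<phi> (w n)) n"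
  have "poly ?p x = 0" for x
    using arg_cong[OF assms(1)[of x], of \<phi>] by (simp add: s \<phi>(3) z poly_sum poly_monom mult.commute)
  then have "?p = 0" by (metis poly_all_0_iff_0)
  then have "coeff ?p n = 0" by simp
  then have "\<phi> (w n) = 0" using assms(2) by (simp add: coeff_sum)
  with \<phi>(1) show False by simp
qed

end

text \<open>The coefficient of \<lambda>^m in (\<lambda> - X)^k X + (\<lambda> - X)^(k+1) =
  \<lambda> (\<lambda> - X)^k. Where the subtraction of naturals truncates, the binomial is
  zero.\<close>

lemma flip_pascal:
  fixes X :: "'a::comm_ring_1"
  shows "of_nat (k choose m) * (- X) ^ (k - m) * X + of_nat (Suc k choose m) * (- X) ^ (Suc k - m) =
    (if m = 0 then 0 else of_nat (k choose (m - 1)) * (- X) ^ (k - (m - 1)))"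
proof (cases m)
  case (Suc l)
  consider "l < k" | "l = k" | "k < l" by linarith
  then show ?thesis
  proof cases
    case 1
    then have "k - l = Suc (k - Suc l)" by simp
    then have "(- X) ^ (k - l) = - (X * (- X) ^ (k - Suc l))" by (simp only: power_Suc) simp
    with Suc show ?thesis by (simp add: algebra_simps)
  qed (auto simp: Suc binomial_eq_0)
qed simp

section \<open>Conformal operators on a \<open>\<complex>[\<partial>]\<close>-module\<close>

locale del_module = module sm
  for sm :: "complex poly \<Rightarrow> 'm::ab_group_add \<Rightarrow> 'm"
begin

abbreviation csc :: "complex \<Rightarrow> 'm \<Rightarrow> 'm" (infixr \<open>\<cdot>\<close> 75) where
  "c \<cdot> v \<equiv> sm [:c:] v"

abbreviation del :: "'m \<Rightarrow> 'm" where
  "del v \<equiv> sm [:0, 1:] v"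

lemma csc_laws:
  "a \<cdot> (u + v) = a \<cdot> u + a \<cdot> v" "(a + b) \<cdot> v = a \<cdot> v + b \<cdot> v" "a \<cdot> b \<cdot> v = (a * b) \<cdot> v" "1 \<cdot> v = v"
proof -
  show "a \<cdot> (u + v) = a \<cdot> u + a \<cdot> v" by (rule scale_right_distrib)
  show "(a + b) \<cdot> v = a \<cdot> v + b \<cdot> v" using scale_left_distrib[of "[:a:]" "[:b:]" v] by simp
  show "a \<cdot> b \<cdot> v = (a * b) \<cdot> v" using scale_scale[of "[:a:]" "[:b:]" v] by (simp add: mult.commute)
  show "1 \<cdot> v = v" using scale_one[of v] by (simp add: one_pCons)
qed

sublocale C: complex_space csc
  by unfold_locales (rule csc_laws)+

lemma csc_minus_one [simp]: "(- 1) \<cdot> v = - v"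
  using C.scale_minus_left[of 1 v] by (simp add: csc_laws)

lemma csc_power: "sm ([:x:] ^ n) v = (x ^ n) \<cdot> v"
  by (simp add: poly_const_pow)

lemma sm_pCons: "sm (pCons c p) v = c \<cdot> v + del (sm p v)"
proof -
  have "pCons c p = [:c:] + [:0, 1:] * p" by simp
  then show ?thesis by (metis scale_left_distrib scale_scale)
qed

lemma sm_linear: "sm [:a, b:] v = a \<cdot> v + b \<cdot> del v"
  using sm_pCons[of a "[:b:]" v] by simp

lemma endo_sm: "C.endo (sm p)"
  by (auto simp: C.endo_def scale_right_distrib mult.commute)

definition ev :: "'m poly \<Rightarrow> complex \<Rightarrow> 'm" where
  "ev p x = (\<Sum>n\<le>degree p. x ^ n \<cdot> coeff p n)"

lemma ev_altdef: "degree p \<le> N \<Longrightarrow> ev p x = (\<Sum>n\<le>N. x ^ n \<cdot> coeff p n)"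
  unfolding ev_def by (intro sum.mono_neutral_left) (auto simp: coeff_eq_0)

lemma ev_0 [simp]: "ev 0 x = 0"
  by (simp add: ev_def)

lemma ev_pCons: "ev (pCons a p) x = a + x \<cdot> ev p x"
proof -
  have "ev (pCons a p) x = (\<Sum>n\<le>Suc (degree p). x ^ n \<cdot> coeff (pCons a p) n)"
    by (rule ev_altdef) (simp add: degree_pCons_le)
  also have "\<dots> = a + (\<Sum>n\<le>degree p. x \<cdot> (x ^ n \<cdot> coeff p n))"
    by (subst sum.atMost_Suc_shift) (simp add: csc_laws(3,4) mult.commute)
  finally show ?thesis by (simp only: ev_def scale_sum_right)
qed

lemma ev_add: "ev (p + q) x = ev p x + ev q x"
  by (subst (1 2 3) ev_altdef[where N = "max (degree p) (degree q)"])
     (auto simp: degree_add_le scale_right_distrib sum.distrib)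

lemma ev_map_poly:
  assumes "C.endo T"
  shows "ev (map_poly T p) x = T (ev p x)"
proof -
  have "degree (map_poly T p) \<le> degree p"
    by (rule degree_le) (simp add: coeff_map_poly C.endo_zero[OF assms] coeff_eq_0)
  then show ?thesis
    by (subst ev_altdef[of _ "degree p"])
      (auto simp: coeff_map_poly C.endo_zero[OF assms] ev_def C.endo_sum[OF assms] C.endo_scale[OF assms])
qed

lemma ev_uminus: "ev (- p) x = - ev p x"
  using ev_add[of p "- p" x] by (simp add: eq_neg_iff_add_eq_0 add.commute)

lemma ev_eqI:
  assumes "\<And>x. ev p x = ev q x"
  shows "p = q"
proof -
  have "ev (p + - q) x = 0" for x
    using assms[of x] by (simp only: ev_add ev_uminus) simp
  then have "(\<Sum>n\<le>degree (p + - q). x ^ n \<cdot> coeff (p + - q) n) = 0" for x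
    by (simp only: ev_def)
  from C.vector_poly_zero[OF this] have "coeff (p + - q) n = 0" for n
    by (metis le_degree coeff_0)
  then show ?thesis by (simp add: poly_eq_iff)
qed

text \<open>The properties of v \<mapsto> a_\<lambda> v for a fixed element a; the algebra does not
  occur, so the following statements concern single operators or pairs of them.\<close>

definition conf_op :: "('m \<Rightarrow> 'm poly) \<Rightarrow> bool" where
  "conf_op f \<longleftrightarrow>
     (\<forall>u v. f (u + v) = f u + f v) \<and>
     (\<forall>c v. f (c \<cdot> v) = map_poly (csc c) (f v)) \<and>
     (\<forall>v. f (del v) = map_poly del (f v) + pCons 0 (f v))"

lemma endo_coeff: "conf_op f \<Longrightarrow> C.endo (\<lambda>v. coeff (f v) n)"
  by (auto simp: conf_op_def C.endo_def coeff_map_poly)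

lemma endo_ev: "conf_op f \<Longrightarrow> C.endo (\<lambda>v. ev (f v) x)"
  by (auto simp: conf_op_def C.endo_def ev_add ev_map_poly[OF endo_sm])

lemma conf_op_zero: "conf_op f \<Longrightarrow> f 0 = 0"
  using C.endo_zero[OF endo_coeff[of f]] by (intro poly_eqI) simp

lemma coeff_del:
  assumes "conf_op f"
  shows "coeff (f (del v)) n = del (coeff (f v) n) + (if n = 0 then 0 else coeff (f v) (n - 1))"
  using assms by (cases n) (auto simp: conf_op_def coeff_map_poly)

lemma conf_op_sm:
  assumes f: "conf_op f"
  shows "ev (f (sm p v)) x = sm (pcompose p [:x, 1:]) (ev (f v) x)"
proof (induction p)
  case 0
  then show ?case by (simp add: conf_op_zero[OF f])
next
  case (pCons c p)
  have "ev (f (del w)) x = sm [:x, 1:] (ev (f w) x)" for w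
    using f by (simp only: conf_op_def ev_add ev_map_poly[OF endo_sm] ev_pCons sm_linear[of x 1] csc_laws(4) add_0_left add.commute)
  then have "ev (f (sm (pCons c p) v)) x = c \<cdot> ev (f v) x + sm [:x, 1:] (ev (f (sm p v)) x)"
    by (simp only: sm_pCons[of c p v] C.endo_add[OF endo_ev[OF f]] C.endo_scale[OF endo_ev[OF f]])
  then show ?case
    by (simp only: pCons pcompose_pCons scale_left_distrib scale_scale)
qed

text \<open>f_\<lambda>(p(\<partial>) v) = p(\<partial> + \<lambda>) f_\<lambda> v, and the highest
  power of \<lambda> in p(\<partial> + \<lambda>) has the constant coefficient
  \<open>lead_coeff p\<close>. The number n only bounds the degree of f_\<lambda> v; the coefficient
  there may vanish.\<close>

lemma coeff_conf_op_sm: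
  assumes f: "conf_op f" and w: "\<And>k. k > n \<Longrightarrow> coeff (f v) k = 0" and "p \<noteq> 0"
  shows "coeff (f (sm p v)) (degree p + n) = lead_coeff p \<cdot> coeff (f v) n \<and>
     (\<forall>m>degree p + n. coeff (f (sm p v)) m = 0)"
  using \<open>p \<noteq> 0\<close>
proof (induction p)
  case 0
  then show ?case by simp
next
  case (pCons a p)
  have e: "coeff (f (sm (pCons a p) v)) k = a \<cdot> coeff (f v) k + (del (coeff (f (sm p v)) k)
      + (if k = 0 then 0 else coeff (f (sm p v)) (k - 1)))" for k
    by (simp only: sm_pCons[of a p v] C.endo_add[OF endo_coeff[OF f]] C.endo_scale[OF endo_coeff[OF f]]
        coeff_del[OF f])
  show ?case
  proof (cases "p = 0")
    case True
    then show ?thesis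
      using w by (simp add: C.endo_scale[OF endo_coeff[OF f]])
  next
    case False
    with pCons.IH w show ?thesis by (simp add: e)
  qed
qed

text \<open>The leading coefficient of f_\<lambda>(p(\<partial>) v) is a nonzero multiple of that of
  f_\<lambda> v, so the former vanishes only if the latter does.\<close>

lemma conf_op_torsion:
  assumes f: "conf_op f" and "p \<noteq> 0" "sm p v = 0"
  shows "f v = 0"
proof -
  let ?n = "degree (f v)"
  have "lead_coeff p \<cdot> coeff (f v) ?n = coeff (f (sm p v)) (degree p + ?n)"
    using coeff_conf_op_sm[OF f coeff_eq_0 assms(2), of ?n v] by simp
  also have "\<dots> = 0"
    by (simp add: assms(3) conf_op_zero[OF f])
  finally show ?thesis
    using assms(2) by (simp add: C.scale_eq_0_iff)
qed

text \<open>The coefficients of \<open>f\<^bsub>\<lambda> - \<partial>\<^esub> v\<close>. In contrast to \<open>f\<^sub>\<lambda> v\<close> they are \<open>\<complex>[\<partial>]\<close>-linear in \<open>v\<close> up to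
  the substitution \<open>\<partial> \<mapsto> \<lambda>\<close>, hence lie in a finite-dimensional space.\<close>

definition flipc :: "('m \<Rightarrow> 'm poly) \<Rightarrow> nat \<Rightarrow> 'm \<Rightarrow> 'm" where
  "flipc f m v = (\<Sum>k\<le>degree (f v). sm (of_nat (k choose m) * [:0, - 1:] ^ (k - m)) (coeff (f v) k))"

lemma flipc_altdef:
  assumes "\<And>k. k > N \<Longrightarrow> coeff (f v) k = 0"
  shows "flipc f m v = (\<Sum>k\<le>N. sm (of_nat (k choose m) * [:0, - 1:] ^ (k - m)) (coeff (f v) k))"
proof -
  have "degree (f v) \<le> N" using assms by (metis degree_le)
  then show ?thesis
    unfolding flipc_def by (intro sum.mono_neutral_left) (auto simp: coeff_eq_0)
qed

lemma endo_flipc: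
  assumes f: "conf_op f"
  shows "C.endo (flipc f m)"
proof -
  have "flipc f m (u + v) = flipc f m u + flipc f m v" for u v
    by (subst (1 2 3) flipc_altdef[where N = "max (degree (f u)) (max (degree (f v)) (degree (f (u + v))))"])
      (auto simp: coeff_eq_0 C.endo_add[OF endo_coeff[OF f]] scale_right_distrib sum.distrib)
  moreover have "flipc f m (c \<cdot> v) = c \<cdot> flipc f m v" for c v
    by (subst (1 2) flipc_altdef[where N = "max (degree (f v)) (degree (f (c \<cdot> v)))"])
      (auto simp: coeff_eq_0 C.endo_scale[OF endo_coeff[OF f]] scale_sum_right mult.commute simp del: mult_pCons_left mult_pCons_right)
  ultimately show ?thesis by (simp add: C.endo_def)
qed

text \<open>Putting \<lambda> - \<partial> for \<lambda> in (\<partial> + \<lambda>) f_\<lambda> v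
  turns the factor into \<lambda>, so applying \<partial> to v merely moves the coefficients up by
  one.\<close>

lemma flipc_del:
  assumes f: "conf_op f"
  shows "flipc f m (del v) = (if m = 0 then 0 else flipc f (m - 1) v)"
proof -
  let ?g = "\<lambda>m k. of_nat (k choose m) * [:0, - 1:] ^ (k - m) :: complex poly"
  let ?N = "degree (f v)"
  have g: "?g m k * [:0, 1:] + ?g m (Suc k) = (if m = 0 then 0 else ?g (m - 1) k)" for k
  proof -
    have "[:0, - 1:] = - [:0, 1::complex:]" by simp
    then show ?thesis by (metis flip_pascal)
  qed
  have top: "coeff (f (del v)) k = 0" if "k > Suc ?N" for k
    using that by (simp add: coeff_del[OF f] coeff_eq_0)
  have "flipc f m (del v) = (\<Sum>k\<le>Suc ?N. sm (?g m k) (coeff (f (del v)) k))"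
    by (rule flipc_altdef) (rule top)
  also have "\<dots> = (\<Sum>k\<le>Suc ?N. sm (?g m k) (del (coeff (f v) k))) +
      (\<Sum>k\<le>Suc ?N. sm (?g m k) (if k = 0 then 0 else coeff (f v) (k - 1)))"
    by (simp only: coeff_del[OF f] scale_right_distrib sum.distrib)
  also have "(\<Sum>k\<le>Suc ?N. sm (?g m k) (if k = 0 then 0 else coeff (f v) (k - 1))) =
      (\<Sum>k\<le>?N. sm (?g m (Suc k)) (coeff (f v) k))"
    by (subst sum.atMost_Suc_shift) simp
  also have "(\<Sum>k\<le>Suc ?N. sm (?g m k) (del (coeff (f v) k))) =
      (\<Sum>k\<le>?N. sm (?g m k * [:0, 1:]) (coeff (f v) k))"
    by (simp only: sum.atMost_Suc scale_scale) (simp add: coeff_eq_0)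
  also have "(\<Sum>k\<le>?N. sm (?g m k * [:0, 1:]) (coeff (f v) k)) + (\<Sum>k\<le>?N. sm (?g m (Suc k)) (coeff (f v) k)) =
      (\<Sum>k\<le>?N. sm (if m = 0 then 0 else ?g (m - 1) k) (coeff (f v) k))"
    by (simp only: sum.distrib[symmetric] scale_left_distrib[symmetric] g)
  also have "\<dots> = (if m = 0 then 0 else flipc f (m - 1) v)"
    by (simp add: flipc_def)
  finally show ?thesis .
qed

lemma flipc_eq_0:
  assumes "\<And>n. n \<ge> N \<Longrightarrow> coeff (f v) n = 0" "m \<ge> N"
  shows "flipc f m v = 0"
proof -
  have "sm (of_nat (k choose m) * [:0, - 1:] ^ (k - m)) (coeff (f v) k) = 0" for k
    using assms by (cases "k < m") (auto simp: binomial_eq_0)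
  then show ?thesis unfolding flipc_def by (intro sum.neutral) simp
qed

text \<open>At m = degree only the top summand survives, and it is the leading coefficient of f v
  itself.\<close>

lemma flipc_all_0:
  assumes "\<And>m. flipc f m v = 0"
  shows "f v = 0"
proof -
  let ?d = "degree (f v)"
  have "flipc f ?d v = (\<Sum>k\<le>?d. if k = ?d then coeff (f v) k else 0)"
    unfolding flipc_def by (intro sum.cong) (auto simp: binomial_eq_0)
  with assms[of ?d] show ?thesis by simp
qed

text \<open>By \<open>flipc_del\<close> the values on p(\<partial>) u are combinations over
  \<complex> of values on u, and for the finitely many generators u only finitely many of these are
  nonzero.\<close>

lemma fin_dim_flipc:
  assumes f: "conf_op f" and U: "finite U" "span U = UNIV"
  shows "C.fin_dim (range (flipc f m))"
proof -
  define G where "G = insert 0 (\<Union>u\<in>U. (\<lambda>i. flipc f i u) ` {..degree (f u)})"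
  have G: "flipc f i u \<in> C.span G" if "u \<in> U" for i u
  proof (cases "i \<le> degree (f u)")
    case True
    with that show ?thesis by (intro C.span_base) (auto simp: G_def)
  next
    case False
    then have "flipc f i u = 0"
      by (intro flipc_eq_0[of "Suc (degree (f u))"]) (auto simp: coeff_eq_0)
    then show ?thesis by (simp add: C.span_zero)
  qed
  have step: "flipc f i (sm p u) \<in> C.span G" if "u \<in> U" for i p u
  proof (induction p arbitrary: i)
    case 0
    then show ?case by (simp add: C.endo_zero[OF endo_flipc[OF f]] C.span_zero)
  next
    case (pCons a p)
    have "flipc f i (sm (pCons a p) u) = a \<cdot> flipc f i u + (if i = 0 then 0 else flipc f (i - 1) (sm p u))"
      by (simp only: sm_pCons[of a p u] C.endo_add[OF endo_flipc[OF f]] C.endo_scale[OF endo_flipc[OF f]]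
          flipc_del[OF f])
    then show ?case
      using pCons.IH[of "i - 1"] G[OF that, of i] by (auto intro!: C.span_add C.span_scale C.span_zero)
  qed
  have "flipc f m v \<in> C.span G" if "v \<in> span U" for v
    using that
  proof (induction rule: span_induct_alt)
    case base
    then show ?case by (simp add: C.endo_zero[OF endo_flipc[OF f]] C.span_zero)
  next
    case (step c x y)
    then show ?case
      using \<open>\<And>u p i. u \<in> U \<Longrightarrow> flipc f i (sm p u) \<in> C.span G\<close>
      by (simp only: C.endo_add[OF endo_flipc[OF f]] C.span_add)
  qed
  moreover have "finite G"
    unfolding G_def using U(1) by simp
  ultimately show ?thesis
    unfolding C.fin_dim_def using U(2) by (intro exI[of _ G]) auto
qed

section \<open>Bounded parts\<close>

definition bounded_part :: "('m \<Rightarrow> 'm poly) set \<Rightarrow> nat \<Rightarrow> 'm set" where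
  "bounded_part F N = {v. \<forall>f\<in>F. \<forall>n\<ge>N. coeff (f v) n = 0}"

lemma subspace_bounded_part:
  assumes "\<And>f. f \<in> F \<Longrightarrow> conf_op f"
  shows "C.subspace (bounded_part F N)"
  unfolding C.subspace_def bounded_part_def
  using C.endo_add[OF endo_coeff[OF assms]] C.endo_scale[OF endo_coeff[OF assms]]
    C.endo_zero[OF endo_coeff[OF assms]]
  by auto

text \<open>The maps \<open>flipc f m\<close> with m < N have finite-dimensional images, and those
  with m \<ge> N vanish on the bounded part; hence a vector killed by all of the former is killed by
  every f in F.\<close>

lemma fin_dim_bounded_part:
  assumes F: "finite F" "\<And>f. f \<in> F \<Longrightarrow> conf_op f"
    and U: "finite U" "span U = UNIV"
    and ker: "\<And>v. (\<And>f. f \<in> F \<Longrightarrow> f v = 0) \<Longrightarrow> v = 0"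
  shows "C.fin_dim (bounded_part F N)"
proof (rule C.fin_dim_by_maps)
  let ?L = "(\<lambda>(f, m). flipc f m) ` (F \<times> {..<N})"
  show "finite ?L" using F(1) by simp
  show "C.endo L" if "L \<in> ?L" for L
    using that endo_flipc F(2) by auto
  show "C.subspace (bounded_part F N)"
    by (rule subspace_bounded_part[OF F(2)])
  show "C.fin_dim (L ` bounded_part F N)" if L: "L \<in> ?L" for L
  proof -
    from L obtain f m where fm: "f \<in> F" "L = flipc f m" by auto
    show ?thesis
      unfolding fm(2) by (rule C.fin_dim_subset[OF fin_dim_flipc[OF F(2)[OF fm(1)] U]]) (rule image_mono, simp)
  qed
  have "v = 0" if v: "v \<in> bounded_part F N" "\<forall>L\<in>?L. L v = 0" for v
  proof (rule ker)
    fix f assume f: "f \<in> F"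
    show "f v = 0"
    proof (rule flipc_all_0)
      fix m
      show "flipc f m v = 0"
      proof (cases "m < N")
        case True
        with v(2) f show ?thesis by force
      next
        case False
        show ?thesis
          by (rule flipc_eq_0[of N]) (use False v(1) f in \<open>auto simp: bounded_part_def\<close>)
      qed
    qed
  qed
  then have "{v \<in> bounded_part F N. \<forall>L\<in>?L. L v = 0} \<subseteq> C.span {}"
    by (auto simp: C.span_zero)
  then show "C.fin_dim {v \<in> bounded_part F N. \<forall>L\<in>?L. L v = 0}"
    unfolding C.fin_dim_def by (intro exI[of _ "{}"]) simp
qed

subsection \<open>Comparing coefficients in two variables\<close>

text \<open>The coefficients are grouped by total degree, strictly below K: powers of x + y and
  scaling of both variables respect this grouping.\<close>

definition arr :: "(nat \<Rightarrow> nat \<Rightarrow> 'm) \<Rightarrow> nat \<Rightarrow> complex \<Rightarrow> complex \<Rightarrow> 'm" where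
  "arr f K x y = (\<Sum>k<K. \<Sum>i\<le>k. (x ^ i * y ^ (k - i)) \<cdot> f i (k - i))"

text \<open>Scaling x and y by s separates the homogeneous parts; in each of them y = 1 leaves a
  polynomial in x.\<close>

lemma arr_zero:
  assumes "\<And>x y. arr f K x y = 0" "i + j < K"
  shows "f i j = 0"
proof -
  obtain M where M: "K = Suc M" using assms(2) by (cases K) auto
  have hom: "(\<Sum>i\<le>k. (x ^ i * y ^ (k - i)) \<cdot> f i (k - i)) = 0" if "k \<le> M" for k x y
  proof (rule C.vector_poly_zero[where N = M])
    fix s
    have "arr f K (s * x) (s * y) = (\<Sum>k\<le>M. s ^ k \<cdot> (\<Sum>i\<le>k. (x ^ i * y ^ (k - i)) \<cdot> f i (k - i)))"
      unfolding arr_def M lessThan_Suc_atMost scale_sum_right csc_laws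
    proof (intro sum.cong refl)
      fix k i :: nat assume "i \<in> {..k}"
      then have "s ^ k = s ^ i * s ^ (k - i)" by (simp flip: power_add)
      then have "(s * x) ^ i * (s * y) ^ (k - i) = s ^ k * (x ^ i * y ^ (k - i))"
        by (simp add: power_mult_distrib)
      then show "((s * x) ^ i * (s * y) ^ (k - i)) \<cdot> f i (k - i) = (s ^ k * (x ^ i * y ^ (k - i))) \<cdot> f i (k - i)"
        by (simp only:)
    qed
    with assms(1)[of "s * x" "s * y"]
    show "(\<Sum>k\<le>M. s ^ k \<cdot> (\<Sum>i\<le>k. (x ^ i * y ^ (k - i)) \<cdot> f i (k - i))) = 0" by simp
  qed (rule that)
  have "f i (i + j - i) = 0"
  proof (rule C.vector_poly_zero[where N = "i + j" and w = "\<lambda>i'. f i' (i + j - i')" and n = i])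
    fix x show "(\<Sum>n\<le>i + j. x ^ n \<cdot> f n (i + j - n)) = 0"
      using hom[of "i + j" x 1] assms(2) M by simp
  qed simp
  then show ?thesis by simp
qed

lemma arr_add: "arr f K x y + arr g K x y = arr (\<lambda>i j. f i j + g i j) K x y"
  by (simp add: arr_def scale_right_distrib sum.distrib)

lemma arr_scale: "c \<cdot> arr f K x y = arr (\<lambda>i j. c \<cdot> f i j) K x y"
  unfolding arr_def scale_sum_right csc_laws by (simp add: mult.commute)

text \<open>An iterated action has its coefficients in a rectangle; completing it to a large enough
  triangle adds only zeros.\<close>

lemma arr_rect:
  assumes "\<And>i j. i > I \<or> j > J \<Longrightarrow> f i j = 0" "K > I + J"
  shows "(\<Sum>j\<le>J. y ^ j \<cdot> (\<Sum>i\<le>I. x ^ i \<cdot> f i j)) = arr f K x y"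
proof -
  let ?g = "\<lambda>i j. (x ^ i * y ^ j) \<cdot> f i j"
  have "arr f K x y = (\<Sum>(i, j)\<in>{(i, j). i + j < K}. ?g i j)"
    unfolding arr_def by (rule sum.triangle_reindex[symmetric])
  also have "\<dots> = (\<Sum>(i, j)\<in>{..I} \<times> {..J}. ?g i j)"
  proof (rule sum.mono_neutral_right)
    have "{(i, j). i + j < K} \<subseteq> {..K} \<times> {..K}" by auto
    then show "finite {(i, j). i + j < K}" by (rule finite_subset) simp
    show "{..I} \<times> {..J} \<subseteq> {(i, j). i + j < K}" using assms(2) by auto
    show "\<forall>p\<in>{(i, j). i + j < K} - {..I} \<times> {..J}. (case p of (i, j) \<Rightarrow> ?g i j) = 0"
    proof
      fix p assume p: "p \<in> {(i, j). i + j < K} - {..I} \<times> {..J}"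
      obtain i j where ij: "p = (i, j)" by (cases p)
      with p have "i > I \<or> j > J" by auto
      then show "(case p of (i, j) \<Rightarrow> ?g i j) = 0" by (simp add: ij assms(1))
    qed
  qed
  also have "\<dots> = (\<Sum>j\<le>J. \<Sum>i\<le>I. ?g i j)"
    by (subst sum.swap) (simp add: sum.cartesian_product)
  also have "\<dots> = (\<Sum>j\<le>J. y ^ j \<cdot> (\<Sum>i\<le>I. x ^ i \<cdot> f i j))"
    unfolding scale_sum_right csc_laws by (simp add: mult.commute)
  finally show ?thesis ..
qed

lemma arr_sum:
  assumes "degree w < K"
  shows "ev w (x + y) = arr (\<lambda>i j. of_nat (i + j choose i) \<cdot> coeff w (i + j)) K x y"
proof -
  obtain M where M: "K = Suc M" using assms by (cases K) auto
  have "ev w (x + y) = (\<Sum>k\<le>M. (x + y) ^ k \<cdot> coeff w k)"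
    using assms M by (intro ev_altdef) simp
  also have "\<dots> = (\<Sum>k\<le>M. \<Sum>i\<le>k. (of_nat (k choose i) * x ^ i * y ^ (k - i)) \<cdot> coeff w k)"
    by (simp only: binomial_ring C.scale_sum_left)
  also have "\<dots> = arr (\<lambda>i j. of_nat (i + j choose i) \<cdot> coeff w (i + j)) K x y"
    unfolding arr_def M lessThan_Suc_atMost csc_laws
    by (intro sum.cong refl) (simp add: mult_ac)
  finally show ?thesis .
qed

lemma arr_shift_left:
  "x \<cdot> arr f K x y = arr (\<lambda>i j. if i = 0 then 0 else f (i - 1) j) (Suc K) x y"
proof -
  have "(\<Sum>i\<le>Suc k. (x ^ i * y ^ (Suc k - i)) \<cdot> (if i = 0 then 0 else f (i - 1) (Suc k - i))) =
      x \<cdot> (\<Sum>i\<le>k. (x ^ i * y ^ (k - i)) \<cdot> f i (k - i))" for k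
    unfolding scale_sum_right csc_laws
    by (subst sum.atMost_Suc_shift) (simp add: mult_ac)
  then show ?thesis
    unfolding arr_def by (subst sum.lessThan_Suc_shift) (simp add: scale_sum_right)
qed

lemma arr_shift_right:
  "y \<cdot> arr f K x y = arr (\<lambda>i j. if j = 0 then 0 else f i (j - 1)) (Suc K) x y"
proof -
  have "(\<Sum>i\<le>Suc k. (x ^ i * y ^ (Suc k - i)) \<cdot> (if Suc k - i = 0 then 0 else f i (Suc k - i - 1))) =
      y \<cdot> (\<Sum>i\<le>k. (x ^ i * y ^ (k - i)) \<cdot> f i (k - i))" for k
  proof -
    have "(\<Sum>i\<le>Suc k. (x ^ i * y ^ (Suc k - i)) \<cdot> (if Suc k - i = 0 then 0 else f i (Suc k - i - 1))) =
      (\<Sum>i\<le>k. (x ^ i * y ^ (Suc k - i)) \<cdot> (if Suc k - i = 0 then 0 else f i (Suc k - i - 1)))"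
      by (subst sum.atMost_Suc) simp
    also have "\<dots> = (\<Sum>i\<le>k. y \<cdot> ((x ^ i * y ^ (k - i)) \<cdot> f i (k - i)))"
      by (intro sum.cong refl) (simp add: csc_laws Suc_diff_le mult_ac)
    finally show ?thesis by (simp only: scale_sum_right)
  qed
  then show ?thesis
    unfolding arr_def by (subst sum.lessThan_Suc_shift) (simp add: scale_sum_right)
qed

lemma arr_extend:
  assumes "\<And>i j. i + j \<ge> K \<Longrightarrow> f i j = 0"
  shows "arr f (Suc K) x y = arr f K x y"
  using assms by (simp add: arr_def)

text \<open>Comparison of the coefficients of \<lambda>^n \<mu>^m. A factor linear in \<lambda>,
  \<mu> is enough for Virasoro-type brackets and for constant brackets of X with itself; s is -1 for
  commutators and 1 for two odd operators. As w is any polynomial, combinations of several actions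
  can stand on the right.\<close>

lemma linear_commutator:
  assumes a: "conf_op a" and b: "conf_op b"
    and rel: "\<And>x y. ev (a (ev (b v) y)) x + s \<cdot> ev (b (ev (a v) x)) y = (p * x + q * y + r) \<cdot> ev w (x + y)"
  shows "coeff (a (coeff (b v) m)) n + s \<cdot> coeff (b (coeff (a v) n)) m =
     (if n = 0 then 0 else (p * of_nat (n - 1 + m choose (n - 1))) \<cdot> coeff w (n - 1 + m)) +
     (if m = 0 then 0 else (q * of_nat (n + (m - 1) choose n)) \<cdot> coeff w (n + (m - 1))) +
     (r * of_nat (n + m choose n)) \<cdot> coeff w (n + m)"
proof -
  define L where "L i j = coeff (a (coeff (b v) j)) i" for i j
  define R where "R i j = coeff (b (coeff (a v) i)) j" for i j
  define W where "W i j = of_nat (i + j choose i) \<cdot> coeff w (i + j)" for i j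
  define Ia where "Ia = degree (a v)"
  define Jb where "Jb = degree (b v)"
  define I where "I = Ia + (\<Sum>j\<le>Jb. degree (a (coeff (b v) j)))"
  define J where "J = Jb + (\<Sum>i\<le>Ia. degree (b (coeff (a v) i)))"
  \<comment> \<open>Beyond the support of both iterated actions and of w, and beyond the index (n,
    m) itself.\<close>
  define K where "K = I + J + degree w + n + m + 1"
  have I1: "degree (a (coeff (b v) j)) \<le> I" for j
  proof (cases "j \<le> Jb")
    case True
    then show ?thesis
      unfolding I_def by (intro trans_le_add2 member_le_sum) auto
  next
    case False
    then show ?thesis by (simp add: Jb_def coeff_eq_0 conf_op_zero[OF a])
  qed
  have J1: "degree (b (coeff (a v) i)) \<le> J" for i
  proof (cases "i \<le> Ia")
    case True
    then show ?thesis
      unfolding J_def by (intro trans_le_add2 member_le_sum) auto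
  next
    case False
    then show ?thesis by (simp add: Ia_def coeff_eq_0 conf_op_zero[OF b])
  qed
  have bJ: "degree (b v) \<le> J" and aI: "degree (a v) \<le> I"
    by (simp_all add: I_def J_def Ia_def Jb_def)
  have L0: "L i j = 0" if "i > I \<or> j > J" for i j
    using that I1[of j] bJ by (auto simp: L_def coeff_eq_0 conf_op_zero[OF a])
  have R0: "R i j = 0" if "i > I \<or> j > J" for i j
    using that J1[of i] aI by (auto simp: R_def coeff_eq_0 conf_op_zero[OF b])
  have K: "K > I + J" "degree w < K" "n + m < K"
    by (auto simp: K_def)
  have LR0: "L i j + s \<cdot> R i j = 0" if "i + j \<ge> K" for i j
  proof -
    have "i > I \<or> j > J" using that K(1) by linarith
    then show ?thesis by (simp add: L0 R0)
  qed
  have evL: "ev (a (ev (b v) y)) x = arr L K x y" for x y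
  proof -
    have "ev (a (ev (b v) y)) x = (\<Sum>j\<le>J. y ^ j \<cdot> ev (a (coeff (b v) j)) x)"
      by (simp only: ev_altdef[OF bJ] C.endo_sum[OF endo_ev[OF a]] C.endo_scale[OF endo_ev[OF a]])
    also have "\<dots> = (\<Sum>j\<le>J. y ^ j \<cdot> (\<Sum>i\<le>I. x ^ i \<cdot> L i j))"
      by (simp only: ev_altdef[OF I1] L_def)
    also have "\<dots> = arr L K x y"
      by (rule arr_rect[OF L0 K(1)])
    finally show ?thesis .
  qed
  have evR: "ev (b (ev (a v) x)) y = arr R K x y" for x y
  proof -
    have "ev (b (ev (a v) x)) y = (\<Sum>i\<le>I. x ^ i \<cdot> ev (b (coeff (a v) i)) y)"
      by (simp only: ev_altdef[OF aI] C.endo_sum[OF endo_ev[OF b]] C.endo_scale[OF endo_ev[OF b]])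
    also have "\<dots> = (\<Sum>i\<le>I. x ^ i \<cdot> (\<Sum>j\<le>J. y ^ j \<cdot> R i j))"
      by (simp only: ev_altdef[OF J1] R_def)
    also have "\<dots> = (\<Sum>j\<le>J. y ^ j \<cdot> (\<Sum>i\<le>I. x ^ i \<cdot> R i j))"
      unfolding scale_sum_right csc_laws by (subst sum.swap) (simp add: mult.commute)
    also have "\<dots> = arr R K x y"
      by (rule arr_rect[OF R0 K(1)])
    finally show ?thesis .
  qed
  have W0: "W i j = 0" if "i + j \<ge> K" for i j
    using that K(2) by (simp add: W_def coeff_eq_0)
  \<comment> \<open>The coefficients of the difference of the two sides. Multiplication by x or y
    raises the total degree by one, hence the bound \<open>Suc K\<close> below.\<close>
  define D where "D i j = (L i j + s \<cdot> R i j) + (- 1) \<cdot> (p \<cdot> (if i = 0 then 0 else W (i - 1) j) +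
      q \<cdot> (if j = 0 then 0 else W i (j - 1)) + r \<cdot> W i j)" for i j
  have "arr D (Suc K) x y = 0" for x y
  proof -
    have "(p * x + q * y + r) \<cdot> ev w (x + y) =
        p \<cdot> x \<cdot> arr W K x y + q \<cdot> y \<cdot> arr W K x y + r \<cdot> arr W K x y"
      unfolding csc_laws arr_sum[OF K(2), of x y, folded W_def] ..
    also have "\<dots> = p \<cdot> arr (\<lambda>i j. if i = 0 then 0 else W (i - 1) j) (Suc K) x y +
        q \<cdot> arr (\<lambda>i j. if j = 0 then 0 else W i (j - 1)) (Suc K) x y + r \<cdot> arr W (Suc K) x y"
      by (simp only: arr_shift_left arr_shift_right arr_extend[of K W x y, OF W0])
    also have "\<dots> = arr (\<lambda>i j. p \<cdot> (if i = 0 then 0 else W (i - 1) j) +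
      q \<cdot> (if j = 0 then 0 else W i (j - 1)) + r \<cdot> W i j) (Suc K) x y"
      by (simp only: arr_scale arr_add)
    finally have 1: "(p * x + q * y + r) \<cdot> ev w (x + y) = \<dots>" .
    have 2: "ev (a (ev (b v) y)) x + s \<cdot> ev (b (ev (a v) x)) y = arr (\<lambda>i j. L i j + s \<cdot> R i j) (Suc K) x y"
      unfolding evL evR arr_scale arr_add by (rule arr_extend[OF LR0, symmetric])
    have "arr D (Suc K) x y = arr (\<lambda>i j. L i j + s \<cdot> R i j) (Suc K) x y +
      (- 1) \<cdot> arr (\<lambda>i j. p \<cdot> (if i = 0 then 0 else W (i - 1) j) +
      q \<cdot> (if j = 0 then 0 else W i (j - 1)) + r \<cdot> W i j) (Suc K) x y"
      unfolding arr_scale arr_add D_def ..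
    with rel[of y x] show ?thesis unfolding 1 2 by simp
  qed
  from arr_zero[OF this, of n m] K(3) have "D n m = 0" by simp
  then have "L n m + s \<cdot> R n m = p \<cdot> (if n = 0 then 0 else W (n - 1) m) +
      q \<cdot> (if m = 0 then 0 else W n (m - 1)) + r \<cdot> W n m"
    unfolding D_def csc_minus_one by (simp only: add_uminus_conv_diff right_minus_eq)
  then show ?thesis
    by (cases "n = 0"; cases "m = 0"; simp add: L_def R_def W_def mult.commute)
qed

end

text \<open>The first number is the value of \<partial> and the second that of \<lambda>, although
  \<lambda> is the outer indeterminate.\<close>

definition ev2 :: "complex poly poly \<Rightarrow> complex \<Rightarrow> complex \<Rightarrow> complex" where
  "ev2 f z x = poly (poly f [:x:]) z"

lemma ev2_eq_0D:
  assumes "\<And>z x. ev2 f z x = 0"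
  shows "f = 0"
proof (rule ccontr)
  assume "f \<noteq> 0"
  have "poly f [:x:] = 0" for x
    using assms by (intro poly_eq_poly_eq_iff[THEN iffD1] ext) (simp add: ev2_def)
  then have "range (\<lambda>x::complex. [:x:]) \<subseteq> {q. poly f q = 0}" by auto
  moreover have "infinite (range (\<lambda>x::complex. [:x:]))"
    by (intro range_inj_infinite infinite_UNIV_char_0 injI | simp add: finite_image_iff inj_on_def infinite_UNIV_char_0)+
  ultimately show False
    using poly_roots_finite[OF \<open>f \<noteq> 0\<close>] finite_subset by blast
qed

text \<open>\<complex>[\<partial>, \<lambda>] has no zero divisors; G is placed in it as a
  polynomial in \<partial> alone.\<close>

lemma ev2_mult_eq_0D:
  assumes "\<And>z x. ev2 f z x * poly G z = 0" "f \<noteq> 0"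
  shows "G = 0"
proof -
  have "f * [:G:] = 0"
    by (rule ev2_eq_0D) (use assms(1) in \<open>simp add: ev2_def mult.commute\<close>)
  with assms(2) show ?thesis by simp
qed

section \<open>Faithful actions and the relations they exclude\<close>

context del_module
begin

abbreviation cf :: "('m \<Rightarrow> 'm poly) \<Rightarrow> nat \<Rightarrow> 'm \<Rightarrow> 'm" where
  "cf f n v \<equiv> coeff (f v) n"

lemma bounded_part_singleton: "v \<in> bounded_part {f} N \<longleftrightarrow> (\<forall>n\<ge>N. cf f n v = 0)"
  by (simp add: bounded_part_def)

text \<open>The translate w(x + y) as a polynomial in y: translation does not raise the degree and
  keeps the coefficient at any upper bound d of the degree, even if that coefficient is
  zero.\<close>

lemma shifted_poly:
  "\<exists>w'. (\<forall>y. ev w' y = ev w (x + y)) \<and>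
     (\<forall>d. (\<forall>n>d. coeff w n = 0) \<longrightarrow> coeff w' d = coeff w d \<and> (\<forall>n>d. coeff w' n = 0))"
proof (induction w)
  case 0
  then show ?case by (intro exI[of _ 0]) simp
next
  case (pCons a w)
  then obtain w' where w': "\<And>y. ev w' y = ev w (x + y)"
    "\<And>d. (\<forall>n>d. coeff w n = 0) \<Longrightarrow> coeff w' d = coeff w d \<and> (\<forall>n>d. coeff w' n = 0)"
    by metis
  let ?w = "pCons a w' + map_poly (csc x) w'"
  show ?case
  proof (intro exI[of _ ?w] conjI allI impI)
    fix y
    show "ev ?w y = ev (pCons a w) (x + y)"
      by (simp only: ev_add ev_pCons ev_map_poly[OF endo_sm] w'(1) csc_laws(2) add_ac)
  next
    fix d assume d: "\<forall>n>d. coeff (pCons a w) n = 0"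
    show "coeff ?w d = coeff (pCons a w) d"
    proof (cases d)
      case 0
      have "w = 0"
      proof (rule poly_eqI)
        fix n show "coeff w n = coeff 0 n"
          using d[rule_format, of "Suc n"] 0 by simp
      qed
      then have "w' = 0"
        using w'(2)[of 0] by (intro poly_eqI) (case_tac n, auto)
      with 0 show ?thesis by simp
    next
      case (Suc e)
      have "coeff w n = 0" if "n > e" for n
        using d[rule_format, of "Suc n"] Suc that by simp
      then have "coeff w' e = coeff w e" "coeff w' (Suc e) = 0"
        using w'(2)[of e] by auto
      then show ?thesis using Suc by (simp add: coeff_map_poly)
    qed
    fix n assume n: "n > d"
    show "coeff ?w n = 0"
    proof -
      obtain m where m: "n = Suc m" using n by (cases n) auto
      have "coeff w k = 0" if "k \<ge> m" for k
        using d[rule_format, of "Suc k"] n m that by simp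
      then have "coeff w' m = 0" "coeff w' n = 0"
        using w'(2)[of m] m by auto
      with m show ?thesis by (simp add: coeff_map_poly)
    qed
  qed
qed

text \<open>Take the least N with a nonzero bounded part. It is positive because b is faithful, so N
  = d + 1, and a vector there with b_d v = 0 would lie in the part for d, which is zero.\<close>

lemma lowest_bounded_part:
  assumes b: "conf_op b" and ker: "\<And>v. b v = 0 \<Longrightarrow> v = 0" and "u \<noteq> (0::'m)"
  obtains d where "bounded_part {b} (Suc d) \<noteq> {0}"
    "\<forall>v\<in>bounded_part {b} (Suc d). cf b d v = 0 \<longrightarrow> v = 0"
proof -
  have ex: "u \<in> bounded_part {b} (Suc (degree (b u)))"
    by (simp add: bounded_part_singleton coeff_eq_0)
  define N where "N = (LEAST N. bounded_part {b} N \<noteq> {0})"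
  have N: "bounded_part {b} N \<noteq> {0}"
    unfolding N_def by (rule LeastI[of _ "Suc (degree (b u))"]) (use ex \<open>u \<noteq> 0\<close> in blast)
  have least: "bounded_part {b} n = {0}" if "n < N" for n
    using not_less_Least[of n "\<lambda>N. bounded_part {b} N \<noteq> {0}"] that unfolding N_def by blast
  have "N \<noteq> 0"
  proof
    assume "N = 0"
    have "v = 0" if "v \<in> bounded_part {b} N" for v
      using that \<open>N = 0\<close> by (intro ker) (simp add: bounded_part_singleton poly_eq_iff)
    moreover have "0 \<in> bounded_part {b} N"
      by (simp add: bounded_part_singleton conf_op_zero[OF b])
    ultimately show False using N by blast
  qed
  then obtain d where d: "N = Suc d" by (cases N) auto
  show thesis
  proof (rule that[of d], goal_cases)
    case 2
    show ?case
    proof (intro ballI impI)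
    fix v assume v: "v \<in> bounded_part {b} (Suc d)" "cf b d v = 0"
    then have "v \<in> bounded_part {b} d"
      by (auto simp: bounded_part_singleton) (metis le_antisym not_less_eq_eq)
    with least[of d] d show "v = 0" by simp
    qed
  qed (use N d in simp)
qed

lemma fin_dim_bounded_part1:
  assumes "conf_op b" "\<And>v. b v = 0 \<Longrightarrow> v = 0" "finite U" "span U = UNIV"
  shows "C.fin_dim (bounded_part {b} N)"
  by (rule fin_dim_bounded_part[OF _ _ assms(3,4)]) (use assms in auto)

lemma subspace_bounded_part1: "conf_op b \<Longrightarrow> C.subspace (bounded_part {b} N)"
  by (rule subspace_bounded_part) simp

lemma bounded_part_commuting:
  assumes "conf_op b" "C.endo T" "\<And>n v. T (cf b n v) = cf b n (T v)"
  shows "T ` bounded_part {b} N \<subseteq> bounded_part {b} N"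
  by (auto simp: bounded_part_singleton C.endo_zero[OF assms(2)] simp flip: assms(3))

text \<open>The top coefficient of \<open>b\<close> is injective on a finite-dimensional space and shifts the
  eigenvalues of \<open>a\<^sub>\<lambda>\<close> there, so there would be infinitely many of them.\<close>

lemma no_faithful_shift:
  assumes a: "conf_op a" and b: "conf_op b" and "p \<noteq> 0"
    and ab: "\<And>v x y. ev (a (ev (b v) y)) x - ev (b (ev (a v) x)) y = poly p x \<cdot> ev (b v) (x + y)"
    and bb: "\<And>n m v. cf b n (cf b m v) = cf b m (cf b n v)"
    and ker: "\<And>v. b v = 0 \<Longrightarrow> v = 0" and U: "finite U" "span U = UNIV"
  shows "(v::'m) = 0"
proof (rule ccontr)
  assume "v \<noteq> 0"
  obtain d where d: "bounded_part {b} (Suc d) \<noteq> {0}"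
    "\<forall>v\<in>bounded_part {b} (Suc d). cf b d v = 0 \<longrightarrow> v = 0"
    using lowest_bounded_part[OF b ker \<open>v \<noteq> 0\<close>] .
  obtain x where x: "poly p x \<noteq> 0"
    using \<open>p \<noteq> 0\<close> poly_all_0_iff_0 by blast
  define c where "c = poly p x"
  define S where "S v = ev (a v) x" for v
  let ?V = "bounded_part {b} (Suc d)"
  have S: "C.endo S" unfolding S_def by (rule endo_ev[OF a])
  \<comment> \<open>For fixed \<lambda> = x, b_\<mu>(S v) = S(b_\<mu> v) - c b_(x+\<mu>) v, and
    translation by x changes neither the degree bound d nor the coefficient at d.\<close>
  have key: "S v \<in> ?V \<and> S (cf b d v) = cf b d (S v) + c \<cdot> cf b d v" if v: "v \<in> ?V" for v
  proof -
    obtain w where w: "\<And>y. ev w y = ev (b v) (x + y)"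
      "\<And>d. (\<forall>n>d. cf b n v = 0) \<Longrightarrow> coeff w d = cf b d v \<and> (\<forall>n>d. coeff w n = 0)"
      using shifted_poly[of "b v" x] by metis
    have "b (S v) = map_poly S (b v) + - map_poly (csc c) w"
    proof (rule ev_eqI)
      fix y
      show "ev (b (S v)) y = ev (map_poly S (b v) + - map_poly (csc c) w) y"
        using ab[of v y x]
        by (simp only: ev_add ev_uminus ev_map_poly[OF S] ev_map_poly[OF endo_sm] w(1))
           (simp add: S_def c_def algebra_simps)
    qed
    then have e: "cf b n (S v) = S (cf b n v) - c \<cdot> coeff w n" for n
      by (simp add: coeff_map_poly C.endo_zero[OF S])
    have wd: "coeff w d = cf b d v" "\<forall>n>d. coeff w n = 0"
      using w(2)[of d] v by (auto simp: bounded_part_singleton)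
    have "cf b n (S v) = 0" if "n \<ge> Suc d" for n
      using v wd(2) that by (simp add: e bounded_part_singleton C.endo_zero[OF S])
    with wd(1) show ?thesis by (simp add: e bounded_part_singleton)
  qed
  have "c = 0"
    by (rule C.no_injective_shift[OF S endo_coeff[OF b, of d] subspace_bounded_part1[OF b]
          fin_dim_bounded_part1[OF b ker U] d(1)])
       (use key d(2) bounded_part_commuting[OF b endo_coeff[OF b] bb] in auto)
  with x c_def show False by simp
qed

text \<open>The hypotheses give a Heisenberg relation on a common eigenspace of the coefficients of \<open>b\<close>.\<close>

lemma no_faithful_central:
  assumes a: "conf_op a" and b: "conf_op b" and "f \<noteq> 0"
    and aa: "\<And>v x y. ev (a (ev (a v) y)) x - ev (a (ev (a v) x)) y = ev2 f (- x - y) x \<cdot> ev (b v) (x + y)"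
    and ab: "\<And>x n v. ev (a (cf b n v)) x = cf b n (ev (a v) x)"
    and bb: "\<And>n m v. cf b n (cf b m v) = cf b m (cf b n v)"
    and ker: "\<And>v. b v = 0 \<Longrightarrow> v = 0" and U: "finite U" "span U = UNIV"
  shows "(v::'m) = 0"
proof (rule ccontr)
  assume "v \<noteq> 0"
  obtain d where d: "bounded_part {b} (Suc d) \<noteq> {0}"
    by (rule lowest_bounded_part[OF b ker \<open>v \<noteq> 0\<close>])
  let ?V = "bounded_part {b} (Suc d)"
  have "\<exists>g. {v \<in> ?V. \<forall>n<Suc d. cf b n v = g n \<cdot> v} \<noteq> {0}"
    by (rule C.common_eigenspace[OF endo_coeff[OF b] subspace_bounded_part1[OF b]
        fin_dim_bounded_part1[OF b ker U] bounded_part_commuting[OF b endo_coeff[OF b] bb] d bb])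
  then obtain g where g: "{v \<in> ?V. \<forall>n<Suc d. cf b n v = g n \<cdot> v} \<noteq> {0}" ..
  define W where "W = {v \<in> ?V. \<forall>n<Suc d. cf b n v = g n \<cdot> v}"
  have W: "C.subspace W"
    using subspace_bounded_part1[OF b, of "Suc d"] unfolding C.subspace_def W_def
    by (auto simp: C.endo_zero[OF endo_coeff[OF b]] C.endo_add[OF endo_coeff[OF b]] C.endo_scale[OF endo_coeff[OF b]]
        scale_right_distrib mult.commute)
  have fd: "C.fin_dim W"
    by (rule C.fin_dim_subset[OF fin_dim_bounded_part1[OF b ker U]]) (auto simp: W_def)
  have inv: "(\<lambda>v. ev (a v) x) ` W \<subseteq> W" for x
    by (auto simp: W_def bounded_part_singleton C.endo_zero[OF endo_ev[OF a]] C.endo_scale[OF endo_ev[OF a]]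
        simp flip: ab)
  have evb: "ev (b v) z = (\<Sum>n\<le>d. g n * z ^ n) \<cdot> v" if "v \<in> W" for v z
  proof -
    have "degree (b v) \<le> d"
      using that by (intro degree_le) (auto simp: W_def bounded_part_singleton)
    then have "ev (b v) z = (\<Sum>n\<le>d. z ^ n \<cdot> cf b n v)" by (rule ev_altdef)
    also have "\<dots> = (\<Sum>n\<le>d. (g n * z ^ n) \<cdot> v)"
      using that by (intro sum.cong) (auto simp: W_def less_Suc_eq_le)
    finally show ?thesis by (simp only: C.scale_sum_left)
  qed
  \<comment> \<open>G(z) is the eigenvalue of b_\<lambda> on W at \<lambda> = -z; the sign comes
    from \<partial> = -\<lambda> - \<mu> in the bracket.\<close>
  define G where "G = (\<Sum>n\<le>d. monom (g n * (- 1) ^ n) n)"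
  have G: "poly G z = (\<Sum>n\<le>d. g n * (- z) ^ n)" for z
    by (simp add: G_def poly_sum poly_monom mult.assoc flip: power_mult_distrib)
  \<comment> \<open>With \<mu> = -z - \<lambda> the factor f(-\<lambda> - \<mu>, \<lambda>) becomes
    f(z, \<lambda>) and \<lambda> + \<mu> becomes -z, so every value of z and x is reached by two
    operators on the same W.\<close>
  have "ev2 f z x * poly G z = 0" for z x
  proof (rule C.no_heisenberg[OF endo_ev[OF a, of "- z - x"] endo_ev[OF a, of x] W fd _ inv inv])
    show "W \<noteq> {0}" using g W_def by simp
    fix v assume v: "v \<in> W"
    show "ev (a (ev (a v) (- z - x))) x = ev (a (ev (a v) x)) (- z - x) + (ev2 f z x * poly G z) \<cdot> v"
      using aa[of v "- z - x" x] evb[OF v, of "- z"] by (simp add: G diff_eq_eq add.commute mult.commute)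
  qed
  from ev2_mult_eq_0D[OF this \<open>f \<noteq> 0\<close>] have "G = 0" .
  have "g n = 0" if "n \<le> d" for n
    using arg_cong[OF \<open>G = 0\<close>, of "\<lambda>p. coeff p n"] that by (simp add: G_def coeff_sum)
  then have "v = 0" if "v \<in> W" for v
    using evb[OF that] by (intro ker ev_eqI) simp
  then have "W = {0}"
    using C.subspace_0[OF W] by auto
  with g W_def show False by simp
qed

text \<open>With \<open>d\<close> minimal such that the coefficients of \<open>b\<close> above \<open>d\<close> have a common kernel vector, the
  eigenvalues shift unless \<open>\<beta> = 0\<close> and \<open>d = \<alpha> - 1\<close>, and \<open>a\<^sub>2\<close>, \<open>b\<^bsub>d - 1\<^esub>\<close> satisfy a Heisenberg
  relation unless \<open>d = 0\<close>.\<close>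

lemma faithful_density:
  assumes a: "conf_op a" and b: "conf_op b"
    and ab: "\<And>v x y. ev (a (ev (b v) y)) x - ev (b (ev (a v) x)) y =
      ((\<alpha> - 1) * x - y + \<beta>) \<cdot> ev (b v) (x + y)"
    and bb: "\<And>n m v. cf b n (cf b m v) = cf b m (cf b n v)"
    and ker: "\<And>v. b v = 0 \<Longrightarrow> v = 0" and U: "finite U" "span U = UNIV" and "u \<noteq> (0::'m)"
  obtains \<tau> where "\<alpha> = 1" "\<beta> = 0" "\<tau> \<noteq> 0" "{v. b v = [:\<tau> \<cdot> v:]} \<noteq> {0}" "C.subspace {v. b v = [:\<tau> \<cdot> v:]}"
    "C.fin_dim {v. b v = [:\<tau> \<cdot> v:]}"
    "\<And>n v. n \<ge> 1 \<Longrightarrow> b v = [:\<tau> \<cdot> v:] \<Longrightarrow> b (cf a n v) = [:\<tau> \<cdot> cf a n v:]"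
    "\<And>v. b v = [:\<tau> \<cdot> v:] \<Longrightarrow> b (cf a 0 v - del v) = [:\<tau> \<cdot> (cf a 0 v - del v):]"
proof -
  obtain d where d: "bounded_part {b} (Suc d) \<noteq> {0}"
    "\<forall>v\<in>bounded_part {b} (Suc d). cf b d v = 0 \<longrightarrow> v = 0"
    using lowest_bounded_part[OF b ker \<open>u \<noteq> 0\<close>] .
  let ?V = "bounded_part {b} (Suc d)"
  have V: "C.subspace ?V" "C.fin_dim ?V"
    by (rule subspace_bounded_part1[OF b] fin_dim_bounded_part1[OF b ker U])+
  have bV: "cf b n ` ?V \<subseteq> ?V" for n
    by (rule bounded_part_commuting[OF b endo_coeff[OF b] bb])
  have com: "cf a n (cf b m v) = cf b m (cf a n v) +
     (if n = 0 then 0 else ((\<alpha> - 1) * of_nat (n - 1 + m choose (n - 1))) \<cdot> cf b (n - 1 + m) v) -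
     (if m = 0 then 0 else of_nat (n + (m - 1) choose n) \<cdot> cf b (n + (m - 1)) v) +
     (\<beta> * of_nat (n + m choose n)) \<cdot> cf b (n + m) v" for n m v
    using linear_commutator[OF a b, where v = v and s = "- 1" and p = "\<alpha> - 1" and q = "- 1"
        and r = \<beta> and w = "b v" and m = m and n = n] ab[of v]
    by (simp add: algebra_simps split: if_splits)
  define T where "T v = cf a 0 v - del v" for v
  have T: "C.endo T"
    unfolding C.endo_def T_def
    by (simp only: C.endo_add[OF endo_coeff[OF a]] C.endo_scale[OF endo_coeff[OF a]]
      C.endo_add[OF endo_sm] C.endo_scale[OF endo_sm] scale_right_diff_distrib) simp
  have comT: "T (cf b m v) = cf b m (T v) + \<beta> \<cdot> cf b m v" for m v
    unfolding T_def
    by (simp add: com coeff_del[OF b] C.endo_diff[OF endo_coeff[OF b]])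
  have aV: "cf a n ` ?V \<subseteq> ?V" if "n \<ge> 1" for n
  proof (clarsimp simp: bounded_part_singleton)
    fix v m assume v: "\<forall>n\<ge>Suc d. cf b n v = 0" and m: "Suc d \<le> m"
    show "cf b m (cf a n v) = 0"
      using com[where n = n and m = m and v = v] v m that by (simp add: C.endo_zero[OF endo_coeff[OF a]])
  qed
  have TV: "T ` ?V \<subseteq> ?V"
  proof (clarsimp simp: bounded_part_singleton)
    fix v m assume v: "\<forall>n\<ge>Suc d. cf b n v = 0" and m: "Suc d \<le> m"
    show "cf b m (T v) = 0"
      using comT[where m = m and v = v] v m by (simp add: C.endo_zero[OF T])
  qed
  have \<beta>: "\<beta> = 0"
    by (rule C.no_injective_shift[OF T endo_coeff[OF b, of d] V d(1) TV bV comT])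
       (use d(2) in blast)
  \<comment> \<open>In \<open>com\<close> at n = 1, m = d the first term contributes \<alpha> - 1
    and the second -d.\<close>
  have "\<alpha> - 1 - of_nat d = 0"
  proof (rule C.no_injective_shift[OF endo_coeff[OF a, of 1] endo_coeff[OF b, of d] V d(1) aV bV])
    fix v assume "v \<in> ?V"
    then show "cf a 1 (cf b d v) = cf b d (cf a 1 v) + (\<alpha> - 1 - of_nat d) \<cdot> cf b d v"
      by (simp add: com \<beta> csc_laws(2) C.scale_left_diff_distrib)
  qed (use d(2) in auto)
  then have \<alpha>: "\<alpha> = 1 + of_nat d" by (simp add: algebra_simps)
  obtain v \<tau> where v: "v \<in> ?V" "v \<noteq> 0" "cf b d v = \<tau> \<cdot> v"
    using C.eigenvector_exists[OF endo_coeff[OF b, of d] V bV d(1)] .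
  have \<tau>: "\<tau> \<noteq> 0"
    using d(2) v by auto
  define W where "W = C.eigenspace ?V (cf b d) \<tau>"
  have W: "C.subspace W"
    unfolding W_def by (rule C.subspace_eigenspace[OF endo_coeff[OF b] V(1)])
  have fd: "C.fin_dim W"
    unfolding W_def by (rule C.fin_dim_subset[OF V(2) C.eigenspace_subset])
  have "v \<in> W" using v by (simp add: W_def C.eigenspace_def)
  with v(2) have Wn: "W \<noteq> {0}" by (metis singletonD)
  have "d = 0"
  proof (rule ccontr)
    assume "d \<noteq> 0"
    \<comment> \<open>In \<open>com\<close> at n = 2, m = d - 1 the first term contributes (\<alpha>
      - 1)(d choose 1) = d^2 and the second -(d choose 2); both multiply b_d, which is \<tau> on
      W.\<close>
    have "((of_nat d * of_nat d - of_nat (d choose 2)) * \<tau> :: complex) = 0"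
    proof (rule C.no_heisenberg[OF endo_coeff[OF b, of "d - 1"] endo_coeff[OF a, of 2] W fd Wn])
      show "cf b (d - 1) ` W \<subseteq> W"
        unfolding W_def
      proof (rule C.eigenspace_invariant[OF endo_coeff[OF b] bV])
        show "cf b (d - 1) (cf b d v) = cf b d (cf b (d - 1) v)" for v by (rule bb)
      qed
      show "cf a 2 ` W \<subseteq> W"
        unfolding W_def
      proof (rule C.eigenspace_invariant[OF endo_coeff[OF a] aV])
        fix v assume "v \<in> ?V"
        then show "cf a 2 (cf b d v) = cf b d (cf a 2 v)"
          by (simp add: com \<beta> bounded_part_singleton)
      qed simp
      fix v assume w: "v \<in> W"
      have "cf a 2 (cf b (d - 1) v) = cf b (d - 1) (cf a 2 v) +
          (of_nat d * of_nat d - of_nat (d choose 2)) \<cdot> cf b d v"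
      proof (cases "d = 1")
        case True
        then show ?thesis by (simp add: com \<beta> \<alpha> binomial_eq_0)
      next
        case False
        with \<open>d \<noteq> 0\<close> have i: "1 + (d - 1) = d" "2 + (d - 1 - 1) = d" "(2::nat) - 1 = 1" "(2 = (0::nat)) = False"
          "(d - 1 = 0) = False" "\<alpha> - 1 = of_nat d"
          by (simp_all add: \<alpha>)
        show ?thesis
          unfolding com[where n = 2 and m = "d - 1" and v = v] i \<beta> if_False
          by (simp add: C.scale_left_diff_distrib)
      qed
      also have "cf b d v = \<tau> \<cdot> v"
        using w by (simp add: W_def C.eigenspace_def)
      finally show "cf a 2 (cf b (d - 1) v) = cf b (d - 1) (cf a 2 v) +
          ((of_nat d * of_nat d - of_nat (d choose 2)) * \<tau>) \<cdot> v"
        by (simp add: mult.commute)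
    qed
    with \<tau> have "(of_nat (d * d) :: complex) = of_nat (d choose 2)" by simp
    then have "d * d = d choose 2" by (simp only: of_nat_eq_iff)
    moreover have "d choose 2 \<le> d * (d - 1)" by (simp add: choose_two)
    moreover have "d * (d - 1) < d * d" using \<open>d \<noteq> 0\<close> by simp
    ultimately show False by simp
  qed
  have W_eq: "W = {v. b v = [:\<tau> \<cdot> v:]}"
  proof (intro set_eqI iffI)
    fix v assume "v \<in> W"
    then have "\<And>n. n \<ge> 1 \<Longrightarrow> cf b n v = 0" "cf b 0 v = \<tau> \<cdot> v"
      by (auto simp: W_def C.eigenspace_def bounded_part_singleton \<open>d = 0\<close>)
    then have "coeff (b v) n = coeff [:\<tau> \<cdot> v:] n" for n
      by (cases n) auto
    then show "v \<in> {v. b v = [:\<tau> \<cdot> v:]}" by (simp add: poly_eq_iff)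
  next
    fix v assume "v \<in> {v. b v = [:\<tau> \<cdot> v:]}"
    then show "v \<in> W"
      by (auto simp: W_def C.eigenspace_def bounded_part_singleton \<open>d = 0\<close> coeff_pCons split: nat.splits)
  qed
  show thesis
  proof (rule that)
    show "\<alpha> = 1" using \<alpha> \<open>d = 0\<close> by simp
    show "\<beta> = 0" by (rule \<beta>)
    show "\<tau> \<noteq> 0" by (rule \<tau>)
    show "{v. b v = [:\<tau> \<cdot> v:]} \<noteq> {0}" "C.subspace {v. b v = [:\<tau> \<cdot> v:]}" "C.fin_dim {v. b v = [:\<tau> \<cdot> v:]}"
      using Wn W fd W_eq by auto
    show "b (cf a n v) = [:\<tau> \<cdot> cf a n v:]" if "n \<ge> 1" "b v = [:\<tau> \<cdot> v:]" for n v
    proof -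
      have "cf a n ` W \<subseteq> W"
        unfolding W_def
      proof (rule C.eigenspace_invariant[OF endo_coeff[OF a] aV[OF that(1)]])
        fix v assume "v \<in> ?V"
        then show "cf a n (cf b d v) = cf b d (cf a n v)"
          using that(1) by (simp add: com \<beta> \<alpha> \<open>d = 0\<close> bounded_part_singleton)
      qed
      with that(2) show ?thesis unfolding W_eq image_subset_iff by simp
    qed
    show "b (cf a 0 v - del v) = [:\<tau> \<cdot> (cf a 0 v - del v):]" if "b v = [:\<tau> \<cdot> v:]" for v
    proof -
      have "T ` W \<subseteq> W"
        unfolding W_def by (rule C.eigenspace_invariant[OF T TV]) (simp add: comT \<beta>)
      with that show ?thesis unfolding W_eq image_subset_iff T_def by simp
    qed
  qed
qed

text \<open>For one N all b_n with n \<ge> N vanish on the finite-dimensional V, and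
  \<open>rel\<close> expresses b_n through b_(n+1), so the vanishing descends to n = 0. The relation
  holds for T = a_0 - \<partial> if b commutes with a_0, since [\<partial>, b_(n+1)] = -b_n.\<close>

lemma commuting_kills:
  assumes b: "conf_op b" and T: "C.endo T" and V: "C.subspace V" "C.fin_dim V"
    and inv: "\<And>n. cf b n ` V \<subseteq> V" "T ` V \<subseteq> V"
    and rel: "\<And>n v. v \<in> V \<Longrightarrow> T (cf b (Suc n) v) = cf b (Suc n) (T v) + cf b n v"
    and v: "v \<in> V"
  shows "b v = 0"
proof -
  obtain B where B: "finite B" "B \<subseteq> V" "V \<subseteq> C.span B"
    using C.fin_dim_spanning[OF V(2)] .
  define N where "N = Suc (\<Sum>u\<in>B. degree (b u))"
  have "cf b n v = 0" if "n \<ge> N" "v \<in> C.span B" for n v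
    using that(2)
  proof (induction rule: C.span_induct_alt)
    case base
    then show ?case by (simp add: conf_op_zero[OF b])
  next
    case (step c x y)
    have "degree (b x) \<le> (\<Sum>u\<in>B. degree (b u))"
      using step B(1) by (intro member_le_sum) auto
    with that(1) have "cf b n x = 0" by (intro coeff_eq_0) (simp add: N_def)
    with step show ?case
      by (simp add: C.endo_add[OF endo_coeff[OF b]] C.endo_scale[OF endo_coeff[OF b]])
  qed
  then have top: "cf b n v = 0" if "n \<ge> N" "v \<in> V" for n v
    using that B(3) by blast
  have "\<forall>n v. n \<ge> N - k \<longrightarrow> v \<in> V \<longrightarrow> cf b n v = 0" for k
  proof (induction k)
    case 0
    then show ?case using top by simp
  next
    case (Suc k)
    show ?case
    proof (intro allI impI)
      fix n v assume n: "n \<ge> N - Suc k" and v: "v \<in> V"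
      show "cf b n v = 0"
      proof (cases "n \<ge> N - k")
        case True
        with Suc v show ?thesis by blast
      next
        case False
        with n have "Suc n \<ge> N - k" by simp
        with Suc v inv(2) have "cf b (Suc n) v = 0" "cf b (Suc n) (T v) = 0" by blast+
        with rel[OF v, of n] show ?thesis by (simp add: C.endo_zero[OF T])
      qed
    qed
  qed
  from this[of N] v show ?thesis by (simp add: poly_eq_iff)
qed

end

lemma bit_cases2: "i = 0 \<or> i = (1::bit)"
  using UNIV_bit by blast

lemma sum_gen: "(\<Sum>k\<in>UNIV. f k) = f genA + f genB + f genX"
  by (simp add: UNIV_gen add.assoc)

section \<open>Anticommuting coefficients and primary operators\<close>

context del_module
begin

lemma self_neg: "w = - w \<Longrightarrow> w = (0::'m)"
  by (metis C.scale_eq_0_iff add.right_inverse csc_laws(2,4) one_add_one zero_neq_numeral)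

lemma zero_commutator:
  assumes "conf_op a" "conf_op b"
    and "\<And>x y. ev (a (ev (b v) y)) x + s \<cdot> ev (b (ev (a v) x)) y = 0"
  shows "cf a n (cf b m v) + s \<cdot> cf b m (cf a n v) = 0"
  using linear_commutator[OF assms(1,2), where v = v and s = s and p = 0 and q = 0 and r = 0 and w = 0
      and m = m and n = n] assms(3) by simp

text \<open>The coefficients are killed one at a time: if x_n u \<noteq> 0, replace u by x_n u,
  which x_n kills because x_n^2 = 0, and which the earlier coefficients still kill by
  anticommutation. Only indices below D matter, as the others vanish on v. The offset
  \<open>n\<^sub>0\<close> admits the case that x_0 has a nonzero square.\<close>

lemma anticommuting_kernel:
  assumes x: "conf_op x" and V: "\<And>n. n \<ge> n\<^sub>0 \<Longrightarrow> cf x n ` V \<subseteq> V"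
    and anti: "\<And>n m v. v \<in> V \<Longrightarrow> n \<ge> n\<^sub>0 \<Longrightarrow> m \<ge> n\<^sub>0 \<Longrightarrow> cf x n (cf x m v) = - cf x m (cf x n v)"
    and v: "v \<in> V" "v \<noteq> 0"
  obtains u where "u \<in> V" "u \<noteq> 0" "\<And>n. n \<ge> n\<^sub>0 \<Longrightarrow> cf x n u = 0"
proof -
  define D where "D = Suc (degree (x v))"
  have "\<exists>u\<in>V. u \<noteq> 0 \<and> (\<forall>n\<ge>n\<^sub>0. n < n\<^sub>0 + k \<or> n \<ge> D \<longrightarrow> cf x n u = 0)" for k
  proof (induction k)
    case 0
    then show ?case
      using v by (intro bexI[of _ v]) (auto simp: D_def coeff_eq_0)
  next
    case (Suc k)
    then obtain u where u: "u \<in> V" "u \<noteq> 0" "\<And>n. n \<ge> n\<^sub>0 \<Longrightarrow> n < n\<^sub>0 + k \<or> n \<ge> D \<Longrightarrow> cf x n u = 0"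
      by metis
    let ?w = "cf x (n\<^sub>0 + k) u"
    show ?case
    proof (cases "?w = 0")
      case True
      show ?thesis
      proof (intro bexI[of _ u] conjI allI impI)
        fix n assume "n\<^sub>0 \<le> n" "n < n\<^sub>0 + Suc k \<or> D \<le> n"
        then show "cf x n u = 0"
          using u(3)[of n] True by (cases "n = n\<^sub>0 + k") auto
      qed (use u in auto)
    next
      case False
      show ?thesis
      proof (intro bexI[of _ ?w] conjI allI impI)
        fix n assume n: "n\<^sub>0 \<le> n" "n < n\<^sub>0 + Suc k \<or> D \<le> n"
        show "cf x n ?w = 0"
        proof (cases "n = n\<^sub>0 + k")
          case True
          with anti[OF u(1), of "n\<^sub>0 + k" "n\<^sub>0 + k"] show ?thesis
            by (intro self_neg) simp
        next
          case False
          with n have "cf x n u = 0" by (intro u(3)) auto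
          then show ?thesis
            using anti[OF u(1) n(1), of "n\<^sub>0 + k"] by (simp add: conf_op_zero[OF x])
        qed
      qed (use False V[of "n\<^sub>0 + k"] u(1) in auto)
    qed
  qed
  from this[of D] obtain u where "u \<in> V" "u \<noteq> 0" "\<And>n. n \<ge> n\<^sub>0 \<Longrightarrow> n < n\<^sub>0 + D \<or> n \<ge> D \<Longrightarrow> cf x n u = 0"
    by metis
  then show thesis
    by (intro that[of u]) (meson not_le_imp_less trans_less_add2)+
qed

text \<open>Neither \<open>f\<^sub>0\<close> nor \<open>\<partial>\<close> preserves the bounded parts, but their difference does.\<close>

definition shift_op :: "('m \<Rightarrow> 'm poly) \<Rightarrow> 'm \<Rightarrow> 'm" where
  "shift_op a v = cf a 0 v - del v"

lemma endo_shift_op: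
  assumes "conf_op a"
  shows "C.endo (shift_op a)"
  unfolding C.endo_def shift_op_def
  by (simp only: C.endo_add[OF endo_coeff[OF assms]] C.endo_scale[OF endo_coeff[OF assms]]
    C.endo_add[OF endo_sm] C.endo_scale[OF endo_sm] scale_right_diff_distrib) simp

text \<open>The hypothesis is [a_\<lambda> b] = (\<partial> + (p + 1)\<lambda>) b with \<partial>
  replaced by -\<lambda> - \<mu>: b is primary of weight p + 1.\<close>

lemma primary_commutator:
  assumes "conf_op a" "conf_op b"
    and "\<And>x y. ev (a (ev (b v) y)) x - ev (b (ev (a v) x)) y = (p * x - y) \<cdot> ev (b v) (x + y)"
  shows "cf a n (cf b m v) = cf b m (cf a n v) +
      (if n = 0 then 0 else (p * of_nat (n - 1 + m choose (n - 1))) \<cdot> cf b (n - 1 + m) v) -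
      (if m = 0 then 0 else of_nat (n + (m - 1) choose n) \<cdot> cf b (n + (m - 1)) v)"
  using linear_commutator[OF assms(1,2), where v = v and s = "- 1" and p = p and q = "- 1"
      and r = 0 and w = "b v" and m = m and n = n] assms(3)
  by (simp add: algebra_simps split: if_splits)

text \<open>a_0 and \<partial> have the same commutator -b_(m-1) with b_m, so it cancels in the
  difference.\<close>

lemma shift_op_commutes:
  assumes "conf_op a" "conf_op b"
    and "\<And>x y. ev (a (ev (b v) y)) x - ev (b (ev (a v) x)) y = (p * x - y) \<cdot> ev (b v) (x + y)"
  shows "shift_op a (cf b m v) = cf b m (shift_op a v)"
  using primary_commutator[OF assms, where n = 0 and m = m]
  by (simp add: shift_op_def coeff_del[OF assms(2)] C.endo_diff[OF endo_coeff[OF assms(2)]])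

lemma weight_commutator:
  assumes "conf_op a" "conf_op b"
    and "\<And>x y. ev (a (ev (b v) y)) x - ev (b (ev (a v) x)) y = (p * x - y) \<cdot> ev (b v) (x + y)"
  shows "cf a 1 (cf b m v) = cf b m (cf a 1 v) + (p - of_nat m) \<cdot> cf b m v"
  using primary_commutator[OF assms, where n = 1 and m = m] by (cases m) (simp_all add: C.scale_left_diff_distrib)

text \<open>The commutator is a multiple of b_(n+m-1) v, which vanishes as soon as n + m - 1 \<ge>
  N.\<close>

lemma primary_bounded:
  assumes "conf_op a" "conf_op b"
    and "\<And>x y. ev (a (ev (b v) y)) x - ev (b (ev (a v) x)) y = (p * x - y) \<cdot> ev (b v) (x + y)"
    and "n \<ge> 1 \<or> m = 0" "\<And>k. k \<ge> N \<Longrightarrow> cf b k v = 0" "m + n \<ge> N + 1 \<or> N = 0"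
  shows "cf a n (cf b m v) = cf b m (cf a n v)"
proof -
  have "n - 1 + m \<ge> N \<or> n = 0" "n + (m - 1) \<ge> N \<or> m = 0" using assms(4,6) by auto
  then show ?thesis
    using primary_commutator[OF assms(1-3), where n = n and m = m] assms(5) by auto
qed

end

section \<open>Irreducible modules\<close>

text \<open>Only the actions of A, B, X are kept, together with the values of the structure
  polynomials \<open>br\<close> at \<partial> and \<lambda>. In \<open>rel\<close> the value of
  \<partial> is -\<lambda> - \<mu>, because [g_\<lambda> h] acts at \<lambda> + \<mu>; two odd
  generators give an anticommutator.\<close>

locale gen_module = del_module sm
  for sm :: "complex poly \<Rightarrow> 'm::ab_group_add \<Rightarrow> 'm" +
  fixes P :: "bit \<Rightarrow> 'm set"
    and op :: "gen \<Rightarrow> 'm \<Rightarrow> 'm poly"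
    and br :: "gen \<Rightarrow> gen \<Rightarrow> gen \<Rightarrow> complex \<Rightarrow> complex \<Rightarrow> complex"
  assumes conf: "conf_op (op g)"
    and part_subspace: "subspace (P i)"
    and part_int: "P 0 \<inter> P 1 = {0}"
    and part_dec: "\<exists>x\<in>P 0. \<exists>y\<in>P 1. v = x + y"
    and op_part: "v \<in> P j \<Longrightarrow> cf (op g) n v \<in> P (gpar g + j)"
    and rel: "ev (op g (ev (op h v) y)) x + (if gpar g * gpar h = 1 then 1 else - 1) \<cdot> ev (op h (ev (op g v) x)) y =
      (\<Sum>k\<in>UNIV. br g h k (- x - y) x \<cdot> ev (op k v) (x + y))"
    and fin_gen: "\<exists>U. finite U \<and> span U = UNIV"
    and nontrivial: "\<exists>g v. op g v \<noteq> 0"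
    and irreducible: "subspace N \<Longrightarrow> (\<And>x y. x \<in> P 0 \<Longrightarrow> y \<in> P 1 \<Longrightarrow> x + y \<in> N \<Longrightarrow> x \<in> N \<and> y \<in> N) \<Longrightarrow>
      (\<And>g v n. v \<in> N \<Longrightarrow> cf (op g) n v \<in> N) \<Longrightarrow> N = {0} \<or> N = UNIV"
begin

definition acts0 :: "gen \<Rightarrow> bool" where
  "acts0 g \<longleftrightarrow> (\<forall>v. op g v = 0)"

lemmas endo_cf = endo_coeff[OF conf]
lemmas cf_add = C.endo_add[OF endo_cf] and cf_scale = C.endo_scale[OF endo_cf]
  and cf_zero = C.endo_zero[OF endo_cf]

lemma part_indep:
  assumes "x \<in> P i" "y \<in> P (i + 1)" "x + y = 0"
  shows "x = 0 \<and> y = 0"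
proof -
  have "x = - y" using assms(3) by (simp add: eq_neg_iff_add_eq_0)
  then have "x \<in> P (i + 1)" using assms(2) subspace_neg[OF part_subspace] by blast
  with assms(1) have "x \<in> P 0 \<inter> P 1" using bit_cases2[of i] by auto
  with part_int assms(3) show ?thesis by auto
qed

lemma part_op_sm: "v \<in> P i \<Longrightarrow> sm p v \<in> P i"
  using subspace_scale[OF part_subspace] .

lemma part_csubspace: "C.subspace (P i)"
  using part_subspace[of i] by (auto simp: C.subspace_def subspace_def)

definition graded :: "'m set \<Rightarrow> bool" where
  "graded N \<longleftrightarrow> (\<forall>x\<in>P 0. \<forall>y\<in>P 1. x + y \<in> N \<longrightarrow> x \<in> N \<and> y \<in> N)"

lemma graded_kernel:
  assumes "\<And>L. L \<in> \<L> \<Longrightarrow> C.endo L" "\<And>L. L \<in> \<L> \<Longrightarrow> \<exists>j. \<forall>i. \<forall>v\<in>P i. L v \<in> P (i + j)"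
    and N: "N = {v \<in> V. \<forall>L\<in>\<L>. L v = 0}" "graded V"
  shows "graded N"
  unfolding graded_def
proof (intro ballI impI)
  fix x y assume xy: "x \<in> P 0" "y \<in> P 1" "x + y \<in> N"
  have V: "x \<in> V" "y \<in> V" using xy N by (auto simp: graded_def)
  have "L x = 0 \<and> L y = 0" if L: "L \<in> \<L>" for L
  proof -
    obtain j where j: "\<And>i v. v \<in> P i \<Longrightarrow> L v \<in> P (i + j)" using assms(2)[OF L] by blast
    have "L x + L y = 0" using xy(3) N(1) L C.endo_add[OF assms(1)[OF L]] by auto
    then show ?thesis
      using part_indep[of "L x" "0 + j" "L y"] j[OF xy(1)] j[OF xy(2)] by (simp add: add.commute)
  qed
  with V show "x \<in> N \<and> y \<in> N" using N(1) by auto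
qed

lemma graded_UNIV: "graded UNIV"
  by (simp add: graded_def)

lemma cf_parity: "\<exists>j. \<forall>i. \<forall>v\<in>P i. cf (op g) n v \<in> P (i + j)"
  by (intro exI[of _ "gpar g"] allI ballI) (subst add.commute, rule op_part)

lemma op_part_even: "gpar g = 0 \<Longrightarrow> v \<in> P i \<Longrightarrow> cf (op g) n v \<in> P i"
  using op_part[of v i g n] by (simp only: add_0)

lemma graded_cf_kernel:
  assumes "graded V" "N = {v \<in> V. \<forall>(g, n)\<in>K. cf (op g) n v = 0}"
  shows "graded N"
proof (rule graded_kernel[OF _ _ _ assms(1)])
  show "N = {v \<in> V. \<forall>L\<in>(\<lambda>(g, n). cf (op g) n) ` K. L v = 0}"
    using assms(2) by auto
  fix L assume "L \<in> (\<lambda>(g, n). cf (op g) n) ` K"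
  then obtain g n where L: "L = cf (op g) n" by auto
  show "C.endo L" "\<exists>j. \<forall>i. \<forall>v\<in>P i. L v \<in> P (i + j)"
    unfolding L by (rule endo_cf cf_parity)+
qed

lemma homogeneous_element:
  assumes "graded N" "N \<noteq> {0}" "0 \<in> N"
  obtains i where "N \<inter> P i \<noteq> {0}"
proof -
  obtain v where v: "v \<in> N" "v \<noteq> 0" using assms by blast
  obtain x y where xy: "x \<in> P 0" "y \<in> P 1" "v = x + y" using part_dec by blast
  then have "x \<in> N" "y \<in> N" using assms(1) v(1) by (auto simp: graded_def)
  moreover have "x \<noteq> 0 \<or> y \<noteq> 0" using v xy by auto
  ultimately show thesis using that xy by blast
qed

text \<open>The hypothesis says that G spans an ideal up to generators that act as zero. The common
  kernel is then a submodule: for v in it, g_\<mu>(h_\<lambda> v) is up to sign [h_\<lambda> g]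
  applied to v, which is zero.\<close>

lemma ker_dichotomy:
  assumes "\<And>h g k. g \<in> G \<Longrightarrow> k \<notin> G \<Longrightarrow> (\<forall>z x. br h g k z x = 0) \<or> acts0 k"
  shows "(\<forall>g\<in>G. acts0 g) \<or> (\<forall>v. (\<forall>g\<in>G. op g v = 0) \<longrightarrow> v = 0)"
proof -
  let ?N = "{v. \<forall>g\<in>G. op g v = 0}"
  have "?N = {0} \<or> ?N = UNIV"
  proof (rule irreducible)
    have "op g (sm p v) = 0" if "op g v = 0" for g p v
      by (rule ev_eqI) (simp add: conf_op_sm[OF conf] that)
    moreover have "op g (u + v) = 0" if "op g u = 0" "op g v = 0" for g u v
      using that conf[of g] by (simp add: conf_op_def)
    ultimately show "subspace ?N"
      by (auto simp: subspace_def conf_op_zero[OF conf])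
  next
    have "?N = {v \<in> UNIV. \<forall>(g, n)\<in>G \<times> UNIV. cf (op g) n v = 0}"
      by (auto simp: poly_eq_iff)
    then have "graded ?N" by (rule graded_cf_kernel[OF graded_UNIV])
    then show "x \<in> ?N \<and> y \<in> ?N" if "x \<in> P 0" "y \<in> P 1" "x + y \<in> ?N" for x y
      using that unfolding graded_def by blast
  next
    fix h v n assume v: "v \<in> ?N"
    have "op g (cf (op h) n v) = 0" if g: "g \<in> G" for g
    proof (rule poly_eqI)
      fix m
      let ?s = "if gpar h * gpar g = 1 then 1 else - 1 :: complex"
      have "br h g k (- x - y) x \<cdot> ev (op k v) (x + y) = 0" for k x y
        using assms[OF g, of k h] v by (cases "k \<in> G") (auto simp: acts0_def)
      then have "ev (op h (ev (op g v) y)) x + ?s \<cdot> ev (op g (ev (op h v) x)) y = 0" for x y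
        by (simp only: rel) simp
      from zero_commutator[OF conf conf this, where n = n and m = m]
      have "?s \<cdot> cf (op g) m (cf (op h) n v) = 0"
        using v g by (simp add: conf_op_zero[OF conf])
      then show "coeff (op g (cf (op h) n v)) m = coeff 0 m"
        by (auto split: if_splits)
    qed
    then show "cf (op h) n v \<in> ?N" by simp
  qed
  then show ?thesis
  proof
    assume "?N = UNIV"
    then show ?thesis by (auto simp: acts0_def)
  qed blast
qed

lemma joint_kernel:
  assumes "\<And>g. op g v = 0"
  shows "v = 0"
  using ker_dichotomy[of UNIV] nontrivial assms by (auto simp: acts0_def)

lemma nonzero_vector: obtains v :: 'm where "v \<noteq> 0"
  using nontrivial conf_op_zero[OF conf] by metis

lemma torsion_free:
  assumes "sm p v = 0" "v \<noteq> 0"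
  shows "p = 0"
proof (rule ccontr)
  assume "p \<noteq> 0"
  then have "op g v = 0" for g using conf_op_torsion[OF conf _ assms(1)] by blast
  with assms(2) joint_kernel show False by blast
qed

text \<open>Stability is checked on S alone: passing from s to \<partial> s only brings in
  \<partial> times a coefficient and the preceding coefficient, so it propagates to p(\<partial>) s.
  Homogeneity of S makes the span graded.\<close>

lemma span_dichotomy:
  assumes hom: "\<And>s. s \<in> S \<Longrightarrow> \<exists>i. s \<in> P i"
    and stable: "\<And>g s n. s \<in> S \<Longrightarrow> cf (op g) n s \<in> span S"
  shows "span S = {0} \<or> span S = UNIV"
proof (rule irreducible)
  show "subspace (span S)" by simp
next
  have "\<exists>x\<in>span S \<inter> P 0. \<exists>y\<in>span S \<inter> P 1. v = x + y" if "v \<in> span S" for v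
    using that
  proof (induction rule: span_induct_alt)
    case base
    have "0 \<in> span S \<inter> P i" for i using span_zero subspace_0[OF part_subspace] by blast
    then show ?case by (intro bexI[of _ 0]) auto
  next
    case (step c s v)
    then obtain x y where xy: "x \<in> span S \<inter> P 0" "y \<in> span S \<inter> P 1" "v = x + y" by blast
    obtain i where i: "s \<in> P i" using hom step by blast
    have s: "sm c s \<in> span S" using step by (simp add: span_scale span_base)
    show ?case
    proof (cases "i = 0")
      case True
      then have "sm c s + x \<in> span S \<inter> P 0"
        using i s xy by (auto intro!: span_add subspace_add[OF part_subspace] part_op_sm)
      then show ?thesis using xy by (intro bexI[of _ "sm c s + x"] bexI[of _ y]) (auto simp: add.assoc)
    next
      case False
      then have "sm c s + y \<in> span S \<inter> P 1"
        using i s xy bit_cases2[of i] by (auto intro!: span_add subspace_add[OF part_subspace] part_op_sm)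
      then show ?thesis using xy by (intro bexI[of _ x] bexI[of _ "sm c s + y"]) (auto simp: add_ac)
    qed
  qed
  then obtain f g where fg: "\<And>v. v \<in> span S \<Longrightarrow> f v \<in> span S \<inter> P 0 \<and> g v \<in> span S \<inter> P 1 \<and> v = f v + g v"
    by metis
  show "x \<in> span S \<and> y \<in> span S" if xy: "x \<in> P 0" "y \<in> P 1" "x + y \<in> span S" for x y
  proof -
    let ?x = "f (x + y)" and ?y = "g (x + y)"
    have "(x - ?x) + (y - ?y) = 0" using fg[OF xy(3)] by (simp add: algebra_simps)
    then have "x - ?x = 0 \<and> y - ?y = 0"
      using fg[OF xy(3)] xy by (intro part_indep[of _ 0]) (auto intro!: subspace_diff[OF part_subspace])
    with fg[OF xy(3)] show ?thesis by simp
  qed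
next
  fix g v n assume "v \<in> span S"
  then show "cf (op g) n v \<in> span S"
  proof (induction arbitrary: n rule: span_induct_alt)
    case base
    then show ?case by (simp add: cf_zero span_zero)
  next
    case (step c s v)
    have "cf (op g) n (sm c s) \<in> span S" for n
    proof (induction c arbitrary: n)
      case 0
      then show ?case by (simp add: cf_zero span_zero)
    next
      case (pCons a p)
      have "cf (op g) n (sm (pCons a p) s) = a \<cdot> cf (op g) n s + (del (cf (op g) n (sm p s))
          + (if n = 0 then 0 else cf (op g) (n - 1) (sm p s)))"
        by (simp only: sm_pCons[of a p s] cf_add cf_scale coeff_del[OF conf])
      then show ?case
        using pCons.IH stable[OF step(1), of g n]
        by (auto intro!: span_add span_scale span_zero)
    qed
    with step show ?case by (auto simp: cf_add intro!: span_add)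
  qed
qed

text \<open>If [X X] acts as zero, the coefficients of X anticommute and kill a common nonzero
  vector; the ideal property does the rest.\<close>

lemma kill_X:
  assumes "\<And>h k. k \<noteq> genX \<Longrightarrow> (\<forall>z x. br h genX k z x = 0) \<or> acts0 k"
    and "\<And>z x. br genX genX genX z x = 0"
  shows "acts0 genX"
proof -
  have "br genX genX k (- x - y) x \<cdot> ev (op k v) (x + y) = 0" for k x y v
    using assms(1)[of k genX] assms(2) by (cases "k = genX") (auto simp: acts0_def)
  then have "(\<Sum>k\<in>UNIV. br genX genX k (- x - y) x \<cdot> ev (op k v) (x + y)) = 0" for x y v
    by (intro sum.neutral ballI)
  with rel[where g = genX and h = genX]
  have "ev (op genX (ev (op genX v) y)) x + 1 \<cdot> ev (op genX (ev (op genX v) x)) y = 0" for v x y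
    by simp
  from zero_commutator[OF conf conf this]
  have anti: "cf (op genX) n (cf (op genX) m v) = - cf (op genX) m (cf (op genX) n v)" for n m v
    by (simp add: csc_laws eq_neg_iff_add_eq_0)
  obtain v :: 'm where "v \<noteq> 0" by (rule nonzero_vector)
  have "\<exists>u. u \<noteq> 0 \<and> (\<forall>n. cf (op genX) n u = 0)"
  proof (rule anticommuting_kernel[OF conf[of genX], where V = UNIV and n\<^sub>0 = 0 and v = v])
    show "cf (op genX) n (cf (op genX) m v) = - cf (op genX) m (cf (op genX) n v)" for n m v
      by (rule anti)
    fix u assume "u \<noteq> 0" "\<And>n. 0 \<le> n \<Longrightarrow> cf (op genX) n u = 0"
    then show ?thesis by (intro exI[of _ u]) simp
  qed (use \<open>v \<noteq> 0\<close> in auto)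
  then obtain u where u: "u \<noteq> 0" "\<And>n. cf (op genX) n u = 0" by (elim exE conjE) simp
  then have "op genX u = 0" by (intro poly_eqI) simp
  moreover have "acts0 genX \<or> (\<forall>v. op genX v = 0 \<longrightarrow> v = 0)"
    using ker_dichotomy[of "{genX}"] assms(1) by auto
  ultimately show ?thesis using u by blast
qed

lemma vector_in_bounded_part:
  assumes "finite F"
  obtains N where "N \<ge> 2" "bounded_part (op ` F) N \<noteq> {0}"
proof -
  obtain v :: 'm where v: "v \<noteq> 0" by (rule nonzero_vector)
  let ?N = "2 + (\<Sum>g\<in>F. Suc (degree (op g v)))"
  have "cf (op g) n v = 0" if "g \<in> F" "n \<ge> ?N" for g n
  proof -
    have "Suc (degree (op g v)) \<le> (\<Sum>g\<in>F. Suc (degree (op g v)))"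
      using that assms by (intro member_le_sum) auto
    with that(2) show ?thesis by (intro coeff_eq_0) simp
  qed
  then have "v \<in> bounded_part (op ` F) ?N" by (simp add: bounded_part_def)
  with v that[of ?N] show thesis by auto
qed

lemma bounded_part_op:
  assumes "finite F" "\<And>v. (\<And>g. g \<in> F \<Longrightarrow> op g v = 0) \<Longrightarrow> v = 0"
  shows "C.subspace (bounded_part (op ` F) N)" "C.fin_dim (bounded_part (op ` F) N)"
    "graded (bounded_part (op ` F) N)"
proof -
  show "C.subspace (bounded_part (op ` F) N)"
    by (rule subspace_bounded_part) (auto simp: conf)
  obtain U where "finite U" "span U = UNIV" using fin_gen by blast
  then show "C.fin_dim (bounded_part (op ` F) N)"
    by (intro fin_dim_bounded_part[of _ U]) (use assms conf in auto)
  have "bounded_part (op ` F) N = {v \<in> UNIV. \<forall>(g, n)\<in>F \<times> {N..}. cf (op g) n v = 0}"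
    by (auto simp: bounded_part_def)
  then show "graded (bounded_part (op ` F) N)" by (rule graded_cf_kernel[OF graded_UNIV])
qed

lemma bounded_part_opI:
  "(\<And>g n. g \<in> F \<Longrightarrow> n \<ge> N \<Longrightarrow> cf (op g) n v = 0) \<Longrightarrow> v \<in> bounded_part (op ` F) N"
  and bounded_part_opD: "v \<in> bounded_part (op ` F) N \<Longrightarrow> g \<in> F \<Longrightarrow> n \<ge> N \<Longrightarrow> cf (op g) n v = 0"
  by (auto simp: bounded_part_def)

text \<open>The coefficients of g commute, so they have a common homogeneous eigenvector in a
  bounded part; f collects the finitely many eigenvalues.\<close>

lemma abelian_vector:
  assumes "gpar g = 0" "\<And>h. h \<noteq> g \<Longrightarrow> acts0 h"
    and gg: "\<And>v x y. ev (op g (ev (op g v) y)) x - ev (op g (ev (op g v) x)) y = 0"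
  obtains v i f where "v \<in> P i" "v \<noteq> 0" "f \<noteq> 0" "op g v = map_poly (\<lambda>c. c \<cdot> v) f"
proof -
  have com: "cf (op g) n (cf (op g) m v) = cf (op g) m (cf (op g) n v)" for n m v
    using zero_commutator[OF conf[of g] conf[of g], where v = v and s = "- 1" and n = n and m = m] gg[of v]
    by simp
  have ker: "v = 0" if "\<And>h. h \<in> {g} \<Longrightarrow> op h v = 0" for v
    using that[of g] assms(2) joint_kernel[of v] unfolding acts0_def by (metis singletonI)
  obtain N where N: "N \<ge> 2" "bounded_part (op ` {g}) N \<noteq> {0}"
    by (rule vector_in_bounded_part[of "{g}"]) auto
  let ?V = "bounded_part (op ` {g}) N"
  have V: "C.subspace ?V" "C.fin_dim ?V" "graded ?V"
    by (rule bounded_part_op; use ker in auto)+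
  obtain i where i: "?V \<inter> P i \<noteq> {0}"
    using homogeneous_element[OF V(3) N(2) C.subspace_0[OF V(1)]] .
  have inv: "cf (op g) n ` (?V \<inter> P i) \<subseteq> ?V \<inter> P i" for n
    using op_part_even[OF assms(1)] by (auto simp: bounded_part_def cf_zero com[where m = n])
  have "\<exists>t. {v \<in> ?V \<inter> P i. \<forall>n<N. cf (op g) n v = t n \<cdot> v} \<noteq> {0}"
  proof (rule C.common_eigenspace[OF endo_cf _ _ inv i com])
    show "C.subspace (?V \<inter> P i)" by (rule C.subspace_inter[OF V(1) part_csubspace])
    show "C.fin_dim (?V \<inter> P i)" by (rule C.fin_dim_subset[OF V(2)]) simp
  qed
  then obtain t where t: "{v \<in> ?V \<inter> P i. \<forall>n<N. cf (op g) n v = t n \<cdot> v} \<noteq> {0}" ..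
  have "0 \<in> {v \<in> ?V \<inter> P i. \<forall>n<N. cf (op g) n v = t n \<cdot> v}"
    using C.subspace_0[OF V(1)] subspace_0[OF part_subspace] by (simp add: cf_zero)
  with t obtain v where v: "v \<in> ?V" "v \<in> P i" "v \<noteq> 0" "\<And>n. n < N \<Longrightarrow> cf (op g) n v = t n \<cdot> v"
    by blast
  define f where "f = (\<Sum>n<N. monom (t n) n)"
  have f: "coeff f n = (if n < N then t n else 0)" for n
    by (auto simp: f_def coeff_sum)
  have e: "op g v = map_poly (\<lambda>c. c \<cdot> v) f"
    using v(1,4) by (intro poly_eqI) (auto simp: coeff_map_poly f bounded_part_def)
  have "f \<noteq> 0"
    using e v(3) ker[of v] by auto
  with that[OF v(2,3) _ e] show thesis by blast
qed

text \<open>Under g_1 the operator g_n has weight 1 - n, so on the extremal eigenspace g_n vanishes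
  for n \<ge> 2. There g_0 - \<partial> commutes with g_1 and supplies \<eta>, and g_\<lambda> v =
  (\<partial> + \<eta> + t\<lambda>) v results. Extremality is kept in the conclusion because it
  also annihilates coefficients of X.\<close>

lemma vir_vector:
  assumes g: "gpar g = 0"
    and vir: "\<And>v x y. ev (op g (ev (op g v) y)) x - ev (op g (ev (op g v) x)) y = (x - y) \<cdot> ev (op g v) (x + y)"
    and V: "C.subspace V" "C.fin_dim V" "V \<noteq> {0}" "graded V"
    and inv: "\<And>n. n \<ge> 1 \<Longrightarrow> cf (op g) n ` V \<subseteq> V" "shift_op (op g) ` V \<subseteq> V"
  obtains v i t \<eta> where "v \<in> V" "v \<in> P i" "v \<noteq> 0" "op g v = [:del v + \<eta> \<cdot> v, t \<cdot> v:]"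
    "\<forall>S c. C.endo S \<longrightarrow> S v \<in> V \<longrightarrow> cf (op g) 1 (S v) = S (cf (op g) 1 v) + c \<cdot> S v \<longrightarrow> Re c < 0 \<longrightarrow> S v = 0"
proof -
  have vir': "ev (op g (ev (op g v) y)) x - ev (op g (ev (op g v) x)) y = (1 * x - y) \<cdot> ev (op g v) (x + y)" for v x y
    using vir by simp
  note T = endo_shift_op[OF conf[of g]]
  obtain t where t: "C.eigenspace V (cf (op g) 1) t \<noteq> {0}"
    "\<And>T c v. v \<in> C.eigenspace V (cf (op g) 1) t \<Longrightarrow> C.endo T \<Longrightarrow> T v \<in> V \<Longrightarrow>
       cf (op g) 1 (T v) = T (cf (op g) 1 v) + c \<cdot> T v \<Longrightarrow> Re c < 0 \<Longrightarrow> T v = 0"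
    by (rule C.extremal_eigenspace[OF endo_cf V(1-3) inv(1)[OF order.refl]]) blast
  let ?E = "C.eigenspace V (cf (op g) 1) t"
  have E: "C.subspace ?E" by (rule C.subspace_eigenspace[OF endo_cf V(1)])
  have "?E = {v \<in> V. \<forall>L\<in>{\<lambda>v. cf (op g) 1 v - t \<cdot> v}. L v = 0}"
    by (auto simp: C.eigenspace_def)
  then have "graded ?E"
  proof (rule graded_kernel[rotated 2])
    fix L assume L: "L \<in> {\<lambda>v. cf (op g) 1 v - t \<cdot> v}"
    then show "C.endo L"
      by (auto simp: C.endo_def cf_add cf_scale scale_right_distrib scale_right_diff_distrib mult.commute)
    have "cf (op g) 1 v - t \<cdot> v \<in> P i" if "v \<in> P i" for v i
      using op_part_even[OF g that] that by (auto intro!: subspace_diff[OF part_subspace] part_op_sm)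
    with L show "\<exists>j. \<forall>i. \<forall>v\<in>P i. L v \<in> P (i + j)"
      by (intro exI[of _ 0]) auto
  qed (rule V)
  then obtain i where i: "?E \<inter> P i \<noteq> {0}"
    using homogeneous_element t(1) C.subspace_0[OF E] by blast
  have TE: "shift_op (op g) ` ?E \<subseteq> ?E"
    by (rule C.eigenspace_invariant[OF T inv(2)])
       (rule shift_op_commutes[OF conf conf vir'])
  have TP: "shift_op (op g) v \<in> P i" if "v \<in> P i" for v
    using op_part_even[OF g that] that
    by (auto simp: shift_op_def intro!: subspace_diff[OF part_subspace] part_op_sm)
  have "C.subspace (?E \<inter> P i)" by (rule C.subspace_inter[OF E part_csubspace])
  moreover have "C.fin_dim (?E \<inter> P i)"
    by (rule C.fin_dim_subset[OF V(2)]) (auto simp: C.eigenspace_def)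
  moreover have "shift_op (op g) ` (?E \<inter> P i) \<subseteq> ?E \<inter> P i" using TE TP by blast
  ultimately obtain v \<eta> where v: "v \<in> ?E \<inter> P i" "v \<noteq> 0" "shift_op (op g) v = \<eta> \<cdot> v"
    using C.eigenvector_exists[OF T _ _ _ i] by metis
  have vE: "v \<in> ?E" "v \<in> V" "cf (op g) 1 v = t \<cdot> v" using v(1) by (auto simp: C.eigenspace_def)
  have "cf (op g) n v = 0" if "n \<ge> 2" for n
  proof (rule t(2)[OF vE(1) endo_cf, where c = "1 - of_nat n"])
    show "cf (op g) n v \<in> V" using inv(1)[of n] that vE(2) by auto
    show "cf (op g) 1 (cf (op g) n v) = cf (op g) n (cf (op g) 1 v) + (1 - of_nat n) \<cdot> cf (op g) n v"
      by (rule weight_commutator[OF conf conf vir'])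
  qed (use that in simp)
  moreover have "cf (op g) 0 v = del v + \<eta> \<cdot> v"
    using v(3) by (simp add: shift_op_def algebra_simps)
  ultimately have "op g v = [:del v + \<eta> \<cdot> v, t \<cdot> v:]"
    using vE(3) by (intro poly_eqI) (auto simp: coeff_pCons numeral_2_eq_2 split: nat.splits)
  with that v t(2)[OF vE(1)] vE(2) show thesis by blast
qed

text \<open>As the module is torsion-free, \<partial> + \<eta> would be invertible in
  \<complex>[\<partial>].\<close>

lemma not_generated_by_shift:
  assumes "v \<noteq> 0" "v = sm p (del v + \<eta> \<cdot> v)"
  shows False
proof -
  have "del v + \<eta> \<cdot> v = sm [:\<eta>, 1:] v"
    by (simp add: sm_linear[of \<eta> 1] csc_laws(4) add.commute)
  with assms(2) have "sm (1 - p * [:\<eta>, 1:]) v = 0"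
    by (simp only: scale_left_diff_distrib scale_one scale_scale[symmetric]) simp
  with torsion_free assms(1) have e: "p * [:\<eta>, 1:] = 1" by (metis right_minus_eq)
  then have "p \<noteq> 0" by auto
  then have "degree (p * [:\<eta>, 1:]) = degree p + 1"
    by (subst degree_mult_eq) auto
  with e show False by simp
qed

lemma vir_module_vector:
  assumes g: "gpar g = 0" "\<And>h. h \<noteq> g \<Longrightarrow> acts0 h"
    and vir: "\<And>v x y. ev (op g (ev (op g v) y)) x - ev (op g (ev (op g v) x)) y = (x - y) \<cdot> ev (op g v) (x + y)"
  obtains v i \<Delta> \<eta> where "v \<in> P i" "v \<noteq> 0" "\<Delta> \<noteq> 0" "op g v = [:del v + \<eta> \<cdot> v, \<Delta> \<cdot> v:]"
proof -
  have vir': "ev (op g (ev (op g v) y)) x - ev (op g (ev (op g v) x)) y = (1 * x - y) \<cdot> ev (op g v) (x + y)" for v x y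
    using vir by simp
  have ker: "v = 0" if "\<And>h. h \<in> {g} \<Longrightarrow> op h v = 0" for v
    using that[of g] assms(2) joint_kernel[of v] unfolding acts0_def by (metis singletonI)
  obtain N where N: "N \<ge> 2" "bounded_part (op ` {g}) N \<noteq> {0}"
    by (rule vector_in_bounded_part[of "{g}"]) auto
  let ?V = "bounded_part (op ` {g}) N"
  have V: "C.subspace ?V" "C.fin_dim ?V" "graded ?V"
    by (rule bounded_part_op; use ker in auto)+
  have inv: "cf (op g) n ` ?V \<subseteq> ?V" if "n \<ge> 1" for n
  proof (intro image_subsetI bounded_part_opI)
    fix v h k assume v: "v \<in> ?V" and h: "h \<in> {g}" and k: "k \<ge> N"
    have "cf (op g) n (cf (op g) k v) = cf (op g) k (cf (op g) n v)"
      by (rule primary_bounded[OF conf conf vir', where N = N]) (use that k bounded_part_opD[OF v] in auto)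
    then show "cf (op h) k (cf (op g) n v) = 0"
      using h bounded_part_opD[OF v, of g k] k by (simp add: cf_zero)
  qed
  have T: "shift_op (op g) ` ?V \<subseteq> ?V"
  proof (intro image_subsetI bounded_part_opI)
    fix v h k assume v: "v \<in> ?V" and h: "h \<in> {g}" and k: "k \<ge> N"
    then show "cf (op h) k (shift_op (op g) v) = 0"
      using bounded_part_opD[OF v, of g k] shift_op_commutes[OF conf conf vir', where v = v and m = k]
      by (simp add: C.endo_zero[OF endo_shift_op[OF conf]])
  qed
  obtain v i \<Delta> \<eta> where v: "v \<in> P i" "v \<noteq> 0" "op g v = [:del v + \<eta> \<cdot> v, \<Delta> \<cdot> v:]"
    using vir_vector[OF g(1) vir V(1,2) N(2) V(3) inv T] by metis
  \<comment> \<open>For \<Delta> = 0 the vector (\<partial> + \<eta>) v generates a submodule; it is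
    not zero, as then g would kill v, and it does not contain v.\<close>
  have "\<Delta> \<noteq> 0"
  proof
    assume "\<Delta> = 0"
    let ?w = "del v + \<eta> \<cdot> v"
    have gv: "op g v = [:?w:]" using v(3) \<open>\<Delta> = 0\<close> by simp
    have w: "?w \<in> span {?w}" by (rule span_base) simp
    have "cf (op h) n ?w \<in> span {?w}" for h n
    proof (cases "h = g")
      case True
      then show ?thesis
        by (auto simp: cf_add cf_scale coeff_del[OF conf] gv coeff_pCons simp del: scale_scale
            intro!: span_add[OF span_scale[OF w] span_scale[OF w]] w span_zero split: nat.splits)
    next
      case False
      with g(2) show ?thesis by (simp add: acts0_def span_zero)
    qed
    then have "span {?w} = {0} \<or> span {?w} = UNIV"
      using v(1) by (intro span_dichotomy) (auto intro!: exI[of _ i] subspace_add[OF part_subspace] part_op_sm)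
    then show False
    proof
      assume "span {?w} = {0}"
      then have "?w = 0" using span_base[of ?w "{?w}"] by auto
      with gv ker[of v] v(2) show False by auto
    next
      assume "span {?w} = UNIV"
      then have "v \<in> span {?w}" by simp
      then obtain p where "v = sm p ?w" by (auto simp: span_singleton)
      with not_generated_by_shift v(2) show False by blast
    qed
  qed
  with that v show thesis by blast
qed

end

section \<open>Eliminating B, and the modules on which B or X survives\<close>

context gen_module
begin

lemma dichotomy1:
  assumes "\<And>h k. k \<noteq> g \<Longrightarrow> (\<forall>z x. br h g k z x = 0) \<or> acts0 k" "\<not> acts0 g" "op g v = 0"
  shows "v = 0"
  using ker_dichotomy[of "{g}"] assms by auto

lemma commuting_cf:
  assumes "\<And>v x y. ev (op g (ev (op h v) y)) x - ev (op h (ev (op g v) x)) y = 0"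
  shows "cf (op g) n (cf (op h) m v) = cf (op h) m (cf (op g) n v)"
  using zero_commutator[OF conf[of g] conf[of h], where v = v and s = "- 1" and n = n and m = m] assms[of v]
  by simp

lemma kill_shift:
  assumes "\<And>h k. k \<noteq> b \<Longrightarrow> (\<forall>z x. br h b k z x = 0) \<or> acts0 k"
    and bb: "\<And>v x y. ev (op b (ev (op b v) y)) x - ev (op b (ev (op b v) x)) y = 0"
    and "p \<noteq> 0"
    and ab: "\<And>v x y. ev (op a (ev (op b v) y)) x - ev (op b (ev (op a v) x)) y = poly p x \<cdot> ev (op b v) (x + y)"
  shows "acts0 b"
proof (rule ccontr)
  assume "\<not> acts0 b"
  with dichotomy1[OF assms(1)] have ker: "\<And>v. op b v = 0 \<Longrightarrow> v = 0" by blast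
  obtain U where U: "finite U" "span U = UNIV" using fin_gen by blast
  have "v = 0" for v :: 'm
    by (rule no_faithful_shift[OF conf conf \<open>p \<noteq> 0\<close> ab commuting_cf[OF bb] ker U])
  then show False using nonzero_vector by metis
qed

lemma kill_central:
  assumes "\<And>h k. k \<noteq> b \<Longrightarrow> (\<forall>z x. br h b k z x = 0) \<or> acts0 k"
    and bb: "\<And>v x y. ev (op b (ev (op b v) y)) x - ev (op b (ev (op b v) x)) y = 0"
    and ab: "\<And>v x y. ev (op a (ev (op b v) y)) x - ev (op b (ev (op a v) x)) y = 0"
    and "f \<noteq> 0"
    and aa: "\<And>v x y. ev (op a (ev (op a v) y)) x - ev (op a (ev (op a v) x)) y =
      ev2 f (- x - y) x \<cdot> ev (op b v) (x + y)"
  shows "acts0 b"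
proof (rule ccontr)
  assume "\<not> acts0 b"
  with dichotomy1[OF assms(1)] have ker: "\<And>v. op b v = 0 \<Longrightarrow> v = 0" by blast
  obtain U where U: "finite U" "span U = UNIV" using fin_gen by blast
  have ab': "ev (op a (cf (op b) n v)) x = cf (op b) n (ev (op a v) x)" for x n v
  proof -
    have "op a (cf (op b) n v) = map_poly (cf (op b) n) (op a v)"
      by (rule poly_eqI) (simp add: coeff_map_poly cf_zero commuting_cf[OF ab])
    then show ?thesis by (simp add: ev_map_poly[OF endo_cf])
  qed
  have "v = 0" for v :: 'm
    by (rule no_faithful_central[OF conf conf \<open>f \<noteq> 0\<close> aa ab' commuting_cf[OF bb] ker U])
  then show False using nonzero_vector by metis
qed

text \<open>Boundedness refers to F and not to b: since b commutes with F, all coefficients of b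
  preserve this finite-dimensional space, and \<open>commuting_kills\<close> with a_0 - \<partial>
  makes b vanish on it.\<close>

lemma kill_by_virasoro:
  assumes "\<And>h k. k \<noteq> b \<Longrightarrow> (\<forall>z x. br h b k z x = 0) \<or> acts0 k"
    and F: "finite F" "\<And>v. (\<And>g. g \<in> F \<Longrightarrow> op g v = 0) \<Longrightarrow> v = 0" "a \<in> F"
    and gb: "\<And>g v x y. g \<in> F \<Longrightarrow> ev (op g (ev (op b v) y)) x - ev (op b (ev (op g v) x)) y = 0"
    and ag: "\<And>g. g \<in> F \<Longrightarrow> \<exists>p. \<forall>v x y. ev (op a (ev (op g v) y)) x - ev (op g (ev (op a v) x)) y =
      (p * x - y) \<cdot> ev (op g v) (x + y)"
  shows "acts0 b"
proof -
  obtain N where N: "bounded_part (op ` F) N \<noteq> {0}"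
    by (rule vector_in_bounded_part[OF F(1)])
  let ?V = "bounded_part (op ` F) N" and ?T = "shift_op (op a)"
  note V = bounded_part_op[OF F(1,2), of N]
  obtain v where v: "v \<in> ?V" "v \<noteq> 0"
    using N C.subspace_0[OF V(1)] by blast
  have com: "cf (op g) n (cf (op b) m v) = cf (op b) m (cf (op g) n v)" if "g \<in> F" for g n m v
    by (rule commuting_cf[OF gb[OF that]])
  have "op b v = 0"
  proof (rule commuting_kills[OF conf endo_shift_op[OF conf] V(1,2) _ _ _ v(1)])
    show "cf (op b) n ` ?V \<subseteq> ?V" for n
      by (auto simp: bounded_part_def com cf_zero)
    show "?T ` ?V \<subseteq> ?V"
    proof (intro image_subsetI bounded_part_opI)
      fix u g k assume u: "u \<in> ?V" and g: "g \<in> F" and k: "k \<ge> N"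
      from ag[OF g] obtain p where p: "\<And>v x y. ev (op a (ev (op g v) y)) x - ev (op g (ev (op a v) x)) y =
        (p * x - y) \<cdot> ev (op g v) (x + y)" by blast
      show "cf (op g) k (?T u) = 0"
        using shift_op_commutes[OF conf conf p, where v = u and m = k] bounded_part_opD[OF u g k]
        by (simp add: C.endo_zero[OF endo_shift_op[OF conf]])
    qed
    fix n u
    show "?T (cf (op b) (Suc n) u) = cf (op b) (Suc n) (?T u) + cf (op b) n u"
      by (simp add: shift_op_def com[OF F(3)] C.endo_diff[OF endo_cf] coeff_del[OF conf])
  qed
  then show ?thesis
    using dichotomy1[OF assms(1)] v(2) by blast
qed

lemma graded_scalar_part:
  assumes "gpar b = 0"
  shows "graded {v. op b v = [:\<tau> \<cdot> v:]}"
proof (rule graded_kernel[OF _ _ _ graded_UNIV])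
  let ?L = "\<lambda>n v. cf (op b) n v - (if n = 0 then \<tau> else 0) \<cdot> v"
  show "{v. op b v = [:\<tau> \<cdot> v:]} = {v \<in> UNIV. \<forall>L\<in>range ?L. L v = 0}"
  proof -
    have "coeff [:\<tau> \<cdot> v:] n = (if n = 0 then \<tau> else 0) \<cdot> v" for n v
      by (cases n) auto
    then show ?thesis by (simp add: poly_eq_iff)
  qed
  fix L assume "L \<in> range ?L"
  then obtain n where L: "L = ?L n" by auto
  show "C.endo L"
    unfolding L
    by (auto simp: C.endo_def cf_add cf_scale scale_right_distrib scale_right_diff_distrib mult.commute)
  have "?L n v \<in> P i" if "v \<in> P i" for v i
    using op_part_even[OF assms that] that by (auto intro!: subspace_diff[OF part_subspace] part_op_sm)
  then show "\<exists>j. \<forall>i. \<forall>v\<in>P i. L v \<in> P (i + j)"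
    unfolding L by (intro exI[of _ 0]) auto
qed

lemma density_action:
  assumes "\<And>h k. k \<noteq> b \<Longrightarrow> (\<forall>z x. br h b k z x = 0) \<or> acts0 k" "\<not> acts0 b" "gpar b = 0"
    and bb: "\<And>v x y. ev (op b (ev (op b v) y)) x - ev (op b (ev (op b v) x)) y = 0"
    and ab: "\<And>v x y. ev (op a (ev (op b v) y)) x - ev (op b (ev (op a v) x)) y =
      ((\<alpha> - 1) * x - y + \<beta>) \<cdot> ev (op b v) (x + y)"
  obtains \<tau> where "\<alpha> = 1" "\<beta> = 0" "\<tau> \<noteq> 0" "{v. op b v = [:\<tau> \<cdot> v:]} \<noteq> {0}"
    "C.subspace {v. op b v = [:\<tau> \<cdot> v:]}" "C.fin_dim {v. op b v = [:\<tau> \<cdot> v:]}"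
    "graded {v. op b v = [:\<tau> \<cdot> v:]}"
    "\<And>n. n \<ge> 1 \<Longrightarrow> cf (op a) n ` {v. op b v = [:\<tau> \<cdot> v:]} \<subseteq> {v. op b v = [:\<tau> \<cdot> v:]}"
    "shift_op (op a) ` {v. op b v = [:\<tau> \<cdot> v:]} \<subseteq> {v. op b v = [:\<tau> \<cdot> v:]}"
proof -
  have ker: "\<And>v. op b v = 0 \<Longrightarrow> v = 0"
    using dichotomy1[OF assms(1,2)] by blast
  obtain U where U: "finite U" "span U = UNIV" using fin_gen by blast
  obtain u :: 'm where u: "u \<noteq> 0" by (rule nonzero_vector)
  show thesis
  proof (rule faithful_density[OF conf conf ab commuting_cf[OF bb] ker U u])
    fix \<tau>
    let ?W = "{v. op b v = [:\<tau> \<cdot> v:]}"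
    assume t: "\<alpha> = 1" "\<beta> = 0" "\<tau> \<noteq> 0" "?W \<noteq> {0}" "C.subspace ?W" "C.fin_dim ?W"
      and 1: "\<And>n v. 1 \<le> n \<Longrightarrow> op b v = [:\<tau> \<cdot> v:] \<Longrightarrow> op b (cf (op a) n v) = [:\<tau> \<cdot> cf (op a) n v:]"
      and 2: "\<And>v. op b v = [:\<tau> \<cdot> v:] \<Longrightarrow> op b (cf (op a) 0 v - del v) = [:\<tau> \<cdot> (cf (op a) 0 v - del v):]"
    show thesis
    proof (rule that[OF t graded_scalar_part[OF assms(3)]])
      show "cf (op a) n ` ?W \<subseteq> ?W" if "n \<ge> 1" for n
        using 1[OF that] by auto
      show "shift_op (op a) ` ?W \<subseteq> ?W"
        using 2 by (auto simp: shift_op_def)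
    qed
  qed
qed

text \<open>On the eigenspace of b the relation becomes [a_0 - \<partial>, a_1] = -c\<tau>: the part
  -a_0 of [a_0, a_1] cancels against [\<partial>, a_1] = -a_0.\<close>

lemma density_cocycle_zero:
  assumes V: "C.subspace {v. op b v = [:\<tau> \<cdot> v:]}" "C.fin_dim {v. op b v = [:\<tau> \<cdot> v:]}"
    "{v. op b v = [:\<tau> \<cdot> v:]} \<noteq> {0}" "\<tau> \<noteq> 0"
    "cf (op a) 1 ` {v. op b v = [:\<tau> \<cdot> v:]} \<subseteq> {v. op b v = [:\<tau> \<cdot> v:]}"
    "shift_op (op a) ` {v. op b v = [:\<tau> \<cdot> v:]} \<subseteq> {v. op b v = [:\<tau> \<cdot> v:]}"
    and aa: "\<And>v x y. ev (op a (ev (op a v) y)) x - ev (op a (ev (op a v) x)) y =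
      (x - y) \<cdot> (ev (op a v) (x + y) + c \<cdot> ev (op b v) (x + y))"
  shows "c = 0"
proof -
  have "- (c * \<tau>) = 0"
  proof (rule C.no_heisenberg[OF endo_cf endo_shift_op[OF conf] V(1-3,5,6)])
    fix v assume v: "v \<in> {v. op b v = [:\<tau> \<cdot> v:]}"
    have "cf (op a) 0 (cf (op a) 1 v) = cf (op a) 1 (cf (op a) 0 v) - (cf (op a) 0 v + c \<cdot> cf (op b) 0 v)"
      using linear_commutator[OF conf[of a] conf[of a], where v = v and s = "- 1" and p = 1 and q = "- 1"
          and r = 0 and w = "op a v + map_poly (csc c) (op b v)" and m = 1 and n = 0] aa[of v]
      by (simp add: ev_add ev_map_poly[OF endo_sm] coeff_map_poly diff_eq_eq)
    then show "shift_op (op a) (cf (op a) 1 v) = cf (op a) 1 (shift_op (op a) v) + (- (c * \<tau>)) \<cdot> v"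
      using v by (simp add: shift_op_def C.endo_diff[OF endo_cf] coeff_del[OF conf] mult.commute)
  qed
  with V(4) show ?thesis by simp
qed

text \<open>Where B acts by \<tau>, the X_n with n \<ge> 1 anticommute and X_0^2 = \<tau>, a
  Clifford relation. X has weight 1, so X_0 commutes with every A_m; hence an eigenvector v of A
  killed by X_n for n \<ge> 1 has the partner w = X_0 v with the same \<Delta> and \<eta>.\<close>

lemma clifford_vector:
  assumes BX: "\<And>v x y. ev (op genB (ev (op genX v) y)) x - ev (op genX (ev (op genB v) x)) y = 0"
    and AX: "\<And>v x y. ev (op genA (ev (op genX v) y)) x - ev (op genX (ev (op genA v) x)) y =
      (- y) \<cdot> ev (op genX v) (x + y)"
    and XX: "\<And>v x y. ev (op genX (ev (op genX v) y)) x + ev (op genX (ev (op genX v) x)) y =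
      2 \<cdot> ev (op genB v) (x + y)"
    and AA: "\<And>v x y. ev (op genA (ev (op genA v) y)) x - ev (op genA (ev (op genA v) x)) y =
      (x - y) \<cdot> ev (op genA v) (x + y)"
    and V: "C.subspace {v. op genB v = [:\<tau> \<cdot> v:]}" "C.fin_dim {v. op genB v = [:\<tau> \<cdot> v:]}"
      "{v. op genB v = [:\<tau> \<cdot> v:]} \<noteq> {0}" "graded {v. op genB v = [:\<tau> \<cdot> v:]}" "\<tau> \<noteq> 0"
      "\<And>n. n \<ge> 1 \<Longrightarrow> cf (op genA) n ` {v. op genB v = [:\<tau> \<cdot> v:]} \<subseteq> {v. op genB v = [:\<tau> \<cdot> v:]}"
      "shift_op (op genA) ` {v. op genB v = [:\<tau> \<cdot> v:]} \<subseteq> {v. op genB v = [:\<tau> \<cdot> v:]}"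
  obtains v w i \<Delta> \<eta> where "v \<in> P i" "w \<in> P (i + 1)" "v \<noteq> 0" "w \<noteq> 0"
    "op genA v = [:del v + \<eta> \<cdot> v, \<Delta> \<cdot> v:]" "op genA w = [:del w + \<eta> \<cdot> w, \<Delta> \<cdot> w:]"
    "op genB v = [:\<tau> \<cdot> v:]" "op genB w = [:\<tau> \<cdot> w:]" "op genX v = [:w:]" "op genX w = [:\<tau> \<cdot> v:]"
proof -
  define W where "W = {v. op genB v = [:\<tau> \<cdot> v:]}"
  note V = V[folded W_def]
  let ?A = "op genA" and ?B = "op genB" and ?X = "op genX"
  have AX': "ev (?A (ev (?X v) y)) x - ev (?X (ev (?A v) x)) y = (0 * x - y) \<cdot> ev (?X v) (x + y)" for v x y
    using AX by simp
  have xx: "cf ?X n (cf ?X m v) + cf ?X m (cf ?X n v) = (2 * of_nat (n + m choose n)) \<cdot> cf ?B (n + m) v" for n m v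
    using linear_commutator[OF conf[of genX] conf[of genX], where v = v and s = 1 and p = 0 and q = 0
        and r = 2 and w = "?B v" and m = m and n = n] XX[of v]
    by (simp add: csc_laws(4))
  have Bcf: "cf ?B n v = (if n = 0 then \<tau> \<cdot> v else 0)" if "v \<in> W" for n v
    using that by (auto simp: W_def coeff_pCons split: nat.splits)
  have XW: "cf ?X n ` W \<subseteq> W" for n
  proof (rule image_subsetI)
    fix v assume v: "v \<in> W"
    have "cf ?B m (cf ?X n v) = coeff [:\<tau> \<cdot> cf ?X n v:] m" for m
      using Bcf[OF v, of m]
      by (simp add: commuting_cf[OF BX] cf_zero cf_scale coeff_pCons split: nat.splits)
    then show "cf ?X n v \<in> W" by (simp add: W_def poly_eq_iff)
  qed
  define W' where "W' = {v \<in> W. \<forall>(g, n)\<in>{genX} \<times> {1..}. cf (op g) n v = 0}"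
  have W': "v \<in> W' \<longleftrightarrow> v \<in> W \<and> (\<forall>n\<ge>1. cf ?X n v = 0)" for v
    by (auto simp: W'_def)
  have sub: "C.subspace W'"
    using V(1) unfolding C.subspace_def by (auto simp: W' cf_add cf_scale cf_zero)
  have fd: "C.fin_dim W'"
    by (rule C.fin_dim_subset[OF V(2)]) (auto simp: W')
  have gr: "graded W'"
    unfolding W'_def by (rule graded_cf_kernel[OF V(4) refl])
  obtain v0 where v0: "v0 \<in> W" "v0 \<noteq> 0"
    using V(3) C.subspace_0[OF V(1)] by blast
  \<comment> \<open>Only indices from 1 on can be killed, since X_0^2 = \<tau> is not zero.\<close>
  have ne: "W' \<noteq> {0}"
  proof (rule anticommuting_kernel[OF conf[of genX], where V = W and n\<^sub>0 = 1 and v = v0])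
    fix n m :: nat and v assume "v \<in> W" "n \<ge> 1" "m \<ge> 1"
    then show "cf ?X n (cf ?X m v) = - cf ?X m (cf ?X n v)"
      using xx[where n = n and m = m and v = v] Bcf[of v "n + m"] by (simp add: eq_neg_iff_add_eq_0)
  next
    fix u assume "u \<in> W" "u \<noteq> 0" "\<And>n. 1 \<le> n \<Longrightarrow> cf ?X n u = 0"
    then have "u \<in> W'" by (simp add: W')
    with \<open>u \<noteq> 0\<close> show "W' \<noteq> {0}" by blast
  qed (use XW v0 in auto)
  have AW: "cf ?A n ` W' \<subseteq> W'" if "n \<ge> 1" for n
  proof (rule image_subsetI)
    fix v assume v: "v \<in> W'"
    have "cf ?X k (cf ?A n v) = 0" if "k \<ge> 1" for k
    proof -
      have "cf ?A n (cf ?X k v) = cf ?X k (cf ?A n v)"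
        by (rule primary_bounded[OF conf conf AX', where N = 1]) (use that \<open>n \<ge> 1\<close> v W' in auto)
      with v that show ?thesis by (simp add: W' cf_zero)
    qed
    with V(6)[OF that] v show "cf ?A n v \<in> W'" by (auto simp: W')
  qed
  have TW: "shift_op ?A ` W' \<subseteq> W'"
  proof (rule image_subsetI)
    fix v assume v: "v \<in> W'"
    have "cf ?X k (shift_op ?A v) = 0" if "k \<ge> 1" for k
      using shift_op_commutes[OF conf conf AX', where v = v and m = k] v that
      by (simp add: W' C.endo_zero[OF endo_shift_op[OF conf]])
    with V(7) v show "shift_op ?A v \<in> W'" by (auto simp: W')
  qed
  obtain v i \<Delta> \<eta> where v: "v \<in> W'" "v \<in> P i" "v \<noteq> 0" "?A v = [:del v + \<eta> \<cdot> v, \<Delta> \<cdot> v:]"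
    by (rule vir_vector[OF _ AA sub fd ne gr AW TW]) auto
  let ?w = "cf ?X 0 v"
  have Xv: "?X v = [:?w:]"
    using v(1) by (intro poly_eqI) (auto simp: W' coeff_pCons split: nat.splits)
  have vW: "v \<in> W" using v(1) by (simp add: W')
  have "cf ?X m ?w = coeff [:\<tau> \<cdot> v:] m" for m
  proof (cases m)
    case 0
    have "2 \<cdot> cf ?X 0 ?w = 2 \<cdot> \<tau> \<cdot> v"
      using xx[where n = 0 and m = 0 and v = v] Bcf[OF vW, of 0] csc_laws(2)[of 1 1 "cf ?X 0 ?w"] by (simp add: csc_laws(4) del: scale_scale)
    then have "2 \<cdot> (cf ?X 0 ?w - \<tau> \<cdot> v) = 0" by (simp only: scale_right_diff_distrib) simp
    then have "cf ?X 0 ?w = \<tau> \<cdot> v" by (simp only: C.scale_eq_0_iff) simp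
    with 0 show ?thesis by simp
  next
    case (Suc k)
    with xx[where n = m and m = 0 and v = v] Bcf[OF vW, of m] v(1) show ?thesis by (simp add: W' cf_zero)
  qed
  then have Xw: "?X ?w = [:\<tau> \<cdot> v:]" by (intro poly_eqI)
  have wW: "?w \<in> W" using XW vW by blast
  have "cf ?A m ?w = coeff [:del ?w + \<eta> \<cdot> ?w, \<Delta> \<cdot> ?w:] m" for m
  proof -
    have "cf ?A m ?w = cf ?X 0 (cf ?A m v)"
      using primary_commutator[OF conf conf AX', where n = m and m = 0 and v = v] by simp
    then show ?thesis
      by (auto simp: v(4) coeff_pCons cf_add cf_scale cf_zero coeff_del[OF conf] split: nat.splits)
  qed
  then have Aw: "?A ?w = [:del ?w + \<eta> \<cdot> ?w, \<Delta> \<cdot> ?w:]" by (intro poly_eqI)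
  have "?w \<noteq> 0"
  proof
    assume "?w = 0"
    with Xw have "\<tau> \<cdot> v = 0" by (simp add: conf_op_zero[OF conf])
    with V(5) v(3) show False by (simp add: C.scale_eq_0_iff)
  qed
  moreover have "?w \<in> P (i + 1)"
    using op_part[OF v(2), of genX 0] by (simp only: gpar.simps add.commute)
  ultimately show thesis
    using that[of v i ?w \<eta> \<Delta>] v Aw Xv Xw vW wW unfolding W_def by blast
qed

text \<open>X_n has weight 1/2 - n under A_1, so it kills an extremal vector v for n \<ge> 1. With w
  = X_0 v the relations X_0^2 = A_0 and X_1 X_0 + X_0 X_1 = 2 A_1 give the two coefficients of
  X_\<lambda> w, whence the factor 2\<Delta>; and [A_1, X_0] = X_0 / 2 moves \<Delta> to \<Delta> +
  1/2 on w.\<close>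

lemma neveu_schwarz_vector:
  assumes AX: "\<And>v x y. ev (op genA (ev (op genX v) y)) x - ev (op genX (ev (op genA v) x)) y =
      (x / 2 - y) \<cdot> ev (op genX v) (x + y)"
    and XX: "\<And>v x y. ev (op genX (ev (op genX v) y)) x + ev (op genX (ev (op genX v) x)) y =
      2 \<cdot> ev (op genA v) (x + y)"
    and AA: "\<And>v x y. ev (op genA (ev (op genA v) y)) x - ev (op genA (ev (op genA v) x)) y =
      (x - y) \<cdot> ev (op genA v) (x + y)"
    and B0: "acts0 genB"
  obtains v w i \<Delta> \<eta> where "v \<in> P i" "w \<in> P (i + 1)" "v \<noteq> 0" "w \<noteq> 0" "\<Delta> \<noteq> 0"
    "op genA v = [:del v + \<eta> \<cdot> v, \<Delta> \<cdot> v:]" "op genA w = [:del w + \<eta> \<cdot> w, (\<Delta> + 1/2) \<cdot> w:]"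
    "op genX v = [:w:]" "op genX w = [:del v + \<eta> \<cdot> v, (2 * \<Delta>) \<cdot> v:]"
proof -
  let ?A = "op genA" and ?X = "op genX" and ?F = "{genA, genX}"
  have AX': "ev (?A (ev (?X v) y)) x - ev (?X (ev (?A v) x)) y = (1/2 * x - y) \<cdot> ev (?X v) (x + y)" for v x y
    using AX by simp
  have AA': "ev (?A (ev (?A v) y)) x - ev (?A (ev (?A v) x)) y = (1 * x - y) \<cdot> ev (?A v) (x + y)" for v x y
    using AA by simp
  have xx: "cf ?X n (cf ?X m v) + cf ?X m (cf ?X n v) = (2 * of_nat (n + m choose n)) \<cdot> cf ?A (n + m) v" for n m v
    using linear_commutator[OF conf[of genX] conf[of genX], where v = v and s = 1 and p = 0 and q = 0
        and r = 2 and w = "?A v" and m = m and n = n] XX[of v]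
    by (simp add: csc_laws(4))
  have ker: "v = 0" if "\<And>g. g \<in> ?F \<Longrightarrow> op g v = 0" for v
  proof (rule joint_kernel)
    fix g show "op g v = 0"
      using that B0 by (cases g) (auto simp: acts0_def)
  qed
  obtain N where N: "N \<ge> 2" "bounded_part (op ` ?F) N \<noteq> {0}"
    by (rule vector_in_bounded_part[of ?F]) auto
  let ?V = "bounded_part (op ` ?F) N"
  have V: "C.subspace ?V" "C.fin_dim ?V" "graded ?V"
    by (rule bounded_part_op; use ker in auto)+
  have VD: "cf ?A k v = 0" "cf ?X k v = 0" if "v \<in> ?V" "k \<ge> N" for v k
    using that by (auto simp: bounded_part_def)
  have AV: "cf ?A n ` ?V \<subseteq> ?V" if "n \<ge> 1" for n
  proof (intro image_subsetI bounded_part_opI)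
    fix v h k assume v: "v \<in> ?V" and h: "h \<in> ?F" and k: "k \<ge> N"
    have "cf ?A n (cf ?A k v) = cf ?A k (cf ?A n v)"
      by (rule primary_bounded[OF conf conf AA', where N = N]) (use that k VD[OF v] in auto)
    moreover have "cf ?A n (cf ?X k v) = cf ?X k (cf ?A n v)"
      by (rule primary_bounded[OF conf conf AX', where N = N]) (use that k VD[OF v] in auto)
    ultimately show "cf (op h) k (cf ?A n v) = 0"
      using h VD[OF v k] by (auto simp: cf_zero)
  qed
  have TV: "shift_op ?A ` ?V \<subseteq> ?V"
  proof (intro image_subsetI bounded_part_opI)
    fix v h k assume v: "v \<in> ?V" and h: "h \<in> ?F" and k: "k \<ge> N"
    show "cf (op h) k (shift_op ?A v) = 0"
      using h VD[OF v k] shift_op_commutes[OF conf conf AA', where v = v and m = k]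
        shift_op_commutes[OF conf conf AX', where v = v and m = k]
      by (auto simp: C.endo_zero[OF endo_shift_op[OF conf]])
  qed
  \<comment> \<open>X_0 need not preserve the bounded part, as [A_N, X_0] is half of X_(N-1); for
    the extremality argument n \<ge> 1 is enough.\<close>
  have XV: "cf ?X n v \<in> ?V" if "n \<ge> 1" "v \<in> ?V" for n v
  proof (intro bounded_part_opI)
    fix h k assume h: "h \<in> ?F" and k: "k \<ge> N"
    have "cf ?A k (cf ?X n v) = cf ?X n (cf ?A k v)"
      by (rule primary_bounded[OF conf conf AX', where N = N]) (use that k VD[OF that(2)] N(1) in auto)
    moreover have "cf ?X k (cf ?X n v) = 0"
      using xx[where n = k and m = n and v = v] VD[OF that(2), of "k + n"] VD[OF that(2) k] k by (simp add: cf_zero)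
    ultimately show "cf (op h) k (cf ?X n v) = 0"
      using h VD[OF that(2) k] by (auto simp: cf_zero)
  qed
  obtain v i \<Delta> \<eta> where v: "v \<in> ?V" "v \<in> P i" "v \<noteq> 0" "?A v = [:del v + \<eta> \<cdot> v, \<Delta> \<cdot> v:]"
    and ext: "\<forall>S c. C.endo S \<longrightarrow> S v \<in> ?V \<longrightarrow> cf ?A 1 (S v) = S (cf ?A 1 v) + c \<cdot> S v \<longrightarrow> Re c < 0 \<longrightarrow> S v = 0"
    by (rule vir_vector[OF gpar.simps(1) AA V(1,2) N(2) V(3) AV TV])
  have X0: "cf ?X n v = 0" if "n \<ge> 1" for n
    using ext[rule_format, OF endo_cf XV[OF that v(1)] weight_commutator[OF conf conf AX']] that
    by simp
  let ?w = "cf ?X 0 v"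
  have Xv: "?X v = [:?w:]"
    using X0 by (intro poly_eqI) (auto simp: coeff_pCons split: nat.splits)
  have two: "2 \<cdot> a = 2 \<cdot> b \<Longrightarrow> a = b" for a b
    by (simp only: C.scale_cancel_left) simp
  have "cf ?X m ?w = coeff [:del v + \<eta> \<cdot> v, (2 * \<Delta>) \<cdot> v:] m" for m
  proof (cases m)
    case 0
    have "2 \<cdot> cf ?X 0 ?w = 2 \<cdot> (del v + \<eta> \<cdot> v)"
      using xx[where n = 0 and m = 0 and v = v] csc_laws(2)[of 1 1 "cf ?X 0 ?w"] by (simp add: v(4) csc_laws(4) del: scale_scale)
    from two[OF this] 0 show ?thesis by simp
  next
    case (Suc k)
    with xx[where n = m and m = 0 and v = v] X0[of m] show ?thesis
      by (auto simp: v(4) cf_zero coeff_pCons mult.commute split: nat.splits)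
  qed
  then have Xw: "?X ?w = [:del v + \<eta> \<cdot> v, (2 * \<Delta>) \<cdot> v:]" by (intro poly_eqI)
  have "cf ?A m ?w = coeff [:del ?w + \<eta> \<cdot> ?w, (\<Delta> + 1/2) \<cdot> ?w:] m" for m
  proof -
    have "cf ?A m ?w = cf ?X 0 (cf ?A m v) + (if m = 0 then 0 else (1/2) \<cdot> cf ?X (m - 1) v)"
      using primary_commutator[OF conf conf AX', where n = m and m = 0 and v = v] by simp
    then show ?thesis
      using X0
      by (auto simp: v(4) coeff_pCons cf_add cf_scale cf_zero coeff_del[OF conf] csc_laws(2)
          simp flip: csc_laws(2) split: nat.splits)
  qed
  then have Aw: "?A ?w = [:del ?w + \<eta> \<cdot> ?w, (\<Delta> + 1/2) \<cdot> ?w:]" by (intro poly_eqI)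
  \<comment> \<open>If X_0 v = 0, then X v = 0, and 2 A_m = X_m X_0 + X_0 X_m shows that A kills v
    too.\<close>
  have w0: "?w \<noteq> 0"
  proof
    assume w: "?w = 0"
    then have "?X v = 0" using Xv by simp
    moreover have "cf ?A m v = 0" for m
    proof -
      have "2 \<cdot> cf ?A m v = 2 \<cdot> 0"
        using xx[where n = m and m = 0 and v = v] w \<open>?X v = 0\<close> by (simp add: cf_zero)
      from two[OF this] show ?thesis .
    qed
    then have "?A v = 0" by (intro poly_eqI) simp
    ultimately show False using ker[of v] v(3) by auto
  qed
  have wP: "?w \<in> P (i + 1)"
    using op_part[OF v(2), of genX 0] by (simp only: gpar.simps add.commute)
  \<comment> \<open>For \<Delta> = 0 the vectors (\<partial> + \<eta>) v and w generate a graded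
    submodule that contains w but not v.\<close>
  have "\<Delta> \<noteq> 0"
  proof
    assume "\<Delta> = 0"
    let ?u = "del v + \<eta> \<cdot> v"
    define S where "S = span {?u, ?w}"
    have uS: "?u \<in> S" and wS: "?w \<in> S" unfolding S_def by (rule span_base; simp)+
    have sub: "subspace S" unfolding S_def by (rule subspace_span)
    note S0 = subspace_0[OF sub]
    have uP: "?u \<in> P i" using v(2) by (auto intro!: subspace_add[OF part_subspace] part_op_sm)
    have Av: "?A v = [:?u:]" using v(4) \<open>\<Delta> = 0\<close> by simp
    have cu: "cf (op h) n ?u \<in> S" if "\<And>n. cf (op h) n v \<in> S" for h n
      unfolding cf_add cf_scale coeff_del[OF conf]
      using that S0 by (intro subspace_add[OF sub] subspace_scale[OF sub]) auto
    have Sv: "cf (op h) n v \<in> S" for h n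
    proof (cases h)
      case genA
      then show ?thesis using uS S0 by (cases n) (simp_all add: Av)
    next
      case genB
      then show ?thesis using B0 S0 by (simp add: acts0_def)
    next
      case genX
      then show ?thesis using wS S0 X0[of n] by (cases "n = 0") simp_all
    qed
    have Sw: "cf (op h) n ?w \<in> S" for h n
    proof (cases h)
      case genA
      have "del ?w + \<eta> \<cdot> ?w \<in> S" "(1/2) \<cdot> ?w \<in> S"
        by (intro subspace_add[OF sub] subspace_scale[OF sub] wS)+
      with genA S0 show ?thesis
        by (auto simp: Aw \<open>\<Delta> = 0\<close> coeff_pCons split: nat.splits)
    next
      case genB
      then show ?thesis using B0 S0 by (simp add: acts0_def)
    next
      case genX
      then show ?thesis using uS S0 by (cases n) (simp_all add: Xw \<open>\<Delta> = 0\<close>)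
    qed
    have "S = {0} \<or> S = UNIV"
      unfolding S_def
    proof (rule span_dichotomy, unfold S_def[symmetric])
      show "\<exists>j. s \<in> P j" if "s \<in> {?u, ?w}" for s
        using that uP wP by auto
      show "cf (op h) n s \<in> S" if "s \<in> {?u, ?w}" for h s n
        using that cu[OF Sv, of h n] Sw[of h n] by auto
    qed
    then show False
    proof
      assume "S = {0}"
      with wS w0 show False by blast
    next
      assume "S = UNIV"
      then have "v \<in> S" by simp
      then obtain p q where pq: "v = sm p ?u + sm q ?w"
        unfolding S_def by (auto simp: span_breakdown_eq diff_eq_eq add.commute)
      \<comment> \<open>The two sides have opposite parities, so both are zero and v would be a
        multiple of (\<partial> + \<eta>) v.\<close>
      have "v - sm p ?u = sm q ?w" unfolding diff_eq_eq by (subst add.commute) (rule pq)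
      then have "(v - sm p ?u) + (- sm q ?w) = 0" by simp
      moreover have "v - sm p ?u \<in> P i"
        using v(2) uP by (auto intro!: subspace_diff[OF part_subspace] part_op_sm)
      moreover have "- sm q ?w \<in> P (i + 1)"
        using wP by (auto intro!: subspace_neg[OF part_subspace] part_op_sm)
      ultimately have "v - sm p ?u = 0" using part_indep by blast
      then have "v = sm p ?u" by simp
      with not_generated_by_shift v(3) show False by blast
    qed
  qed
  with that v wP w0 Xv Xw Aw show thesis by blast
qed

end

section \<open>Free modules\<close>

lemma inst_0 [simp]: "inst 0 t = 0"
  by (simp add: inst_def)

lemma inst_pCons: "inst (pCons a p) t = cst a + t * inst p t"
  by (simp add: inst_def map_poly_pCons)

lemma inst_const [simp]: "inst [:c:] t = cst c"
  by (simp add: inst_pCons)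

lemma inst_add: "inst (p + q) t = inst p t + inst q t"
proof -
  have "map_poly cst (p + q) = map_poly cst p + map_poly cst q"
    by (rule poly_eqI) (simp add: coeff_map_poly)
  then show ?thesis by (simp add: inst_def)
qed

lemma inst_smult: "inst (Polynomial.smult c p) t = cst c * inst p t"
proof -
  have "map_poly cst (Polynomial.smult c p) = Polynomial.smult (cst c) (map_poly cst p)"
    by (rule poly_eqI) (simp add: coeff_map_poly)
  then show ?thesis by (simp add: inst_def)
qed

lemma poly_inst: "poly (poly (inst p t) q) z = poly p (poly (poly t q) z)"
  by (induction p) (auto simp: inst_pCons)

text \<open>Covers the substitution of a polynomial in \<partial> for \<lambda>, such as -x -
  \<partial>: at \<partial> = z only the value of that polynomial enters.\<close>

lemma poly_poly_eq_ev2: "poly (poly f q) z = ev2 f z (poly q z)"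
  unfolding ev2_def by (induction f) auto

lemma ev2_simps:
  "ev2 0 z x = 0" "ev2 1 z x = 1" "ev2 (f + g) z x = ev2 f z x + ev2 g z x"
  "ev2 (f * g) z x = ev2 f z x * ev2 g z x" "ev2 (- f) z x = - ev2 f z x"
  "ev2 (f - g) z x = ev2 f z x - ev2 g z x" "ev2 (f ^ n) z x = ev2 f z x ^ n"
  "ev2 (numeral k) z x = numeral k" "ev2 (cst c) z x = c" "ev2 pDel z x = z" "ev2 pLam z x = x"
  by (simp_all add: ev2_def)

lemma ev2_inst: "ev2 (inst p t) z x = poly p (ev2 t z x)"
  by (simp add: ev2_def poly_inst)

lemma ev2_flip: "ev2 (flip f) z x = ev2 f z (- x - z)"
  unfolding ev2_def[of "flip f"] unfolding flip_def poly_pcompose poly_poly_eq_ev2[of f] by simp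

text \<open>The component at k as an element of \<complex>[\<partial>, \<lambda>], before
  \<open>sesq_extend\<close> rearranges the components into a polynomial in \<lambda> with vector
  coefficients.\<close>

definition sesq_comp where
  "sesq_comp t u w k =
    (\<Sum>i\<in>UNIV. \<Sum>j\<in>UNIV. inst (u $ i) (- pLam) * inst (w $ j) (pDel + pLam) * (t (i, j) $ k))"

lemma axis_nth_if: "axis k c $ k' = (if k' = k then c else 0)"
  by (simp add: axis_def)

lemma coeff_sesq_extend: "coeff (sesq_extend t u w) n $ k = coeff (sesq_comp t u w k) n"
proof -
  have "axis k (0::complex poly) = 0" for k :: 'a
    by (simp add: vec_eq_iff axis_nth_if)
  moreover have "sesq_extend t u w = (\<Sum>k\<in>UNIV. map_poly (axis k) (sesq_comp t u w k))"
    by (simp only: sesq_extend_def sesq_comp_def)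
  ultimately show ?thesis
    by (simp add: coeff_sum coeff_map_poly axis_nth_if)
qed

lemma sesq_comp_add_left: "sesq_comp t (u + u') w k = sesq_comp t u w k + sesq_comp t u' w k"
  by (simp add: sesq_comp_def inst_add ring_distribs sum.distrib)

lemma sesq_comp_add_right: "sesq_comp t u (w + w') k = sesq_comp t u w k + sesq_comp t u w' k"
  by (simp add: sesq_comp_def inst_add ring_distribs sum.distrib)

lemma inst_mult_const: "inst ([:a:] * p) t = cst a * inst p t"
  by (simp add: inst_smult)

lemma inst_mult_del: "inst ([:0, 1:] * p) t = t * inst p t"
  by (simp add: inst_pCons)

lemma sesq_comp_const_left: "sesq_comp t ([:c:] *s u) w k = cst c * sesq_comp t u w k"
  unfolding sesq_comp_def vector_smult_component inst_mult_const sum_distrib_left mult.assoc ..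

lemma sesq_comp_const_right: "sesq_comp t u ([:c:] *s w) k = cst c * sesq_comp t u w k"
  unfolding sesq_comp_def vector_smult_component inst_mult_const sum_distrib_left
  by (intro sum.cong refl) (simp only: mult_ac)

lemma sesq_comp_del_left: "sesq_comp t ([:0, 1:] *s u) w k = - pLam * sesq_comp t u w k"
  unfolding sesq_comp_def vector_smult_component inst_mult_del sum_distrib_left mult.assoc ..

lemma sesq_comp_del_right: "sesq_comp t u ([:0, 1:] *s w) k = (pDel + pLam) * sesq_comp t u w k"
  unfolding sesq_comp_def vector_smult_component inst_mult_del sum_distrib_left
  by (intro sum.cong refl) (simp only: mult_ac)

lemma free_graded_simps:
  "smul (free_graded par) = (*s)" "part (free_graded par) i = {u. \<forall>j. par j \<noteq> i \<longrightarrow> u $ j = 0}"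
  by (simp_all add: free_graded_def)

lemma algebra_of_simps:
  "smul (algebra_of t) = (*s)" "part (algebra_of t) = part (free_graded gpar)"
  "brk (algebra_of t) = sesq_extend (skew_complete t)"
  by (simp_all add: algebra_of_def graded.extend_def free_graded_def)

lemma module_of_simps:
  "smul (module_of par s) = (*s)" "part (module_of par s) = part (free_graded par)"
  "act (module_of par s) = sesq_extend s"
  by (simp_all add: module_of_def graded.extend_def free_graded_def)

lemma module_vec: "module ((*s) :: complex poly \<Rightarrow> complex poly ^ 'j::finite \<Rightarrow> _)"
  by unfold_locales (simp_all add: vec_eq_iff algebra_simps)

lemma lambda_map_sesq_extend:
  fixes R :: "(complex poly ^ 'i::finite, 'y) graded_scheme" and M :: "(complex poly ^ 'j::finite, 'z) graded_scheme"
  assumes R: "smul R = (*s)" "part R = part (free_graded \<rho>)"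
    and M: "smul M = (*s)" "part M = part (free_graded par)"
    and parity: "\<And>i j k. t (i, j) $ k \<noteq> 0 \<Longrightarrow> par k = \<rho> i + par j"
  shows "lambda_map R M (sesq_extend t)"
  unfolding lambda_map_def
proof (intro conjI allI ballI)
  note e = poly_eq_iff vec_eq_iff coeff_sesq_extend coeff_map_poly R M
  have z: "p *s (0 :: complex poly ^ 'j) = 0" for p by (simp add: vec_eq_iff)
  fix a a' :: "complex poly ^ 'i" and v v' :: "complex poly ^ 'j" and c :: complex
  show "sesq_extend t (a + a') v = sesq_extend t a v + sesq_extend t a' v"
    by (simp add: e sesq_comp_add_left)
  show "sesq_extend t a (v + v') = sesq_extend t a v + sesq_extend t a v'"
    by (simp add: e sesq_comp_add_right)
  show "sesq_extend t (smul R [:c:] a) v = map_poly (smul M [:c:]) (sesq_extend t a v)"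
    by (simp add: e z sesq_comp_const_left)
  show "sesq_extend t a (smul M [:c:] v) = map_poly (smul M [:c:]) (sesq_extend t a v)"
    by (simp add: e z sesq_comp_const_right)
  show "sesq_extend t (smul R [:0, 1:] a) v = - pCons 0 (sesq_extend t a v)"
    by (simp add: e z sesq_comp_del_left coeff_pCons split: nat.splits)
  show "sesq_extend t a (smul M [:0, 1:] v) = map_poly (smul M [:0, 1:]) (sesq_extend t a v) + pCons 0 (sesq_extend t a v)"
    by (simp add: e z sesq_comp_del_right ring_distribs coeff_pCons split: nat.splits)
next
  fix i j a v n assume a: "a \<in> part R i" and v: "v \<in> part M j"
  have "coeff (sesq_extend t a v) n $ k = 0" if k: "par k \<noteq> i + j" for k
  proof -
    have "inst (a $ g) (- pLam) * inst (v $ h) (pDel + pLam) * (t (g, h) $ k) = 0" for g h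
    proof -
      have "a $ g = 0 \<or> v $ h = 0 \<or> t (g, h) $ k = 0"
      proof (rule ccontr)
        assume c: "\<not> ?thesis"
        then have "\<rho> g = i" "par h = j" using a v unfolding R M free_graded_simps by blast+
        with c parity[of g h k] k show False by metis
      qed
      then show ?thesis by (elim disjE) simp_all
    qed
    then have "sesq_comp t a v k = 0" unfolding sesq_comp_def by (intro sum.neutral ballI)
    then show ?thesis by (simp add: coeff_sesq_extend)
  qed
  then show "coeff (sesq_extend t a v) n \<in> part M (i + j)"
    by (simp add: M free_graded_simps)
qed

lemma lambda_subst_sesq_extend:
  assumes "smul M = (*s)"
  shows "lambda_subst M (sesq_extend t u w) q $ k = poly (sesq_comp t u w k) q"
proof -
  let ?P = "sesq_extend t u w" and ?C = "sesq_comp t u w k"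
  have "degree ?C \<le> degree ?P"
  proof (rule degree_le, intro allI impI)
    fix n assume "n > degree ?P"
    then show "coeff ?C n = 0" using coeff_sesq_extend[of t u w n k] by (simp add: coeff_eq_0)
  qed
  then have "poly ?C q = (\<Sum>n\<le>degree ?P. coeff ?C n * q ^ n)"
    unfolding poly_altdef by (intro sum.mono_neutral_left) (auto simp: coeff_eq_0)
  then show ?thesis
    by (simp add: lambda_subst_def assms coeff_sesq_extend mult.commute)
qed

text \<open>Evaluation at \<partial> = z turns the axioms into identities of complex numbers. A
  general q is required by skew-symmetry, where \<lambda> becomes -x - \<partial>.\<close>

lemma lambda_subst_value:
  assumes "smul M = (*s)"
  shows "poly (lambda_subst M (sesq_extend t u w) q $ k) z =
    (\<Sum>i\<in>UNIV. \<Sum>j\<in>UNIV. poly (u $ i) (- poly q z) * poly (w $ j) (z + poly q z) * ev2 (t (i, j) $ k) z (poly q z))"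
proof -
  have 1: "poly (poly (- pLam) q) z = - poly q z" "poly (poly (pDel + pLam) q) z = z + poly q z"
    by simp_all
  show ?thesis
    by (simp only: lambda_subst_sesq_extend[OF assms] sesq_comp_def poly_sum poly_mult poly_inst 1)
       (simp only: poly_poly_eq_ev2)
qed

lemma lambda_eval_value:
  assumes "smul M = (*s)"
  shows "poly (lambda_eval M (sesq_extend t u w) x $ k) z =
    (\<Sum>i\<in>UNIV. \<Sum>j\<in>UNIV. poly (u $ i) (- x) * poly (w $ j) (z + x) * ev2 (t (i, j) $ k) z x)"
  by (simp add: lambda_eval_def lambda_subst_value[OF assms])

text \<open>The shape of a_\<lambda>(b_\<mu> v): the coordinates of the three elements are pulled
  out, which leaves an expression in the tables for each triple of basis vectors.
  \<open>sum_nest_left\<close> does the same for [a_\<lambda> b]_(\<lambda>+\<mu>) v.\<close>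

lemma sum_nest_right:
  fixes u v w :: "_ \<Rightarrow> 'a::comm_semiring_1"
  shows "(\<Sum>g\<in>G. \<Sum>l\<in>L. u g * (\<Sum>h\<in>H. \<Sum>m\<in>K. v h * w m * a h m l) * b g l) =
    (\<Sum>g\<in>G. \<Sum>h\<in>H. \<Sum>m\<in>K. u g * v h * w m * (\<Sum>l\<in>L. a h m l * b g l))"
proof (intro sum.cong refl)
  fix g
  have "(\<Sum>l\<in>L. u g * (\<Sum>h\<in>H. \<Sum>m\<in>K. v h * w m * a h m l) * b g l) =
      (\<Sum>l\<in>L. \<Sum>h\<in>H. \<Sum>m\<in>K. u g * v h * w m * (a h m l * b g l))"
    by (simp add: sum_distrib_left sum_distrib_right mult_ac)
  also have "\<dots> = (\<Sum>h\<in>H. \<Sum>m\<in>K. \<Sum>l\<in>L. u g * v h * w m * (a h m l * b g l))"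
    by (subst sum.swap, intro sum.cong refl) (rule sum.swap)
  finally show "(\<Sum>l\<in>L. u g * (\<Sum>h\<in>H. \<Sum>m\<in>K. v h * w m * a h m l) * b g l) =
      (\<Sum>h\<in>H. \<Sum>m\<in>K. u g * v h * w m * (\<Sum>l\<in>L. a h m l * b g l))"
    by (simp only: sum_distrib_left)
qed

lemma sum_nest_left:
  fixes u v w :: "_ \<Rightarrow> 'a::comm_semiring_1"
  shows "(\<Sum>l\<in>L. \<Sum>m\<in>K. (\<Sum>g\<in>G. \<Sum>h\<in>H. u g * v h * c g h l) * w m * d l m) =
    (\<Sum>g\<in>G. \<Sum>h\<in>H. \<Sum>m\<in>K. u g * v h * w m * (\<Sum>l\<in>L. c g h l * d l m))"
proof -
  have "(\<Sum>l\<in>L. \<Sum>m\<in>K. (\<Sum>g\<in>G. \<Sum>h\<in>H. u g * v h * c g h l) * w m * d l m) =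
      (\<Sum>m\<in>K. \<Sum>l\<in>L. \<Sum>g\<in>G. \<Sum>h\<in>H. u g * v h * w m * (c g h l * d l m))"
    by (subst sum.swap) (simp add: sum_distrib_left sum_distrib_right mult_ac)
  also have "\<dots> = (\<Sum>m\<in>K. \<Sum>g\<in>G. \<Sum>h\<in>H. \<Sum>l\<in>L. u g * v h * w m * (c g h l * d l m))"
  proof (intro sum.cong refl)
    fix m
    show "(\<Sum>l\<in>L. \<Sum>g\<in>G. \<Sum>h\<in>H. u g * v h * w m * (c g h l * d l m)) =
      (\<Sum>g\<in>G. \<Sum>h\<in>H. \<Sum>l\<in>L. u g * v h * w m * (c g h l * d l m))"
      by (subst sum.swap, intro sum.cong refl) (rule sum.swap)
  qed
  also have "\<dots> = (\<Sum>g\<in>G. \<Sum>h\<in>H. \<Sum>m\<in>K. \<Sum>l\<in>L. u g * v h * w m * (c g h l * d l m))"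
    by (subst sum.swap, intro sum.cong refl) (rule sum.swap)
  finally show ?thesis by (simp only: sum_distrib_left)
qed

abbreviation odd_sign :: "gen \<Rightarrow> gen \<Rightarrow> complex" where
  "odd_sign g h \<equiv> if gpar g * gpar h = 1 then - 1 else 1"

text \<open>The module identity on generators as functions of \<partial> = z, \<lambda> = x, \<mu> =
  y; with S = T it is the Jacobi identity. By sesquilinearity the inner action is read at \<partial>
  + \<lambda> or \<partial> + \<mu>, and the bracket of g and h at \<partial> = -\<lambda> -
  \<mu>.\<close>

definition jacobi_tables ::
    "(gen \<times> gen \<Rightarrow> complex poly poly ^ gen) \<Rightarrow> (gen \<times> 'j::finite \<Rightarrow> complex poly poly ^ 'j) \<Rightarrow> bool" where
  "jacobi_tables T S \<longleftrightarrow> (\<forall>g h m k x y z.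
     (\<Sum>l\<in>UNIV. ev2 (S (h, m) $ l) (z + x) y * ev2 (S (g, l) $ k) z x) =
     (\<Sum>l\<in>UNIV. ev2 (T (g, h) $ l) (- x - y) x * ev2 (S (l, m) $ k) z (x + y)) +
     odd_sign g h * (\<Sum>l\<in>UNIV. ev2 (S (g, m) $ l) (z + y) x * ev2 (S (h, l) $ k) z y))"

lemma jacobi_sesq_extend:
  fixes R :: "(complex poly ^ gen, 'y) graded_scheme" and M :: "(complex poly ^ 'j::finite, 'z) graded_scheme"
  assumes "smul R = (*s)" "smul M = (*s)" "jacobi_tables T S"
    and u: "u \<in> part (free_graded gpar) i" and v: "v \<in> part (free_graded gpar) j"
  shows "lambda_eval M (sesq_extend S u (lambda_eval M (sesq_extend S v w) y)) x =
    lambda_eval M (sesq_extend S (lambda_eval R (sesq_extend T u v) x) w) (x + y) +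
    sgn_rule i j (lambda_eval M (sesq_extend S v (lambda_eval M (sesq_extend S u w) x)) y)"
    (is "?l = ?r1 + sgn_rule i j ?r2")
proof -
  note val = lambda_eval_value[OF assms(1)] lambda_eval_value[OF assms(2)]
  have "poly (?l $ k) z = poly (?r1 $ k) z + (if i * j = 1 then - 1 else 1) * poly (?r2 $ k) z" for k z
  proof -
    let ?U = "\<lambda>g. poly (u $ g) (- x)" and ?V = "\<lambda>h. poly (v $ h) (- y)" and ?W = "\<lambda>m. poly (w $ m) (z + x + y)"
    let ?A = "\<lambda>g h m. \<Sum>l\<in>UNIV. ev2 (S (h, m) $ l) (z + x) y * ev2 (S (g, l) $ k) z x"
    let ?B = "\<lambda>g h m. \<Sum>l\<in>UNIV. ev2 (T (g, h) $ l) (- x - y) x * ev2 (S (l, m) $ k) z (x + y)"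
    let ?C = "\<lambda>g h m. \<Sum>l\<in>UNIV. ev2 (S (g, m) $ l) (z + y) x * ev2 (S (h, l) $ k) z y"
    have 1: "poly (?l $ k) z = (\<Sum>g\<in>UNIV. \<Sum>h\<in>UNIV. \<Sum>m\<in>UNIV. ?U g * ?V h * ?W m * ?A g h m)"
      unfolding val by (rule sum_nest_right)
    have s: "- (x + y) = - x - y" "- x - y + x = - y" "z + (x + y) = z + x + y" "z + y + x = z + x + y"
      by simp_all
    have 2: "poly (?r1 $ k) z = (\<Sum>g\<in>UNIV. \<Sum>h\<in>UNIV. \<Sum>m\<in>UNIV. ?U g * ?V h * ?W m * ?B g h m)"
      unfolding val s by (rule sum_nest_left)
    have "poly (?r2 $ k) z = (\<Sum>h\<in>UNIV. \<Sum>g\<in>UNIV. \<Sum>m\<in>UNIV. ?V h * ?U g * ?W m * ?C g h m)"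
      unfolding val s by (rule sum_nest_right)
    also have "\<dots> = (\<Sum>g\<in>UNIV. \<Sum>h\<in>UNIV. \<Sum>m\<in>UNIV. ?U g * ?V h * ?W m * ?C g h m)"
      by (subst sum.swap) (simp only: mult.commute[of "?V _" "?U _"])
    finally have 3: "poly (?r2 $ k) z = \<dots>" .
    \<comment> \<open>\<open>odd_sign\<close> refers to the generators and \<open>sgn_rule\<close>
      to u and v; the two signs agree wherever both coordinates are nonzero.\<close>
    have "?U g * ?V h * ?W m * ?A g h m = ?U g * ?V h * ?W m * ?B g h m +
        (if i * j = 1 then - 1 else 1) * (?U g * ?V h * ?W m * ?C g h m)" for g h m
    proof (cases "gpar g = i \<and> gpar h = j")
      case True
      have "?A g h m = ?B g h m + odd_sign g h * ?C g h m"
        using assms(3) unfolding jacobi_tables_def by blast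
      with True show ?thesis by (simp only: distrib_left mult_ac)
    next
      case False
      then have "u $ g = 0 \<or> v $ h = 0"
        using u v by (auto simp: free_graded_simps)
      then show ?thesis by auto
    qed
    then show ?thesis
      unfolding 1 2 3 by (simp only: sum.distrib sum_distrib_left)
  qed
  then have "?l $ k = ?r1 $ k + sgn_rule i j ?r2 $ k" for k
    by (intro poly_eq_poly_eq_iff[THEN iffD1] ext) (simp add: sgn_rule_def)
  then show ?thesis by (simp add: vec_eq_iff)
qed

definition even_tables :: "('j::finite \<Rightarrow> bit) \<Rightarrow> (gen \<times> 'j \<Rightarrow> complex poly poly ^ 'j) \<Rightarrow> bool" where
  "even_tables par t \<longleftrightarrow> (\<forall>i j k. t (i, j) $ k \<noteq> 0 \<longrightarrow> par k = gpar i + par j)"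

lemma graded_module_free:
  fixes M :: "(complex poly ^ 'j::finite, 'z) graded_scheme"
  assumes "smul M = (*s)" "part M = part (free_graded par)"
  shows "graded_module M"
  unfolding graded_module_def assms
proof (intro conjI allI)
  show "module ((*s) :: complex poly \<Rightarrow> complex poly ^ 'j \<Rightarrow> _)" by (rule module_vec)
  show "module.subspace (*s) (part (free_graded par) i)" for i
    by (auto simp: module.subspace_def[OF module_vec] free_graded_simps)
  show "part (free_graded par) 0 \<inter> part (free_graded par) 1 = {0}"
  proof (intro equalityI subsetI)
    fix x assume "x \<in> part (free_graded par) 0 \<inter> part (free_graded par) 1"
    then have "x $ j = 0" for j
      using bit_cases2[of "par j"] by (auto simp: free_graded_simps)
    then show "x \<in> {0}" by (simp add: vec_eq_iff)
  qed (simp add: free_graded_simps)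
  fix v :: "complex poly ^ 'j"
  show "\<exists>x\<in>part (free_graded par) 0. \<exists>y\<in>part (free_graded par) 1. v = x + y"
  proof (intro bexI)
    show "v = (\<chi> j. if par j = 0 then v $ j else 0) + (\<chi> j. if par j = 0 then 0 else v $ j)"
      by (simp add: vec_eq_iff)
  qed (use bit_cases2 in \<open>auto simp: free_graded_simps\<close>)
qed

lemma lie_conformal_superalgebra_algebra_of:
  assumes "even_tables gpar (skew_complete t)" "jacobi_tables (skew_complete t) (skew_complete t)"
    and skew: "\<And>g h k z x. ev2 (skew_complete t (g, h) $ k) z x = - odd_sign g h * ev2 (skew_complete t (h, g) $ k) z (- x - z)"
  shows "lie_conformal_superalgebra (algebra_of t)"
  unfolding lie_conformal_superalgebra_def
proof (intro conjI allI ballI)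
  let ?R = "algebra_of t" and ?T = "skew_complete t"
  show "graded_module ?R" by (rule graded_module_free) (rule algebra_of_simps)+
  show "lambda_map ?R ?R (brk ?R)"
    unfolding algebra_of_simps
    by (rule lambda_map_sesq_extend) (use assms(1) in \<open>auto simp: algebra_of_simps even_tables_def\<close>)
  fix i j a b x y and c :: rank3
  assume a: "a \<in> part ?R i" and b: "b \<in> part ?R j"
  have "poly (lambda_eval ?R (brk ?R a b) x $ k) z =
      (if i * j = 1 then 1 else - 1) * poly (lambda_subst ?R (brk ?R b a) [:- x, - 1:] $ k) z" for k z
  proof -
    have e: "poly (a $ g) (- x) * poly (b $ h) (z + x) * ev2 (?T (g, h) $ k) z x =
        (if i * j = 1 then 1 else - 1) * (poly (b $ h) (x + z) * poly (a $ g) (- x) * ev2 (?T (h, g) $ k) z (- x - z))" for g h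
    proof (cases "gpar g = i \<and> gpar h = j")
      case True
      have "ev2 (?T (g, h) $ k) z x = - odd_sign g h * ev2 (?T (h, g) $ k) z (- x - z)" by (rule skew)
      with True show ?thesis by (simp add: add.commute)
    next
      case False
      then have "a $ g = 0 \<or> b $ h = 0"
        using a b by (auto simp: algebra_of_simps free_graded_simps)
      then show ?thesis by auto
    qed
    have "poly (lambda_eval ?R (brk ?R a b) x $ k) z =
       (\<Sum>g\<in>UNIV. \<Sum>h\<in>UNIV. poly (a $ g) (- x) * poly (b $ h) (z + x) * ev2 (?T (g, h) $ k) z x)"
      unfolding algebra_of_simps by (rule lambda_eval_value) (rule algebra_of_simps)
    also have "\<dots> = (if i * j = 1 then 1 else - 1) *
       (\<Sum>h\<in>UNIV. \<Sum>g\<in>UNIV. poly (b $ h) (x + z) * poly (a $ g) (- x) * ev2 (?T (h, g) $ k) z (- x - z))"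
      unfolding e sum_distrib_left by (rule sum.swap)
    also have "(\<Sum>h\<in>UNIV. \<Sum>g\<in>UNIV. poly (b $ h) (x + z) * poly (a $ g) (- x) * ev2 (?T (h, g) $ k) z (- x - z)) =
       poly (lambda_subst ?R (brk ?R b a) [:- x, - 1:] $ k) z"
      unfolding algebra_of_simps(3) by (subst lambda_subst_value, rule algebra_of_simps) (simp add: add.commute)
    finally show ?thesis .
  qed
  then have "lambda_eval ?R (brk ?R a b) x $ k = - sgn_rule i j (lambda_subst ?R (brk ?R b a) [:- x, - 1:]) $ k" for k
    by (intro poly_eq_poly_eq_iff[THEN iffD1] ext) (simp add: sgn_rule_def)
  then show "lambda_eval ?R (brk ?R a b) x = - sgn_rule i j (lambda_subst ?R (brk ?R b a) [:- x, - 1:])"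
    by (simp add: vec_eq_iff)
  show "lambda_eval ?R (brk ?R a (lambda_eval ?R (brk ?R b c) y)) x =
      lambda_eval ?R (brk ?R (lambda_eval ?R (brk ?R a b) x) c) (x + y) +
      sgn_rule i j (lambda_eval ?R (brk ?R b (lambda_eval ?R (brk ?R a c) x)) y)"
    unfolding algebra_of_simps
    by (rule jacobi_sesq_extend[OF _ _ assms(2)]) (use a b in \<open>simp_all add: algebra_of_simps\<close>)
qed

lemma conformal_module_module_of:
  assumes "lie_conformal_superalgebra (algebra_of t)" "even_tables par s" "jacobi_tables (skew_complete t) s"
  shows "conformal_module (algebra_of t) (module_of par s)"
  unfolding conformal_module_def
proof (intro conjI allI ballI assms(1))
  let ?R = "algebra_of t" and ?M = "module_of par s"
  show "graded_module ?M" by (rule graded_module_free) (rule module_of_simps)+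
  show "lambda_map ?R ?M (act ?M)"
    unfolding module_of_simps
    by (rule lambda_map_sesq_extend) (use assms(2) in \<open>auto simp: algebra_of_simps module_of_simps even_tables_def\<close>)
  fix i j a b v x y
  assume "a \<in> part ?R i" "b \<in> part ?R j"
  then show "lambda_eval ?M (act ?M (lambda_eval ?R (brk ?R a b) x) v) (x + y) =
      lambda_eval ?M (act ?M a (lambda_eval ?M (act ?M b v) y)) x -
      sgn_rule i j (lambda_eval ?M (act ?M b (lambda_eval ?M (act ?M a v) x)) y)"
    unfolding algebra_of_simps module_of_simps
    by (subst jacobi_sesq_extend[OF _ _ assms(3), where R = ?R]) (simp_all add: algebra_of_simps module_of_simps)
qed

lemma vec_expansion: "(\<Sum>j\<in>UNIV. (u $ j) *s axis j 1) = (u :: complex poly ^ 'j::finite)"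
  by (simp add: vec_eq_iff axis_nth_if if_distrib[of "(*) _"] cong: if_cong)

lemma finite_cmod_module_of: "finite_cmod (module_of par s)"
  unfolding finite_cmod_def module_of_simps
proof (intro exI conjI)
  interpret module "(*s) :: complex poly \<Rightarrow> complex poly ^ 'a \<Rightarrow> _" by (rule module_vec)
  have "u \<in> span (range (\<lambda>j::'a. axis j 1))" for u
    by (subst vec_expansion[of u, symmetric]) (intro span_sum span_scale span_base rangeI)
  then show "span (range (\<lambda>j::'a. axis j 1)) = UNIV" by auto
qed simp

lemma sum_delta_pair:
  fixes F :: "'a::finite \<Rightarrow> 'b::finite \<Rightarrow> 'c::comm_semiring_1"
  shows "(\<Sum>i\<in>UNIV. \<Sum>j\<in>UNIV. (if i = g then 1 else 0) * (if j = h then c else 0) * F i j) = c * F g h"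
proof -
  have 1: "(if i = g then 1 else 0) * (if j = h then c else 0) * F i j =
      (if j = h then if i = g then c * F g h else 0 else 0)" for i j
    by simp
  show ?thesis
    unfolding 1 by (simp only: sum.delta finite UNIV_I if_True)
qed

lemma sesq_comp_axis:
  "sesq_comp s (axis g 1) (p *s axis j 1) k = inst p (pDel + pLam) * (s (g, j) $ k)"
proof -
  have "inst (axis g 1 $ i) (- pLam) = (if i = g then 1 else 0)" for i
    by (simp add: axis_nth_if inst_pCons one_pCons)
  moreover have "inst ((p *s axis j 1) $ i) (pDel + pLam) = (if i = j then inst p (pDel + pLam) else 0)" for i
    by (simp add: axis_nth_if)
  ultimately show ?thesis
    unfolding sesq_comp_def by (simp only: sum_delta_pair)
qed

lemma nontrivial_module_of:
  assumes "s (g, j) \<noteq> 0"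
  shows "nontrivial_cmod (module_of par s)"
  unfolding nontrivial_cmod_def module_of_simps
proof (intro exI notI)
  assume "sesq_extend s (axis g 1) (1 *s axis j 1) = 0"
  then have "sesq_comp s (axis g 1) (1 *s axis j 1) k = 0" for k
    by (intro poly_eqI) (simp flip: coeff_sesq_extend)
  then have "s (g, j) $ k = 0" for k
    unfolding sesq_comp_axis by (simp add: inst_pCons one_pCons)
  with assms show False by (simp add: vec_eq_iff)
qed

lemma lead_coeff_inst_shift:
  assumes "p \<noteq> 0"
  shows "inst p (pDel + pLam) \<noteq> 0 \<and> lead_coeff (inst p (pDel + pLam)) = [:lead_coeff p:]"
  using assms
proof (induction p)
  case 0
  then show ?case by simp
next
  case (pCons a p)
  show ?case
  proof (cases "p = 0")
    case True
    with pCons show ?thesis by simp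
  next
    case False
    let ?q = "(pDel + pLam) * inst p (pDel + pLam)"
    have t: "pDel + pLam = [:[:0, 1:], 1:]" by simp
    have q: "?q \<noteq> 0" "degree ?q = Suc (degree (inst p (pDel + pLam)))" "lead_coeff ?q = [:lead_coeff p:]"
      using pCons False unfolding lead_coeff_mult by (auto simp: t degree_mult_eq simp del: mult_pCons_left)
    have "degree (cst a) < degree ?q" using q(2) by simp
    then have "degree (cst a + ?q) = degree ?q" "lead_coeff (cst a + ?q) = lead_coeff ?q"
      by (rule degree_add_eq_right, rule lead_coeff_add_le)
    with q False show ?thesis by (auto simp: inst_pCons simp del: mult_pCons_left)
  qed
qed

text \<open>The leading coefficient in \<lambda> of p(\<partial> + \<lambda>) h is
  \<open>lead_coeff p\<close> times c. It is free of \<partial>, so it can be inverted inside the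
  submodule.\<close>

lemma submodule_step:
  assumes N: "conformal_submodule (module_of par s) N" "p *s axis j 1 \<in> N" "p \<noteq> 0"
    and s: "s (g, j) = axis j' h" "lead_coeff h = [:c:]" "c \<noteq> 0"
  shows "axis j' 1 \<in> N"
proof -
  interpret module "(*s) :: complex poly \<Rightarrow> complex poly ^ 'a \<Rightarrow> _" by (rule module_vec)
  have sub: "subspace N" and act: "\<And>a v n. v \<in> N \<Longrightarrow> coeff (sesq_extend s a v) n \<in> N"
    using N(1) by (auto simp: conformal_submodule_def module_of_simps)
  let ?q = "inst p (pDel + pLam) * h"
  have lc: "lead_coeff ?q = [:lead_coeff p * c:]"
    using lead_coeff_inst_shift[OF N(3)] s(2) by (simp add: lead_coeff_mult)
  have "coeff (sesq_extend s (axis g 1) (p *s axis j 1)) (degree ?q) = [:lead_coeff p * c:] *s axis j' 1"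
    using lc by (simp add: vec_eq_iff coeff_sesq_extend sesq_comp_axis s(1) axis_nth_if)
  with act[OF N(2), of "axis g 1" "degree ?q"] have "[:lead_coeff p * c:] *s axis j' 1 \<in> N" by simp
  then have "[:inverse (lead_coeff p * c):] *s ([:lead_coeff p * c:] *s axis j' 1) \<in> N"
    by (rule subspace_scale[OF sub])
  moreover have "[:inverse d:] *s ([:d:] *s w) = w" if "d \<noteq> 0" for d and w :: "complex poly ^ 'a"
    using that by (simp add: vec_eq_iff)
  moreover have "lead_coeff p * c \<noteq> 0" using N(3) s(3) by simp
  ultimately show ?thesis by metis
qed

lemma irreducible_rank_one:
  assumes "lead_coeff (s (g, ()) $ ()) = [:c:]" "c \<noteq> 0"
  shows "irreducible_cmod (module_of par s)"
  unfolding irreducible_cmod_def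
proof (intro allI impI)
  interpret module "(*s) :: complex poly \<Rightarrow> complex poly ^ unit \<Rightarrow> _" by (rule module_vec)
  fix N assume N: "conformal_submodule (module_of par s) N"
  then have sub: "subspace N" by (simp add: conformal_submodule_def module_of_simps)
  show "N = {0} \<or> N = UNIV"
  proof (cases "N = {0}")
    case False
    then obtain u where u: "u \<in> N" "u \<noteq> 0" using subspace_0[OF sub] by blast
    have exp: "w = (w $ ()) *s axis () 1" for w :: "complex poly ^ unit"
      by (simp add: vec_eq_iff axis_nth_if)
    have "axis () 1 \<in> N"
    proof (rule submodule_step[OF N])
      show "(u $ ()) *s axis () 1 \<in> N" using u(1) exp[of u] by simp
      show "u $ () \<noteq> 0" using u(2) by (auto simp: vec_eq_iff)
      show "s (g, ()) = axis () (s (g, ()) $ ())" by (simp add: vec_eq_iff axis_nth_if)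
    qed (rule assms)+
    then have "w \<in> N" for w
      by (subst exp) (rule subspace_scale[OF sub])
    then show ?thesis by blast
  qed simp
qed

text \<open>The grading puts both components of a vector into the submodule, and g leads from either
  basis vector to the other.\<close>

lemma irreducible_rank_two:
  fixes s :: "gen \<times> bit \<Rightarrow> complex poly poly ^ bit"
  assumes s: "s (g, 0) = axis 1 h" "s (g, 1) = axis 0 h'"
    and h: "lead_coeff h = [:c:]" "c \<noteq> 0" "lead_coeff h' = [:c':]" "c' \<noteq> 0"
  shows "irreducible_cmod (module_of (\<lambda>i. i) s)"
  unfolding irreducible_cmod_def
proof (intro allI impI)
  interpret module "(*s) :: complex poly \<Rightarrow> complex poly ^ bit \<Rightarrow> _" by (rule module_vec)
  fix N assume N: "conformal_submodule (module_of (\<lambda>i. i) s) N"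
  then have sub: "subspace N" and gr: "\<And>x y. x \<in> part (free_graded (\<lambda>i. i)) 0 \<Longrightarrow>
      y \<in> part (free_graded (\<lambda>i. i)) 1 \<Longrightarrow> x + y \<in> N \<Longrightarrow> x \<in> N \<and> y \<in> N"
    by (auto simp: conformal_submodule_def module_of_simps)
  show "N = {0} \<or> N = UNIV"
  proof (cases "N = {0}")
    case False
    then obtain u where u: "u \<in> N" "u \<noteq> 0" using subspace_0[OF sub] by blast
    have exp: "w = (w $ 0) *s axis 0 1 + (w $ 1) *s axis 1 1" for w :: "complex poly ^ bit"
      using vec_expansion[of w] by (simp add: UNIV_bit)
    have "(u $ 0) *s axis 0 1 \<in> N \<and> (u $ 1) *s axis 1 1 \<in> N"
      using u(1) exp[of u] by (intro gr) (auto simp: free_graded_simps axis_nth_if)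
    moreover have "u $ 0 \<noteq> 0 \<or> u $ 1 \<noteq> 0"
      using u(2) exp[of u] by auto
    moreover have step0: "axis 1 1 \<in> N" if "p *s axis 0 1 \<in> N" "p \<noteq> 0" for p
      by (rule submodule_step[OF N that s(1) h(1,2)])
    moreover have step1: "axis 0 1 \<in> N" if "p *s axis 1 1 \<in> N" "p \<noteq> 0" for p
      by (rule submodule_step[OF N that s(2) h(3,4)])
    ultimately have "axis 0 1 \<in> N \<or> axis 1 1 \<in> N" by blast
    then have "axis 0 1 \<in> N \<and> axis 1 1 \<in> N"
      using step0[of 1] step1[of 1] by auto
    then have "w \<in> N" for w
      by (subst exp) (intro subspace_add[OF sub] subspace_scale[OF sub]; simp)
    then show ?thesis by blast
  qed simp
qed

section \<open>Invariance under isomorphism\<close>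

lemma lambda_subst_hom:
  assumes "module_hom (smul M) (smul N) f"
  shows "f (lambda_subst M p q) = lambda_subst N (map_poly f p) q"
proof -
  interpret module_hom "smul M" "smul N" f by (rule assms)
  have "degree (map_poly f p) \<le> degree p"
    by (rule degree_le) (simp add: coeff_map_poly zero coeff_eq_0)
  then have "lambda_subst N (map_poly f p) q = (\<Sum>n\<le>degree p. smul N (q ^ n) (coeff (map_poly f p) n))"
    unfolding lambda_subst_def
    by (intro sum.mono_neutral_left) (auto simp: coeff_eq_0 simp del: coeff_map_poly)
  then show ?thesis
    by (simp add: lambda_subst_def sum scale coeff_map_poly zero)
qed

lemma sgn_rule_hom:
  assumes "\<And>v. f (- v) = - f v"
  shows "f (sgn_rule i j v) = sgn_rule i j (f v)"
  by (simp add: sgn_rule_def assms)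

lemma conformal_moduleD:
  assumes "conformal_module R M"
  shows "lie_conformal_superalgebra R" "graded_module M" "lambda_map R M (act M)"
    "\<And>i j a b v x y. a \<in> part R i \<Longrightarrow> b \<in> part R j \<Longrightarrow>
      lambda_eval M (act M (lambda_eval R (brk R a b) x) v) (x + y) =
        lambda_eval M (act M a (lambda_eval M (act M b v) y)) x -
        sgn_rule i j (lambda_eval M (act M b (lambda_eval M (act M a v) x)) y)"
proof -
  show "lie_conformal_superalgebra R" "graded_module M" "lambda_map R M (act M)"
    using assms by (simp_all add: conformal_module_def)
  show "lambda_eval M (act M (lambda_eval R (brk R a b) x) v) (x + y) =
      lambda_eval M (act M a (lambda_eval M (act M b v) y)) x -
      sgn_rule i j (lambda_eval M (act M b (lambda_eval M (act M a v) x)) y)"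
    if "a \<in> part R i" "b \<in> part R j" for i j a b v x y
    using assms[unfolded conformal_module_def, THEN conjunct2, THEN conjunct2, THEN conjunct2, rule_format, OF that] .
qed

text \<open>Each axiom of M becomes, after applying f, the corresponding axiom of N and is pulled
  back by injectivity; submodules of M have submodules of N as images.\<close>

lemma fin_nontriv_irred_iso:
  assumes "M \<cong> N" "fin_nontriv_irred R N"
  shows "fin_nontriv_irred R M"
proof -
  obtain f where f: "bij f" "module_hom (smul M) (smul N) f" "\<And>i. f ` part M i = part N i"
    "\<And>a v. act N a (f v) = map_poly f (act M a v)"
    using assms(1) unfolding cmod_iso_def by blast
  interpret f: module_hom "smul M" "smul N" f by (rule f(2))
  note hom = f.add f.scale f.zero f.neg f.diff
  have inj: "f u = f v \<longleftrightarrow> u = v" for u v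
    using f(1) by (auto simp: bij_def inj_eq)
  have surj: "\<exists>v. w = f v" for w
    using f(1) by (metis bij_pointE)
  have part: "v \<in> part M i \<longleftrightarrow> f v \<in> part N i" for v i
    using inj_image_mem_iff[OF bij_is_inj[OF f(1)], of v "part M i"] f(3)[of i] by simp
  have fc: "f (coeff (act M a v) n) = coeff (act N a (f v)) n" for a v n
    by (simp add: f(4) coeff_map_poly f.zero)
  have fe: "f (lambda_eval M (act M a v) x) = lambda_eval N (act N a (f v)) x" for a v x
    by (simp add: lambda_eval_def lambda_subst_hom[OF f(2)] f(4))
  have "conformal_module R N"
    and fin: "finite_cmod N" and nontriv: "nontrivial_cmod N" and irr: "irreducible_cmod N"
    using assms(2) by (simp_all add: fin_nontriv_irred_def)
  note N = conformal_moduleD[OF this(1)]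
  have subN: "f.m2.subspace (part N i)" for i
    using N(2) by (auto simp: graded_module_def)
  have "graded_module M"
    unfolding graded_module_def
  proof (intro conjI allI)
    show "module (smul M)" by (rule f.m1.module_axioms)
    show "f.m1.subspace (part M i)" for i
      using subN[of i] unfolding f.m1.subspace_def f.m2.subspace_def by (simp add: part hom)
    have "part N 0 \<inter> part N 1 = {0}" using N(2) by (simp add: graded_module_def)
    then have "v \<in> part M 0 \<inter> part M 1 \<longleftrightarrow> f v = f 0" for v
      unfolding Int_iff part f.zero by blast
    then show "part M 0 \<inter> part M 1 = {0}" unfolding inj by blast
    fix v
    obtain x y where "x \<in> part N 0" "y \<in> part N 1" "f v = x + y"
      using N(2) by (auto simp: graded_module_def) metis
    moreover obtain x' y' where "x = f x'" "y = f y'" using surj by metis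
    ultimately show "\<exists>x\<in>part M 0. \<exists>y\<in>part M 1. v = x + y"
      by (intro bexI[of _ x'] bexI[of _ y']) (auto simp: part simp flip: f.add inj)
  qed
  moreover have "lambda_map R M (act M)"
    using N(3) unfolding lambda_map_def
    by (simp add: poly_eq_iff coeff_map_poly hom part fc coeff_pCons if_distrib[of f] split: nat.split flip: inj cong: if_cong)
  moreover have "lambda_eval M (act M (lambda_eval R (brk R a b) x) v) (x + y) =
          lambda_eval M (act M a (lambda_eval M (act M b v) y)) x -
          sgn_rule i j (lambda_eval M (act M b (lambda_eval M (act M a v) x)) y)"
    if "a \<in> part R i" "b \<in> part R j" for i j a b v x y
    using N(4)[OF that, of x "f v" y]
    by (simp add: f.diff fe sgn_rule_hom[of f, OF f.neg] flip: inj)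
  ultimately have "conformal_module R M"
    using N(1) unfolding conformal_module_def by blast
  moreover have "finite_cmod M"
  proof -
    obtain S where S: "finite S" "f.m2.span S = UNIV"
      using fin by (auto simp: finite_cmod_def)
    have "f ` inv f ` S = S"
      using f(1) by (simp add: image_f_inv_f bij_is_surj)
    then have "f ` f.m1.span (inv f ` S) = UNIV"
      using f.span_image[of "inv f ` S"] S(2) by simp
    then have "f v \<in> f ` f.m1.span (inv f ` S)" for v by simp
    then have "f.m1.span (inv f ` S) = UNIV"
      unfolding inj_image_mem_iff[OF bij_is_inj[OF f(1)]] by blast
    then show ?thesis
      unfolding finite_cmod_def using S(1) by (intro exI[of _ "inv f ` S"]) simp
  qed
  moreover have "nontrivial_cmod M"
  proof -
    obtain a w where aw: "act N a w \<noteq> 0" using nontriv by (auto simp: nontrivial_cmod_def)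
    obtain v where "w = f v" using surj by blast
    with aw have "act M a v \<noteq> 0" using f(4)[of a v] by auto
    then show ?thesis by (auto simp: nontrivial_cmod_def)
  qed
  moreover have "irreducible_cmod M"
    unfolding irreducible_cmod_def
  proof (intro allI impI)
    fix K assume K: "conformal_submodule M K"
    have mem: "f v \<in> f ` K \<longleftrightarrow> v \<in> K" for v
      by (rule inj_image_mem_iff[OF bij_is_inj[OF f(1)]])
    have "conformal_submodule N (f ` K)"
      unfolding conformal_submodule_def
    proof (intro conjI ballI allI impI)
      show "f.m2.subspace (f ` K)"
        using K by (intro f.subspace_image) (simp add: conformal_submodule_def)
    next
      fix x y assume xy: "x \<in> part N 0" "y \<in> part N 1" "x + y \<in> f ` K"
      obtain x' y' where x': "x = f x'" "y = f y'" using surj by metis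
      with xy have "x' \<in> part M 0" "y' \<in> part M 1" "x' + y' \<in> K"
        by (simp_all add: part mem flip: f.add)
      then have "x' \<in> K \<and> y' \<in> K" using K by (auto simp: conformal_submodule_def)
      then show "x \<in> f ` K" "y \<in> f ` K" by (simp_all add: x' mem)
    next
      fix a w n assume "w \<in> f ` K"
      then obtain v where v: "w = f v" "v \<in> K" by blast
      then have "coeff (act M a v) n \<in> K" using K by (auto simp: conformal_submodule_def)
      then show "coeff (act N a w) n \<in> f ` K" unfolding v(1) fc[symmetric] by (rule imageI)
    qed
    then have "f ` K = {0} \<or> f ` K = UNIV" using irr by (simp add: irreducible_cmod_def)
    then show "K = {0} \<or> K = UNIV"
    proof
      assume e: "f ` K = {0}"
      have "v \<in> K \<longleftrightarrow> v = 0" for v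
        using mem[of v] inj[of v 0] unfolding e f.zero by simp
      then show ?thesis by blast
    next
      assume e: "f ` K = UNIV"
      then have "v \<in> K" for v using mem[of v] by simp
      then show ?thesis by blast
    qed
  qed
  ultimately show ?thesis by (simp add: fin_nontriv_irred_def)
qed

section \<open>Irreducible modules over an algebra given by a table\<close>

context
  fixes t :: "gen \<times> gen \<Rightarrow> complex poly poly ^ gen" and M :: "(rank3, 'm::ab_group_add) conf_module"
  assumes mod: "module (smul M)" and lam: "lambda_map (algebra_of t) M (act M)"
begin

interpretation del_module "smul M" by (rule del_module.intro[OF mod])

lemma act_props:
  "act M (a + a') v = act M a v + act M a' v"
  "act M ([:c:] *s a) v = map_poly (smul M [:c:]) (act M a v)"
  "act M ([:0, 1:] *s a) v = - pCons 0 (act M a v)"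
  "conf_op (act M a)"
  using lam unfolding lambda_map_def conf_op_def algebra_of_simps by simp_all

lemma act_part:
  assumes "u \<in> part (free_graded gpar) i" "v \<in> part M j"
  shows "coeff (act M u v) n \<in> part M (i + j)"
  using lam[unfolded lambda_map_def algebra_of_simps, THEN conjunct2, THEN conjunct2, THEN conjunct2,
      THEN conjunct2, THEN conjunct1, rule_format, OF assms] .

lemma lambda_eval_ev: "lambda_eval M p x = ev p x"
  by (simp add: lambda_eval_def lambda_subst_def ev_def csc_power)

lemma act_0: "act M 0 v = 0"
  using act_props(1)[of 0 0 v] by simp

lemma act_pCons: "act M (pCons c p *s a) v = map_poly (smul M [:c:]) (act M a v) - pCons 0 (act M (p *s a) v)"
proof -
  have "pCons c p *s a = [:c:] *s a + [:0, 1:] *s (p *s a)"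
    by (simp add: vec_eq_iff)
  then show ?thesis by (simp only: act_props) simp
qed

lemma ev_act_smul: "ev (act M (p *s a) v) x = smul M [:poly p (- x):] (ev (act M a v) x)"
proof (induction p)
  case 0
  have "0 *s a = 0" by (simp add: vec_eq_iff)
  then show ?case by (simp add: act_0)
next
  case (pCons c p)
  have "ev (act M (pCons c p *s a) v) x = smul M [:c:] (ev (act M a v) x) +
      - (smul M [:x:] (smul M [:poly p (- x):] (ev (act M a v) x)))"
    unfolding act_pCons by (simp only: diff_conv_add_uminus ev_add ev_uminus ev_map_poly[OF endo_sm] ev_pCons pCons)
      (simp add: C.scale_right_distrib)
  also have "\<dots> = smul M [:c + (- x) * poly p (- x):] (ev (act M a v) x)"
    by (simp only: csc_laws(2)[of c] csc_laws(3) C.scale_minus_left mult_minus_left)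
  finally show ?case by (simp only: poly_pCons)
qed

lemma act_sum: "act M (sum f A) v = (\<Sum>k\<in>A. act M (f k) v)"
  by (induction A rule: infinite_finite_induct) (auto simp: act_0 act_props)

lemma ev_sum: "ev (sum f A) x = (\<Sum>k\<in>A. ev (f k) x)"
  by (induction A rule: infinite_finite_induct) (auto simp: ev_add)

lemma ev_act_expansion:
  "ev (act M u v) x = (\<Sum>k\<in>UNIV. smul M [:poly (u $ k) (- x):] (ev (act M (axis k 1) v) x))"
  by (subst vec_expansion[of u, symmetric]) (simp only: act_sum ev_sum ev_act_smul)

text \<open>p(\<partial>) a acts as p(-\<lambda>) a_\<lambda>, which only recombines coefficients,
  so closure of N may be tested on the generators.\<close>

lemma coeff_act_in:
  assumes N: "subspace N" and gen: "\<And>g n. coeff (act M (axis g 1) v) n \<in> N"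
  shows "coeff (act M u v) n \<in> N"
proof -
  have "coeff (act M (p *s axis g 1) v) n \<in> N" for p g n
  proof (induction p arbitrary: n)
    case 0
    have "0 *s axis g 1 = (0 :: rank3)" by (simp add: vec_eq_iff)
    then show ?case using subspace_0[OF N] by (simp add: act_0)
  next
    case (pCons c p)
    show ?case
      unfolding act_pCons
      using pCons.IH gen[of g n] subspace_0[OF N]
      by (auto simp: coeff_map_poly coeff_pCons intro!: subspace_diff[OF N] subspace_scale[OF N] split: nat.splits)
  qed
  then have "coeff (\<Sum>k\<in>UNIV. act M ((u $ k) *s axis k 1) v) n \<in> N"
    unfolding coeff_sum by (intro subspace_sum[OF N])
  then show ?thesis by (simp only: act_sum[symmetric] vec_expansion)
qed

end

lemma axis_part: "axis g 1 \<in> part (free_graded gpar) (gpar g)"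
  by (auto simp: free_graded_simps axis_nth_if)

lemma inst_1 [simp]: "inst 1 t = 1"
  using inst_const[of 1 t] by (simp add: one_pCons)

text \<open>The structure polynomials as complex functions of \<partial> and \<lambda>, the form in
  which the commutation relations of the operators use them.\<close>

definition struct :: "(gen \<times> gen \<Rightarrow> complex poly poly ^ gen) \<Rightarrow> gen \<Rightarrow> gen \<Rightarrow> gen \<Rightarrow> complex \<Rightarrow> complex \<Rightarrow> complex" where
  "struct t g h k z x = ev2 (skew_complete t (g, h) $ k) z x"

text \<open>Restricting to the generators loses nothing: by \<open>coeff_act_in\<close> both
  nontriviality and submodules are detected there.\<close>

lemma gen_module_of:
  assumes "fin_nontriv_irred (algebra_of t) M"
  shows "gen_module (smul M) (part M) (\<lambda>g. act M (axis g 1)) (struct t)"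
proof -
  let ?R = "algebra_of t"
  have "conformal_module ?R M"
    and fin: "finite_cmod M" and nontriv: "nontrivial_cmod M" and irr: "irreducible_cmod M"
    using assms by (simp_all add: fin_nontriv_irred_def)
  note M = conformal_moduleD(2-4)[OF this(1)]
  have mod: "module (smul M)" using M(1) by (simp add: graded_module_def)
  interpret del_module "smul M" by (rule del_module.intro[OF mod])
  note le = lambda_eval_ev[OF mod M(2)]
  show ?thesis
  proof unfold_locales
    show "conf_op (act M (axis g 1))" for g by (rule act_props[OF mod M(2)])
    show "subspace (part M i)" for i using M(1) by (simp add: graded_module_def)
    show "part M 0 \<inter> part M 1 = {0}" using M(1) by (simp add: graded_module_def)
    show "\<exists>x\<in>part M 0. \<exists>y\<in>part M 1. v = x + y" for v using M(1) by (simp add: graded_module_def)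
    show "coeff (act M (axis g 1) v) n \<in> part M (gpar g + j)" if "v \<in> part M j" for v j g n
      by (rule act_part[OF mod M(2) axis_part that])
    show "\<exists>U. finite U \<and> span U = UNIV" using fin by (simp add: finite_cmod_def)
    show "\<exists>g v. act M (axis g 1) v \<noteq> 0"
    proof (rule ccontr)
      assume "\<not> ?thesis"
      then have z: "act M (axis g 1) v = 0" for g v by simp
      have "coeff (act M u v) n \<in> {0}" for u v n
        by (rule coeff_act_in[OF mod M(2) subspace_single_0]) (simp add: z)
      then have "act M u v = 0" for u v by (intro poly_eqI) simp
      with nontriv show False by (simp add: nontrivial_cmod_def)
    qed
    show "N = {0} \<or> N = UNIV"
      if "subspace N" "\<And>x y. x \<in> part M 0 \<Longrightarrow> y \<in> part M 1 \<Longrightarrow> x + y \<in> N \<Longrightarrow> x \<in> N \<and> y \<in> N"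
        "\<And>g v n. v \<in> N \<Longrightarrow> coeff (act M (axis g 1) v) n \<in> N" for N
    proof -
      have 1: "\<forall>x\<in>part M 0. \<forall>y\<in>part M 1. x + y \<in> N \<longrightarrow> x \<in> N \<and> y \<in> N"
        by (intro ballI impI) (rule that(2))
      have 2: "\<forall>a. \<forall>v\<in>N. \<forall>n. coeff (act M a v) n \<in> N"
        by (intro allI ballI) (rule coeff_act_in[OF mod M(2) that(1) that(3)])
      have "conformal_submodule M N"
        unfolding conformal_submodule_def by (intro conjI that(1) 1 2)
      with irr show ?thesis by (simp add: irreducible_cmod_def)
    qed
    fix g h v x y
    have c: "lambda_eval ?R (brk ?R (axis g 1) (axis h 1)) x $ k = poly (skew_complete t (g, h) $ k) [:x:]" for k
    proof -
      have "(1 :: complex poly) *s axis h 1 = axis h 1" by (simp add: vec_eq_iff)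
      then have "sesq_comp (skew_complete t) (axis g 1) (axis h 1) k = skew_complete t (g, h) $ k"
        using sesq_comp_axis[of "skew_complete t" g 1 h k] by simp
      then show ?thesis
        by (simp only: lambda_eval_def algebra_of_simps(3) lambda_subst_sesq_extend[OF algebra_of_simps(1)])
    qed
    have "ev (act M (lambda_eval ?R (brk ?R (axis g 1) (axis h 1)) x) v) (x + y) =
        (\<Sum>k\<in>UNIV. smul M [:struct t g h k (- x - y) x:] (ev (act M (axis k 1) v) (x + y)))"
      by (subst ev_act_expansion[OF mod M(2)]) (simp add: c ev2_def struct_def)
    then show "ev (act M (axis g 1) (ev (act M (axis h 1) v) y)) x +
        smul M [:if gpar g * gpar h = 1 then 1 else - 1:] (ev (act M (axis h 1) (ev (act M (axis g 1) v) x)) y) =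
        (\<Sum>k\<in>UNIV. smul M [:struct t g h k (- x - y) x:] (ev (act M (axis k 1) v) (x + y)))"
      using M(3)[of "axis g 1" "gpar g" "axis h 1" "gpar h" x v y] axis_part
      by (simp add: algebra_of_simps(2) le sgn_rule_def csc_laws(4) split: if_splits)
  qed
qed

text \<open>The vectors generate M, because their span is nonzero and stable under the generators.
  They are free because \<open>par\<close> is injective: there is at most one vector of each parity,
  so a relation splits into homogeneous terms, and torsion-freeness makes each coefficient
  zero.\<close>

lemma iso_module_of:
  fixes vs :: "'j::finite \<Rightarrow> 'm::ab_group_add"
  assumes "fin_nontriv_irred (algebra_of t) M"
    and par: "inj par" and vs: "\<And>j. vs j \<in> part M (par j)" "\<And>j. vs j \<noteq> 0"
    and s: "\<And>g j. act M (axis g 1) (vs j) = (\<Sum>k\<in>UNIV. map_poly (\<lambda>p. smul M p (vs k)) (s (g, j) $ k))"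
  shows "M \<cong> module_of par s"
proof -
  interpret gen_module "smul M" "part M" "\<lambda>g. act M (axis g 1)" "struct t"
    by (rule gen_module_of[OF assms(1)])
  have mod: "module (smul M)" by (rule module_axioms)
  have lam: "lambda_map (algebra_of t) M (act M)"
    using assms(1) conformal_moduleD(3) unfolding fin_nontriv_irred_def by blast
  \<comment> \<open>This map goes from the free module to M, where it has an explicit formula; the
    isomorphism asked for is its inverse.\<close>
  define \<phi> where "\<phi> u = (\<Sum>j\<in>UNIV. smul M (u $ j) (vs j))" for u :: "complex poly ^ 'j"
  have add: "\<phi> (u + w) = \<phi> u + \<phi> w" for u w
    by (simp add: \<phi>_def scale_left_distrib sum.distrib)
  have scale: "\<phi> (c *s u) = smul M c (\<phi> u)" for c u
    by (simp add: \<phi>_def scale_sum_right)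
  have ax: "\<phi> (p *s axis j 1) = smul M p (vs j)" for p j
    by (simp add: \<phi>_def axis_nth_if if_distrib[of "\<lambda>q. smul M q _"] if_distrib[of "\<lambda>q. p * q"] cong: if_cong)
  have zero: "\<phi> 0 = 0" by (simp add: \<phi>_def)
  have "v \<in> range \<phi>" if "v \<in> span (range vs)" for v
    using that
  proof (induction rule: span_induct_alt)
    case base
    then show ?case using zero by (metis rangeI)
  next
    case (step c w v)
    then obtain j u where "w = vs j" "v = \<phi> u" by blast
    then have "smul M c w + v = \<phi> (c *s axis j 1 + u)" by (simp only: add ax)
    then show ?case by blast
  qed
  moreover have "span (range vs) = {0} \<or> span (range vs) = UNIV"
  proof (rule span_dichotomy)
    show "\<exists>i. w \<in> part M i" if "w \<in> range vs" for w using that vs(1) by blast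
    fix g w n assume "w \<in> range vs"
    then obtain j where j: "w = vs j" by blast
    have "coeff (act M (axis g 1) w) n = (\<Sum>k\<in>UNIV. smul M (coeff (s (g, j) $ k) n) (vs k))"
      by (simp add: j s coeff_sum coeff_map_poly)
    then show "coeff (act M (axis g 1) w) n \<in> span (range vs)"
      by (simp only:) (intro span_sum span_scale span_base rangeI)
  qed
  moreover have "span (range vs) \<noteq> {0}"
    using vs(2) span_base[OF rangeI, of vs] by (metis singletonD)
  ultimately have "v \<in> range \<phi>" for v by simp
  then have surj: "\<exists>u. v = \<phi> u" for v by blast
  have rest: "(\<Sum>j\<in>UNIV - {j0}. smul M (u $ j) (vs j)) \<in> part M (par j0 + 1)"
    and split: "\<phi> u = smul M (u $ j0) (vs j0) + (\<Sum>j\<in>UNIV - {j0}. smul M (u $ j) (vs j))" for u j0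
  proof -
    have "par j = par j0 + 1" if "j \<noteq> j0" for j
      using par that bit_cases2[of "par j"] bit_cases2[of "par j0"] by (auto simp: inj_def)
    then show "(\<Sum>j\<in>UNIV - {j0}. smul M (u $ j) (vs j)) \<in> part M (par j0 + 1)"
      using vs(1) by (intro subspace_sum[OF part_subspace] part_op_sm) (metis DiffD2 singletonI)
    show "\<phi> u = smul M (u $ j0) (vs j0) + (\<Sum>j\<in>UNIV - {j0}. smul M (u $ j) (vs j))"
      unfolding \<phi>_def by (rule sum.remove) simp_all
  qed
  have inj0: "u = 0" if "\<phi> u = 0" for u
  proof -
    have "u $ j0 = 0" for j0
    proof -
      have "smul M (u $ j0) (vs j0) = 0"
        using part_indep[OF part_op_sm[OF vs(1)] rest] split[of u j0] that by metis
      then show ?thesis using torsion_free vs(2) by blast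
    qed
    then show ?thesis by (simp add: vec_eq_iff)
  qed
  have neg: "\<phi> (- u) = - \<phi> u" for u
    using add[of u "- u"] zero by (simp add: eq_neg_iff_add_eq_0 add.commute)
  have inj: "u = w" if "\<phi> u = \<phi> w" for u w
    using inj0[of "u + - w"] that by (simp only: add neg) simp
  have parts: "\<phi> u \<in> part M i \<longleftrightarrow> u \<in> part (free_graded par) i" for u i
  proof
    assume u: "u \<in> part (free_graded par) i"
    have "smul M (u $ j) (vs j) \<in> part M i" for j
      using u part_op_sm[OF vs(1), of "u $ j" j] subspace_0[OF part_subspace]
      by (cases "par j = i") (auto simp: free_graded_simps)
    then show "\<phi> u \<in> part M i" unfolding \<phi>_def by (intro subspace_sum[OF part_subspace])
  next
    assume u: "\<phi> u \<in> part M i"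
    have "u $ j = 0" if "par j \<noteq> i" for j
    proof -
      have i: "i = par j + 1" using that bit_cases2[of i] bit_cases2[of "par j"] by auto
      have "(\<Sum>j\<in>UNIV - {j}. smul M (u $ j) (vs j)) - \<phi> u \<in> part M (par j + 1)"
        using rest[of u j] u unfolding i by (intro subspace_diff[OF part_subspace])
      then have "smul M (u $ j) (vs j) = 0"
        using part_indep[OF part_op_sm[OF vs(1)], of "(\<Sum>j\<in>UNIV - {j}. smul M (u $ j) (vs j)) - \<phi> u" j "u $ j"]
          split[of u j] by (simp add: algebra_simps)
      then show ?thesis using torsion_free vs(2) by blast
    qed
    then show "u \<in> part (free_graded par) i" by (simp add: free_graded_simps)
  qed
  have hom: "module_hom (smul (module_of par s)) (smul M) \<phi>"
    by (intro module_hom.intro module_hom_axioms.intro mod) (simp_all add: module_of_simps module_vec add scale)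
  have act: "act M a (\<phi> u) = map_poly \<phi> (sesq_extend s a u)" for a u
  proof (rule ev_eqI)
    fix x
    have vec: "ev (act M (axis g 1) (vs j)) x = (\<Sum>k\<in>UNIV. smul M (poly (s (g, j) $ k) [:x:]) (vs k))" for g j
    proof -
      have "ev (map_poly (\<lambda>p. smul M p w) q) x = smul M (poly q [:x:]) w" for q w
      proof (induction q)
        case 0
        then show ?case by simp
      next
        case (pCons a q)
        then show ?case
          by (simp add: map_poly_pCons ev_pCons scale_left_distrib)
      qed
      then show ?thesis by (simp only: s ev_sum[OF mod lam])
    qed
    have "ev (act M a (\<phi> u)) x = (\<Sum>g\<in>UNIV. \<Sum>j\<in>UNIV. \<Sum>k\<in>UNIV.
        smul M ([:poly (a $ g) (- x):] * pcompose (u $ j) [:x, 1:] * poly (s (g, j) $ k) [:x:]) (vs k))"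
      unfolding ev_act_expansion[OF mod lam, of a]
      by (simp only: \<phi>_def C.endo_sum[OF endo_ev[OF conf]] conf_op_sm[OF conf] vec scale_sum_right scale_scale mult.assoc)
    also have "\<dots> = (\<Sum>k\<in>UNIV. smul M (\<Sum>g\<in>UNIV. \<Sum>j\<in>UNIV.
        [:poly (a $ g) (- x):] * pcompose (u $ j) [:x, 1:] * poly (s (g, j) $ k) [:x:]) (vs k))"
      unfolding scale_sum_left
      by (subst sum.swap[of _ _ "UNIV :: 'j set"], subst (2) sum.swap) (rule refl)
    also have "\<dots> = (\<Sum>k\<in>UNIV. smul M (lambda_eval (module_of par s) (sesq_extend s a u) x $ k) (vs k))"
    proof (intro sum.cong refl arg_cong2[of _ _ _ _ "smul M"])
      fix k
      show "(\<Sum>g\<in>UNIV. \<Sum>j\<in>UNIV. [:poly (a $ g) (- x):] * pcompose (u $ j) [:x, 1:] * poly (s (g, j) $ k) [:x:]) =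
        lambda_eval (module_of par s) (sesq_extend s a u) x $ k"
      proof (rule poly_eq_poly_eq_iff[THEN iffD1], rule ext)
        fix z
        show "poly (\<Sum>g\<in>UNIV. \<Sum>j\<in>UNIV. [:poly (a $ g) (- x):] * pcompose (u $ j) [:x, 1:] * poly (s (g, j) $ k) [:x:]) z =
          poly (lambda_eval (module_of par s) (sesq_extend s a u) x $ k) z"
          by (subst lambda_eval_value, rule module_of_simps)
             (simp add: poly_sum poly_pcompose ev2_def add.commute mult.assoc)
      qed
    qed
    also have "\<dots> = \<phi> (lambda_eval (module_of par s) (sesq_extend s a u) x)"
      by (simp add: \<phi>_def)
    also have "\<dots> = ev (map_poly \<phi> (sesq_extend s a u)) x"
      unfolding lambda_eval_def lambda_subst_hom[OF hom]
      by (simp only: lambda_eval_ev[OF mod lam, unfolded lambda_eval_def])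
    finally show "ev (act M a (\<phi> u)) x = ev (map_poly \<phi> (sesq_extend s a u)) x" .
  qed
  define f where "f = inv \<phi>"
  have bij: "bij \<phi>"
    unfolding bij_def inj_def surj_def by (intro conjI allI impI inj surj)
  have f\<phi>: "f (\<phi> u) = u" for u using bij by (simp add: f_def bij_is_inj inv_f_f)
  have \<phi>f: "\<phi> (f v) = v" for v using bij by (simp add: f_def bij_is_surj surj_f_inv_f)
  show ?thesis
    unfolding cmod_iso_def
  proof (intro exI conjI allI)
    show "bij f" unfolding f_def by (rule bij_imp_bij_inv[OF bij])
    show "module_hom (smul M) (smul (module_of par s)) f"
    proof (intro module_hom.intro module_hom_axioms.intro mod)
      show "module (smul (module_of par s))" by (simp add: module_of_simps module_vec)
      show "f (u + v) = f u + f v" for u v by (rule inj) (simp only: add \<phi>f)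
      show "f (smul M c v) = smul (module_of par s) c (f v)" for c v
        by (rule inj) (simp only: module_of_simps scale \<phi>f)
    qed
    show "f ` part M i = part (module_of par s) i" for i
    proof (intro equalityI subsetI)
      fix u assume "u \<in> f ` part M i"
      then obtain v where "v \<in> part M i" "u = f v" by blast
      then show "u \<in> part (module_of par s) i" using parts[of u i] by (simp add: module_of_simps \<phi>f)
    next
      fix u assume "u \<in> part (module_of par s) i"
      then have "\<phi> u \<in> part M i" using parts by (simp add: module_of_simps)
      then show "u \<in> f ` part M i" by (metis f\<phi> imageI)
    qed
    show "act (module_of par s) a (f v) = map_poly f (act M a v)" for a v
    proof -
      have f0: "f 0 = 0" using f\<phi>[of 0] zero by simp
      have "act M a v = map_poly \<phi> (sesq_extend s a (f v))" using act[of a "f v"] by (simp add: \<phi>f)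
      then have "map_poly f (act M a v) = sesq_extend s a (f v)"
        by (intro poly_eqI) (simp add: coeff_map_poly zero f0 f\<phi>)
      then show ?thesis by (simp add: module_of_simps)
    qed
  qed
qed

section \<open>The classification, case by case\<close>

context del_module
begin

lemma map_poly_table [simp]:
  "map_poly (\<lambda>p. sm p v) (pDel + cst c * pLam + cst e) = [:del v + e \<cdot> v, c \<cdot> v:]"
  "map_poly (\<lambda>p. sm p v) (cst c) = [:c \<cdot> v:]" "map_poly (\<lambda>p. sm p v) 1 = [:v:]"
  "map_poly (\<lambda>p. sm p v) 0 = 0"
proof -
  have "pDel + cst c * pLam + cst e = [:[:e, 1:], [:c:]:]" by simp
  then show "map_poly (\<lambda>p. sm p v) (pDel + cst c * pLam + cst e) = [:del v + e \<cdot> v, c \<cdot> v:]"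
    by (simp only: map_poly_pCons scale_zero_left map_poly_0) (simp add: sm_linear[of e 1] csc_laws(4) add.commute map_poly_pCons)
qed (simp_all add: map_poly_pCons one_pCons)

lemma map_poly_inst: "map_poly (\<lambda>p. sm p v) (inst f pLam) = map_poly (\<lambda>c. c \<cdot> v) f"
proof -
  have "inst f pLam = map_poly (\<lambda>c. [:c:]) f"
    by (induction f) (simp_all add: inst_pCons map_poly_pCons)
  then show ?thesis
    by (intro poly_eqI) (simp add: coeff_map_poly)
qed

end

context gen_module
begin

lemma rel_even:
  assumes "gpar g * gpar h \<noteq> 1"
  shows "ev (op g (ev (op h v) y)) x - ev (op h (ev (op g v) x)) y =
    br g h genA (- x - y) x \<cdot> ev (op genA v) (x + y) + br g h genB (- x - y) x \<cdot> ev (op genB v) (x + y) +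
    br g h genX (- x - y) x \<cdot> ev (op genX v) (x + y)"
  using rel[of g h v y x] unfolding if_not_P[OF assms] by (simp add: sum_gen)

lemma rel_odd:
  "ev (op genX (ev (op genX v) y)) x + ev (op genX (ev (op genX v) x)) y =
    br genX genX genA (- x - y) x \<cdot> ev (op genA v) (x + y) + br genX genX genB (- x - y) x \<cdot> ev (op genB v) (x + y) +
    br genX genX genX (- x - y) x \<cdot> ev (op genX v) (x + y)"
  using rel[of genX genX v y x] by (simp add: sum_gen csc_laws(4))

lemma acts0_ev: "acts0 g \<Longrightarrow> ev (op g v) x = 0"
  by (simp add: acts0_def)

end

locale table_module =
  fixes t :: "gen \<times> gen \<Rightarrow> complex poly poly ^ gen" and M :: "(rank3, 'm::ab_group_add) conf_module"
  assumes irr: "fin_nontriv_irred (algebra_of t) M"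
begin

sublocale gen_module "smul M" "part M" "\<lambda>g. act M (axis g 1)" "struct t"
  by (rule gen_module_of[OF irr])

abbreviation op :: "gen \<Rightarrow> 'm \<Rightarrow> 'm poly" where
  "op g \<equiv> act M (axis g 1)"

lemma iso_rank_one:
  assumes "v \<in> part M i" "v \<noteq> 0" "\<And>g. op g v = map_poly (\<lambda>p. smul M p v) (s (g, ()) $ ())"
  shows "M \<cong> module_of (\<lambda>_. i) s"
  by (rule iso_module_of[OF irr, where vs = "\<lambda>_. v"]) (use assms in \<open>auto simp: inj_def UNIV_unit\<close>)

lemma iso_rank_two:
  assumes "v \<in> part M 0" "w \<in> part M 1" "v \<noteq> 0" "w \<noteq> 0"
    and "\<And>g. op g v = map_poly (\<lambda>p. smul M p v) (s (g, 0) $ 0) + map_poly (\<lambda>p. smul M p w) (s (g, 0) $ 1)"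
    and "\<And>g. op g w = map_poly (\<lambda>p. smul M p v) (s (g, 1) $ 0) + map_poly (\<lambda>p. smul M p w) (s (g, 1) $ 1)"
  shows "M \<cong> module_of (\<lambda>i. i) s"
proof (rule iso_module_of[OF irr, where vs = "\<lambda>j. if j = 0 then v else w"])
  fix g and j :: bit
  show "op g (if j = 0 then v else w) =
      (\<Sum>k\<in>UNIV. map_poly (\<lambda>p. smul M p (if k = 0 then v else w)) (s (g, j) $ k))"
    using assms(5,6)[of g] bit_cases2[of j] by (auto simp: UNIV_bit)
  show "(if j = 0 then v else w) \<in> part M j" "(if j = 0 then v else w) \<noteq> 0"
    using assms(1-4) bit_cases2[of j] by auto
qed (simp add: inj_def)

lemma final_abelian:
  assumes "gpar g = 0" "\<And>h. h \<noteq> g \<Longrightarrow> acts0 h" "\<And>z x. struct t g g g z x = 0"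
  obtains i f where "f \<noteq> 0" "M \<cong> module_of (\<lambda>_. i) (no_action((g, ()) := axis () (inst f pLam)))"
proof -
  have gg: "ev (op g (ev (op g v) y)) x - ev (op g (ev (op g v) x)) y = 0" for v x y
    using rel_even[of g g v y x] assms by (cases g) (simp_all add: acts0_ev)
  obtain v i f where v: "v \<in> part M i" "v \<noteq> 0" "f \<noteq> 0" "op g v = map_poly (\<lambda>c. smul M [:c:] v) f"
    by (rule abelian_vector[OF assms(1,2) gg])
  have "M \<cong> module_of (\<lambda>_. i) (no_action((g, ()) := axis () (inst f pLam)))"
  proof (rule iso_rank_one[OF v(1,2)])
    fix h
    show "op h v = map_poly (\<lambda>p. smul M p v) ((no_action((g, ()) := axis () (inst f pLam))) (h, ()) $ ())"
      using v(4) assms(2)[of h] by (cases "h = g") (auto simp: axis_nth_if map_poly_inst acts0_def)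
  qed
  with v(3) that show thesis by blast
qed

lemma final_virasoro:
  assumes "gpar g = 0" "\<And>h. h \<noteq> g \<Longrightarrow> acts0 h" "\<And>z x. struct t g g g z x = z + 2 * x"
  obtains i \<Delta> \<eta> where "\<Delta> \<noteq> 0"
    "M \<cong> module_of (\<lambda>_. i) (no_action((g, ()) := axis () (pDel + cst \<Delta> * pLam + cst \<eta>)))"
proof -
  have gg: "ev (op g (ev (op g v) y)) x - ev (op g (ev (op g v) x)) y = smul M [:x - y:] (ev (op g v) (x + y))" for v x y
    using rel_even[of g g v y x] assms by (cases g) (simp_all add: acts0_ev)
  obtain v i \<Delta> \<eta> where v: "v \<in> part M i" "v \<noteq> 0" "\<Delta> \<noteq> 0"
    "op g v = [:smul M [:0, 1:] v + smul M [:\<eta>:] v, smul M [:\<Delta>:] v:]"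
    by (rule vir_module_vector[OF assms(1,2) gg])
  have "M \<cong> module_of (\<lambda>_. i) (no_action((g, ()) := axis () (pDel + cst \<Delta> * pLam + cst \<eta>)))"
  proof (rule iso_rank_one[OF v(1,2)])
    fix h
    show "op h v = map_poly (\<lambda>p. smul M p v)
        ((no_action((g, ()) := axis () (pDel + cst \<Delta> * pLam + cst \<eta>))) (h, ()) $ ())"
    proof (cases "h = g")
      case True
      then show ?thesis
        by (simp only: True fun_upd_same axis_nth_if refl if_True v(4) map_poly_table)
    next
      case False
      with assms(2)[of h] show ?thesis by (simp add: acts0_def)
    qed
  qed
  with v(3) that show thesis by blast
qed

lemma final_Nf:
  assumes "acts0 genB" "acts0 genX" "\<And>z x. struct t genA genA genA z x = 0"
  shows "\<exists>N\<in>fam_Nf. M \<cong> N"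
proof -
  have h: "acts0 h" if "h \<noteq> genA" for h using assms(1,2) that by (cases h) auto
  obtain i f where "f \<noteq> 0" "M \<cong> mod_Nf i f"
    unfolding mod_Nf_def by (rule final_abelian[OF gpar.simps(1) h assms(3)])
  then show ?thesis unfolding fam_Nf_def by blast
qed

lemma final_Ng:
  assumes "acts0 genA" "acts0 genX" "\<And>z x. struct t genB genB genB z x = 0"
  shows "\<exists>N\<in>fam_Ng. M \<cong> N"
proof -
  have h: "acts0 h" if "h \<noteq> genB" for h using assms(1,2) that by (cases h) auto
  obtain i f where "f \<noteq> 0" "M \<cong> mod_Ng i f"
    unfolding mod_Ng_def by (rule final_abelian[OF gpar.simps(2) h assms(3)])
  then show ?thesis unfolding fam_Ng_def by blast
qed

lemma final_MA:
  assumes "acts0 genB" "acts0 genX" "\<And>z x. struct t genA genA genA z x = z + 2 * x"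
  shows "\<exists>N\<in>fam_MA. M \<cong> N"
proof -
  have h: "acts0 h" if "h \<noteq> genA" for h using assms(1,2) that by (cases h) auto
  obtain i \<Delta> \<eta> where "\<Delta> \<noteq> 0" "M \<cong> mod_MA i \<Delta> \<eta>"
    unfolding mod_MA_def by (rule final_virasoro[OF gpar.simps(1) h assms(3)])
  then show ?thesis unfolding fam_MA_def by blast
qed

lemma final_MB:
  assumes "acts0 genA" "acts0 genX" "\<And>z x. struct t genB genB genB z x = z + 2 * x"
  shows "\<exists>N\<in>fam_MB. M \<cong> N"
proof -
  have h: "acts0 h" if "h \<noteq> genB" for h using assms(1,2) that by (cases h) auto
  obtain i \<Delta> \<eta> where "\<Delta> \<noteq> 0" "M \<cong> mod_MB i \<Delta> \<eta>"
    unfolding mod_MB_def by (rule final_virasoro[OF gpar.simps(2) h assms(3)])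
  then show ?thesis unfolding fam_MB_def by blast
qed

text \<open>The parity of the extremal vector v decides. If v is even, it is the even generator of
  M^+. If v is odd, it is the odd generator of M^-, whose parameter belongs to the even partner w
  and is \<Delta> + 1/2; thus \<Delta> \<noteq> 0 becomes the exclusion of 1/2.\<close>

lemma final_neveu_schwarz:
  assumes "acts0 genB" "\<And>z x. struct t genA genA genA z x = z + 2 * x" "\<And>z x. struct t genA genA genX z x = 0"
    "\<And>z x. struct t genA genX genX z x = z + 3/2 * x" "\<And>z x. struct t genA genX genA z x = 0"
    "\<And>z x. struct t genX genX genA z x = 2" "\<And>z x. struct t genX genX genX z x = 0"
  shows "(\<exists>N\<in>fam_Mplus. M \<cong> N) \<or> (\<exists>N\<in>fam_Mminus. M \<cong> N)"
proof -
  have AA: "ev (op genA (ev (op genA v) y)) x - ev (op genA (ev (op genA v) x)) y = smul M [:x - y:] (ev (op genA v) (x + y))" for v x y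
    using rel_even[of genA genA v y x] assms by (simp add: acts0_ev)
  have AX: "ev (op genA (ev (op genX v) y)) x - ev (op genX (ev (op genA v) x)) y = smul M [:x / 2 - y:] (ev (op genX v) (x + y))" for v x y
    using rel_even[of genA genX v y x] assms by (simp add: acts0_ev)
  have XX: "ev (op genX (ev (op genX v) y)) x + ev (op genX (ev (op genX v) x)) y = smul M [:2:] (ev (op genA v) (x + y))" for v x y
    using rel_odd[of v y x] assms by (simp add: acts0_ev)
  obtain v w i \<Delta> \<eta> where vw: "v \<in> part M i" "w \<in> part M (i + 1)" "v \<noteq> 0" "w \<noteq> 0" "\<Delta> \<noteq> 0"
    "op genA v = [:del v + smul M [:\<eta>:] v, smul M [:\<Delta>:] v:]" "op genA w = [:del w + smul M [:\<eta>:] w, smul M [:\<Delta> + 1/2:] w:]"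
    "op genX v = [:w:]" "op genX w = [:del v + smul M [:\<eta>:] v, smul M [:2 * \<Delta>:] v:]"
    by (rule neveu_schwarz_vector[OF AX XX AA assms(1)])
  have B: "op genB u = 0" for u using assms(1) by (simp add: acts0_def)
  consider "i = 0" | "i = 1" using bit_cases2 by blast
  then show ?thesis
  proof cases
    case 1
    have "M \<cong> mod_Mplus \<Delta> \<eta>"
      unfolding mod_Mplus_def
    proof (rule iso_rank_two[of v w])
      show "v \<in> part M 0" "w \<in> part M 1" using vw(1,2) 1 by simp_all
      fix g
      let ?s = "no_action((genA, 0) := axis 0 (pDel + cst \<Delta> * pLam + cst \<eta>),
          (genA, 1) := axis 1 (pDel + cst (\<Delta> + 1/2) * pLam + cst \<eta>), (genX, 0) := axis 1 1,
          (genX, 1) := axis 0 (pDel + cst (2 * \<Delta>) * pLam + cst \<eta>)) :: gen \<times> bit \<Rightarrow> complex poly poly ^ bit"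
      show "op g v = map_poly (\<lambda>p. smul M p v) (?s (g, 0) $ 0) + map_poly (\<lambda>p. smul M p w) (?s (g, 0) $ 1)"
        by (cases g) (simp_all add: axis_nth_if vw B del: mult_pCons_left mult_pCons_right add_pCons)
      show "op g w = map_poly (\<lambda>p. smul M p v) (?s (g, 1) $ 0) + map_poly (\<lambda>p. smul M p w) (?s (g, 1) $ 1)"
        by (cases g) (simp_all add: axis_nth_if vw B del: mult_pCons_left mult_pCons_right add_pCons)
    qed (rule vw)+
    with vw(5) show ?thesis unfolding fam_Mplus_def by blast
  next
    case 2
    have "M \<cong> mod_Mminus (\<Delta> + 1/2) \<eta>"
      unfolding mod_Mminus_def
    proof (rule iso_rank_two[of w v])
      have "i + 1 = 0" using 2 by simp
      then show "w \<in> part M 0" "v \<in> part M 1" using vw(1,2) 2 by simp_all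
      fix g
      let ?s = "no_action((genA, 0) := axis 0 (pDel + cst (\<Delta> + 1/2) * pLam + cst \<eta>),
          (genA, 1) := axis 1 (pDel + cst (\<Delta> + 1/2 - 1/2) * pLam + cst \<eta>),
          (genX, 0) := axis 1 (pDel + cst (2 * (\<Delta> + 1/2) - 1) * pLam + cst \<eta>),
          (genX, 1) := axis 0 1) :: gen \<times> bit \<Rightarrow> complex poly poly ^ bit"
      show "op g w = map_poly (\<lambda>p. smul M p w) (?s (g, 0) $ 0) + map_poly (\<lambda>p. smul M p v) (?s (g, 0) $ 1)"
        by (cases g) (simp_all add: axis_nth_if vw B del: mult_pCons_left mult_pCons_right add_pCons)
      show "op g v = map_poly (\<lambda>p. smul M p w) (?s (g, 1) $ 0) + map_poly (\<lambda>p. smul M p v) (?s (g, 1) $ 1)"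
        by (cases g) (simp_all add: axis_nth_if vw B del: mult_pCons_left mult_pCons_right add_pCons)
    qed (rule vw)+
    moreover have "\<Delta> + 1/2 \<noteq> 1/2" using vw(5) by simp
    ultimately show ?thesis unfolding fam_Mminus_def by blast
  qed
qed

text \<open>A nontrivial action of B forces a = 1 and b = 0. At these values [A A] can contain only
  a cocycle c(\<partial> + 2\<lambda>), and \<open>density_cocycle_zero\<close> removes it.\<close>

lemma final_density:
  assumes B: "\<not> acts0 genB" and ideal: "\<And>h k. k \<noteq> genB \<Longrightarrow> (\<forall>z x. struct t h genB k z x = 0) \<or> acts0 k"
    and BB: "\<And>z x. struct t genB genB genB z x = 0" and AB: "\<And>z x. struct t genA genB genB z x = z + a * x + b"
    and AA: "\<And>z x. struct t genA genA genA z x = z + 2 * x" "\<And>z x. struct t genA genA genX z x = 0"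
    and Q: "a = 1 \<Longrightarrow> b = 0 \<Longrightarrow> \<exists>c. \<forall>z x. struct t genA genA genB z x = c * (z + 2 * x)"
  obtains \<tau> where "a = 1" "b = 0" "\<And>z x. struct t genA genA genB z x = 0" "\<tau> \<noteq> 0"
    "{v. op genB v = [:smul M [:\<tau>:] v:]} \<noteq> {0}"
    "C.subspace {v. op genB v = [:smul M [:\<tau>:] v:]}" "C.fin_dim {v. op genB v = [:smul M [:\<tau>:] v:]}"
    "graded {v. op genB v = [:smul M [:\<tau>:] v:]}"
    "\<And>n. n \<ge> 1 \<Longrightarrow> cf (op genA) n ` {v. op genB v = [:smul M [:\<tau>:] v:]} \<subseteq> {v. op genB v = [:smul M [:\<tau>:] v:]}"
    "shift_op (op genA) ` {v. op genB v = [:smul M [:\<tau>:] v:]} \<subseteq> {v. op genB v = [:smul M [:\<tau>:] v:]}"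
    "\<And>v x y. ev (op genA (ev (op genA v) y)) x - ev (op genA (ev (op genA v) x)) y = smul M [:x - y:] (ev (op genA v) (x + y))"
proof -
  have 0: "struct t h genB k z x = 0 \<or> acts0 k" if "k \<noteq> genB" for h k z x
    using ideal[OF that] by blast
  have z: "smul M [:struct t h genB genA z' x':] (ev (op genA v) x) = 0" "smul M [:struct t h genB genX z' x':] (ev (op genX v) x) = 0" for h z' x' v x
    using 0[of genA h z' x'] 0[of genX h z' x'] by (auto simp: acts0_ev)
  have BB': "ev (op genB (ev (op genB v) y)) x - ev (op genB (ev (op genB v) x)) y = 0" for v x y
    using rel_even[of genB genB v y x] BB z by simp
  have AB': "ev (op genA (ev (op genB v) y)) x - ev (op genB (ev (op genA v) x)) y =
      smul M [:(a - 1) * x - y + b:] (ev (op genB v) (x + y))" for v x y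
  proof -
    have "- x - y + a * x + b = (a - 1) * x - y + b" by (simp add: algebra_simps)
    then show ?thesis using rel_even[of genA genB v y x] AB z by simp
  qed
  show thesis
  proof (rule density_action[OF ideal B gpar.simps(2) BB' AB'])
    fix \<tau>
    let ?W = "{v. op genB v = [:smul M [:\<tau>:] v:]}"
    assume ab: "a = 1" "b = 0" and W: "\<tau> \<noteq> 0" "?W \<noteq> {0}" "C.subspace ?W" "C.fin_dim ?W" "graded ?W"
      "\<And>n. n \<ge> 1 \<Longrightarrow> cf (op genA) n ` ?W \<subseteq> ?W" "shift_op (op genA) ` ?W \<subseteq> ?W"
    obtain c where c: "\<And>z x. struct t genA genA genB z x = c * (z + 2 * x)" using Q[OF ab] by blast
    have AA': "ev (op genA (ev (op genA v) y)) x - ev (op genA (ev (op genA v) x)) y =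
        smul M [:x - y:] (ev (op genA v) (x + y) + smul M [:c:] (ev (op genB v) (x + y)))" for v x y
      using rel_even[of genA genA v y x] AA c by (simp add: scale_right_distrib algebra_simps)
    have "c = 0"
      by (rule density_cocycle_zero[OF W(3,4,2,1) W(6)[OF order.refl] W(7) AA'])
    show thesis
    proof (rule that[OF ab _ W])
      show "struct t genA genA genB z x = 0" for z x by (simp add: c \<open>c = 0\<close>)
      show "ev (op genA (ev (op genA v) y)) x - ev (op genA (ev (op genA v) x)) y = smul M [:x - y:] (ev (op genA v) (x + y))" for v x y
        using AA'[of v y x] \<open>c = 0\<close> by simp
    qed
  qed
qed

lemma final_Momega:
  assumes X: "acts0 genX" and W: "\<tau> \<noteq> 0" "{v. op genB v = [:smul M [:\<tau>:] v:]} \<noteq> {0}"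
    "C.subspace {v. op genB v = [:smul M [:\<tau>:] v:]}" "C.fin_dim {v. op genB v = [:smul M [:\<tau>:] v:]}"
    "graded {v. op genB v = [:smul M [:\<tau>:] v:]}"
    "\<And>n. n \<ge> 1 \<Longrightarrow> cf (op genA) n ` {v. op genB v = [:smul M [:\<tau>:] v:]} \<subseteq> {v. op genB v = [:smul M [:\<tau>:] v:]}"
    "shift_op (op genA) ` {v. op genB v = [:smul M [:\<tau>:] v:]} \<subseteq> {v. op genB v = [:smul M [:\<tau>:] v:]}"
    "\<And>v x y. ev (op genA (ev (op genA v) y)) x - ev (op genA (ev (op genA v) x)) y = smul M [:x - y:] (ev (op genA v) (x + y))"
  shows "\<exists>N\<in>fam_Momega. M \<cong> N"
proof -
  obtain v i \<Delta> \<eta> where v: "v \<in> {v. op genB v = [:smul M [:\<tau>:] v:]}" "v \<in> part M i" "v \<noteq> 0"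
    "op genA v = [:del v + smul M [:\<eta>:] v, smul M [:\<Delta>:] v:]"
    by (rule vir_vector[OF gpar.simps(1) W(8) W(3,4,2,5,6,7)])
  have "M \<cong> mod_Momega i \<Delta> \<eta> \<tau>"
    unfolding mod_Momega_def
  proof (rule iso_rank_one[OF v(2,3)])
    fix g
    let ?s = "no_action((genA, ()) := axis () (pDel + cst \<Delta> * pLam + cst \<eta>),
      (genB, ()) := axis () (cst \<tau>)) :: gen \<times> unit \<Rightarrow> complex poly poly ^ unit"
    show "op g v = map_poly (\<lambda>p. smul M p v) (?s (g, ()) $ ())"
      using v(1,4) X by (cases g) (simp_all add: axis_nth_if acts0_def del: mult_pCons_left mult_pCons_right add_pCons)
  qed
  with W(1) show ?thesis unfolding fam_Momega_def by blast
qed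

text \<open>X sends v to w and w to \<tau> v, so (c, \<epsilon>) can be taken as (1, \<tau>) for
  even v and as (\<tau>, 1) for odd v; the action of B sees only the product.\<close>

lemma final_Mceps:
  assumes BX: "\<And>k z x. struct t genB genX k z x = 0" and AX: "\<And>z x. struct t genA genX genX z x = z + x"
      "\<And>z x. struct t genA genX genA z x = 0" "\<And>z x. struct t genA genX genB z x = 0"
    and XX: "\<And>z x. struct t genX genX genB z x = 2" "\<And>z x. struct t genX genX genA z x = 0" "\<And>z x. struct t genX genX genX z x = 0"
    and W: "\<tau> \<noteq> 0" "{v. op genB v = [:smul M [:\<tau>:] v:]} \<noteq> {0}"
    "C.subspace {v. op genB v = [:smul M [:\<tau>:] v:]}" "C.fin_dim {v. op genB v = [:smul M [:\<tau>:] v:]}"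
    "graded {v. op genB v = [:smul M [:\<tau>:] v:]}"
    "\<And>n. n \<ge> 1 \<Longrightarrow> cf (op genA) n ` {v. op genB v = [:smul M [:\<tau>:] v:]} \<subseteq> {v. op genB v = [:smul M [:\<tau>:] v:]}"
    "shift_op (op genA) ` {v. op genB v = [:smul M [:\<tau>:] v:]} \<subseteq> {v. op genB v = [:smul M [:\<tau>:] v:]}"
    "\<And>v x y. ev (op genA (ev (op genA v) y)) x - ev (op genA (ev (op genA v) x)) y = smul M [:x - y:] (ev (op genA v) (x + y))"
  shows "\<exists>N\<in>fam_Mceps. M \<cong> N"
proof -
  have BX': "ev (op genB (ev (op genX v) y)) x - ev (op genX (ev (op genB v) x)) y = 0" for v x y
    using rel_even[of genB genX v y x] BX by simp
  have AX': "ev (op genA (ev (op genX v) y)) x - ev (op genX (ev (op genA v) x)) y = smul M [:- y:] (ev (op genX v) (x + y))" for v x y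
    using rel_even[of genA genX v y x] AX by simp
  have XX': "ev (op genX (ev (op genX v) y)) x + ev (op genX (ev (op genX v) x)) y = smul M [:2:] (ev (op genB v) (x + y))" for v x y
    using rel_odd[of v y x] XX by simp
  obtain v w i \<Delta> \<eta> where vw: "v \<in> part M i" "w \<in> part M (i + 1)" "v \<noteq> 0" "w \<noteq> 0"
    "op genA v = [:del v + smul M [:\<eta>:] v, smul M [:\<Delta>:] v:]" "op genA w = [:del w + smul M [:\<eta>:] w, smul M [:\<Delta>:] w:]"
    "op genB v = [:smul M [:\<tau>:] v:]" "op genB w = [:smul M [:\<tau>:] w:]" "op genX v = [:w:]" "op genX w = [:smul M [:\<tau>:] v:]"
    by (rule clifford_vector[OF BX' AX' XX' W(8) W(3,4,2,5,1,6,7)])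
  have one: "[:u:] = [:smul M [:1:] u:]" for u by (simp only: csc_laws)
  consider "i = 0" | "i = 1" using bit_cases2 by blast
  then show ?thesis
  proof cases
    case 1
    have "M \<cong> mod_Mceps \<Delta> \<eta> 1 \<tau>"
      unfolding mod_Mceps_def
    proof (rule iso_rank_two[of v w])
      show "v \<in> part M 0" "w \<in> part M 1" using vw(1,2) 1 by simp_all
      fix g
      let ?s = "no_action((genA, 0) := axis 0 (pDel + cst \<Delta> * pLam + cst \<eta>),
          (genA, 1) := axis 1 (pDel + cst \<Delta> * pLam + cst \<eta>), (genB, 0) := axis 0 (cst (1 * \<tau>)),
          (genB, 1) := axis 1 (cst (1 * \<tau>)), (genX, 0) := axis 1 (cst 1),
          (genX, 1) := axis 0 (cst \<tau>)) :: gen \<times> bit \<Rightarrow> complex poly poly ^ bit"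
      show "op g v = map_poly (\<lambda>p. smul M p v) (?s (g, 0) $ 0) + map_poly (\<lambda>p. smul M p w) (?s (g, 0) $ 1)"
        by (cases g) (simp_all add: axis_nth_if vw csc_laws(4) del: mult_pCons_left mult_pCons_right add_pCons)
      show "op g w = map_poly (\<lambda>p. smul M p v) (?s (g, 1) $ 0) + map_poly (\<lambda>p. smul M p w) (?s (g, 1) $ 1)"
        by (cases g) (simp_all add: axis_nth_if vw csc_laws(4) del: mult_pCons_left mult_pCons_right add_pCons)
    qed (rule vw)+
    with W(1) show ?thesis unfolding fam_Mceps_def by (intro bexI CollectI exI conjI) (assumption | rule refl zero_neq_one[symmetric])+
  next
    case 2
    have "M \<cong> mod_Mceps \<Delta> \<eta> \<tau> 1"
      unfolding mod_Mceps_def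
    proof (rule iso_rank_two[of w v])
      have "i + 1 = 0" using 2 by simp
      then show "w \<in> part M 0" "v \<in> part M 1" using vw(1,2) 2 by simp_all
      fix g
      let ?s = "no_action((genA, 0) := axis 0 (pDel + cst \<Delta> * pLam + cst \<eta>),
          (genA, 1) := axis 1 (pDel + cst \<Delta> * pLam + cst \<eta>), (genB, 0) := axis 0 (cst (\<tau> * 1)),
          (genB, 1) := axis 1 (cst (\<tau> * 1)), (genX, 0) := axis 1 (cst \<tau>),
          (genX, 1) := axis 0 (cst 1)) :: gen \<times> bit \<Rightarrow> complex poly poly ^ bit"
      show "op g w = map_poly (\<lambda>p. smul M p w) (?s (g, 0) $ 0) + map_poly (\<lambda>p. smul M p v) (?s (g, 0) $ 1)"
        by (cases g) (simp_all add: axis_nth_if vw csc_laws(4) del: mult_pCons_left mult_pCons_right add_pCons)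
      show "op g v = map_poly (\<lambda>p. smul M p w) (?s (g, 1) $ 0) + map_poly (\<lambda>p. smul M p v) (?s (g, 1) $ 1)"
        by (cases g) (simp_all add: axis_nth_if vw csc_laws(4) del: mult_pCons_left mult_pCons_right add_pCons)
    qed (rule vw)+
    with W(1) show ?thesis unfolding fam_Mceps_def by (intro bexI CollectI exI conjI) (assumption | rule refl zero_neq_one[symmetric])+
  qed
qed

end

section \<open>Irreducibility of the listed modules\<close>

lemma ev2_pCons: "ev2 (pCons p f) z x = poly p z + x * ev2 f z x"
  by (simp add: ev2_def)

lemma ev2_smult: "ev2 (Polynomial.smult p f) z x = poly p z * ev2 f z x"
  by (simp add: ev2_def)

lemmas table_simps = axis_nth_if ev2_simps ev2_inst ev2_flip ev2_pCons ev2_smult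

lemma lie_conformal_superalgebra_struct:
  assumes even: "\<And>g h k z x. gpar k \<noteq> gpar g + gpar h \<Longrightarrow> struct t g h k z x = 0"
    and skew: "\<And>g h k z x. struct t g h k z x = - odd_sign g h * struct t h g k z (- x - z)"
    and jacobi: "\<And>g h m k x y z.
      (\<Sum>l\<in>UNIV. struct t h m l (z + x) y * struct t g l k z x) =
      (\<Sum>l\<in>UNIV. struct t g h l (- x - y) x * struct t l m k z (x + y)) +
      odd_sign g h * (\<Sum>l\<in>UNIV. struct t g m l (z + y) x * struct t h l k z y)"
  shows "lie_conformal_superalgebra (algebra_of t)"
proof (rule lie_conformal_superalgebra_algebra_of)
  show "even_tables gpar (skew_complete t)"
    unfolding even_tables_def
  proof (intro allI impI)
    fix g h k assume nz: "skew_complete t (g, h) $ k \<noteq> 0"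
    show "gpar k = gpar g + gpar h"
    proof (rule ccontr)
      assume "gpar k \<noteq> gpar g + gpar h"
      from even[OF this] have "skew_complete t (g, h) $ k = 0"
        unfolding struct_def by (rule ev2_eq_0D)
      with nz show False by blast
    qed
  qed
  show "jacobi_tables (skew_complete t) (skew_complete t)"
    unfolding jacobi_tables_def by (intro allI) (rule jacobi[unfolded struct_def])
  show "ev2 (skew_complete t (g, h) $ k) z x = - odd_sign g h * ev2 (skew_complete t (h, g) $ k) z (- x - z)" for g h k z x
    using skew unfolding struct_def .
qed

lemma fin_nontriv_irredI:
  assumes "lie_conformal_superalgebra (algebra_of t)" "even_tables par s" "jacobi_tables (skew_complete t) s"
    "s (g, j) \<noteq> 0" "irreducible_cmod (module_of par s)"
  shows "fin_nontriv_irred (algebra_of t) (module_of par s)"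
  unfolding fin_nontriv_irred_def
proof (intro conjI)
  show "conformal_module (algebra_of t) (module_of par s)" by (rule conformal_module_module_of[OF assms(1-3)])
  show "finite_cmod (module_of par s)" by (rule finite_cmod_module_of)
  show "nontrivial_cmod (module_of par s)" by (rule nontrivial_module_of[where s = s and g = g and j = j, OF assms(4)])
  show "irreducible_cmod (module_of par s)" by (rule assms(5))
qed

lemma lead_coeff_inst_lambda:
  assumes "f \<noteq> 0"
  shows "lead_coeff (inst f pLam) = [:lead_coeff f:]"
proof -
  have e: "inst f pLam = map_poly (\<lambda>c. [:c:]) f"
    by (induction f) (simp_all add: inst_pCons map_poly_pCons)
  have "degree (map_poly (\<lambda>c. [:c:]) f) = degree f"
    by (rule degree_map_poly) simp
  then show ?thesis unfolding e by (simp add: coeff_map_poly)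
qed

lemma lead_coeff_linear: "c \<noteq> 0 \<Longrightarrow> lead_coeff (pDel + cst c * pLam + cst e) = [:c:]"
  by simp

text \<open>An odd generator would change the parity of the only basis vector, hence it acts as
  zero.\<close>

lemma rank_one_irreducible:
  assumes lie: "lie_conformal_superalgebra (algebra_of t)"
    and even: "\<And>g. gpar g \<noteq> 0 \<Longrightarrow> s (g, ()) = 0"
    and jacobi: "\<And>g h x y z. ev2 (s (h, ()) $ ()) (z + x) y * ev2 (s (g, ()) $ ()) z x =
      (\<Sum>l\<in>UNIV. struct t g h l (- x - y) x * ev2 (s (l, ()) $ ()) z (x + y)) +
      odd_sign g h * (ev2 (s (g, ()) $ ()) (z + y) x * ev2 (s (h, ()) $ ()) z y)"
    and lead: "lead_coeff (s (g, ()) $ ()) = [:c:]" "c \<noteq> 0"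
  shows "fin_nontriv_irred (algebra_of t) (module_of (\<lambda>_. i) s)"
proof (rule fin_nontriv_irredI[OF lie])
  show "even_tables (\<lambda>_. i) s"
    unfolding even_tables_def
  proof (intro allI impI)
    fix g j k assume nz: "s (g, j) $ k \<noteq> 0"
    have "gpar g = 0"
    proof (rule ccontr)
      assume "gpar g \<noteq> 0"
      from even[OF this] nz show False by (cases j) simp
    qed
    then show "i = gpar g + i" by simp
  qed
  show "jacobi_tables (skew_complete t) s"
    unfolding jacobi_tables_def
  proof (intro allI)
    fix g h and m k :: unit and x y z
    show "(\<Sum>l\<in>UNIV. ev2 (s (h, m) $ l) (z + x) y * ev2 (s (g, l) $ k) z x) =
     (\<Sum>l\<in>UNIV. ev2 (skew_complete t (g, h) $ l) (- x - y) x * ev2 (s (l, m) $ k) z (x + y)) +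
     odd_sign g h * (\<Sum>l\<in>UNIV. ev2 (s (g, m) $ l) (z + y) x * ev2 (s (h, l) $ k) z y)"
      using jacobi[of h z x y g] by (cases m; cases k) (simp add: UNIV_unit struct_def)
  qed
  show "s (g, ()) \<noteq> 0"
  proof
    assume "s (g, ()) = 0"
    with lead show False by simp
  qed
  show "irreducible_cmod (module_of (\<lambda>_. i) s)" by (rule irreducible_rank_one[where s = s and g = g and c = c, OF lead])
qed

lemma rank_two_irreducible:
  assumes lie: "lie_conformal_superalgebra (algebra_of t)"
    and even: "\<And>g j k. k \<noteq> gpar g + j \<Longrightarrow> s (g, j) $ k = 0"
    and jacobi: "\<And>g h m k x y z.
      ev2 (s (h, m) $ 0) (z + x) y * ev2 (s (g, 0) $ k) z x + ev2 (s (h, m) $ 1) (z + x) y * ev2 (s (g, 1) $ k) z x =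
      (\<Sum>l\<in>UNIV. struct t g h l (- x - y) x * ev2 (s (l, m) $ k) z (x + y)) +
      odd_sign g h * (ev2 (s (g, m) $ 0) (z + y) x * ev2 (s (h, 0) $ k) z y + ev2 (s (g, m) $ 1) (z + y) x * ev2 (s (h, 1) $ k) z y)"
    and s: "s (g, 0) = axis 1 h" "s (g, 1) = axis 0 h'"
    and lead: "lead_coeff h = [:c:]" "c \<noteq> 0" "lead_coeff h' = [:c':]" "c' \<noteq> 0"
  shows "fin_nontriv_irred (algebra_of t) (module_of (\<lambda>i. i) s)"
proof (rule fin_nontriv_irredI[OF lie])
  show "even_tables (\<lambda>i. i) s"
    unfolding even_tables_def using even by metis
  show "jacobi_tables (skew_complete t) s"
    unfolding jacobi_tables_def
  proof (intro allI)
    fix g h m k x y z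
    show "(\<Sum>l\<in>UNIV. ev2 (s (h, m) $ l) (z + x) y * ev2 (s (g, l) $ k) z x) =
     (\<Sum>l\<in>UNIV. ev2 (skew_complete t (g, h) $ l) (- x - y) x * ev2 (s (l, m) $ k) z (x + y)) +
     odd_sign g h * (\<Sum>l\<in>UNIV. ev2 (s (g, m) $ l) (z + y) x * ev2 (s (h, l) $ k) z y)"
      using jacobi[of h m z x y g k] by (simp add: UNIV_bit struct_def)
  qed
  have "h \<noteq> 0"
  proof
    assume "h = 0"
    with lead(1,2) show False by simp
  qed
  then have "axis 1 h $ 1 \<noteq> (0 :: complex poly poly ^ bit) $ 1" by (simp add: axis_nth_if)
  then show "s (g, 0) \<noteq> 0" unfolding s by metis
  show "irreducible_cmod (module_of (\<lambda>i. i) s)" by (rule irreducible_rank_two[OF s lead])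
qed

lemma single_table [simp]:
  "(no_action((a, ()) := axis () h)) (g, ()) $ () = (if g = a then h else 0)"
  by (simp add: axis_nth_if)

text \<open>No bracket contains A, so factoring out B and X leaves an abelian algebra, on which any
  polynomial f defines an action.\<close>

lemma irreducible_Nf:
  assumes "lie_conformal_superalgebra (algebra_of t)" "\<And>g h z x. struct t g h genA z x = 0" "f \<noteq> 0"
  shows "fin_nontriv_irred (algebra_of t) (mod_Nf i f)"
  unfolding mod_Nf_def
proof (rule rank_one_irreducible[OF assms(1), where g = genA and c = "lead_coeff f"])
  let ?s = "no_action((genA, ()) := axis () (inst f pLam)) :: gen \<times> unit \<Rightarrow> complex poly poly ^ unit"
  show "?s (g, ()) = 0" if "gpar g \<noteq> 0" for g using that by (cases g) auto
  show "lead_coeff (?s (genA, ()) $ ()) = [:lead_coeff f:]" "lead_coeff f \<noteq> 0"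
    using assms(3) by (simp_all add: lead_coeff_inst_lambda axis_nth_if)
  fix g h x y z
  show "ev2 (?s (h, ()) $ ()) (z + x) y * ev2 (?s (g, ()) $ ()) z x =
      (\<Sum>l\<in>UNIV. struct t g h l (- x - y) x * ev2 (?s (l, ()) $ ()) z (x + y)) +
      odd_sign g h * (ev2 (?s (g, ()) $ ()) (z + y) x * ev2 (?s (h, ()) $ ()) z y)"
    unfolding single_table by (cases g; cases h) (simp_all add: sum_gen assms(2) table_simps)
qed

lemma irreducible_Ng:
  assumes "lie_conformal_superalgebra (algebra_of t)" "\<And>g h z x. struct t g h genB z x = 0" "f \<noteq> 0"
  shows "fin_nontriv_irred (algebra_of t) (mod_Ng i f)"
  unfolding mod_Ng_def
proof (rule rank_one_irreducible[OF assms(1), where g = genB and c = "lead_coeff f"])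
  let ?s = "no_action((genB, ()) := axis () (inst f pLam)) :: gen \<times> unit \<Rightarrow> complex poly poly ^ unit"
  show "?s (g, ()) = 0" if "gpar g \<noteq> 0" for g using that by (cases g) auto
  show "lead_coeff (?s (genB, ()) $ ()) = [:lead_coeff f:]" "lead_coeff f \<noteq> 0"
    using assms(3) by (simp_all add: lead_coeff_inst_lambda axis_nth_if)
  fix g h x y z
  show "ev2 (?s (h, ()) $ ()) (z + x) y * ev2 (?s (g, ()) $ ()) z x =
      (\<Sum>l\<in>UNIV. struct t g h l (- x - y) x * ev2 (?s (l, ()) $ ()) z (x + y)) +
      odd_sign g h * (ev2 (?s (g, ()) $ ()) (z + y) x * ev2 (?s (h, ()) $ ()) z y)"
    unfolding single_table by (cases g; cases h) (simp_all add: sum_gen assms(2) table_simps)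
qed

text \<open>Factoring out B and X leaves the Virasoro conformal algebra, whose rank one modules are
  pulled back.\<close>

lemma irreducible_MA:
  assumes "lie_conformal_superalgebra (algebra_of t)"
    "\<And>g h z x. struct t g h genA z x = (if g = genA \<and> h = genA then z + 2 * x else 0)" "\<Delta> \<noteq> 0"
  shows "fin_nontriv_irred (algebra_of t) (mod_MA i \<Delta> \<eta>)"
  unfolding mod_MA_def
proof (rule rank_one_irreducible[OF assms(1), where g = genA and c = \<Delta>])
  let ?s = "no_action((genA, ()) := axis () (pDel + cst \<Delta> * pLam + cst \<eta>)) :: gen \<times> unit \<Rightarrow> complex poly poly ^ unit"
  show "?s (g, ()) = 0" if "gpar g \<noteq> 0" for g using that by (cases g) auto
  show "lead_coeff (?s (genA, ()) $ ()) = [:\<Delta>:]" "\<Delta> \<noteq> 0"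
    using assms(3) by (simp_all add: axis_nth_if)
  fix g h x y z
  show "ev2 (?s (h, ()) $ ()) (z + x) y * ev2 (?s (g, ()) $ ()) z x =
      (\<Sum>l\<in>UNIV. struct t g h l (- x - y) x * ev2 (?s (l, ()) $ ()) z (x + y)) +
      odd_sign g h * (ev2 (?s (g, ()) $ ()) (z + y) x * ev2 (?s (h, ()) $ ()) z y)"
    unfolding single_table by (cases g; cases h) (simp_all add: sum_gen assms(2) table_simps algebra_simps)
qed

lemma irreducible_MB:
  assumes "lie_conformal_superalgebra (algebra_of t)"
    "\<And>g h z x. struct t g h genB z x = (if g = genB \<and> h = genB then z + 2 * x else 0)" "\<Delta> \<noteq> 0"
  shows "fin_nontriv_irred (algebra_of t) (mod_MB i \<Delta> \<eta>)"
  unfolding mod_MB_def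
proof (rule rank_one_irreducible[OF assms(1), where g = genB and c = \<Delta>])
  let ?s = "no_action((genB, ()) := axis () (pDel + cst \<Delta> * pLam + cst \<eta>)) :: gen \<times> unit \<Rightarrow> complex poly poly ^ unit"
  show "?s (g, ()) = 0" if "gpar g \<noteq> 0" for g using that by (cases g) auto
  show "lead_coeff (?s (genB, ()) $ ()) = [:\<Delta>:]" "\<Delta> \<noteq> 0"
    using assms(3) by (simp_all add: axis_nth_if)
  fix g h x y z
  show "ev2 (?s (h, ()) $ ()) (z + x) y * ev2 (?s (g, ()) $ ()) z x =
      (\<Sum>l\<in>UNIV. struct t g h l (- x - y) x * ev2 (?s (l, ()) $ ()) z (x + y)) +
      odd_sign g h * (ev2 (?s (g, ()) $ ()) (z + y) x * ev2 (?s (h, ()) $ ()) z y)"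
    unfolding single_table by (cases g; cases h) (simp_all add: sum_gen assms(2) table_simps algebra_simps)
qed

text \<open>Irreducibility is read off from B, whose action \<omega> is a nonzero constant;
  therefore \<Delta> = 0 is allowed.\<close>

lemma irreducible_Momega:
  assumes "lie_conformal_superalgebra (algebra_of t)"
    "\<And>g h z x. struct t g h genA z x = (if g = genA \<and> h = genA then z + 2 * x else 0)"
    "\<And>g h z x. struct t g h genB z x = (if g = genA \<and> h = genB then z + x else if g = genB \<and> h = genA then x else 0)"
    "\<omega> \<noteq> 0"
  shows "fin_nontriv_irred (algebra_of t) (mod_Momega i \<Delta> \<eta> \<omega>)"
  unfolding mod_Momega_def
proof (rule rank_one_irreducible[OF assms(1), where g = genB and c = \<omega>])
  let ?s = "no_action((genA, ()) := axis () (pDel + cst \<Delta> * pLam + cst \<eta>), (genB, ()) := axis () (cst \<omega>))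
    :: gen \<times> unit \<Rightarrow> complex poly poly ^ unit"
  show "?s (g, ()) = 0" if "gpar g \<noteq> 0" for g using that by (cases g) auto
  show "lead_coeff (?s (genB, ()) $ ()) = [:\<omega>:]" "\<omega> \<noteq> 0"
    using assms(4) by (simp_all add: axis_nth_if)
  fix g h x y z
  show "ev2 (?s (h, ()) $ ()) (z + x) y * ev2 (?s (g, ()) $ ()) z x =
      (\<Sum>l\<in>UNIV. struct t g h l (- x - y) x * ev2 (?s (l, ()) $ ()) z (x + y)) +
      odd_sign g h * (ev2 (?s (g, ()) $ ()) (z + y) x * ev2 (?s (h, ()) $ ()) z y)"
    by (cases g; cases h) (simp_all add: sum_gen assms(2,3) table_simps algebra_simps)
qed

text \<open>X exchanges the two generators with leading coefficients 1 and 2\<Delta>, which is where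
  \<Delta> \<noteq> 0 enters.\<close>

lemma irreducible_Mplus:
  assumes "lie_conformal_superalgebra (algebra_of t)"
    "\<And>g h z x. struct t g h genA z x = (if g = genA \<and> h = genA then z + 2 * x else if g = genX \<and> h = genX then 2 else 0)"
    "\<And>g h z x. struct t g h genX z x =
      (if g = genA \<and> h = genX then z + 3/2 * x else if g = genX \<and> h = genA then z / 2 + 3/2 * x else 0)"
    "\<Delta> \<noteq> 0"
  shows "fin_nontriv_irred (algebra_of t) (mod_Mplus \<Delta> \<eta>)"
proof -
  define s :: "gen \<times> bit \<Rightarrow> complex poly poly ^ bit" where
    "s = no_action((genA, 0) := axis 0 (pDel + cst \<Delta> * pLam + cst \<eta>),
          (genA, 1) := axis 1 (pDel + cst (\<Delta> + 1/2) * pLam + cst \<eta>), (genX, 0) := axis 1 1,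
          (genX, 1) := axis 0 (pDel + cst (2 * \<Delta>) * pLam + cst \<eta>))"
  have s: "ev2 (s (g, j) $ k) z x = (if g = genA \<and> j = k then z + (if j = 0 then \<Delta> else \<Delta> + 1/2) * x + \<eta>
      else if g = genX \<and> j \<noteq> k then (if j = 0 then 1 else z + 2 * \<Delta> * x + \<eta>) else 0)" for g j k z x
    using bit_cases2[of j] bit_cases2[of k]
    by (cases g; elim disjE; simp add: s_def table_simps; simp add: mult.commute)
  show ?thesis
    unfolding mod_Mplus_def s_def[symmetric]
  proof (rule rank_two_irreducible[OF assms(1), where g = genX and h = 1 and h' = "pDel + cst (2 * \<Delta>) * pLam + cst \<eta>"
      and c = 1 and c' = "2 * \<Delta>"])
    show "s (g, j) $ k = 0" if "k \<noteq> gpar g + j" for g j k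
      using that bit_cases2[of j] bit_cases2[of k] by (cases g; elim disjE; simp add: s_def axis_nth_if)
    fix g h m k x y z
    show "ev2 (s (h, m) $ 0) (z + x) y * ev2 (s (g, 0) $ k) z x + ev2 (s (h, m) $ 1) (z + x) y * ev2 (s (g, 1) $ k) z x =
      (\<Sum>l\<in>UNIV. struct t g h l (- x - y) x * ev2 (s (l, m) $ k) z (x + y)) +
      odd_sign g h * (ev2 (s (g, m) $ 0) (z + y) x * ev2 (s (h, 0) $ k) z y + ev2 (s (g, m) $ 1) (z + y) x * ev2 (s (h, 1) $ k) z y)"
      using bit_cases2[of m] bit_cases2[of k]
      by (cases g; cases h; elim disjE; simp add: sum_gen assms(2,3) s; simp add: field_simps)
  next
    show "s (genX, 0) = axis 1 1" "s (genX, 1) = axis 0 (pDel + cst (2 * \<Delta>) * pLam + cst \<eta>)"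
      by (simp_all add: s_def)
  qed (use assms(4) in \<open>simp_all add: one_pCons\<close>)
qed

text \<open>X exchanges the two generators with leading coefficients 2\<Delta> - 1 and 1, hence
  \<Delta> \<noteq> 1/2.\<close>

lemma irreducible_Mminus:
  assumes "lie_conformal_superalgebra (algebra_of t)"
    "\<And>g h z x. struct t g h genA z x = (if g = genA \<and> h = genA then z + 2 * x else if g = genX \<and> h = genX then 2 else 0)"
    "\<And>g h z x. struct t g h genX z x =
      (if g = genA \<and> h = genX then z + 3/2 * x else if g = genX \<and> h = genA then z / 2 + 3/2 * x else 0)"
    "\<Delta> \<noteq> 1/2"
  shows "fin_nontriv_irred (algebra_of t) (mod_Mminus \<Delta> \<eta>)"
proof -
  define s :: "gen \<times> bit \<Rightarrow> complex poly poly ^ bit" where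
    "s = no_action((genA, 0) := axis 0 (pDel + cst \<Delta> * pLam + cst \<eta>),
          (genA, 1) := axis 1 (pDel + cst (\<Delta> - 1/2) * pLam + cst \<eta>),
          (genX, 0) := axis 1 (pDel + cst (2 * \<Delta> - 1) * pLam + cst \<eta>),
          (genX, 1) := axis 0 1)"
  have s: "ev2 (s (g, j) $ k) z x = (if g = genA \<and> j = k then z + (if j = 0 then \<Delta> else \<Delta> - 1/2) * x + \<eta>
      else if g = genX \<and> j \<noteq> k then (if j = 0 then z + (2 * \<Delta> - 1) * x + \<eta> else 1) else 0)" for g j k z x
    using bit_cases2[of j] bit_cases2[of k]
    by (cases g; elim disjE; simp add: s_def table_simps; simp add: mult.commute)
  show ?thesis
    unfolding mod_Mminus_def s_def[symmetric]
  proof (rule rank_two_irreducible[OF assms(1), where g = genX and h' = 1 and h = "pDel + cst (2 * \<Delta> - 1) * pLam + cst \<eta>"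
      and c' = 1 and c = "2 * \<Delta> - 1"])
    show "s (g, j) $ k = 0" if "k \<noteq> gpar g + j" for g j k
      using that bit_cases2[of j] bit_cases2[of k] by (cases g; elim disjE; simp add: s_def axis_nth_if)
    fix g h m k x y z
    show "ev2 (s (h, m) $ 0) (z + x) y * ev2 (s (g, 0) $ k) z x + ev2 (s (h, m) $ 1) (z + x) y * ev2 (s (g, 1) $ k) z x =
      (\<Sum>l\<in>UNIV. struct t g h l (- x - y) x * ev2 (s (l, m) $ k) z (x + y)) +
      odd_sign g h * (ev2 (s (g, m) $ 0) (z + y) x * ev2 (s (h, 0) $ k) z y + ev2 (s (g, m) $ 1) (z + y) x * ev2 (s (h, 1) $ k) z y)"
      using bit_cases2[of m] bit_cases2[of k]
      by (cases g; cases h; elim disjE; simp add: sum_gen assms(2,3) s; simp add: field_simps)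
  next
    show "s (genX, 0) = axis 1 (pDel + cst (2 * \<Delta> - 1) * pLam + cst \<eta>)" "s (genX, 1) = axis 0 1"
      by (simp_all add: s_def)
    show "2 * \<Delta> - 1 \<noteq> 0" using assms(4) by (simp add: field_simps)
    then show "lead_coeff (pDel + cst (2 * \<Delta> - 1) * pLam + cst \<eta>) = [:2 * \<Delta> - 1:]" by (rule lead_coeff_linear)
  qed (simp_all add: one_pCons)
qed

text \<open>X exchanges the two generators with the nonzero constants c and e, so that \<Delta> and
  \<zeta> stay unrestricted.\<close>

lemma irreducible_Mceps:
  assumes "lie_conformal_superalgebra (algebra_of t)"
    "\<And>g h z x. struct t g h genA z x = (if g = genA \<and> h = genA then z + 2 * x else 0)"
    "\<And>g h z x. struct t g h genB z x = (if g = genA \<and> h = genB then z + x else if g = genB \<and> h = genA then x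
      else if g = genX \<and> h = genX then 2 else 0)"
    "\<And>g h z x. struct t g h genX z x = (if g = genA \<and> h = genX then z + x else if g = genX \<and> h = genA then x else 0)"
    "c \<noteq> 0" "e \<noteq> 0"
  shows "fin_nontriv_irred (algebra_of t) (mod_Mceps \<Delta> \<zeta> c e)"
proof -
  define s :: "gen \<times> bit \<Rightarrow> complex poly poly ^ bit" where
    "s = no_action((genA, 0) := axis 0 (pDel + cst \<Delta> * pLam + cst \<zeta>),
          (genA, 1) := axis 1 (pDel + cst \<Delta> * pLam + cst \<zeta>), (genB, 0) := axis 0 (cst (c * e)),
          (genB, 1) := axis 1 (cst (c * e)), (genX, 0) := axis 1 (cst c), (genX, 1) := axis 0 (cst e))"
  have s: "ev2 (s (g, j) $ k) z x = (if g = genA \<and> j = k then z + \<Delta> * x + \<zeta> else if g = genB \<and> j = k then c * e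
      else if g = genX \<and> j \<noteq> k then (if j = 0 then c else e) else 0)" for g j k z x
    using bit_cases2[of j] bit_cases2[of k]
    by (cases g; elim disjE; simp add: s_def table_simps; simp add: mult.commute)
  show ?thesis
    unfolding mod_Mceps_def s_def[symmetric]
  proof (rule rank_two_irreducible[OF assms(1), where g = genX and h = "cst c" and h' = "cst e" and c = c and c' = e])
    show "s (g, j) $ k = 0" if "k \<noteq> gpar g + j" for g j k
      using that bit_cases2[of j] bit_cases2[of k] by (cases g; elim disjE; simp add: s_def axis_nth_if)
    fix g h m k x y z
    show "ev2 (s (h, m) $ 0) (z + x) y * ev2 (s (g, 0) $ k) z x + ev2 (s (h, m) $ 1) (z + x) y * ev2 (s (g, 1) $ k) z x =
      (\<Sum>l\<in>UNIV. struct t g h l (- x - y) x * ev2 (s (l, m) $ k) z (x + y)) +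
      odd_sign g h * (ev2 (s (g, m) $ 0) (z + y) x * ev2 (s (h, 0) $ k) z y + ev2 (s (g, m) $ 1) (z + y) x * ev2 (s (h, 1) $ k) z y)"
      using bit_cases2[of m] bit_cases2[of k]
      by (cases g; cases h; elim disjE; simp add: sum_gen assms(2-4) s; simp add: field_simps)
  next
    show "s (genX, 0) = axis 1 (cst c)" "s (genX, 1) = axis 0 (cst e)"
      by (simp_all add: s_def)
  qed (use assms(5,6) in simp_all)
qed

lemma ev2_skew:
  assumes "skew_symmetric f"
  shows "ev2 f z x = - ev2 f z (- x - z)"
proof -
  have "ev2 f z x = ev2 (- flip f) z x" using assms by (simp add: skew_symmetric_def)
  then show ?thesis by (simp add: ev2_simps ev2_flip)
qed

context table_module
begin

text \<open>Components of brackets along generators already known to act as zero are ignored, so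
  that B and X can be eliminated one after the other.\<close>

lemma kill_X':
  assumes "\<And>h k z x. k \<noteq> genX \<Longrightarrow> \<not> acts0 k \<Longrightarrow> struct t h genX k z x = 0" "\<And>z x. struct t genX genX genX z x = 0"
  shows "acts0 genX"
  by (rule kill_X) (use assms in blast)+

lemma ideal1:
  assumes "\<And>h k z x. k \<noteq> b \<Longrightarrow> \<not> acts0 k \<Longrightarrow> struct t h b k z x = 0" "k \<noteq> b"
  shows "(\<forall>z x. struct t h b k z x = 0) \<or> acts0 k"
  using assms by blast

lemma commuting_pair:
  assumes "gpar g * gpar h \<noteq> 1" "\<And>k z x. struct t g h k z x = 0"
  shows "ev (op g (ev (op h v) y)) x - ev (op h (ev (op g v) x)) y = 0"
  using rel_even[OF assms(1), of v y x] assms(2) by simp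

end

section \<open>The algebras of type A\<close>

definition "tab_A1 f \<phi> = no_action(
     (genA, genA) := axis genB f,
     (genA, genX) := axis genX (inst \<phi> pLam))"

definition "tab_A2 f \<psi> = no_action(
     (genA, genA) := axis genB f,
     (genX, genX) := axis genB (inst \<psi> pDel))"

definition "tab_A3 \<phi> = no_action(
     (genA, genB) := axis genB (2 * inst \<phi> pLam),
     (genA, genX) := axis genX (inst \<phi> pLam),
     (genX, genX) := axis genB 2)"

definition "tab_A4 p \<phi> = no_action(
     (genA, genB) := axis genB (inst p pLam),
     (genA, genX) := axis genX (inst \<phi> pLam))"

lemma struct_A1:
  "struct (tab_A1 f \<phi>) g h k z x = (if g = genA \<and> h = genA \<and> k = genB then ev2 f z x
    else if g = genA \<and> h = genX \<and> k = genX then poly \<phi> x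
    else if g = genX \<and> h = genA \<and> k = genX then - poly \<phi> (- x - z) else 0)"
  by (cases g; cases h; cases k; simp add: struct_def tab_A1_def table_simps)

lemma struct_A2:
  "struct (tab_A2 f \<psi>) g h k z x = (if g = genA \<and> h = genA \<and> k = genB then ev2 f z x
    else if g = genX \<and> h = genX \<and> k = genB then poly \<psi> z else 0)"
  by (cases g; cases h; cases k; simp add: struct_def tab_A2_def table_simps)

lemma struct_A3:
  "struct (tab_A3 \<phi>) g h k z x = (if g = genA \<and> h = genB \<and> k = genB then 2 * poly \<phi> x
    else if g = genB \<and> h = genA \<and> k = genB then - 2 * poly \<phi> (- x - z)
    else if g = genA \<and> h = genX \<and> k = genX then poly \<phi> x
    else if g = genX \<and> h = genA \<and> k = genX then - poly \<phi> (- x - z)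
    else if g = genX \<and> h = genX \<and> k = genB then 2 else 0)"
  by (cases g; cases h; cases k; simp add: struct_def tab_A3_def table_simps)

lemma struct_A4:
  "struct (tab_A4 p \<phi>) g h k z x = (if g = genA \<and> h = genB \<and> k = genB then poly p x
    else if g = genB \<and> h = genA \<and> k = genB then - poly p (- x - z)
    else if g = genA \<and> h = genX \<and> k = genX then poly \<phi> x
    else if g = genX \<and> h = genA \<and> k = genX then - poly \<phi> (- x - z) else 0)"
  by (cases g; cases h; cases k; simp add: struct_def tab_A4_def table_simps)

text \<open>Brings the arguments of unspecified polynomials on the two sides of the Jacobi
  identities to a common form.\<close>

lemma minus_exchange: "- y - (x + z) = - x - (y + z :: complex)"
  by simp

lemma lie_A1:
  assumes "skew_symmetric f"
  shows "lie_conformal_superalgebra (algebra_of (tab_A1 f \<phi>))"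
proof (rule lie_conformal_superalgebra_struct)
  show "struct (tab_A1 f \<phi>) g h k z x = 0" if "gpar k \<noteq> gpar g + gpar h" for g h k z x
    using that by (cases g; cases h; cases k; simp add: struct_A1)
  show "struct (tab_A1 f \<phi>) g h k z x = - odd_sign g h * struct (tab_A1 f \<phi>) h g k z (- x - z)" for g h k z x
    using ev2_skew[OF assms, of z x] by (cases g; cases h; cases k; simp add: struct_A1)
  show "(\<Sum>l\<in>UNIV. struct (tab_A1 f \<phi>) h m l (z + x) y * struct (tab_A1 f \<phi>) g l k z x) =
      (\<Sum>l\<in>UNIV. struct (tab_A1 f \<phi>) g h l (- x - y) x * struct (tab_A1 f \<phi>) l m k z (x + y)) +
      odd_sign g h * (\<Sum>l\<in>UNIV. struct (tab_A1 f \<phi>) g m l (z + y) x * struct (tab_A1 f \<phi>) h l k z y)" for g h m k x y z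
    by (cases g; cases h; cases m; cases k; simp add: struct_A1 sum_gen algebra_simps minus_exchange)
qed

lemma lie_A2:
  assumes "skew_symmetric f"
  shows "lie_conformal_superalgebra (algebra_of (tab_A2 f \<psi>))"
proof (rule lie_conformal_superalgebra_struct)
  show "struct (tab_A2 f \<psi>) g h k z x = 0" if "gpar k \<noteq> gpar g + gpar h" for g h k z x
    using that by (cases g; cases h; cases k; simp add: struct_A2)
  show "struct (tab_A2 f \<psi>) g h k z x = - odd_sign g h * struct (tab_A2 f \<psi>) h g k z (- x - z)" for g h k z x
    using ev2_skew[OF assms, of z x] by (cases g; cases h; cases k; simp add: struct_A2)
  show "(\<Sum>l\<in>UNIV. struct (tab_A2 f \<psi>) h m l (z + x) y * struct (tab_A2 f \<psi>) g l k z x) =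
      (\<Sum>l\<in>UNIV. struct (tab_A2 f \<psi>) g h l (- x - y) x * struct (tab_A2 f \<psi>) l m k z (x + y)) +
      odd_sign g h * (\<Sum>l\<in>UNIV. struct (tab_A2 f \<psi>) g m l (z + y) x * struct (tab_A2 f \<psi>) h l k z y)" for g h m k x y z
    by (cases g; cases h; cases m; cases k; simp add: struct_A2 sum_gen algebra_simps minus_exchange)
qed

lemma lie_A3: "lie_conformal_superalgebra (algebra_of (tab_A3 \<phi>))"
proof (rule lie_conformal_superalgebra_struct)
  show "struct (tab_A3 \<phi>) g h k z x = 0" if "gpar k \<noteq> gpar g + gpar h" for g h k z x
    using that by (cases g; cases h; cases k; simp add: struct_A3)
  show "struct (tab_A3 \<phi>) g h k z x = - odd_sign g h * struct (tab_A3 \<phi>) h g k z (- x - z)" for g h k z x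
    by (cases g; cases h; cases k; simp add: struct_A3)
  show "(\<Sum>l\<in>UNIV. struct (tab_A3 \<phi>) h m l (z + x) y * struct (tab_A3 \<phi>) g l k z x) =
      (\<Sum>l\<in>UNIV. struct (tab_A3 \<phi>) g h l (- x - y) x * struct (tab_A3 \<phi>) l m k z (x + y)) +
      odd_sign g h * (\<Sum>l\<in>UNIV. struct (tab_A3 \<phi>) g m l (z + y) x * struct (tab_A3 \<phi>) h l k z y)" for g h m k x y z
    by (cases g; cases h; cases m; cases k; simp add: struct_A3 sum_gen algebra_simps minus_exchange)
qed

lemma lie_A4: "lie_conformal_superalgebra (algebra_of (tab_A4 p \<phi>))"
proof (rule lie_conformal_superalgebra_struct)
  show "struct (tab_A4 p \<phi>) g h k z x = 0" if "gpar k \<noteq> gpar g + gpar h" for g h k z x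
    using that by (cases g; cases h; cases k; simp add: struct_A4)
  show "struct (tab_A4 p \<phi>) g h k z x = - odd_sign g h * struct (tab_A4 p \<phi>) h g k z (- x - z)" for g h k z x
    by (cases g; cases h; cases k; simp add: struct_A4)
  show "(\<Sum>l\<in>UNIV. struct (tab_A4 p \<phi>) h m l (z + x) y * struct (tab_A4 p \<phi>) g l k z x) =
      (\<Sum>l\<in>UNIV. struct (tab_A4 p \<phi>) g h l (- x - y) x * struct (tab_A4 p \<phi>) l m k z (x + y)) +
      odd_sign g h * (\<Sum>l\<in>UNIV. struct (tab_A4 p \<phi>) g m l (z + y) x * struct (tab_A4 p \<phi>) h l k z y)" for g h m k x y z
    by (cases g; cases h; cases m; cases k; simp add: struct_A4 sum_gen algebra_simps minus_exchange)
qed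

lemma back_Nf:
  assumes "lie_conformal_superalgebra (algebra_of t)" "\<And>g h z x. struct t g h genA z x = 0" "\<exists>N\<in>fam_Nf. M \<cong> N"
  shows "fin_nontriv_irred (algebra_of t) M"
proof -
  obtain i f where "f \<noteq> 0" "M \<cong> mod_Nf i f" using assms(3) unfolding fam_Nf_def by blast
  then show ?thesis using fin_nontriv_irred_iso irreducible_Nf[OF assms(1,2)] by blast
qed

text \<open>X spans an ideal with [X X] = 0 and is eliminated by itself. B is central and [A A] = f
  B with f \<noteq> 0, so B is eliminated by the Heisenberg argument.\<close>

lemma case_A1:
  assumes "f \<noteq> 0" "skew_symmetric f"
  shows "fin_nontriv_irred (alg_A1 f \<phi>) M \<longleftrightarrow> (\<exists>N\<in>fam_Nf. M \<cong> N)"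
  unfolding alg_A1_def tab_A1_def[symmetric]
proof
  assume "fin_nontriv_irred (algebra_of (tab_A1 f \<phi>)) M"
  then interpret table_module "tab_A1 f \<phi>" M by (rule table_module.intro)
  have X: "acts0 genX"
    by (rule kill_X') (simp_all add: struct_A1)
  have B: "acts0 genB"
  proof (rule kill_central[where a = genA and f = f])
    show "(\<forall>z x. struct (tab_A1 f \<phi>) h genB k z x = 0) \<or> acts0 k" for h k by (simp add: struct_A1)
    show "ev (op genA (ev (op genA v) y)) x - ev (op genA (ev (op genA v) x)) y =
        smul M [:ev2 f (- x - y) x:] (ev (op genB v) (x + y))" for v x y
      using rel_even[of genA genA v y x] by (simp add: struct_A1)
  qed (use assms in \<open>simp_all add: commuting_pair struct_A1\<close>)
  show "\<exists>N\<in>fam_Nf. M \<cong> N" by (rule final_Nf[OF B X]) (simp add: struct_A1)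
next
  assume "\<exists>N\<in>fam_Nf. M \<cong> N"
  then show "fin_nontriv_irred (algebra_of (tab_A1 f \<phi>)) M"
    by (rule back_Nf[OF lie_A1[OF assms(2)], rotated]) (simp add: struct_A1)
qed

text \<open>[X X] is a multiple of B, so B has to be eliminated before X.\<close>

lemma case_A2:
  assumes "f \<noteq> 0" "skew_symmetric f"
  shows "fin_nontriv_irred (alg_A2 f \<psi>) M \<longleftrightarrow> (\<exists>N\<in>fam_Nf. M \<cong> N)"
  unfolding alg_A2_def tab_A2_def[symmetric]
proof
  assume "fin_nontriv_irred (algebra_of (tab_A2 f \<psi>)) M"
  then interpret table_module "tab_A2 f \<psi>" M by (rule table_module.intro)
  have B: "acts0 genB"
  proof (rule kill_central[where a = genA and f = f])
    show "(\<forall>z x. struct (tab_A2 f \<psi>) h genB k z x = 0) \<or> acts0 k" for h k by (simp add: struct_A2)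
    show "ev (op genA (ev (op genA v) y)) x - ev (op genA (ev (op genA v) x)) y =
        smul M [:ev2 f (- x - y) x:] (ev (op genB v) (x + y))" for v x y
      using rel_even[of genA genA v y x] by (simp add: struct_A2)
  qed (use assms in \<open>simp_all add: commuting_pair struct_A2\<close>)
  have X: "acts0 genX"
    by (rule kill_X') (use B in \<open>auto simp: struct_A2\<close>)
  show "\<exists>N\<in>fam_Nf. M \<cong> N" by (rule final_Nf[OF B X]) (simp add: struct_A2)
next
  assume "\<exists>N\<in>fam_Nf. M \<cong> N"
  then show "fin_nontriv_irred (algebra_of (tab_A2 f \<psi>)) M"
    by (rule back_Nf[OF lie_A2[OF assms(2)], rotated]) (simp add: struct_A2)
qed

text \<open>[A B] = 2\<phi>(\<lambda>) B makes coefficients of B shift the eigenvalues of A, which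
  eliminates B; after that [X X] = 2B acts as zero and X follows.\<close>

lemma case_A3:
  assumes "\<phi> \<noteq> 0"
  shows "fin_nontriv_irred (alg_A3 \<phi>) M \<longleftrightarrow> (\<exists>N\<in>fam_Nf. M \<cong> N)"
  unfolding alg_A3_def tab_A3_def[symmetric]
proof
  assume "fin_nontriv_irred (algebra_of (tab_A3 \<phi>)) M"
  then interpret table_module "tab_A3 \<phi>" M by (rule table_module.intro)
  have B: "acts0 genB"
  proof (rule kill_shift[where a = genA and p = "Polynomial.smult 2 \<phi>"])
    show "(\<forall>z x. struct (tab_A3 \<phi>) h genB k z x = 0) \<or> acts0 k" if "k \<noteq> genB" for h k
      using that by (simp add: struct_A3)
    show "ev (op genA (ev (op genB v) y)) x - ev (op genB (ev (op genA v) x)) y =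
        smul M [:poly (Polynomial.smult 2 \<phi>) x:] (ev (op genB v) (x + y))" for v x y
      using rel_even[of genA genB v y x] by (simp add: struct_A3)
  qed (use assms in \<open>simp_all add: commuting_pair struct_A3\<close>)
  have X: "acts0 genX"
    by (rule kill_X') (use B in \<open>auto simp: struct_A3\<close>)
  show "\<exists>N\<in>fam_Nf. M \<cong> N" by (rule final_Nf[OF B X]) (simp add: struct_A3)
next
  assume "\<exists>N\<in>fam_Nf. M \<cong> N"
  then show "fin_nontriv_irred (algebra_of (tab_A3 \<phi>)) M"
    by (rule back_Nf[OF lie_A3, rotated]) (simp add: struct_A3)
qed

lemma case_A4:
  assumes "p \<noteq> 0"
  shows "fin_nontriv_irred (alg_A4 p \<phi>) M \<longleftrightarrow> (\<exists>N\<in>fam_Nf. M \<cong> N)"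
  unfolding alg_A4_def tab_A4_def[symmetric]
proof
  assume "fin_nontriv_irred (algebra_of (tab_A4 p \<phi>)) M"
  then interpret table_module "tab_A4 p \<phi>" M by (rule table_module.intro)
  have B: "acts0 genB"
  proof (rule kill_shift[where a = genA and p = p])
    show "(\<forall>z x. struct (tab_A4 p \<phi>) h genB k z x = 0) \<or> acts0 k" if "k \<noteq> genB" for h k
      using that by (simp add: struct_A4)
    show "ev (op genA (ev (op genB v) y)) x - ev (op genB (ev (op genA v) x)) y =
        smul M [:poly p x:] (ev (op genB v) (x + y))" for v x y
      using rel_even[of genA genB v y x] by (simp add: struct_A4)
  qed (use assms in \<open>simp_all add: commuting_pair struct_A4\<close>)
  have X: "acts0 genX"
    by (rule kill_X') (simp_all add: struct_A4)
  show "\<exists>N\<in>fam_Nf. M \<cong> N" by (rule final_Nf[OF B X]) (simp add: struct_A4)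
next
  assume "\<exists>N\<in>fam_Nf. M \<cong> N"
  then show "fin_nontriv_irred (algebra_of (tab_A4 p \<phi>)) M"
    by (rule back_Nf[OF lie_A4, rotated]) (simp add: struct_A4)
qed

text \<open>The two identities say that Q is a cocycle twisting [A A] by B: skew-symmetry, and the
  component along B of the Jacobi identity for A, A, A. For each exceptional weight a they are
  identities of explicit polynomials.\<close>

lemma cond_C1_properties:
  assumes "cond_C1 a b Q"
  shows "ev2 Q z x = - ev2 Q z (- x - z)" (is ?skew)
    and "(z + x + 2 * y) * ev2 Q z x + ev2 Q (z + x) y * (z + a * x + b) =
      (x - y) * ev2 Q z (x + y) + ev2 Q (- x - y) x * ((a - 1) * z + a * (x + y) - b) +
      ((z + y + 2 * x) * ev2 Q z y + ev2 Q (z + y) x * (z + a * y + b))" (is ?cocycle)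
proof -
  let ?t = "pDel * pLam + pLam ^ 2"
  consider "Q = 0" | c where "a = 1" "b = 0" "Q = cst c * Vir"
    | c d where "a = 0" "b = 0" "Q = Vir * (cst c * ?t + cst d * pDel)"
    | c d where "a = - 1" "b = 0" "Q = Vir * (cst c * pDel ^ 2 + cst d * ?t * pDel)"
    | c where "a = - 4" "b = 0" "Q = cst c * Vir * ?t ^ 3"
    | c where "a = - 6" "b = 0" "Q = cst c * Vir * (11 * ?t ^ 4 + 2 * ?t ^ 3 * pDel ^ 2)"
    using assms unfolding cond_C1_def Let_def by (auto split: if_splits simp del: mult_pCons_left mult_pCons_right add_pCons)
  then have "?skew \<and> ?cocycle"
  proof cases
    case 1
    then show ?thesis by (simp add: ev2_simps)
  next
    case (2 c)
    show ?thesis unfolding 2 by (simp only: ev2_simps) algebra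
  next
    case (3 c d)
    show ?thesis unfolding 3 by (simp only: ev2_simps) algebra
  next
    case (4 c d)
    show ?thesis unfolding 4 by (simp only: ev2_simps) algebra
  next
    case (5 c)
    show ?thesis unfolding 5 by (simp only: ev2_simps) algebra
  next
    case (6 c)
    show ?thesis unfolding 6 by (simp only: ev2_simps) algebra
  qed
  then show ?skew ?cocycle by blast+
qed

section \<open>The algebras of types B, C and D\<close>

definition "tab_B1 \<alpha> \<beta> = no_action(
     (genA, genA) := axis genA Vir,
     (genB, genB) := axis genB Vir,
     (genA, genX) := axis genX (pDel + cst \<alpha> * pLam + cst \<beta>))"

definition "tab_B2 = no_action(
     (genA, genA) := axis genA Vir,
     (genB, genB) := axis genB Vir,
     (genA, genX) := axis genX (pDel + cst (3/2) * pLam),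
     (genX, genX) := axis genA 2)"

definition "tab_C1 \<alpha> \<beta> = no_action(
     (genA, genA) := axis genA Vir,
     (genA, genX) := axis genX (pDel + cst \<alpha> * pLam + cst \<beta>))"

definition "tab_C2 = no_action(
     (genA, genA) := axis genA Vir,
     (genA, genX) := axis genX (pDel + cst (3/2) * pLam),
     (genX, genX) := axis genA 2)"

definition "tab_C3 \<phi> = no_action(
     (genA, genA) := axis genA Vir,
     (genB, genX) := axis genX (inst \<phi> pLam))"

definition "tab_D1 a b Q \<alpha> \<beta> = no_action(
     (genA, genA) := axis genA Vir + axis genB Q,
     (genA, genB) := axis genB (pDel + cst a * pLam + cst b),
     (genA, genX) := axis genX (pDel + cst \<alpha> * pLam + cst \<beta>))"

definition "tab_D2 a b Q = no_action(
     (genA, genA) := axis genA Vir + axis genB Q,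
     (genA, genB) := axis genB (pDel + cst a * pLam + cst b),
     (genA, genX) := axis genX (pDel + cst ((a + 1) / 2) * pLam + cst (b / 2)),
     (genX, genX) := axis genB 2)"

definition "tab_D3 b Q = no_action(
     (genA, genA) := axis genA Vir + axis genB Q,
     (genA, genB) := axis genB (pDel + cst b),
     (genA, genX) := axis genX (pDel + pLam + cst (b / 2)),
     (genX, genX) := axis genB (pDel + cst b))"

definition "tab_D4 \<alpha> \<beta> \<gamma> = no_action(
     (genA, genA) := axis genA Vir,
     (genA, genB) := axis genB (pDel + pLam),
     (genA, genX) := axis genX (pDel + cst \<alpha> * pLam + cst \<beta>),
     (genB, genX) := axis genX (cst \<gamma>))"

lemma struct_B1:
  "struct (tab_B1 \<alpha> \<beta>) g h k z x = (if g = genA \<and> h = genA \<and> k = genA then z + 2 * x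
    else if g = genB \<and> h = genB \<and> k = genB then z + 2 * x
    else if g = genA \<and> h = genX \<and> k = genX then z + \<alpha> * x + \<beta>
    else if g = genX \<and> h = genA \<and> k = genX then - (z + \<alpha> * (- x - z) + \<beta>) else 0)"
  by (cases g; cases h; cases k; simp add: struct_def tab_B1_def table_simps; simp add: field_simps)

lemma struct_B2:
  "struct tab_B2 g h k z x = (if g = genA \<and> h = genA \<and> k = genA then z + 2 * x
    else if g = genB \<and> h = genB \<and> k = genB then z + 2 * x
    else if g = genA \<and> h = genX \<and> k = genX then z + 3/2 * x
    else if g = genX \<and> h = genA \<and> k = genX then z / 2 + 3/2 * x
    else if g = genX \<and> h = genX \<and> k = genA then 2 else 0)"
  by (cases g; cases h; cases k; simp add: struct_def tab_B2_def table_simps; simp add: field_simps)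

lemma struct_C1:
  "struct (tab_C1 \<alpha> \<beta>) g h k z x = (if g = genA \<and> h = genA \<and> k = genA then z + 2 * x
    else if g = genA \<and> h = genX \<and> k = genX then z + \<alpha> * x + \<beta>
    else if g = genX \<and> h = genA \<and> k = genX then - (z + \<alpha> * (- x - z) + \<beta>) else 0)"
  by (cases g; cases h; cases k; simp add: struct_def tab_C1_def table_simps; simp add: field_simps)

lemma struct_C2:
  "struct tab_C2 g h k z x = (if g = genA \<and> h = genA \<and> k = genA then z + 2 * x
    else if g = genA \<and> h = genX \<and> k = genX then z + 3/2 * x
    else if g = genX \<and> h = genA \<and> k = genX then z / 2 + 3/2 * x
    else if g = genX \<and> h = genX \<and> k = genA then 2 else 0)"
  by (cases g; cases h; cases k; simp add: struct_def tab_C2_def table_simps; simp add: field_simps)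

lemma struct_C3:
  "struct (tab_C3 \<phi>) g h k z x = (if g = genA \<and> h = genA \<and> k = genA then z + 2 * x
    else if g = genB \<and> h = genX \<and> k = genX then poly \<phi> x
    else if g = genX \<and> h = genB \<and> k = genX then - poly \<phi> (- x - z) else 0)"
  by (cases g; cases h; cases k; simp add: struct_def tab_C3_def table_simps; simp add: field_simps)

lemma struct_D1:
  "struct (tab_D1 a b Q \<alpha> \<beta>) g h k z x = (if g = genA \<and> h = genA \<and> k = genA then z + 2 * x
    else if g = genA \<and> h = genA \<and> k = genB then ev2 Q z x
    else if g = genA \<and> h = genB \<and> k = genB then z + a * x + b
    else if g = genB \<and> h = genA \<and> k = genB then (a - 1) * z + a * x - b
    else if g = genA \<and> h = genX \<and> k = genX then z + \<alpha> * x + \<beta>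
    else if g = genX \<and> h = genA \<and> k = genX then (\<alpha> - 1) * z + \<alpha> * x - \<beta> else 0)"
  by (cases g; cases h; cases k; simp add: struct_def tab_D1_def table_simps; simp add: field_simps)

lemma struct_D2:
  "struct (tab_D2 a b Q) g h k z x = (if g = genA \<and> h = genA \<and> k = genA then z + 2 * x
    else if g = genA \<and> h = genA \<and> k = genB then ev2 Q z x
    else if g = genA \<and> h = genB \<and> k = genB then z + a * x + b
    else if g = genB \<and> h = genA \<and> k = genB then (a - 1) * z + a * x - b
    else if g = genA \<and> h = genX \<and> k = genX then z + (a + 1) / 2 * x + b / 2
    else if g = genX \<and> h = genA \<and> k = genX then (a - 1) / 2 * z + (a + 1) / 2 * x - b / 2
    else if g = genX \<and> h = genX \<and> k = genB then 2 else 0)"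
  by (cases g; cases h; cases k; simp add: struct_def tab_D2_def table_simps; simp add: field_simps)

lemma struct_D3:
  "struct (tab_D3 b Q) g h k z x = (if g = genA \<and> h = genA \<and> k = genA then z + 2 * x
    else if g = genA \<and> h = genA \<and> k = genB then ev2 Q z x
    else if g = genA \<and> h = genB \<and> k = genB then z + b
    else if g = genB \<and> h = genA \<and> k = genB then - z - b
    else if g = genA \<and> h = genX \<and> k = genX then z + x + b / 2
    else if g = genX \<and> h = genA \<and> k = genX then x - b / 2
    else if g = genX \<and> h = genX \<and> k = genB then z + b else 0)"
  by (cases g; cases h; cases k; simp add: struct_def tab_D3_def table_simps; simp add: field_simps)

lemma struct_D4:
  "struct (tab_D4 \<alpha> \<beta> \<gamma>) g h k z x = (if g = genA \<and> h = genA \<and> k = genA then z + 2 * x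
    else if g = genA \<and> h = genB \<and> k = genB then z + x
    else if g = genB \<and> h = genA \<and> k = genB then x
    else if g = genA \<and> h = genX \<and> k = genX then z + \<alpha> * x + \<beta>
    else if g = genX \<and> h = genA \<and> k = genX then - (z + \<alpha> * (- x - z) + \<beta>)
    else if g = genB \<and> h = genX \<and> k = genX then \<gamma>
    else if g = genX \<and> h = genB \<and> k = genX then - \<gamma> else 0)"
  by (cases g; cases h; cases k; simp add: struct_def tab_D4_def table_simps; simp add: field_simps)

lemma lie_B1: "lie_conformal_superalgebra (algebra_of (tab_B1 \<alpha> \<beta>))"
proof (rule lie_conformal_superalgebra_struct)
  show "struct (tab_B1 \<alpha> \<beta>) g h k z x = 0" if "gpar k \<noteq> gpar g + gpar h" for g h k z x
    using that by (cases g; cases h; cases k; simp add: struct_B1)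
  show "struct (tab_B1 \<alpha> \<beta>) g h k z x = - odd_sign g h * struct (tab_B1 \<alpha> \<beta>) h g k z (- x - z)" for g h k z x
    by (cases g; cases h; cases k; simp add: struct_B1 algebra_simps)
  show "(\<Sum>l\<in>UNIV. struct (tab_B1 \<alpha> \<beta>) h m l (z + x) y * struct (tab_B1 \<alpha> \<beta>) g l k z x) =
      (\<Sum>l\<in>UNIV. struct (tab_B1 \<alpha> \<beta>) g h l (- x - y) x * struct (tab_B1 \<alpha> \<beta>) l m k z (x + y)) +
      odd_sign g h * (\<Sum>l\<in>UNIV. struct (tab_B1 \<alpha> \<beta>) g m l (z + y) x * struct (tab_B1 \<alpha> \<beta>) h l k z y)" for g h m k x y z
    by (cases g; cases h; cases m; cases k; simp add: struct_B1 sum_gen field_simps minus_exchange)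
qed

lemma lie_B2: "lie_conformal_superalgebra (algebra_of (tab_B2))"
proof (rule lie_conformal_superalgebra_struct)
  show "struct (tab_B2) g h k z x = 0" if "gpar k \<noteq> gpar g + gpar h" for g h k z x
    using that by (cases g; cases h; cases k; simp add: struct_B2)
  show "struct (tab_B2) g h k z x = - odd_sign g h * struct (tab_B2) h g k z (- x - z)" for g h k z x
    by (cases g; cases h; cases k; simp add: struct_B2 algebra_simps)
  show "(\<Sum>l\<in>UNIV. struct (tab_B2) h m l (z + x) y * struct (tab_B2) g l k z x) =
      (\<Sum>l\<in>UNIV. struct (tab_B2) g h l (- x - y) x * struct (tab_B2) l m k z (x + y)) +
      odd_sign g h * (\<Sum>l\<in>UNIV. struct (tab_B2) g m l (z + y) x * struct (tab_B2) h l k z y)" for g h m k x y z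
    by (cases g; cases h; cases m; cases k; simp add: struct_B2 sum_gen field_simps minus_exchange)
qed

lemma lie_C1: "lie_conformal_superalgebra (algebra_of (tab_C1 \<alpha> \<beta>))"
proof (rule lie_conformal_superalgebra_struct)
  show "struct (tab_C1 \<alpha> \<beta>) g h k z x = 0" if "gpar k \<noteq> gpar g + gpar h" for g h k z x
    using that by (cases g; cases h; cases k; simp add: struct_C1)
  show "struct (tab_C1 \<alpha> \<beta>) g h k z x = - odd_sign g h * struct (tab_C1 \<alpha> \<beta>) h g k z (- x - z)" for g h k z x
    by (cases g; cases h; cases k; simp add: struct_C1 algebra_simps)
  show "(\<Sum>l\<in>UNIV. struct (tab_C1 \<alpha> \<beta>) h m l (z + x) y * struct (tab_C1 \<alpha> \<beta>) g l k z x) =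
      (\<Sum>l\<in>UNIV. struct (tab_C1 \<alpha> \<beta>) g h l (- x - y) x * struct (tab_C1 \<alpha> \<beta>) l m k z (x + y)) +
      odd_sign g h * (\<Sum>l\<in>UNIV. struct (tab_C1 \<alpha> \<beta>) g m l (z + y) x * struct (tab_C1 \<alpha> \<beta>) h l k z y)" for g h m k x y z
    by (cases g; cases h; cases m; cases k; simp add: struct_C1 sum_gen field_simps minus_exchange)
qed

lemma lie_C2: "lie_conformal_superalgebra (algebra_of (tab_C2))"
proof (rule lie_conformal_superalgebra_struct)
  show "struct (tab_C2) g h k z x = 0" if "gpar k \<noteq> gpar g + gpar h" for g h k z x
    using that by (cases g; cases h; cases k; simp add: struct_C2)
  show "struct (tab_C2) g h k z x = - odd_sign g h * struct (tab_C2) h g k z (- x - z)" for g h k z x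
    by (cases g; cases h; cases k; simp add: struct_C2 algebra_simps)
  show "(\<Sum>l\<in>UNIV. struct (tab_C2) h m l (z + x) y * struct (tab_C2) g l k z x) =
      (\<Sum>l\<in>UNIV. struct (tab_C2) g h l (- x - y) x * struct (tab_C2) l m k z (x + y)) +
      odd_sign g h * (\<Sum>l\<in>UNIV. struct (tab_C2) g m l (z + y) x * struct (tab_C2) h l k z y)" for g h m k x y z
    by (cases g; cases h; cases m; cases k; simp add: struct_C2 sum_gen field_simps minus_exchange)
qed

lemma lie_C3: "lie_conformal_superalgebra (algebra_of (tab_C3 \<phi>))"
proof (rule lie_conformal_superalgebra_struct)
  show "struct (tab_C3 \<phi>) g h k z x = 0" if "gpar k \<noteq> gpar g + gpar h" for g h k z x
    using that by (cases g; cases h; cases k; simp add: struct_C3)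
  show "struct (tab_C3 \<phi>) g h k z x = - odd_sign g h * struct (tab_C3 \<phi>) h g k z (- x - z)" for g h k z x
    by (cases g; cases h; cases k; simp add: struct_C3 algebra_simps)
  show "(\<Sum>l\<in>UNIV. struct (tab_C3 \<phi>) h m l (z + x) y * struct (tab_C3 \<phi>) g l k z x) =
      (\<Sum>l\<in>UNIV. struct (tab_C3 \<phi>) g h l (- x - y) x * struct (tab_C3 \<phi>) l m k z (x + y)) +
      odd_sign g h * (\<Sum>l\<in>UNIV. struct (tab_C3 \<phi>) g m l (z + y) x * struct (tab_C3 \<phi>) h l k z y)" for g h m k x y z
    by (cases g; cases h; cases m; cases k; simp add: struct_C3 sum_gen field_simps minus_exchange)
qed

lemma lie_D4: "lie_conformal_superalgebra (algebra_of (tab_D4 \<alpha> \<beta> \<gamma>))"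
proof (rule lie_conformal_superalgebra_struct)
  show "struct (tab_D4 \<alpha> \<beta> \<gamma>) g h k z x = 0" if "gpar k \<noteq> gpar g + gpar h" for g h k z x
    using that by (cases g; cases h; cases k; simp add: struct_D4)
  show "struct (tab_D4 \<alpha> \<beta> \<gamma>) g h k z x = - odd_sign g h * struct (tab_D4 \<alpha> \<beta> \<gamma>) h g k z (- x - z)" for g h k z x
    by (cases g; cases h; cases k; simp add: struct_D4 algebra_simps)
  show "(\<Sum>l\<in>UNIV. struct (tab_D4 \<alpha> \<beta> \<gamma>) h m l (z + x) y * struct (tab_D4 \<alpha> \<beta> \<gamma>) g l k z x) =
      (\<Sum>l\<in>UNIV. struct (tab_D4 \<alpha> \<beta> \<gamma>) g h l (- x - y) x * struct (tab_D4 \<alpha> \<beta> \<gamma>) l m k z (x + y)) +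
      odd_sign g h * (\<Sum>l\<in>UNIV. struct (tab_D4 \<alpha> \<beta> \<gamma>) g m l (z + y) x * struct (tab_D4 \<alpha> \<beta> \<gamma>) h l k z y)" for g h m k x y z
    by (cases g; cases h; cases m; cases k; simp add: struct_D4 sum_gen field_simps minus_exchange)
qed

lemma lie_D1:
  assumes "cond_C1 a b Q"
  shows "lie_conformal_superalgebra (algebra_of (tab_D1 a b Q \<alpha> \<beta>))"
proof (rule lie_conformal_superalgebra_struct)
  show "struct (tab_D1 a b Q \<alpha> \<beta>) g h k z x = 0" if "gpar k \<noteq> gpar g + gpar h" for g h k z x
    using that by (cases g; cases h; cases k; simp add: struct_D1)
  show "struct (tab_D1 a b Q \<alpha> \<beta>) g h k z x = - odd_sign g h * struct (tab_D1 a b Q \<alpha> \<beta>) h g k z (- x - z)" for g h k z x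
    using cond_C1_properties(1)[OF assms, of z x]
    by (cases g; cases h; cases k; simp add: struct_D1; simp add: field_simps)
  fix g h m k x y z
  show "(\<Sum>l\<in>UNIV. struct (tab_D1 a b Q \<alpha> \<beta>) h m l (z + x) y * struct (tab_D1 a b Q \<alpha> \<beta>) g l k z x) =
      (\<Sum>l\<in>UNIV. struct (tab_D1 a b Q \<alpha> \<beta>) g h l (- x - y) x * struct (tab_D1 a b Q \<alpha> \<beta>) l m k z (x + y)) +
      odd_sign g h * (\<Sum>l\<in>UNIV. struct (tab_D1 a b Q \<alpha> \<beta>) g m l (z + y) x * struct (tab_D1 a b Q \<alpha> \<beta>) h l k z y)"
  \<comment> \<open>Q contributes to the Jacobi identity only on A, A, A and along B, because B
    brackets trivially with B and X; there the cocycle identity is used.\<close>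
  proof (cases "g = genA \<and> h = genA \<and> m = genA \<and> k = genB")
    case True
    then show ?thesis
      using cond_C1_properties(2)[OF assms, of z x y]
      by (simp add: struct_D1 sum_gen algebra_simps)
  next
    case False
    then show ?thesis
      by (cases g; cases h; cases m; cases k; simp add: struct_D1 sum_gen; simp add: field_simps)
  qed
qed

lemma lie_D2:
  assumes "cond_C1 a b Q"
  shows "lie_conformal_superalgebra (algebra_of (tab_D2 a b Q))"
proof (rule lie_conformal_superalgebra_struct)
  show "struct (tab_D2 a b Q) g h k z x = 0" if "gpar k \<noteq> gpar g + gpar h" for g h k z x
    using that by (cases g; cases h; cases k; simp add: struct_D2)
  show "struct (tab_D2 a b Q) g h k z x = - odd_sign g h * struct (tab_D2 a b Q) h g k z (- x - z)" for g h k z x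
    using cond_C1_properties(1)[OF assms, of z x]
    by (cases g; cases h; cases k; simp add: struct_D2; simp add: field_simps)
  fix g h m k x y z
  show "(\<Sum>l\<in>UNIV. struct (tab_D2 a b Q) h m l (z + x) y * struct (tab_D2 a b Q) g l k z x) =
      (\<Sum>l\<in>UNIV. struct (tab_D2 a b Q) g h l (- x - y) x * struct (tab_D2 a b Q) l m k z (x + y)) +
      odd_sign g h * (\<Sum>l\<in>UNIV. struct (tab_D2 a b Q) g m l (z + y) x * struct (tab_D2 a b Q) h l k z y)"
  proof (cases "g = genA \<and> h = genA \<and> m = genA \<and> k = genB")
    case True
    then show ?thesis
      using cond_C1_properties(2)[OF assms, of z x y]
      by (simp add: struct_D2 sum_gen algebra_simps)
  next
    case False
    then show ?thesis
      by (cases g; cases h; cases m; cases k; simp add: struct_D2 sum_gen; simp add: field_simps)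
  qed
qed

lemma lie_D3:
  assumes "cond_C1 0 b Q"
  shows "lie_conformal_superalgebra (algebra_of (tab_D3 b Q))"
proof (rule lie_conformal_superalgebra_struct)
  show "struct (tab_D3 b Q) g h k z x = 0" if "gpar k \<noteq> gpar g + gpar h" for g h k z x
    using that by (cases g; cases h; cases k; simp add: struct_D3)
  show "struct (tab_D3 b Q) g h k z x = - odd_sign g h * struct (tab_D3 b Q) h g k z (- x - z)" for g h k z x
    using cond_C1_properties(1)[OF assms, of z x]
    by (cases g; cases h; cases k; simp add: struct_D3; simp add: field_simps)
  fix g h m k x y z
  show "(\<Sum>l\<in>UNIV. struct (tab_D3 b Q) h m l (z + x) y * struct (tab_D3 b Q) g l k z x) =
      (\<Sum>l\<in>UNIV. struct (tab_D3 b Q) g h l (- x - y) x * struct (tab_D3 b Q) l m k z (x + y)) +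
      odd_sign g h * (\<Sum>l\<in>UNIV. struct (tab_D3 b Q) g m l (z + y) x * struct (tab_D3 b Q) h l k z y)"
  proof (cases "g = genA \<and> h = genA \<and> m = genA \<and> k = genB")
    case True
    then show ?thesis
      using cond_C1_properties(2)[OF assms, of z x y]
      by (simp add: struct_D3 sum_gen algebra_simps)
  next
    case False
    then show ?thesis
      by (cases g; cases h; cases m; cases k; simp add: struct_D3 sum_gen; simp add: field_simps)
  qed
qed

section \<open>Dichotomies for B commuting with a Virasoro part\<close>

context table_module
begin

lemma primary_pair:
  assumes "gpar g * gpar h \<noteq> 1" "\<And>z x. struct t g h h z x = z + c * x"
    "\<And>k z x. k \<noteq> h \<Longrightarrow> \<not> acts0 k \<Longrightarrow> struct t g h k z x = 0"
  shows "ev (op g (ev (op h v) y)) x - ev (op h (ev (op g v) x)) y = smul M [:(c - 1) * x - y:] (ev (op h v) (x + y))"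
proof -
  have z: "csc (struct t g h k z' x') (ev (op k v) x) = 0" if "k \<noteq> h" for k z' x' x
    using assms(3)[OF that] by (cases "acts0 k") (simp_all add: acts0_ev)
  have e: "- x - y + c * x = (c - 1) * x - y" by (simp add: algebra_simps)
  show ?thesis
    unfolding e[symmetric]
    using rel_even[OF assms(1), of v y x] assms(2) z[of genA "- x - y" x "x + y"]
      z[of genB "- x - y" x "x + y"] z[of genX "- x - y" x "x + y"]
    by (cases h) auto
qed

lemma kill_by_virasoro':
  assumes "finite F" "genA \<in> F" "\<forall>v. (\<forall>g\<in>F. op g v = 0) \<longrightarrow> v = 0"
    and "\<And>h k z x. k \<noteq> genB \<Longrightarrow> \<not> acts0 k \<Longrightarrow> struct t h genB k z x = 0"
    and "\<And>g k z x. g \<in> F \<Longrightarrow> struct t g genB k z x = 0"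
    and "\<And>g. g \<in> F \<Longrightarrow> \<exists>c. \<forall>z x. struct t genA g g z x = z + c * x"
    and "\<And>g k z x. g \<in> F \<Longrightarrow> k \<noteq> g \<Longrightarrow> \<not> acts0 k \<Longrightarrow> struct t genA g k z x = 0"
  shows "acts0 genB"
proof (rule kill_by_virasoro[where a = genA and F = F])
  show "(\<forall>z x. struct t h genB k z x = 0) \<or> acts0 k" if "k \<noteq> genB" for h k
    by (rule ideal1[OF assms(4) that])
  show "v = 0" if "\<And>g. g \<in> F \<Longrightarrow> op g v = 0" for v using assms(3) that by blast
  show "ev (op g (ev (op genB v) y)) x - ev (op genB (ev (op g v) x)) y = 0" if "g \<in> F" for g v x y
    by (rule commuting_pair) (use assms(5)[OF that] in simp_all)
  show "\<exists>p. \<forall>v x y. ev (op genA (ev (op g v) y)) x - ev (op g (ev (op genA v) x)) y =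
      smul M [:p * x - y:] (ev (op g v) (x + y))" if g: "g \<in> F" for g
  proof -
    obtain c where c: "\<And>z x. struct t genA g g z x = z + c * x" using assms(6)[OF g] by blast
    show ?thesis
      by (intro exI[of _ "c - 1"] allI primary_pair c assms(7)[OF g]) simp_all
  qed
qed (rule assms)+

text \<open>Unless A acts as zero, its kernel is zero, and then B, which commutes with A, is
  eliminated: only one of the two commuting parts can survive.\<close>

lemma virasoro_dichotomy:
  assumes "\<And>h k z x. k \<noteq> genA \<Longrightarrow> \<not> acts0 k \<Longrightarrow> struct t h genA k z x = 0"
    and "\<And>h k z x. k \<noteq> genB \<Longrightarrow> \<not> acts0 k \<Longrightarrow> struct t h genB k z x = 0"
    and "\<And>k z x. struct t genA genB k z x = 0" "\<And>z x. struct t genA genA genA z x = z + 2 * x"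
  shows "acts0 genA \<or> acts0 genB"
proof -
  have "acts0 genA \<or> (\<forall>v. (\<forall>g\<in>{genA}. op g v = 0) \<longrightarrow> v = 0)"
    using ker_dichotomy[of "{genA}"] assms(1) by auto
  then show ?thesis
  proof
    assume ker: "\<forall>v. (\<forall>g\<in>{genA}. op g v = 0) \<longrightarrow> v = 0"
    have "acts0 genB"
    proof (rule kill_by_virasoro'[OF _ _ ker assms(2)])
      show "\<exists>c. \<forall>z x. struct t genA g g z x = z + c * x" if "g \<in> {genA}" for g
        using that assms(4) by (intro exI[of _ 2]) simp
    qed (use assms(1,3) in auto)
    then show ?thesis ..
  qed simp
qed

text \<open>The ideal spanned by A and X takes the role of A; only the common kernel of the two has
  to be zero.\<close>

lemma superconformal_dichotomy:
  assumes "\<And>h k z x. k \<noteq> genB \<Longrightarrow> \<not> acts0 k \<Longrightarrow> struct t h genB k z x = 0"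
    and "\<And>g k z x. g \<noteq> genB \<Longrightarrow> struct t g genB k z x = 0" "\<And>g h z x. h \<noteq> genB \<Longrightarrow> struct t g h genB z x = 0"
    and "\<And>k z x. struct t genA genA k z x = (if k = genA then z + 2 * x else 0)"
    and "\<And>k z x. struct t genA genX k z x = (if k = genX then z + 3/2 * x else 0)"
  shows "acts0 genA \<and> acts0 genX \<or> acts0 genB"
proof -
  let ?F = "{genA, genX}"
  have "(\<forall>g\<in>?F. acts0 g) \<or> (\<forall>v. (\<forall>g\<in>?F. op g v = 0) \<longrightarrow> v = 0)"
  proof (rule ker_dichotomy)
    fix h g k assume "g \<in> ?F" "k \<notin> ?F"
    then have "g \<noteq> genB" "k = genB" by (cases k; auto)+
    then show "(\<forall>z x. struct t h g k z x = 0) \<or> acts0 k" using assms(3) by blast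
  qed
  then show ?thesis
  proof
    assume ker: "\<forall>v. (\<forall>g\<in>?F. op g v = 0) \<longrightarrow> v = 0"
    have "acts0 genB"
    proof (rule kill_by_virasoro'[OF _ _ ker assms(1)])
      show "\<exists>c. \<forall>z x. struct t genA g g z x = z + c * x" if "g \<in> ?F" for g
      proof (cases "g = genA")
        case True
        then show ?thesis using assms(4)[of genA] by (intro exI[of _ 2]) simp
      next
        case False
        with that show ?thesis using assms(5)[of genX] by (intro exI[of _ "3/2"]) simp
      qed
    qed (use assms in auto)
    then show ?thesis ..
  qed simp
qed

end

section \<open>Converse directions and the individual algebras of types B, C and D\<close>

lemma back_Ng:
  assumes "lie_conformal_superalgebra (algebra_of t)" "\<And>g h z x. struct t g h genB z x = 0" "\<exists>N\<in>fam_Ng. M \<cong> N"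
  shows "fin_nontriv_irred (algebra_of t) M"
proof -
  obtain i f where "f \<noteq> 0" "M \<cong> mod_Ng i f" using assms(3) unfolding fam_Ng_def by blast
  then show ?thesis using fin_nontriv_irred_iso irreducible_Ng[OF assms(1,2)] by blast
qed

lemma back_MA:
  assumes "lie_conformal_superalgebra (algebra_of t)"
    "\<And>g h z x. struct t g h genA z x = (if g = genA \<and> h = genA then z + 2 * x else 0)" "\<exists>N\<in>fam_MA. M \<cong> N"
  shows "fin_nontriv_irred (algebra_of t) M"
proof -
  obtain i \<Delta> \<eta> where "\<Delta> \<noteq> 0" "M \<cong> mod_MA i \<Delta> \<eta>" using assms(3) unfolding fam_MA_def by blast
  then show ?thesis using fin_nontriv_irred_iso irreducible_MA[OF assms(1,2)] by blast
qed

lemma back_MB: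
  assumes "lie_conformal_superalgebra (algebra_of t)"
    "\<And>g h z x. struct t g h genB z x = (if g = genB \<and> h = genB then z + 2 * x else 0)" "\<exists>N\<in>fam_MB. M \<cong> N"
  shows "fin_nontriv_irred (algebra_of t) M"
proof -
  obtain i \<Delta> \<eta> where "\<Delta> \<noteq> 0" "M \<cong> mod_MB i \<Delta> \<eta>" using assms(3) unfolding fam_MB_def by blast
  then show ?thesis using fin_nontriv_irred_iso irreducible_MB[OF assms(1,2)] by blast
qed

lemma back_Momega:
  assumes "lie_conformal_superalgebra (algebra_of t)"
    "\<And>g h z x. struct t g h genA z x = (if g = genA \<and> h = genA then z + 2 * x else 0)"
    "\<And>g h z x. struct t g h genB z x = (if g = genA \<and> h = genB then z + x else if g = genB \<and> h = genA then x else 0)"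
    "\<exists>N\<in>fam_Momega. M \<cong> N"
  shows "fin_nontriv_irred (algebra_of t) M"
proof -
  obtain i \<Delta> \<eta> \<omega> where "\<omega> \<noteq> 0" "M \<cong> mod_Momega i \<Delta> \<eta> \<omega>" using assms(4) unfolding fam_Momega_def by blast
  then show ?thesis using fin_nontriv_irred_iso irreducible_Momega[OF assms(1-3)] by blast
qed

lemma back_Mceps:
  assumes "lie_conformal_superalgebra (algebra_of t)"
    "\<And>g h z x. struct t g h genA z x = (if g = genA \<and> h = genA then z + 2 * x else 0)"
    "\<And>g h z x. struct t g h genB z x = (if g = genA \<and> h = genB then z + x else if g = genB \<and> h = genA then x
      else if g = genX \<and> h = genX then 2 else 0)"
    "\<And>g h z x. struct t g h genX z x = (if g = genA \<and> h = genX then z + x else if g = genX \<and> h = genA then x else 0)"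
    "\<exists>N\<in>fam_Mceps. M \<cong> N"
  shows "fin_nontriv_irred (algebra_of t) M"
proof -
  obtain \<Delta> \<zeta> c e where "c \<noteq> 0" "e \<noteq> 0" "M \<cong> mod_Mceps \<Delta> \<zeta> c e" using assms(5) unfolding fam_Mceps_def by blast
  then show ?thesis using fin_nontriv_irred_iso irreducible_Mceps[OF assms(1-4)] by blast
qed

lemma back_neveu_schwarz:
  assumes "lie_conformal_superalgebra (algebra_of t)"
    "\<And>g h z x. struct t g h genA z x = (if g = genA \<and> h = genA then z + 2 * x else if g = genX \<and> h = genX then 2 else 0)"
    "\<And>g h z x. struct t g h genX z x =
      (if g = genA \<and> h = genX then z + 3/2 * x else if g = genX \<and> h = genA then z / 2 + 3/2 * x else 0)"
    "(\<exists>N\<in>fam_Mplus. M \<cong> N) \<or> (\<exists>N\<in>fam_Mminus. M \<cong> N)"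
  shows "fin_nontriv_irred (algebra_of t) M"
  using assms(4)
proof
  assume "\<exists>N\<in>fam_Mplus. M \<cong> N"
  then obtain \<Delta> \<eta> where "\<Delta> \<noteq> 0" "M \<cong> mod_Mplus \<Delta> \<eta>" unfolding fam_Mplus_def by blast
  then show ?thesis using fin_nontriv_irred_iso irreducible_Mplus[OF assms(1-3)] by blast
next
  assume "\<exists>N\<in>fam_Mminus. M \<cong> N"
  then obtain \<Delta> \<eta> where "\<Delta> \<noteq> 1/2" "M \<cong> mod_Mminus \<Delta> \<eta>" unfolding fam_Mminus_def by blast
  then show ?thesis using fin_nontriv_irred_iso irreducible_Mminus[OF assms(1-3)] by blast
qed

lemma case_B1:
  "fin_nontriv_irred (alg_B1 \<alpha> \<beta>) M \<longleftrightarrow> (\<exists>N\<in>fam_MA. M \<cong> N) \<or> (\<exists>N\<in>fam_MB. M \<cong> N)"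
  unfolding alg_B1_def tab_B1_def[symmetric]
proof
  assume "fin_nontriv_irred (algebra_of (tab_B1 \<alpha> \<beta>)) M"
  then interpret table_module "tab_B1 \<alpha> \<beta>" M by (rule table_module.intro)
  have X: "acts0 genX" by (rule kill_X') (simp_all add: struct_B1)
  have "acts0 genA \<or> acts0 genB"
    by (rule virasoro_dichotomy) (use X in \<open>auto simp: struct_B1\<close>)
  then show "(\<exists>N\<in>fam_MA. M \<cong> N) \<or> (\<exists>N\<in>fam_MB. M \<cong> N)"
    using final_MA[OF _ X] final_MB[OF _ X] by (simp add: struct_B1) blast
next
  assume "(\<exists>N\<in>fam_MA. M \<cong> N) \<or> (\<exists>N\<in>fam_MB. M \<cong> N)"
  then show "fin_nontriv_irred (algebra_of (tab_B1 \<alpha> \<beta>)) M"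
  proof
    assume "\<exists>N\<in>fam_MA. M \<cong> N"
    then show ?thesis by (rule back_MA[OF lie_B1, rotated]) (simp add: struct_B1)
  next
    assume "\<exists>N\<in>fam_MB. M \<cong> N"
    then show ?thesis by (rule back_MB[OF lie_B1, rotated]) (simp add: struct_B1)
  qed
qed

lemma case_C1:
  "fin_nontriv_irred (alg_C1 \<alpha> \<beta>) M \<longleftrightarrow> (\<exists>N\<in>fam_Ng. M \<cong> N) \<or> (\<exists>N\<in>fam_MA. M \<cong> N)"
  unfolding alg_C1_def tab_C1_def[symmetric]
proof
  assume "fin_nontriv_irred (algebra_of (tab_C1 \<alpha> \<beta>)) M"
  then interpret table_module "tab_C1 \<alpha> \<beta>" M by (rule table_module.intro)
  have X: "acts0 genX" by (rule kill_X') (simp_all add: struct_C1)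
  have "acts0 genA \<or> acts0 genB"
    by (rule virasoro_dichotomy) (use X in \<open>auto simp: struct_C1\<close>)
  then show "(\<exists>N\<in>fam_Ng. M \<cong> N) \<or> (\<exists>N\<in>fam_MA. M \<cong> N)"
    using final_MA[OF _ X] final_Ng[OF _ X] by (simp add: struct_C1) blast
next
  assume "(\<exists>N\<in>fam_Ng. M \<cong> N) \<or> (\<exists>N\<in>fam_MA. M \<cong> N)"
  then show "fin_nontriv_irred (algebra_of (tab_C1 \<alpha> \<beta>)) M"
  proof
    assume "\<exists>N\<in>fam_Ng. M \<cong> N"
    then show ?thesis by (rule back_Ng[OF lie_C1, rotated]) (simp add: struct_C1)
  next
    assume "\<exists>N\<in>fam_MA. M \<cong> N"
    then show ?thesis by (rule back_MA[OF lie_C1, rotated]) (simp add: struct_C1)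
  qed
qed

lemma case_C3:
  "fin_nontriv_irred (alg_C3 \<phi>) M \<longleftrightarrow> (\<exists>N\<in>fam_Ng. M \<cong> N) \<or> (\<exists>N\<in>fam_MA. M \<cong> N)"
  unfolding alg_C3_def tab_C3_def[symmetric]
proof
  assume "fin_nontriv_irred (algebra_of (tab_C3 \<phi>)) M"
  then interpret table_module "tab_C3 \<phi>" M by (rule table_module.intro)
  have X: "acts0 genX" by (rule kill_X') (simp_all add: struct_C3)
  have "acts0 genA \<or> acts0 genB"
    by (rule virasoro_dichotomy) (use X in \<open>auto simp: struct_C3\<close>)
  then show "(\<exists>N\<in>fam_Ng. M \<cong> N) \<or> (\<exists>N\<in>fam_MA. M \<cong> N)"
    using final_MA[OF _ X] final_Ng[OF _ X] by (simp add: struct_C3) blast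
next
  assume "(\<exists>N\<in>fam_Ng. M \<cong> N) \<or> (\<exists>N\<in>fam_MA. M \<cong> N)"
  then show "fin_nontriv_irred (algebra_of (tab_C3 \<phi>)) M"
  proof
    assume "\<exists>N\<in>fam_Ng. M \<cong> N"
    then show ?thesis by (rule back_Ng[OF lie_C3, rotated]) (simp add: struct_C3)
  next
    assume "\<exists>N\<in>fam_MA. M \<cong> N"
    then show ?thesis by (rule back_MA[OF lie_C3, rotated]) (simp add: struct_C3)
  qed
qed

text \<open>Either A and X act as zero and the Virasoro part of B remains, or B acts as zero and the
  Neveu-Schwarz part spanned by A and X remains.\<close>

lemma case_B2:
  "fin_nontriv_irred alg_B2 M \<longleftrightarrow>
    (\<exists>N\<in>fam_MB. M \<cong> N) \<or> (\<exists>N\<in>fam_Mplus. M \<cong> N) \<or> (\<exists>N\<in>fam_Mminus. M \<cong> N)"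
  unfolding alg_B2_def tab_B2_def[symmetric]
proof
  assume "fin_nontriv_irred (algebra_of tab_B2) M"
  then interpret table_module tab_B2 M by (rule table_module.intro)
  have "acts0 genA \<and> acts0 genX \<or> acts0 genB"
    by (rule superconformal_dichotomy) (auto simp: struct_B2)
  then show "(\<exists>N\<in>fam_MB. M \<cong> N) \<or> (\<exists>N\<in>fam_Mplus. M \<cong> N) \<or> (\<exists>N\<in>fam_Mminus. M \<cong> N)"
  proof
    assume "acts0 genA \<and> acts0 genX"
    then have "\<exists>N\<in>fam_MB. M \<cong> N" by (intro final_MB) (simp_all add: struct_B2)
    then show ?thesis ..
  next
    assume "acts0 genB"
    then have "(\<exists>N\<in>fam_Mplus. M \<cong> N) \<or> (\<exists>N\<in>fam_Mminus. M \<cong> N)"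
      by (rule final_neveu_schwarz) (simp_all add: struct_B2)
    then show ?thesis ..
  qed
next
  assume "(\<exists>N\<in>fam_MB. M \<cong> N) \<or> (\<exists>N\<in>fam_Mplus. M \<cong> N) \<or> (\<exists>N\<in>fam_Mminus. M \<cong> N)"
  then show "fin_nontriv_irred (algebra_of tab_B2) M"
  proof
    assume "\<exists>N\<in>fam_MB. M \<cong> N"
    then show ?thesis by (rule back_MB[OF lie_B2, rotated]) (simp add: struct_B2)
  next
    assume "(\<exists>N\<in>fam_Mplus. M \<cong> N) \<or> (\<exists>N\<in>fam_Mminus. M \<cong> N)"
    then show ?thesis by (rule back_neveu_schwarz[OF lie_B2, rotated 2]) (simp_all add: struct_B2)
  qed
qed

lemma case_C2:
  "fin_nontriv_irred alg_C2 M \<longleftrightarrow>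
    (\<exists>N\<in>fam_Ng. M \<cong> N) \<or> (\<exists>N\<in>fam_Mplus. M \<cong> N) \<or> (\<exists>N\<in>fam_Mminus. M \<cong> N)"
  unfolding alg_C2_def tab_C2_def[symmetric]
proof
  assume "fin_nontriv_irred (algebra_of tab_C2) M"
  then interpret table_module tab_C2 M by (rule table_module.intro)
  have "acts0 genA \<and> acts0 genX \<or> acts0 genB"
    by (rule superconformal_dichotomy) (auto simp: struct_C2)
  then show "(\<exists>N\<in>fam_Ng. M \<cong> N) \<or> (\<exists>N\<in>fam_Mplus. M \<cong> N) \<or> (\<exists>N\<in>fam_Mminus. M \<cong> N)"
  proof
    assume "acts0 genA \<and> acts0 genX"
    then have "\<exists>N\<in>fam_Ng. M \<cong> N" by (intro final_Ng) (simp_all add: struct_C2)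
    then show ?thesis ..
  next
    assume "acts0 genB"
    then have "(\<exists>N\<in>fam_Mplus. M \<cong> N) \<or> (\<exists>N\<in>fam_Mminus. M \<cong> N)"
      by (rule final_neveu_schwarz) (simp_all add: struct_C2)
    then show ?thesis ..
  qed
next
  assume "(\<exists>N\<in>fam_Ng. M \<cong> N) \<or> (\<exists>N\<in>fam_Mplus. M \<cong> N) \<or> (\<exists>N\<in>fam_Mminus. M \<cong> N)"
  then show "fin_nontriv_irred (algebra_of tab_C2) M"
  proof
    assume "\<exists>N\<in>fam_Ng. M \<cong> N"
    then show ?thesis by (rule back_Ng[OF lie_C2, rotated]) (simp add: struct_C2)
  next
    assume "(\<exists>N\<in>fam_Mplus. M \<cong> N) \<or> (\<exists>N\<in>fam_Mminus. M \<cong> N)"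
    then show ?thesis by (rule back_neveu_schwarz[OF lie_C2, rotated 2]) (simp_all add: struct_C2)
  qed
qed

lemma cond_C1_current:
  assumes "cond_C1 1 0 Q"
  shows "\<exists>c. \<forall>z x. ev2 Q z x = c * (z + 2 * x)"
proof -
  obtain c where "Q = cst c * Vir" using assms unfolding cond_C1_def Let_def by auto
  then show ?thesis by (intro exI[of _ c] allI) (simp only: ev2_simps)
qed

lemma cond_C1_trivial: "cond_C1 1 0 0"
  unfolding cond_C1_def Let_def by (auto intro: exI[of _ 0])

text \<open>X has zero square and acts trivially for all \<alpha>, \<beta>. A nontrivial action of B
  then forces (a, b, Q) = (1, 0, 0), whence the condition attached to the second family.\<close>

lemma case_D1:
  assumes Q: "cond_C1 a b Q"
  shows "fin_nontriv_irred (alg_D1 a b Q \<alpha> \<beta>) M \<longleftrightarrow>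
    (\<exists>N\<in>fam_MA. M \<cong> N) \<or> ((a, b, Q) = (1, 0, 0) \<and> (\<exists>N\<in>fam_Momega. M \<cong> N))"
  unfolding alg_D1_def tab_D1_def[symmetric]
proof
  assume "fin_nontriv_irred (algebra_of (tab_D1 a b Q \<alpha> \<beta>)) M"
  then interpret table_module "tab_D1 a b Q \<alpha> \<beta>" M by (rule table_module.intro)
  have X: "acts0 genX" by (rule kill_X') (simp_all add: struct_D1)
  show "(\<exists>N\<in>fam_MA. M \<cong> N) \<or> ((a, b, Q) = (1, 0, 0) \<and> (\<exists>N\<in>fam_Momega. M \<cong> N))"
  proof (cases "acts0 genB")
    case True
    have "\<exists>N\<in>fam_MA. M \<cong> N" by (rule final_MA[OF True X]) (simp add: struct_D1)
    then show ?thesis ..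
  next
    case False
    show ?thesis
    proof (rule final_density[OF False, of a b])
      fix \<tau> assume ab: "a = 1" "b = 0" and q: "\<And>z x. struct (tab_D1 a b Q \<alpha> \<beta>) genA genA genB z x = 0"
        and W: "\<tau> \<noteq> 0" "{v. op genB v = [:smul M [:\<tau>:] v:]} \<noteq> {0}"
        "C.subspace {v. op genB v = [:smul M [:\<tau>:] v:]}" "C.fin_dim {v. op genB v = [:smul M [:\<tau>:] v:]}"
        "graded {v. op genB v = [:smul M [:\<tau>:] v:]}"
        "\<And>n. n \<ge> 1 \<Longrightarrow> cf (op genA) n ` {v. op genB v = [:smul M [:\<tau>:] v:]} \<subseteq> {v. op genB v = [:smul M [:\<tau>:] v:]}"
        "shift_op (op genA) ` {v. op genB v = [:smul M [:\<tau>:] v:]} \<subseteq> {v. op genB v = [:smul M [:\<tau>:] v:]}"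
        "\<And>v x y. ev (op genA (ev (op genA v) y)) x - ev (op genA (ev (op genA v) x)) y = smul M [:x - y:] (ev (op genA v) (x + y))"
      have "Q = 0" by (rule ev2_eq_0D) (use q in \<open>simp add: struct_D1\<close>)
      with ab final_Momega[OF X W] show ?thesis by simp
    qed (use Q cond_C1_current in \<open>auto simp: struct_D1\<close>)
  qed
next
  assume "(\<exists>N\<in>fam_MA. M \<cong> N) \<or> ((a, b, Q) = (1, 0, 0) \<and> (\<exists>N\<in>fam_Momega. M \<cong> N))"
  then show "fin_nontriv_irred (algebra_of (tab_D1 a b Q \<alpha> \<beta>)) M"
  proof
    assume "\<exists>N\<in>fam_MA. M \<cong> N"
    then show ?thesis by (rule back_MA[OF lie_D1[OF Q], rotated]) (simp add: struct_D1)
  next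
    assume N: "(a, b, Q) = (1, 0, 0) \<and> (\<exists>N\<in>fam_Momega. M \<cong> N)"
    then have "\<exists>N\<in>fam_Momega. M \<cong> N" ..
    then show ?thesis
      by (rule back_Momega[OF lie_D1[OF Q], rotated 2]) (use N in \<open>simp_all add: struct_D1 ev2_simps\<close>)
  qed
qed

text \<open>\<gamma> leaves no trace: X is eliminated first, and with it the bracket [B X]. What
  remains acts as in the first algebra of type D at (1, 0, 0).\<close>

lemma case_D4:
  "fin_nontriv_irred (alg_D4 \<alpha> \<beta> \<gamma>) M \<longleftrightarrow> (\<exists>N\<in>fam_MA. M \<cong> N) \<or> (\<exists>N\<in>fam_Momega. M \<cong> N)"
  unfolding alg_D4_def tab_D4_def[symmetric]
proof
  assume "fin_nontriv_irred (algebra_of (tab_D4 \<alpha> \<beta> \<gamma>)) M"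
  then interpret table_module "tab_D4 \<alpha> \<beta> \<gamma>" M by (rule table_module.intro)
  have X: "acts0 genX" by (rule kill_X') (simp_all add: struct_D4)
  show "(\<exists>N\<in>fam_MA. M \<cong> N) \<or> (\<exists>N\<in>fam_Momega. M \<cong> N)"
  proof (cases "acts0 genB")
    case True
    have "\<exists>N\<in>fam_MA. M \<cong> N" by (rule final_MA[OF True X]) (simp add: struct_D4)
    then show ?thesis ..
  next
    case False
    show ?thesis
    proof (rule final_density[OF False, of 1 0])
      fix \<tau> assume
        W: "\<tau> \<noteq> 0" "{v. op genB v = [:smul M [:\<tau>:] v:]} \<noteq> {0}"
        "C.subspace {v. op genB v = [:smul M [:\<tau>:] v:]}" "C.fin_dim {v. op genB v = [:smul M [:\<tau>:] v:]}"
        "graded {v. op genB v = [:smul M [:\<tau>:] v:]}"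
        "\<And>n. n \<ge> 1 \<Longrightarrow> cf (op genA) n ` {v. op genB v = [:smul M [:\<tau>:] v:]} \<subseteq> {v. op genB v = [:smul M [:\<tau>:] v:]}"
        "shift_op (op genA) ` {v. op genB v = [:smul M [:\<tau>:] v:]} \<subseteq> {v. op genB v = [:smul M [:\<tau>:] v:]}"
        "\<And>v x y. ev (op genA (ev (op genA v) y)) x - ev (op genA (ev (op genA v) x)) y = smul M [:x - y:] (ev (op genA v) (x + y))"
      from final_Momega[OF X W] show ?thesis by simp
    qed (use X in \<open>auto simp: struct_D4\<close>)
  qed
next
  assume "(\<exists>N\<in>fam_MA. M \<cong> N) \<or> (\<exists>N\<in>fam_Momega. M \<cong> N)"
  then show "fin_nontriv_irred (algebra_of (tab_D4 \<alpha> \<beta> \<gamma>)) M"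
  proof
    assume "\<exists>N\<in>fam_MA. M \<cong> N"
    then show ?thesis by (rule back_MA[OF lie_D4, rotated]) (simp add: struct_D4)
  next
    assume "\<exists>N\<in>fam_Momega. M \<cong> N"
    then show ?thesis by (rule back_Momega[OF lie_D4, rotated 2]) (simp_all add: struct_D4)
  qed
qed

text \<open>If B acts as zero, so does [X X] = 2B, and X is eliminated. Otherwise [X X] = 2B keeps X
  alive, and the Clifford relation produces a module of rank two.\<close>

lemma D2_forward:
  assumes Q: "cond_C1 a b Q" and M: "fin_nontriv_irred (algebra_of (tab_D2 a b Q)) M"
  shows "(\<exists>N\<in>fam_MA. M \<cong> N) \<or> ((a, b, Q) = (1, 0, 0) \<and> (\<exists>N\<in>fam_Mceps. M \<cong> N))"
proof -
  interpret table_module "tab_D2 a b Q" M using M by (rule table_module.intro)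
  show ?thesis
  proof (cases "acts0 genB")
    case True
    have X: "acts0 genX" by (rule kill_X') (use True in \<open>auto simp: struct_D2\<close>)
    have "\<exists>N\<in>fam_MA. M \<cong> N" by (rule final_MA[OF True X]) (simp add: struct_D2)
    then show ?thesis ..
  next
    case False
    show ?thesis
    proof (rule final_density[OF False, of a b])
      fix \<tau> assume ab: "a = 1" "b = 0" and q: "\<And>z x. struct (tab_D2 a b Q) genA genA genB z x = 0"
        and W: "\<tau> \<noteq> 0" "{v. op genB v = [:smul M [:\<tau>:] v:]} \<noteq> {0}"
        "C.subspace {v. op genB v = [:smul M [:\<tau>:] v:]}" "C.fin_dim {v. op genB v = [:smul M [:\<tau>:] v:]}"
        "graded {v. op genB v = [:smul M [:\<tau>:] v:]}"
        "\<And>n. n \<ge> 1 \<Longrightarrow> cf (op genA) n ` {v. op genB v = [:smul M [:\<tau>:] v:]} \<subseteq> {v. op genB v = [:smul M [:\<tau>:] v:]}"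
        "shift_op (op genA) ` {v. op genB v = [:smul M [:\<tau>:] v:]} \<subseteq> {v. op genB v = [:smul M [:\<tau>:] v:]}"
        "\<And>v x y. ev (op genA (ev (op genA v) y)) x - ev (op genA (ev (op genA v) x)) y = smul M [:x - y:] (ev (op genA v) (x + y))"
      have "Q = 0" by (rule ev2_eq_0D) (use q in \<open>simp add: struct_D2\<close>)
      moreover have "\<exists>N\<in>fam_Mceps. M \<cong> N"
        by (rule final_Mceps[OF _ _ _ _ _ _ _ W]) (simp_all add: struct_D2 ab)
      ultimately show ?thesis using ab by simp
    qed (use Q cond_C1_current in \<open>auto simp: struct_D2\<close>)
  qed
qed

lemma case_HVS:
  "fin_nontriv_irred (alg_D2 1 0 0) M \<longleftrightarrow> (\<exists>N\<in>fam_MA. M \<cong> N) \<or> (\<exists>N\<in>fam_Mceps. M \<cong> N)"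
  unfolding alg_D2_def tab_D2_def[symmetric]
proof
  assume "fin_nontriv_irred (algebra_of (tab_D2 1 0 0)) M"
  then show "(\<exists>N\<in>fam_MA. M \<cong> N) \<or> (\<exists>N\<in>fam_Mceps. M \<cong> N)"
    using D2_forward[OF cond_C1_trivial] by blast
next
  assume "(\<exists>N\<in>fam_MA. M \<cong> N) \<or> (\<exists>N\<in>fam_Mceps. M \<cong> N)"
  then show "fin_nontriv_irred (algebra_of (tab_D2 1 0 0)) M"
  proof
    assume "\<exists>N\<in>fam_MA. M \<cong> N"
    then show ?thesis by (rule back_MA[OF lie_D2[OF cond_C1_trivial], rotated]) (simp add: struct_D2)
  next
    assume "\<exists>N\<in>fam_Mceps. M \<cong> N"
    then show ?thesis
      by (rule back_Mceps[OF lie_D2[OF cond_C1_trivial], rotated 3]) (simp_all add: struct_D2 ev2_simps)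
  qed
qed

lemma case_D2:
  assumes "cond_C1 a b Q" "(a, b, Q) \<noteq> (1, 0, 0)"
  shows "fin_nontriv_irred (alg_D2 a b Q) M \<longleftrightarrow> (\<exists>N\<in>fam_MA. M \<cong> N)"
  unfolding alg_D2_def tab_D2_def[symmetric]
proof
  assume "fin_nontriv_irred (algebra_of (tab_D2 a b Q)) M"
  then show "\<exists>N\<in>fam_MA. M \<cong> N"
    using D2_forward[OF assms(1)] assms(2) by blast
next
  assume "\<exists>N\<in>fam_MA. M \<cong> N"
  then show "fin_nontriv_irred (algebra_of (tab_D2 a b Q)) M"
    by (rule back_MA[OF lie_D2[OF assms(1)], rotated]) (simp add: struct_D2)
qed

lemma case_D3:
  assumes "cond_C1 0 b Q"
  shows "fin_nontriv_irred (alg_D3 b Q) M \<longleftrightarrow> (\<exists>N\<in>fam_MA. M \<cong> N)"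
  unfolding alg_D3_def tab_D3_def[symmetric]
proof
  assume "fin_nontriv_irred (algebra_of (tab_D3 b Q)) M"
  then interpret table_module "tab_D3 b Q" M by (rule table_module.intro)
  have B: "acts0 genB"
  proof (rule ccontr)
    assume B: "\<not> acts0 genB"
    \<comment> \<open>\<open>final_density\<close> would give a = 1, whereas [A B] = (\<partial> +
      b) B has a = 0.\<close>
    show False
      by (rule final_density[OF B, of 0 b]) (auto simp: struct_D3)
  qed
  have X: "acts0 genX" by (rule kill_X') (use B in \<open>auto simp: struct_D3\<close>)
  show "\<exists>N\<in>fam_MA. M \<cong> N" by (rule final_MA[OF B X]) (simp add: struct_D3)
next
  assume "\<exists>N\<in>fam_MA. M \<cong> N"
  then show "fin_nontriv_irred (algebra_of (tab_D3 b Q)) M"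
    by (rule back_MA[OF lie_D3[OF assms], rotated]) (simp add: struct_D3)
qed

text \<open>M is a module on an arbitrary carrier, so each equivalence classifies up to isomorphism
  and also asserts that all listed modules occur. The restriction to (1, 0, 0) in the item for
  \<open>alg_D1\<close> is forced, as \<omega> \<noteq> 0 means a nontrivial action of B.\<close>

theorem theorem5p2:
  fixes M :: "(rank3, 'm::ab_group_add) conf_module"
  shows
    "(\<forall>f \<phi>. f \<noteq> 0 \<and> skew_symmetric f \<longrightarrow>
        (fin_nontriv_irred (alg_A1 f \<phi>) M \<longleftrightarrow> (\<exists>N\<in>fam_Nf. M \<cong> N))) \<and>
     (\<forall>f \<psi>. f \<noteq> 0 \<and> skew_symmetric f \<longrightarrow>
        (fin_nontriv_irred (alg_A2 f \<psi>) M \<longleftrightarrow> (\<exists>N\<in>fam_Nf. M \<cong> N))) \<and>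
     (\<forall>\<phi>. \<phi> \<noteq> 0 \<longrightarrow>
        (fin_nontriv_irred (alg_A3 \<phi>) M \<longleftrightarrow> (\<exists>N\<in>fam_Nf. M \<cong> N))) \<and>
     (\<forall>p \<phi>. p \<noteq> 0 \<longrightarrow>
        (fin_nontriv_irred (alg_A4 p \<phi>) M \<longleftrightarrow> (\<exists>N\<in>fam_Nf. M \<cong> N))) \<and>
     (\<forall>\<alpha> \<beta>.
        fin_nontriv_irred (alg_B1 \<alpha> \<beta>) M \<longleftrightarrow>
          (\<exists>N\<in>fam_MA. M \<cong> N) \<or> (\<exists>N\<in>fam_MB. M \<cong> N)) \<and>
     (fin_nontriv_irred alg_B2 M \<longleftrightarrow>
        (\<exists>N\<in>fam_MB. M \<cong> N) \<or> (\<exists>N\<in>fam_Mplus. M \<cong> N) \<or> (\<exists>N\<in>fam_Mminus. M \<cong> N)) \<and>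
     (\<forall>\<alpha> \<beta>.
        fin_nontriv_irred (alg_C1 \<alpha> \<beta>) M \<longleftrightarrow>
          (\<exists>N\<in>fam_Ng. M \<cong> N) \<or> (\<exists>N\<in>fam_MA. M \<cong> N)) \<and>
     (\<forall>\<phi>. \<phi> \<noteq> 0 \<longrightarrow>
        (fin_nontriv_irred (alg_C3 \<phi>) M \<longleftrightarrow>
          (\<exists>N\<in>fam_Ng. M \<cong> N) \<or> (\<exists>N\<in>fam_MA. M \<cong> N))) \<and>
     (fin_nontriv_irred alg_C2 M \<longleftrightarrow>
        (\<exists>N\<in>fam_Ng. M \<cong> N) \<or> (\<exists>N\<in>fam_Mplus. M \<cong> N) \<or> (\<exists>N\<in>fam_Mminus. M \<cong> N)) \<and>
     (\<forall>a b Q \<alpha> \<beta>. cond_C1 a b Q \<longrightarrow>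
        (fin_nontriv_irred (alg_D1 a b Q \<alpha> \<beta>) M \<longleftrightarrow>
          (\<exists>N\<in>fam_MA. M \<cong> N) \<or> ((a, b, Q) = (1, 0, 0) \<and> (\<exists>N\<in>fam_Momega. M \<cong> N)))) \<and>
     (\<forall>\<alpha> \<beta> \<gamma>.
        fin_nontriv_irred (alg_D4 \<alpha> \<beta> \<gamma>) M \<longleftrightarrow>
          (\<exists>N\<in>fam_MA. M \<cong> N) \<or> (\<exists>N\<in>fam_Momega. M \<cong> N)) \<and>
     (fin_nontriv_irred (alg_D2 1 0 0) M \<longleftrightarrow>
        (\<exists>N\<in>fam_MA. M \<cong> N) \<or> (\<exists>N\<in>fam_Mceps. M \<cong> N)) \<and>
     (\<forall>a b Q. cond_C1 a b Q \<and> (a, b, Q) \<noteq> (1, 0, 0) \<longrightarrow>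
        (fin_nontriv_irred (alg_D2 a b Q) M \<longleftrightarrow> (\<exists>N\<in>fam_MA. M \<cong> N))) \<and>
     (\<forall>b Q. cond_C1 0 b Q \<longrightarrow>
        (fin_nontriv_irred (alg_D3 b Q) M \<longleftrightarrow> (\<exists>N\<in>fam_MA. M \<cong> N)))"
  by (intro conjI allI impI; (elim conjE)?;
      rule case_A1 case_A2 case_A3 case_A4 case_B1 case_B2 case_C1 case_C2 case_C3 case_D1 case_D4
        case_HVS case_D2 case_D3; assumption)

end
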